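(* Let $\mathbb K$ be a field, $C$ a unital associative $\mathbb K$-algebra, $K$ a (not necessarily unital) associative $\mathbb K$-algebra, and let $\Psi$ be an abstract kernel represented by $((p,\partial,j),\psi_0)$, where $0\to\mathrm Z(K)\xrightarrow{j}K\xrightarrow{\partial}A\xrightarrow{p}Q\to0$ is a crossed biextension with $\partial$ faithful and $\psi_0\colon C\to Q$ is a surjective morphism of unital algebras. Let $\xi$ denote the action ($Q$-bimodule structure) of $Q$ on $\mathrm Z(K)$ induced by the crossed bimodule structure of $\partial$, let $[\omega]$ be the corresponding element of the Hochschild cohomology group $\mathcal H^3_H(Q,\mathrm Z(K),\xi)$, and let $\mathrm{Ext}(C,K,\Psi)$ denote the set of isomorphism classes of extensions of $C$ by $K$ inducing the abstract kernel $\Psi$. Then: (i) $\mathrm{Ext}(C,K,\Psi)\neq\emptyset$ if and only if $[\omega\cdot(\psi_0\otimes\psi_0\otimes\psi_0)]=0$ in $\mathcal H^3_H(C,\mathrm Z(K),\psi_0^*\xi)$; (ii) if $\mathrm{Ext}(C,K,\Psi)\neq\emptyset$, it is a simply transitive $\mathcal H^2_H(C,\mathrm Z(K),\psi_0^*\xi)$-set.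
   Context: All algebras are over $\mathbb K$. A bimodule over a unital associative algebra $C$ is a $\mathbb K$-vector space with left and right unital $\mathbb K$-bilinear actions with $(c*b)*c'=c*(b*c')$. $\mathcal H^n_H(C,B,\xi)$ is Hochschild cohomology of $C$ with coefficients in the bimodule $B$ with structure $\xi$. A crossed bimodule is a morphism $\partial\colon A_2\to A_1$ of $A_1$-bimodules, $A_1$ a unital associative algebra, with $\partial(a)*a'=a*\partial(a')$ for all $a,a'\in A_2$; then $aa'=\partial(a)*a'$ makes $A_2$ an associative algebra (for $\partial\colon K\to A$ above this product is the given product of $K$). It is faithful if $a\in A_1$ satisfies $a*a'=a'*a=0$ for all $a'\in A_2$ only when $a=0$; then $\ker\partial$ is the annihilator $\mathrm Z(A_2)=\{x:xa=ax=0\ \forall a\in A_2\}$. A crossed biextension is an exact sequence $0\to B\xrightarrow{j}A_2\xrightarrow{\partial}A_1\xrightarrow{p}Q\to0$ of vector spaces with $p$ a surjective morphism of unital associative algebras and $\partial$ a crossed bimodule; it induces a $Q$-bimodule structure on $B$ by $j(p(a)*b)=a*j(b)$, $j(b*p(a))=j(b)*a$. Its class in $\mathcal H^3_H(Q,B)$ is that of the cocycle $\omega\colon Q\otimes Q\otimes Q\to B$ obtained by choosing linear sections $s$ of $p$ and $q$ of $A_2\to\operatorname{im}\partial$, setting $f(x,y)=q(s(x)s(y)-s(xy))$ and $j\omega(x,y,z)=s(x)*f(y,z)-f(xy,z)+f(x,yz)-f(x,y)*s(z)$. $\psi_0^*\xi$ is the $C$-bimodule structure on $\mathrm Z(K)$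 obtained from $\xi$ by restriction along $\psi_0$. An abstract kernel (of $C$ and $K$) is an isomorphism class of data $((p,\partial,j),\psi_0)$ consisting of a crossed biextension $\mathrm Z(K)\xrightarrow{j}K\xrightarrow{\partial}A\xrightarrow{p}Q$ with $\partial$ a faithful crossed bimodule and a surjective morphism of unital algebras $\psi_0\colon C\to Q$; an isomorphism from $((p,\partial,j),\psi_0)$ to $((p',\partial',j),\psi_0')$ is an isomorphism of crossed biextensions which is the identity on $\mathrm Z(K)$ and $K$, with components $A\cong A'$ and $\tau\colon Q\cong Q'$ such that $\psi_0'=\tau\psi_0$. An extension of $C$ by $K$ is a short exact sequence $0\to K\xrightarrow{k}E\xrightarrow{f}C\to0$ of associative algebras with $f$ a surjective morphism of unital associative algebras; isomorphisms of extensions are unital algebra isomorphisms $E\to E'$ compatible with the maps from $K$ and to $C$. It induces the following abstract kernel: let $\mathrm Z(K,E)=\{e\in E: e\,k(x)=k(x)\,e=0\ \forall x\in K\}$, $A=E/\mathrm Z(K,E)$ acting on $K$ by multiplication in $E$, $\partial\colon K\to A$ the composite of $k$ with the quotient map $q\colon E\to A$, $p\colon A\to Q$ the cokernel of $\partial$, and $\psi_0\colon C\to Q$ the surjection with $\psi_0f=pq$. A simply transitive $\Gamma$-set is a set on which the group $\Gamma$ acts so that for any two elements exactly one group element carries the first to the second. *)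

theory Defs
  imports "HOL-Algebra.Algebra"
begin

text \<open>
  Algebras over a field \<open>F\<close> are HOL-Algebra records of type \<open>('f, 'a) module\<close>, that is, ring
  records with a scalar multiplication. All notions depend only on the values of
  the operations on the carriers. A unital algebra may be zero (\<open>\<one> = \<zero>\<close>), which is needed because
  the algebra \<open>Q\<close> in a crossed biextension may vanish. For non-unital algebras the field \<open>one\<close> of
  the record, and for mere vector spaces the fields \<open>mult\<close> and \<open>one\<close>, are ignored.
\<close>

section \<open>Vector spaces, associative algebras, bimodules\<close>

locale lin_space = F?: field F + V?: module F V for F (structure) and V (structure)

locale assoc_algebra = lin_space F A for F (structure) and A (structure) +
  assumes alg_m_closed: "\<lbrakk>x \<in> carrier A; y \<in> carrier A\<rbrakk> \<Longrightarrow> x \<otimes>\<^bsub>A\<^esub> y \<in> carrier A"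
    and alg_m_assoc: "\<lbrakk>x \<in> carrier A; y \<in> carrier A; z \<in> carrier A\<rbrakk>
      \<Longrightarrow> (x \<otimes>\<^bsub>A\<^esub> y) \<otimes>\<^bsub>A\<^esub> z = x \<otimes>\<^bsub>A\<^esub> (y \<otimes>\<^bsub>A\<^esub> z)"
    and alg_l_distr: "\<lbrakk>x \<in> carrier A; y \<in> carrier A; z \<in> carrier A\<rbrakk>
      \<Longrightarrow> (x \<oplus>\<^bsub>A\<^esub> y) \<otimes>\<^bsub>A\<^esub> z = x \<otimes>\<^bsub>A\<^esub> z \<oplus>\<^bsub>A\<^esub> y \<otimes>\<^bsub>A\<^esub> z"
    and alg_r_distr: "\<lbrakk>x \<in> carrier A; y \<in> carrier A; z \<in> carrier A\<rbrakk>
      \<Longrightarrow> z \<otimes>\<^bsub>A\<^esub> (x \<oplus>\<^bsub>A\<^esub> y) = z \<otimes>\<^bsub>A\<^esub> x \<oplus>\<^bsub>A\<^esub> z \<otimes>\<^bsub>A\<^esub> y"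
    and alg_smult_l: "\<lbrakk>r \<in> carrier F; x \<in> carrier A; y \<in> carrier A\<rbrakk>
      \<Longrightarrow> (r \<odot>\<^bsub>A\<^esub> x) \<otimes>\<^bsub>A\<^esub> y = r \<odot>\<^bsub>A\<^esub> (x \<otimes>\<^bsub>A\<^esub> y)"
    and alg_smult_r: "\<lbrakk>r \<in> carrier F; x \<in> carrier A; y \<in> carrier A\<rbrakk>
      \<Longrightarrow> x \<otimes>\<^bsub>A\<^esub> (r \<odot>\<^bsub>A\<^esub> y) = r \<odot>\<^bsub>A\<^esub> (x \<otimes>\<^bsub>A\<^esub> y)"

locale unital_algebra = assoc_algebra F A + monoid A for F (structure) and A (structure)

definition linear_map where
  "linear_map F V W = {h. h \<in> carrier V \<rightarrow> carrier W
     \<and> (\<forall>x\<in>carrier V. \<forall>y\<in>carrier V. h (x \<oplus>\<^bsub>V\<^esub> y) = h x \<oplus>\<^bsub>W\<^esub> h y)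
     \<and> (\<forall>r\<in>carrier F. \<forall>x\<in>carrier V. h (r \<odot>\<^bsub>V\<^esub> x) = r \<odot>\<^bsub>W\<^esub> h x)}"

definition linear_iso where
  "linear_iso F V W = {h \<in> linear_map F V W. bij_betw h (carrier V) (carrier W)}"

definition alg_hom where
  "alg_hom F A B = {h \<in> linear_map F A B.
     \<forall>x\<in>carrier A. \<forall>y\<in>carrier A. h (x \<otimes>\<^bsub>A\<^esub> y) = h x \<otimes>\<^bsub>B\<^esub> h y}"

definition unital_alg_hom where
  "unital_alg_hom F A B = {h \<in> alg_hom F A B. h \<one>\<^bsub>A\<^esub> = \<one>\<^bsub>B\<^esub>}"

definition unital_alg_iso where
  "unital_alg_iso F A B = {h \<in> unital_alg_hom F A B. bij_betw h (carrier A) (carrier B)}"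

text \<open>A bimodule structure \<open>\<xi>\<close> is the pair of the left action and the right action.\<close>

type_synonym ('c, 'b) bimod_structure = "('c \<Rightarrow> 'b \<Rightarrow> 'b) \<times> ('b \<Rightarrow> 'c \<Rightarrow> 'b)"

locale bimodule = C?: unital_algebra F C + B?: lin_space F B
  for F (structure) and C (structure) and B (structure) +
  fixes \<xi>
  assumes lact_closed: "\<lbrakk>c \<in> carrier C; b \<in> carrier B\<rbrakk> \<Longrightarrow> fst \<xi> c b \<in> carrier B"
    and ract_closed: "\<lbrakk>c \<in> carrier C; b \<in> carrier B\<rbrakk> \<Longrightarrow> snd \<xi> b c \<in> carrier B"
    and lact_add_l: "\<lbrakk>c \<in> carrier C; c' \<in> carrier C; b \<in> carrier B\<rbrakk>
      \<Longrightarrow> fst \<xi> (c \<oplus>\<^bsub>C\<^esub> c') b = fst \<xi> c b \<oplus>\<^bsub>B\<^esub> fst \<xi> c' b"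
    and lact_add_r: "\<lbrakk>c \<in> carrier C; b \<in> carrier B; b' \<in> carrier B\<rbrakk>
      \<Longrightarrow> fst \<xi> c (b \<oplus>\<^bsub>B\<^esub> b') = fst \<xi> c b \<oplus>\<^bsub>B\<^esub> fst \<xi> c b'"
    and lact_smult_l: "\<lbrakk>r \<in> carrier F; c \<in> carrier C; b \<in> carrier B\<rbrakk>
      \<Longrightarrow> fst \<xi> (r \<odot>\<^bsub>C\<^esub> c) b = r \<odot>\<^bsub>B\<^esub> fst \<xi> c b"
    and lact_smult_r: "\<lbrakk>r \<in> carrier F; c \<in> carrier C; b \<in> carrier B\<rbrakk>
      \<Longrightarrow> fst \<xi> c (r \<odot>\<^bsub>B\<^esub> b) = r \<odot>\<^bsub>B\<^esub> fst \<xi> c b"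
    and ract_add_l: "\<lbrakk>c \<in> carrier C; b \<in> carrier B; b' \<in> carrier B\<rbrakk>
      \<Longrightarrow> snd \<xi> (b \<oplus>\<^bsub>B\<^esub> b') c = snd \<xi> b c \<oplus>\<^bsub>B\<^esub> snd \<xi> b' c"
    and ract_add_r: "\<lbrakk>c \<in> carrier C; c' \<in> carrier C; b \<in> carrier B\<rbrakk>
      \<Longrightarrow> snd \<xi> b (c \<oplus>\<^bsub>C\<^esub> c') = snd \<xi> b c \<oplus>\<^bsub>B\<^esub> snd \<xi> b c'"
    and ract_smult_l: "\<lbrakk>r \<in> carrier F; c \<in> carrier C; b \<in> carrier B\<rbrakk>
      \<Longrightarrow> snd \<xi> (r \<odot>\<^bsub>B\<^esub> b) c = r \<odot>\<^bsub>B\<^esub> snd \<xi> b c"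
    and ract_smult_r: "\<lbrakk>r \<in> carrier F; c \<in> carrier C; b \<in> carrier B\<rbrakk>
      \<Longrightarrow> snd \<xi> b (r \<odot>\<^bsub>C\<^esub> c) = r \<odot>\<^bsub>B\<^esub> snd \<xi> b c"
    and lact_one: "b \<in> carrier B \<Longrightarrow> fst \<xi> \<one>\<^bsub>C\<^esub> b = b"
    and ract_one: "b \<in> carrier B \<Longrightarrow> snd \<xi> b \<one>\<^bsub>C\<^esub> = b"
    and lact_mult: "\<lbrakk>c \<in> carrier C; c' \<in> carrier C; b \<in> carrier B\<rbrakk>
      \<Longrightarrow> fst \<xi> (c \<otimes>\<^bsub>C\<^esub> c') b = fst \<xi> c (fst \<xi> c' b)"
    and ract_mult: "\<lbrakk>c \<in> carrier C; c' \<in> carrier C; b \<in> carrier B\<rbrakk>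
      \<Longrightarrow> snd \<xi> b (c \<otimes>\<^bsub>C\<^esub> c') = snd \<xi> (snd \<xi> b c) c'"
    and lact_ract: "\<lbrakk>c \<in> carrier C; c' \<in> carrier C; b \<in> carrier B\<rbrakk>
      \<Longrightarrow> snd \<xi> (fst \<xi> c b) c' = fst \<xi> c (snd \<xi> b c')"

text \<open>Restriction of a bimodule structure along a map of algebras.\<close>

definition pullback_bimod ::
  "('c \<Rightarrow> 'q) \<Rightarrow> ('q, 'b) bimod_structure \<Rightarrow> ('c, 'b) bimod_structure" where
  "pullback_bimod \<psi> \<xi> = (\<lambda>c b. fst \<xi> (\<psi> c) b, \<lambda>b c. snd \<xi> b (\<psi> c))"


section \<open>Hochschild cohomology\<close>

text \<open>
  An \<open>n\<close>-cochain, a linear map from the \<open>n\<close>-fold tensor power of \<open>C\<close> to \<open>B\<close>, is given by the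
  corresponding multilinear map. It is represented as a function on the lists of length \<open>n\<close> over
  the carrier of \<open>C\<close>, extensional outside this set, so that equality of cochains is equality of
  functions.
\<close>

definition tuples :: "('c, 'm) ring_scheme \<Rightarrow> nat \<Rightarrow> 'c list set" where
  "tuples C n = {xs. length xs = n \<and> set xs \<subseteq> carrier C}"

definition hh_cochains where
  "hh_cochains F C B n = {f \<in> tuples C n \<rightarrow>\<^sub>E carrier B.
     \<forall>xs ys. \<forall>x\<in>carrier C. set xs \<subseteq> carrier C \<longrightarrow> set ys \<subseteq> carrier C
        \<longrightarrow> length xs + 1 + length ys = n \<longrightarrow>
       (\<forall>y\<in>carrier C. f (xs @ (x \<oplus>\<^bsub>C\<^esub> y) # ys) = f (xs @ x # ys) \<oplus>\<^bsub>B\<^esub> f (xs @ y # ys))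
     \<and> (\<forall>r\<in>carrier F. f (xs @ (r \<odot>\<^bsub>C\<^esub> x) # ys) = r \<odot>\<^bsub>B\<^esub> f (xs @ x # ys))}"

text \<open>Replaces the entries at positions \<open>i\<close> and \<open>i + 1\<close> (counted from \<open>0\<close>) by their product.\<close>

definition contract :: "('c, 'm) ring_scheme \<Rightarrow> nat \<Rightarrow> 'c list \<Rightarrow> 'c list" where
  "contract C i xs = take i xs @ (xs ! i \<otimes>\<^bsub>C\<^esub> xs ! (i + 1)) # drop (i + 2) xs"

definition alt_sign where
  "alt_sign B m b = (if even m then b else \<ominus>\<^bsub>B\<^esub> b)"

text \<open>
  The coboundary
  \<open>(\<delta> f)(c\<^sub>1, \<dots>, c\<^sub>n\<^sub>+\<^sub>1) = c\<^sub>1 * f(c\<^sub>2, \<dots>, c\<^sub>n\<^sub>+\<^sub>1)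
     + (\<Sum>i=1..n. (-1)^i f(c\<^sub>1, \<dots>, c\<^sub>i c\<^sub>i\<^sub>+\<^sub>1, \<dots>, c\<^sub>n\<^sub>+\<^sub>1)) + (-1)^(n+1) f(c\<^sub>1, \<dots>, c\<^sub>n) * c\<^sub>n\<^sub>+\<^sub>1\<close>;
  the summation index below is \<open>i - 1\<close>.
\<close>

definition hh_delta where
  "hh_delta C B \<xi> n f = (\<lambda>xs\<in>tuples C (Suc n).
     fst \<xi> (hd xs) (f (tl xs))
     \<oplus>\<^bsub>B\<^esub> (\<Oplus>\<^bsub>B\<^esub>i\<in>{..<n}. alt_sign B (Suc i) (f (contract C i xs)))
     \<oplus>\<^bsub>B\<^esub> alt_sign B (Suc n) (snd \<xi> (f (butlast xs)) (last xs)))"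

definition hh_zero where
  "hh_zero C B n = (\<lambda>xs\<in>tuples C n. \<zero>\<^bsub>B\<^esub>)"

definition hh_cocycles where
  "hh_cocycles F C B \<xi> n = {f \<in> hh_cochains F C B n. hh_delta C B \<xi> n f = hh_zero C B (Suc n)}"

definition hh_coboundaries where
  "hh_coboundaries F C B \<xi> n =
     (case n of 0 \<Rightarrow> {hh_zero C B 0} | Suc m \<Rightarrow> hh_delta C B \<xi> m ` hh_cochains F C B m)"

definition hh_cocycle_group where
  "hh_cocycle_group F C B \<xi> n =
     \<lparr>carrier = hh_cocycles F C B \<xi> n,
      monoid.mult = (\<lambda>f g. \<lambda>xs\<in>tuples C n. f xs \<oplus>\<^bsub>B\<^esub> g xs),
      one = hh_zero C B n\<rparr>"

definition HH where
  "HH F C B \<xi> n = hh_cocycle_group F C B \<xi> n Mod hh_coboundaries F C B \<xi> n"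

definition hh_class where
  "hh_class F C B \<xi> n f = hh_coboundaries F C B \<xi> n #>\<^bsub>hh_cocycle_group F C B \<xi> n\<^esub> f"

text \<open>The composite \<open>\<omega> \<cdot> (\<psi> \<otimes> \<dots> \<otimes> \<psi>)\<close>.\<close>

definition pullback_cochain where
  "pullback_cochain C \<psi> n \<omega> = (\<lambda>xs\<in>tuples C n. \<omega> (map \<psi> xs))"


section \<open>Crossed bimodules and crossed biextensions\<close>

locale crossed_bimodule = bimodule F A1 A2 act
  for F (structure) and A1 (structure) and A2 (structure) and act +
  fixes d
  assumes d_linear: "d \<in> linear_map F A2 A1"
    and d_lact: "\<lbrakk>a \<in> carrier A1; x \<in> carrier A2\<rbrakk> \<Longrightarrow> d (fst act a x) = a \<otimes>\<^bsub>A1\<^esub> d x"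
    and d_ract: "\<lbrakk>a \<in> carrier A1; x \<in> carrier A2\<rbrakk> \<Longrightarrow> d (snd act x a) = d x \<otimes>\<^bsub>A1\<^esub> a"
    and peiffer: "\<lbrakk>x \<in> carrier A2; y \<in> carrier A2\<rbrakk> \<Longrightarrow> fst act (d x) y = snd act x (d y)"

definition faithful_crossed where
  "faithful_crossed A1 A2 act \<longleftrightarrow> (\<forall>a\<in>carrier A1.
     (\<forall>x\<in>carrier A2. fst act a x = \<zero>\<^bsub>A2\<^esub> \<and> snd act x a = \<zero>\<^bsub>A2\<^esub>) \<longrightarrow> a = \<zero>\<^bsub>A1\<^esub>)"

text \<open>
  The data of a sequence \<open>B \<rightarrow> A2 \<rightarrow> A1 \<rightarrow> Q\<close> with maps \<open>bx_j\<close>, \<open>bx_d\<close>, \<open>bx_p\<close>, together with the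
  action \<open>bx_act\<close> of \<open>A1\<close> on \<open>A2\<close>.
\<close>

record ('f, 'b, 'x, 'a, 'q) biext =
  bx_B :: "('f, 'b) module"
  bx_A2 :: "('f, 'x) module"
  bx_A1 :: "('f, 'a) module"
  bx_Q :: "('f, 'q) module"
  bx_act :: "('a, 'x) bimod_structure"
  bx_j :: "'b \<Rightarrow> 'x"
  bx_d :: "'x \<Rightarrow> 'a"
  bx_p :: "'a \<Rightarrow> 'q"

definition crossed_biextension where
  "crossed_biextension F D \<longleftrightarrow>
     lin_space F (bx_B D) \<and> unital_algebra F (bx_Q D)
   \<and> crossed_bimodule F (bx_A1 D) (bx_A2 D) (bx_act D) (bx_d D)
   \<and> bx_j D \<in> linear_map F (bx_B D) (bx_A2 D)
   \<and> bx_p D \<in> unital_alg_hom F (bx_A1 D) (bx_Q D)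
   \<and> inj_on (bx_j D) (carrier (bx_B D))
   \<and> bx_j D ` carrier (bx_B D) = {x \<in> carrier (bx_A2 D). bx_d D x = \<zero>\<^bsub>bx_A1 D\<^esub>}
   \<and> bx_d D ` carrier (bx_A2 D) = {a \<in> carrier (bx_A1 D). bx_p D a = \<zero>\<^bsub>bx_Q D\<^esub>}
   \<and> bx_p D ` carrier (bx_A1 D) = carrier (bx_Q D)"

text \<open>
  The induced \<open>Q\<close>-bimodule structure on \<open>B\<close>, determined by \<open>j (p a * b) = a * j b\<close> and
  \<open>j (b * p a) = j b * a\<close>.
\<close>

definition biext_bimod ::
  "('f, 'b, 'x, 'a, 'q) biext \<Rightarrow> ('q, 'b) bimod_structure" where
  "biext_bimod D =
    (\<lambda>y b. THE b'. b' \<in> carrier (bx_B D)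
        \<and> (\<exists>a\<in>carrier (bx_A1 D). bx_p D a = y \<and> bx_j D b' = fst (bx_act D) a (bx_j D b)),
     \<lambda>b y. THE b'. b' \<in> carrier (bx_B D)
        \<and> (\<exists>a\<in>carrier (bx_A1 D). bx_p D a = y \<and> bx_j D b' = snd (bx_act D) (bx_j D b) a))"

text \<open>Linear sections \<open>s\<close> of \<open>p\<close> and \<open>q\<close> of \<open>A2 \<rightarrow> im \<partial>\<close>.\<close>

definition biext_sections where
  "biext_sections F D s q \<longleftrightarrow>
     s \<in> linear_map F (bx_Q D) (bx_A1 D)
   \<and> (\<forall>y\<in>carrier (bx_Q D). bx_p D (s y) = y)
   \<and> q \<in> linear_map F (bx_A1 D\<lparr>carrier := bx_d D ` carrier (bx_A2 D)\<rparr>) (bx_A2 D)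
   \<and> (\<forall>a\<in>bx_d D ` carrier (bx_A2 D). bx_d D (q a) = a)"

definition biext_f where
  "biext_f D s q x y = q (s x \<otimes>\<^bsub>bx_A1 D\<^esub> s y \<ominus>\<^bsub>bx_A1 D\<^esub> s (x \<otimes>\<^bsub>bx_Q D\<^esub> y))"

definition biext_cocycle where
  "biext_cocycle D s q = (\<lambda>xs\<in>tuples (bx_Q D) 3.
     let x = xs ! 0; y = xs ! 1; z = xs ! 2; f = biext_f D s q in
     inv_into (carrier (bx_B D)) (bx_j D)
       (fst (bx_act D) (s x) (f y z) \<ominus>\<^bsub>bx_A2 D\<^esub> f (x \<otimes>\<^bsub>bx_Q D\<^esub> y) z
        \<oplus>\<^bsub>bx_A2 D\<^esub> f x (y \<otimes>\<^bsub>bx_Q D\<^esub> z) \<ominus>\<^bsub>bx_A2 D\<^esub> snd (bx_act D) (f x y) (s z)))"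

text \<open>The class of a crossed biextension; it does not depend on the sections.\<close>

definition biext_class where
  "biext_class F D = (THE c. \<exists>s q. biext_sections F D s q
     \<and> c = hh_class F (bx_Q D) (bx_B D) (biext_bimod D) 3 (biext_cocycle D s q))"

definition biext_iso where
  "biext_iso F D D' \<beta> \<kappa> \<alpha> \<tau> \<longleftrightarrow>
     \<beta> \<in> linear_iso F (bx_B D) (bx_B D') \<and> \<kappa> \<in> linear_iso F (bx_A2 D) (bx_A2 D')
   \<and> \<alpha> \<in> unital_alg_iso F (bx_A1 D) (bx_A1 D') \<and> \<tau> \<in> unital_alg_iso F (bx_Q D) (bx_Q D')
   \<and> (\<forall>b\<in>carrier (bx_B D). \<kappa> (bx_j D b) = bx_j D' (\<beta> b))
   \<and> (\<forall>x\<in>carrier (bx_A2 D). \<alpha> (bx_d D x) = bx_d D' (\<kappa> x))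
   \<and> (\<forall>a\<in>carrier (bx_A1 D). \<tau> (bx_p D a) = bx_p D' (\<alpha> a))
   \<and> (\<forall>a\<in>carrier (bx_A1 D). \<forall>x\<in>carrier (bx_A2 D).
        \<kappa> (fst (bx_act D) a x) = fst (bx_act D') (\<alpha> a) (\<kappa> x)
      \<and> \<kappa> (snd (bx_act D) x a) = snd (bx_act D') (\<kappa> x) (\<alpha> a))"


section \<open>Abstract kernels\<close>

text \<open>\<open>Z(K)\<close>, as a subspace of \<open>K\<close>.\<close>

definition ann_alg :: "('f, 'k) module \<Rightarrow> ('f, 'k) module" where
  "ann_alg K = K\<lparr>carrier := {x \<in> carrier K. \<forall>a\<in>carrier K. x \<otimes>\<^bsub>K\<^esub> a = \<zero>\<^bsub>K\<^esub> \<and> a \<otimes>\<^bsub>K\<^esub> x = \<zero>\<^bsub>K\<^esub>}\<rparr>"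

text \<open>
  The pair \<open>(D, \<psi>\<^sub>0)\<close> is a representative of an abstract kernel of \<open>C\<close> and \<open>K\<close>. The map \<open>j\<close> is the
  inclusion of \<open>Z(K)\<close>, and the product on \<open>K\<close> obtained from the crossed bimodule is the given one.
\<close>

definition abstract_kernel where
  "abstract_kernel F C K D \<psi>\<^sub>0 \<longleftrightarrow>
     crossed_biextension F D
   \<and> bx_B D = ann_alg K \<and> bx_A2 D = K
   \<and> (\<forall>x\<in>carrier (ann_alg K). bx_j D x = x)
   \<and> (\<forall>x\<in>carrier K. \<forall>y\<in>carrier K. fst (bx_act D) (bx_d D x) y = x \<otimes>\<^bsub>K\<^esub> y)
   \<and> faithful_crossed (bx_A1 D) K (bx_act D)
   \<and> \<psi>\<^sub>0 \<in> unital_alg_hom F C (bx_Q D) \<and> \<psi>\<^sub>0 ` carrier C = carrier (bx_Q D)"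

definition kernel_iso where
  "kernel_iso F C D \<psi>\<^sub>0 D' \<psi>\<^sub>0' \<longleftrightarrow>
     (\<exists>\<alpha> \<tau>. biext_iso F D D' id id \<alpha> \<tau> \<and> (\<forall>c\<in>carrier C. \<psi>\<^sub>0' c = \<tau> (\<psi>\<^sub>0 c)))"


section \<open>Extensions\<close>

type_synonym ('f, 'k, 'c, 'e) extension = "('f, 'e) module \<times> ('k \<Rightarrow> 'e) \<times> ('e \<Rightarrow> 'c)"

definition extensions ::
  "('f, 'm) ring_scheme \<Rightarrow> ('f, 'c) module \<Rightarrow> ('f, 'k) module \<Rightarrow> ('f, 'k, 'c, 'e) extension set"
  where
  "extensions F C K = {(E, k, f). unital_algebra F E
     \<and> k \<in> alg_hom F K E \<and> f \<in> unital_alg_hom F E C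
     \<and> inj_on k (carrier K) \<and> k ` carrier K = {e \<in> carrier E. f e = \<zero>\<^bsub>C\<^esub>}
     \<and> f ` carrier E = carrier C}"

definition ext_rel ::
  "('f, 'm) ring_scheme \<Rightarrow> ('f, 'c) module \<Rightarrow> ('f, 'k) module
   \<Rightarrow> (('f, 'k, 'c, 'e) extension \<times> ('f, 'k, 'c, 'e) extension) set" where
  "ext_rel F C K = {((E, k, f), (E', k', f')).
     (E, k, f) \<in> extensions F C K \<and> (E', k', f') \<in> extensions F C K
     \<and> (\<exists>h \<in> unital_alg_iso F E E'. (\<forall>x\<in>carrier K. h (k x) = k' x)
          \<and> (\<forall>e\<in>carrier E. f' (h e) = f e))}"

text \<open>The quotient algebra of \<open>E\<close> by a two-sided ideal \<open>I\<close>: the quotient ring with its scalars.\<close>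

definition quot_alg :: "('f, 'e) module \<Rightarrow> 'e set \<Rightarrow> ('f, 'e set) module" where
  "quot_alg E I =
     \<lparr>carrier = carrier (E Quot I), monoid.mult = monoid.mult (E Quot I), monoid.one = monoid.one (E Quot I),
      ring.zero = ring.zero (E Quot I), ring.add = ring.add (E Quot I),
      module.smult = (\<lambda>r S. \<Union>x\<in>S. I +>\<^bsub>E\<^esub> (r \<odot>\<^bsub>E\<^esub> x))\<rparr>"

text \<open>\<open>Z(K, E)\<close>\<close>

definition ext_ann where
  "ext_ann K E k = {e \<in> carrier E. \<forall>x\<in>carrier K. e \<otimes>\<^bsub>E\<^esub> k x = \<zero>\<^bsub>E\<^esub> \<and> k x \<otimes>\<^bsub>E\<^esub> e = \<zero>\<^bsub>E\<^esub>}"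

text \<open>
  The abstract kernel induced by an extension. Elements of \<open>A = E / Z(K, E)\<close> are cosets \<open>S\<close>; the
  action of the coset of \<open>e\<close> on \<open>x\<close> is the \<open>y\<close> with \<open>k y = e \<cdot> k x\<close>, respectively \<open>k y = k x \<cdot> e\<close>.
  The cokernel of \<open>\<partial>\<close> is the quotient of \<open>A\<close> by the image of \<open>\<partial>\<close>.
\<close>

definition induced_biext ::
  "('f, 'k) module \<Rightarrow> ('f, 'k, 'c, 'e) extension \<Rightarrow> ('f, 'k, 'k, 'e set, 'e set set) biext" where
  "induced_biext K = (\<lambda>(E, k, f).
     let Z = ext_ann K E k;
         A = quot_alg E Z;
         d = (\<lambda>x. Z +>\<^bsub>E\<^esub> k x);
         J = d ` carrier K
     in \<lparr>bx_B = ann_alg K, bx_A2 = K, bx_A1 = A, bx_Q = quot_alg A J,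
         bx_act = (\<lambda>S x. THE y. y \<in> carrier K \<and> (\<exists>e\<in>S. k y = e \<otimes>\<^bsub>E\<^esub> k x),
                   \<lambda>x S. THE y. y \<in> carrier K \<and> (\<exists>e\<in>S. k y = k x \<otimes>\<^bsub>E\<^esub> e)),
         bx_j = (\<lambda>x. x), bx_d = d, bx_p = (\<lambda>S. J +>\<^bsub>A\<^esub> S)\<rparr>)"

definition induced_psi ::
  "('f, 'k) module \<Rightarrow> ('f, 'k, 'c, 'e) extension \<Rightarrow> 'c \<Rightarrow> 'e set set" where
  "induced_psi K = (\<lambda>(E, k, f) c.
     THE y. \<exists>e\<in>carrier E. f e = c
       \<and> y = bx_p (induced_biext K (E, k, f)) (ext_ann K E k +>\<^bsub>E\<^esub> e))"

text \<open>
  \<open>Ext(C, K, \<Psi>)\<close> for the abstract kernel \<open>\<Psi>\<close> represented by \<open>(D, \<psi>\<^sub>0)\<close>. The algebras \<open>E\<close> range over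
  all algebras whose carrier is a subset of the type \<open>'e\<close>; up to isomorphism these are all
  extensions as soon as \<open>'e\<close> is at least as large as the product of the carriers of \<open>K\<close> and \<open>C\<close>.
\<close>

definition Ext ::
  "('f, 'm) ring_scheme \<Rightarrow> ('f, 'c) module \<Rightarrow> ('f, 'k) module
   \<Rightarrow> ('f, 'k, 'k, 'a, 'q) biext \<Rightarrow> ('c \<Rightarrow> 'q) \<Rightarrow> ('f, 'k, 'c, 'e) extension set set" where
  "Ext F C K D \<psi>\<^sub>0 =
     {S \<in> extensions F C K. kernel_iso F C (induced_biext K S) (induced_psi K S) D \<psi>\<^sub>0}
       // ext_rel F C K"


section \<open>The action of second cohomology\<close>

text \<open>
  The action of \<open>H\<^sup>2(C, Z(K))\<close> on \<open>Ext(C, K, \<Psi>)\<close> changes the product of \<open>E\<close> by a cocycle \<open>\<chi>\<close>: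
  the new product of \<open>x\<close> and \<open>y\<close> is \<open>x y + k (\<chi> (f x, f y))\<close>, equivalently \<open>\<chi>\<close> is added to the factor
  set of \<open>E\<close> for any section of \<open>f\<close>. As \<open>\<chi>\<close> need not be normalized, the unit becomes
  \<open>1 - k (\<chi> (1, 1))\<close>.
\<close>

definition twist ::
  "('f, 'c) module \<Rightarrow> ('c list \<Rightarrow> 'k) \<Rightarrow> ('f, 'k, 'c, 'e) extension
   \<Rightarrow> ('f, 'k, 'c, 'e) extension" where
  "twist C \<chi> = (\<lambda>(E, k, f).
     (E\<lparr>monoid.mult := (\<lambda>x y. x \<otimes>\<^bsub>E\<^esub> y \<oplus>\<^bsub>E\<^esub> k (\<chi> [f x, f y])),
        one := \<one>\<^bsub>E\<^esub> \<ominus>\<^bsub>E\<^esub> k (\<chi> [\<one>\<^bsub>C\<^esub>, \<one>\<^bsub>C\<^esub>])\<rparr>, k, f))"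

text \<open>
  The class of \<open>\<chi>\<close> sends the isomorphism class of an extension to that of its twist by \<open>\<chi>\<close>.
  It is extensional on \<open>Ext(C, K, \<Psi>)\<close>, as required by \<open>group_action\<close>.
\<close>

definition ext_action ::
  "('f, 'm) ring_scheme \<Rightarrow> ('f, 'c) module \<Rightarrow> ('f, 'k) module
   \<Rightarrow> ('f, 'k, 'k, 'a, 'q) biext \<Rightarrow> ('c \<Rightarrow> 'q)
   \<Rightarrow> ('c list \<Rightarrow> 'k) set \<Rightarrow> ('f, 'k, 'c, 'e) extension set \<Rightarrow> ('f, 'k, 'c, 'e) extension set"
  where
  "ext_action F C K D \<psi>\<^sub>0 h = (\<lambda>S\<in>Ext F C K D \<psi>\<^sub>0.
     {Y. \<exists>\<chi>\<in>h. \<exists>U\<in>S. (twist C \<chi> U, Y) \<in> ext_rel F C K})"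

locale simply_transitive_action = group_action +
  assumes simply_transitive: "\<lbrakk>x \<in> E; y \<in> E\<rbrakk> \<Longrightarrow> \<exists>!g. g \<in> carrier G \<and> \<phi> g x = y"

end

theory Submission
  imports Defs
begin

text \<open>
  A linear section \<open>\<sigma> : C \<rightarrow> A\<close> over \<open>\<psi>\<close> and a bilinear \<open>g : C \<times> C \<rightarrow> K\<close> with
  \<open>\<partial> g(x, y) = \<sigma>(x) \<sigma>(y) - \<sigma>(x y)\<close> define a product on \<open>K \<times> C\<close> whose associator is the
  \<open>Z(K)\<close>-valued obstruction \<open>\<omega>(\<sigma>, g)\<close>. Changing \<open>\<sigma>\<close> by a map \<open>\<partial> t\<close> gives an isomorphic product, and
  changing \<open>g\<close> by a \<open>Z(K)\<close>-valued cochain \<open>\<eta>\<close> adds \<open>\<delta> \<eta>\<close> to the obstruction; so the class of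
  \<open>\<omega>(\<sigma>, g)\<close> is the pulled back class of the crossed biextension. It vanishes iff \<open>g\<close> can be chosen
  with \<open>\<omega>(\<sigma>, g) = 0\<close>, i.e. iff \<open>K \<times> C\<close> carries an extension, and every extension arises in this way
  from a linear section. Two extensions have sections over the same \<open>\<sigma>\<close>; their \<open>g\<close> then differ by a
  2-cocycle, which makes the second a twist of the first. An isomorphism between two twists of \<open>E\<close>
  has the form \<open>e \<mapsto> e + k (t (f e))\<close> with \<open>t : C \<rightarrow> Z(K)\<close>, and such a map is multiplicative iff the
  twisting cocycles differ by \<open>\<delta> t\<close>.
\<close>


section \<open>Linear maps\<close>

text \<open>Over a field every surjection of vector spaces has a linear section, so factor sets can
  be chosen bilinear and every comparison of choices stays among multilinear cochains. These choices
  are not normalized: \<sigma> need not preserve the unit, and then (0, 1) is no unit of the crossed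
  product. The unit is obtained as 2e - e^2 from an element e over 1 for which (1 - e)^2 acts as
  zero. On the side of extensions, the induced kernel is given by two successive quotients of E and
  by definite descriptions. All of this is condensed into one homomorphism \<pi> from E to A that is
  compatible with the actions on K; faithfulness of \<partial> is what makes the kernel of \<pi>
  equal to Z(K, E). Two extensions can be compared over one \<sigma> because any linear lift of
  \<psi> to A lifts further to a section of each extension, after correcting an arbitrary section by
  a map into K.\<close>

lemma linear_mapI:
  assumes "\<And>x. x \<in> carrier V \<Longrightarrow> h x \<in> carrier W"
    and "\<And>x y. x \<in> carrier V \<Longrightarrow> y \<in> carrier V \<Longrightarrow> h (x \<oplus>\<^bsub>V\<^esub> y) = h x \<oplus>\<^bsub>W\<^esub> h y"
    and "\<And>r x. r \<in> carrier F \<Longrightarrow> x \<in> carrier V \<Longrightarrow> h (r \<odot>\<^bsub>V\<^esub> x) = r \<odot>\<^bsub>W\<^esub> h x"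
  shows "h \<in> linear_map F V W"
  using assms by (auto simp: linear_map_def)

lemma linear_mapD:
  assumes "h \<in> linear_map F V W" "x \<in> carrier V"
  shows "h x \<in> carrier W"
    and "y \<in> carrier V \<Longrightarrow> h (x \<oplus>\<^bsub>V\<^esub> y) = h x \<oplus>\<^bsub>W\<^esub> h y"
    and "r \<in> carrier F \<Longrightarrow> h (r \<odot>\<^bsub>V\<^esub> x) = r \<odot>\<^bsub>W\<^esub> h x"
  using assms by (auto simp: linear_map_def)

lemma linear_map_comp:
  assumes "h \<in> linear_map F U V" "h' \<in> linear_map F V W"
  shows "(\<lambda>x. h' (h x)) \<in> linear_map F U W"
  using assms by (auto intro!: linear_mapI simp: linear_mapD)

lemma lin_space_abelian_group: "lin_space F V \<Longrightarrow> abelian_group V"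
  by (simp add: lin_space_def module_def)

lemma lin_space_smult:
  assumes "lin_space F V" "r \<in> carrier F" "x \<in> carrier V"
  shows "r \<odot>\<^bsub>V\<^esub> x \<in> carrier V"
    and "y \<in> carrier V \<Longrightarrow> r \<odot>\<^bsub>V\<^esub> (x \<oplus>\<^bsub>V\<^esub> y) = r \<odot>\<^bsub>V\<^esub> x \<oplus>\<^bsub>V\<^esub> r \<odot>\<^bsub>V\<^esub> y"
    and "r \<odot>\<^bsub>V\<^esub> \<zero>\<^bsub>V\<^esub> = \<zero>\<^bsub>V\<^esub>"
    and "r \<odot>\<^bsub>V\<^esub> (\<ominus>\<^bsub>V\<^esub> x) = \<ominus>\<^bsub>V\<^esub> (r \<odot>\<^bsub>V\<^esub> x)"
proof -
  interpret lin_space F V by fact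
  show "r \<odot>\<^bsub>V\<^esub> x \<in> carrier V"
    "y \<in> carrier V \<Longrightarrow> r \<odot>\<^bsub>V\<^esub> (x \<oplus>\<^bsub>V\<^esub> y) = r \<odot>\<^bsub>V\<^esub> x \<oplus>\<^bsub>V\<^esub> r \<odot>\<^bsub>V\<^esub> y"
    "r \<odot>\<^bsub>V\<^esub> \<zero>\<^bsub>V\<^esub> = \<zero>\<^bsub>V\<^esub>" "r \<odot>\<^bsub>V\<^esub> (\<ominus>\<^bsub>V\<^esub> x) = \<ominus>\<^bsub>V\<^esub> (r \<odot>\<^bsub>V\<^esub> x)"
    using assms(2,3) by (simp_all add: smult_r_distr smult_r_minus)
qed

text \<open>Only additivity is asked for, so that these facts also cover a product or an action
  regarded as a function of one of its arguments.\<close>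

lemma abelian_group_hom_lemmas:
  assumes V: "abelian_group V" and W: "abelian_group W"
    and closed: "\<And>x. x \<in> carrier V \<Longrightarrow> h x \<in> carrier W"
    and add: "\<And>x y. x \<in> carrier V \<Longrightarrow> y \<in> carrier V \<Longrightarrow> h (x \<oplus>\<^bsub>V\<^esub> y) = h x \<oplus>\<^bsub>W\<^esub> h y"
  shows additive_zero: "h \<zero>\<^bsub>V\<^esub> = \<zero>\<^bsub>W\<^esub>"
    and additive_neg: "x \<in> carrier V \<Longrightarrow> h (\<ominus>\<^bsub>V\<^esub> x) = \<ominus>\<^bsub>W\<^esub> h x"
    and additive_minus: "x \<in> carrier V \<Longrightarrow> y \<in> carrier V \<Longrightarrow> h (x \<ominus>\<^bsub>V\<^esub> y) = h x \<ominus>\<^bsub>W\<^esub> h y"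
proof -
  interpret V: abelian_group V by fact
  interpret W: abelian_group W by fact
  have "h \<zero>\<^bsub>V\<^esub> \<oplus>\<^bsub>W\<^esub> h \<zero>\<^bsub>V\<^esub> = h \<zero>\<^bsub>V\<^esub>"
    by (simp flip: add)
  then show z: "h \<zero>\<^bsub>V\<^esub> = \<zero>\<^bsub>W\<^esub>"
    by (simp add: closed)
  show neg: "h (\<ominus>\<^bsub>V\<^esub> x) = \<ominus>\<^bsub>W\<^esub> h x" if "x \<in> carrier V" for x
  proof -
    have "h (\<ominus>\<^bsub>V\<^esub> x) \<oplus>\<^bsub>W\<^esub> h x = \<zero>\<^bsub>W\<^esub>"
      using that by (simp flip: add) (simp add: V.l_neg z)
    then show ?thesis
      using W.minus_equality that closed by force
  qed
  show "h (x \<ominus>\<^bsub>V\<^esub> y) = h x \<ominus>\<^bsub>W\<^esub> h y" if "x \<in> carrier V" "y \<in> carrier V"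
    using that by (simp add: a_minus_def add neg)
qed

lemma
  assumes "lin_space F V" "lin_space F W" "h \<in> linear_map F V W"
  shows linear_map_zero: "h \<zero>\<^bsub>V\<^esub> = \<zero>\<^bsub>W\<^esub>"
    and linear_map_neg: "x \<in> carrier V \<Longrightarrow> h (\<ominus>\<^bsub>V\<^esub> x) = \<ominus>\<^bsub>W\<^esub> h x"
    and linear_map_minus: "x \<in> carrier V \<Longrightarrow> y \<in> carrier V \<Longrightarrow> h (x \<ominus>\<^bsub>V\<^esub> y) = h x \<ominus>\<^bsub>W\<^esub> h y"
  using assms(3)
  by (auto intro!: additive_zero additive_neg additive_minus assms(1,2)[THEN lin_space_abelian_group]
      simp: linear_mapD)

text \<open>A maximal subspace that meets the kernel trivially is mapped bijectively onto the target.\<close>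

lemma linear_section_exists:
  assumes V: "lin_space F V" and W: "lin_space F W" and h: "h \<in> linear_map F V W"
    and surj: "h ` carrier V = carrier W"
  obtains s where "s \<in> linear_map F W V" "\<And>y. y \<in> carrier W \<Longrightarrow> h (s y) = y"
proof -
  interpret V: lin_space F V by (rule V)
  interpret W: abelian_group W by (rule lin_space_abelian_group[OF W])
  note h_simps = linear_mapD[OF h] linear_map_zero[OF V W h] linear_map_neg[OF V W h]
    linear_map_minus[OF V W h]
  define subsp where "subsp M \<longleftrightarrow> M \<subseteq> carrier V \<and> \<zero>\<^bsub>V\<^esub> \<in> M \<and> (\<forall>x\<in>M. \<forall>y\<in>M. x \<oplus>\<^bsub>V\<^esub> y \<in> M)
      \<and> (\<forall>r\<in>carrier F. \<forall>x\<in>M. r \<odot>\<^bsub>V\<^esub> x \<in> M)" for M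
  define \<A> where "\<A> = {M. subsp M \<and> (\<forall>x\<in>M. h x = \<zero>\<^bsub>W\<^esub> \<longrightarrow> x = \<zero>\<^bsub>V\<^esub>)}"
  have "\<exists>M\<in>\<A>. \<forall>U\<in>\<A>. M \<subseteq> U \<longrightarrow> U = M"
  proof (rule subset_Zorn_nonempty)
    have "{\<zero>\<^bsub>V\<^esub>} \<in> \<A>"
      by (auto simp: \<A>_def subsp_def)
    then show "\<A> \<noteq> {}" by auto
  next
    fix \<C> assume ne: "\<C> \<noteq> {}" and ch: "subset.chain \<A> \<C>"
    have sub: "subsp U" "x \<in> U \<Longrightarrow> h x = \<zero>\<^bsub>W\<^esub> \<Longrightarrow> x = \<zero>\<^bsub>V\<^esub>" if "U \<in> \<C>" for U x
      using that ch by (auto simp: subset_chain_def \<A>_def)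
    have "x \<oplus>\<^bsub>V\<^esub> y \<in> \<Union>\<C>" if xy: "x \<in> U" "y \<in> Y" and XY: "U \<in> \<C>" "Y \<in> \<C>" for x y U Y
    proof -
      have "U \<subseteq> Y \<or> Y \<subseteq> U"
        using ch XY by (auto simp: subset_chain_def)
      then show ?thesis
        using xy XY sub(1)[of U] sub(1)[of Y] unfolding subsp_def by (metis UnionI subsetD)
    qed
    moreover have sub': "x \<in> U \<Longrightarrow> x \<in> carrier V" "\<zero>\<^bsub>V\<^esub> \<in> U"
      "r \<in> carrier F \<Longrightarrow> x \<in> U \<Longrightarrow> r \<odot>\<^bsub>V\<^esub> x \<in> U" if "U \<in> \<C>" for U r x
      using sub(1)[OF that] by (auto simp: subsp_def)
    moreover obtain U\<^sub>0 where "U\<^sub>0 \<in> \<C>"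
      using ne by auto
    ultimately have "subsp (\<Union>\<C>)"
      unfolding subsp_def by (intro conjI subsetI ballI) (metis UnionE UnionI)+
    moreover have "\<forall>x\<in>\<Union>\<C>. h x = \<zero>\<^bsub>W\<^esub> \<longrightarrow> x = \<zero>\<^bsub>V\<^esub>"
      using sub(2) by blast
    ultimately show "\<Union>\<C> \<in> \<A>"
      by (simp add: \<A>_def)
  qed
  then obtain M where M: "M \<in> \<A>" and max: "\<And>U. U \<in> \<A> \<Longrightarrow> M \<subseteq> U \<Longrightarrow> U = M"
    by blast
  have M_sub: "x \<in> carrier V" if "x \<in> M" for x
    using M that by (auto simp: \<A>_def subsp_def)
  have M_zero: "\<zero>\<^bsub>V\<^esub> \<in> M" and M_add: "\<And>x y. x \<in> M \<Longrightarrow> y \<in> M \<Longrightarrow> x \<oplus>\<^bsub>V\<^esub> y \<in> M"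
    and M_smult: "\<And>r x. r \<in> carrier F \<Longrightarrow> x \<in> M \<Longrightarrow> r \<odot>\<^bsub>V\<^esub> x \<in> M"
    and M_triv: "\<And>x. x \<in> M \<Longrightarrow> h x = \<zero>\<^bsub>W\<^esub> \<Longrightarrow> x = \<zero>\<^bsub>V\<^esub>"
    using M by (auto simp: \<A>_def subsp_def)
  have M_neg: "\<ominus>\<^bsub>V\<^esub> x \<in> M" if "x \<in> M" for x
  proof -
    have "(\<ominus>\<^bsub>F\<^esub> \<one>\<^bsub>F\<^esub>) \<odot>\<^bsub>V\<^esub> x \<in> M"
      by (rule M_smult) (use that in simp_all)
    then show ?thesis
      using V.V.smult_l_minus[OF V.F.one_closed M_sub[OF that]] V.V.smult_one[OF M_sub[OF that]]
      by (simp only:)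
  qed
  have ex: "\<exists>m\<in>M. h m = y" if y: "y \<in> carrier W" for y
  proof -
    obtain v where v: "v \<in> carrier V" "h v = y"
      using y surj by (metis imageE)
    \<comment> \<open>Adjoin one preimage v of y to M. If the sum still meets the kernel trivially,
      maximality puts v into M; otherwise some kernel element m + r v can be solved for v modulo the
      kernel.\<close>
    define U where "U = {m \<oplus>\<^bsub>V\<^esub> r \<odot>\<^bsub>V\<^esub> v | m r. m \<in> M \<and> r \<in> carrier F}"
    show ?thesis
    proof (cases "U \<in> \<A>")
      case True
      have "M \<subseteq> U"
      proof
        fix m assume "m \<in> M"
        then show "m \<in> U"
          unfolding U_def using M_sub v by (intro CollectI exI[of _ m] exI[of _ "\<zero>\<^bsub>F\<^esub>"]) simp
      qed
      then have "U = M"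
        by (rule max[OF True])
      moreover have "v \<in> U"
        unfolding U_def using v M_zero
          by (intro CollectI exI[of _ "\<zero>\<^bsub>V\<^esub>"] exI[of _ "\<one>\<^bsub>F\<^esub>"]) simp
      ultimately have "v \<in> M"
        by simp
      then show ?thesis
        using v(2) by (intro bexI[of _ v])
    next
      case False
      have "subsp U"
        unfolding subsp_def
      proof (intro conjI ballI)
        show "U \<subseteq> carrier V"
          unfolding U_def using M_sub v by auto
        show "\<zero>\<^bsub>V\<^esub> \<in> U"
          unfolding U_def using v M_zero
          by (intro CollectI exI[of _ "\<zero>\<^bsub>V\<^esub>"] exI[of _ "\<zero>\<^bsub>F\<^esub>"]) simp
      next
        fix x x' assume "x \<in> U" "x' \<in> U"
        then obtain m r m' r' where mr: "x = m \<oplus>\<^bsub>V\<^esub> r \<odot>\<^bsub>V\<^esub> v" "m \<in> M" "r \<in> carrier F"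
          "x' = m' \<oplus>\<^bsub>V\<^esub> r' \<odot>\<^bsub>V\<^esub> v" "m' \<in> M" "r' \<in> carrier F"
          unfolding U_def by blast
        have "x \<oplus>\<^bsub>V\<^esub> x' = (m \<oplus>\<^bsub>V\<^esub> m') \<oplus>\<^bsub>V\<^esub> (r \<oplus>\<^bsub>F\<^esub> r') \<odot>\<^bsub>V\<^esub> v"
          using mr M_sub v by (simp add: V.V.smult_l_distr V.V.M.a_ac)
        then show "x \<oplus>\<^bsub>V\<^esub> x' \<in> U"
          unfolding U_def using mr M_add by blast
      next
        fix c x assume c: "c \<in> carrier F" and "x \<in> U"
        then obtain m r where mr: "x = m \<oplus>\<^bsub>V\<^esub> r \<odot>\<^bsub>V\<^esub> v" "m \<in> M" "r \<in> carrier F"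
          unfolding U_def by blast
        have "c \<odot>\<^bsub>V\<^esub> x = c \<odot>\<^bsub>V\<^esub> m \<oplus>\<^bsub>V\<^esub> (c \<otimes>\<^bsub>F\<^esub> r) \<odot>\<^bsub>V\<^esub> v"
          using mr M_sub v c by (simp add: V.V.smult_r_distr V.V.smult_assoc1)
        then show "c \<odot>\<^bsub>V\<^esub> x \<in> U"
          unfolding U_def using mr c M_smult by blast
      qed
      then obtain m r where mr: "m \<in> M" "r \<in> carrier F" "h (m \<oplus>\<^bsub>V\<^esub> r \<odot>\<^bsub>V\<^esub> v) = \<zero>\<^bsub>W\<^esub>"
        "m \<oplus>\<^bsub>V\<^esub> r \<odot>\<^bsub>V\<^esub> v \<noteq> \<zero>\<^bsub>V\<^esub>"
        using False unfolding \<A>_def U_def by blast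
      \<comment> \<open>With r = 0 the kernel element would be m itself, which lies in M and would
        have to vanish.\<close>
      have "r \<noteq> \<zero>\<^bsub>F\<^esub>"
        using mr M_triv[of m] M_sub[of m] v by auto
      then have r: "r \<in> Units F"
        using mr(2) V.F.field_Units by auto
      \<comment> \<open>From h (m + r v) = 0 one gets h v = h (- r^(-1) m), so this element of M is
        a preimage of y.\<close>
      define m' where "m' = \<ominus>\<^bsub>V\<^esub> (inv\<^bsub>F\<^esub> r \<odot>\<^bsub>V\<^esub> m)"
      have "inv\<^bsub>F\<^esub> r \<odot>\<^bsub>V\<^esub> (m \<oplus>\<^bsub>V\<^esub> r \<odot>\<^bsub>V\<^esub> v) = v \<oplus>\<^bsub>V\<^esub> inv\<^bsub>F\<^esub> r \<odot>\<^bsub>V\<^esub> m"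
        using mr M_sub[of m] v r
        by (simp add: V.V.smult_r_distr V.V.M.a_comm V.F.Units_l_inv flip: V.V.smult_assoc1)
      moreover have "h (inv\<^bsub>F\<^esub> r \<odot>\<^bsub>V\<^esub> (m \<oplus>\<^bsub>V\<^esub> r \<odot>\<^bsub>V\<^esub> v)) = \<zero>\<^bsub>W\<^esub>"
        using mr M_sub[of m] v r y
          lin_space_smult(3)[OF W, of "inv\<^bsub>F\<^esub> r" y] by (simp add: h_simps(3))
      ultimately have "h (v \<oplus>\<^bsub>V\<^esub> inv\<^bsub>F\<^esub> r \<odot>\<^bsub>V\<^esub> m) = \<zero>\<^bsub>W\<^esub>"
        by simp
      then have "h v \<oplus>\<^bsub>W\<^esub> h (inv\<^bsub>F\<^esub> r \<odot>\<^bsub>V\<^esub> m) = \<zero>\<^bsub>W\<^esub>"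
        using mr M_sub[of m] v r by (simp add: h_simps(2))
      then have "h m' = y"
        unfolding m'_def using mr M_sub[of m] v r y h_simps(1)
          W.minus_equality[of y "h (inv\<^bsub>F\<^esub> r \<odot>\<^bsub>V\<^esub> m)"]
        by (simp add: h_simps(5))
      moreover have "m' \<in> M"
        unfolding m'_def using mr r by (intro M_neg M_smult) simp_all
      ultimately show ?thesis
        by (intro bexI[of _ m'])
    qed
  qed
  have uniq: "m = m'" if m: "m \<in> M" "m' \<in> M" and eq: "h m = h m'" for m m'
  proof -
    have "h (m \<oplus>\<^bsub>V\<^esub> \<ominus>\<^bsub>V\<^esub> m') = h m \<oplus>\<^bsub>W\<^esub> \<ominus>\<^bsub>W\<^esub> h m'"
      using m by (simp add: h_simps(2,5) M_sub)
    also have "\<dots> = \<zero>\<^bsub>W\<^esub>"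
      using m by (simp add: eq W.r_neg h_simps(1) M_sub)
    finally have "m \<oplus>\<^bsub>V\<^esub> \<ominus>\<^bsub>V\<^esub> m' = \<zero>\<^bsub>V\<^esub>"
      by (rule M_triv[OF M_add[OF m(1) M_neg[OF m(2)]]])
    then show ?thesis
      using m M_sub V.V.M.minus_equality[of m "\<ominus>\<^bsub>V\<^esub> m'"] by simp
  qed
  \<comment> \<open>h is injective on M, so the choice is forced and inherits linearity from
    h.\<close>
  define s where "s y = (SOME m. m \<in> M \<and> h m = y)" for y
  have s: "s y \<in> M \<and> h (s y) = y" if "y \<in> carrier W" for y
    unfolding s_def by (rule someI_ex) (use ex[OF that] in blast)
  show thesis
  proof (rule that)
    show "s \<in> linear_map F W V"
    proof (rule linear_mapI)
      fix x assume x: "x \<in> carrier W"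
      then show "s x \<in> carrier V"
        using s M_sub by simp
      show "s (x \<oplus>\<^bsub>W\<^esub> y) = s x \<oplus>\<^bsub>V\<^esub> s y" if "y \<in> carrier W" for y
        by (rule uniq) (simp_all add: x that s M_add M_sub h_simps(2))
      show "s (r \<odot>\<^bsub>W\<^esub> x) = r \<odot>\<^bsub>V\<^esub> s x" if "r \<in> carrier F" for r
        by (rule uniq) (simp_all add: x that s M_smult M_sub h_simps(3) lin_space_smult(1)[OF W])
    qed
  qed (simp add: s)
qed

section \<open>Images, quotients and transport of algebras\<close>

lemma lin_spaceI:
  assumes "field F" "abelian_group V"
    and "\<And>r x. r \<in> carrier F \<Longrightarrow> x \<in> carrier V \<Longrightarrow> r \<odot>\<^bsub>V\<^esub> x \<in> carrier V"
    and "\<And>r s x. r \<in> carrier F \<Longrightarrow> s \<in> carrier F \<Longrightarrow> x \<in> carrier V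
      \<Longrightarrow> (r \<oplus>\<^bsub>F\<^esub> s) \<odot>\<^bsub>V\<^esub> x = r \<odot>\<^bsub>V\<^esub> x \<oplus>\<^bsub>V\<^esub> s \<odot>\<^bsub>V\<^esub> x"
    and "\<And>r x y. r \<in> carrier F \<Longrightarrow> x \<in> carrier V \<Longrightarrow> y \<in> carrier V
      \<Longrightarrow> r \<odot>\<^bsub>V\<^esub> (x \<oplus>\<^bsub>V\<^esub> y) = r \<odot>\<^bsub>V\<^esub> x \<oplus>\<^bsub>V\<^esub> r \<odot>\<^bsub>V\<^esub> y"
    and "\<And>r s x. r \<in> carrier F \<Longrightarrow> s \<in> carrier F \<Longrightarrow> x \<in> carrier V
      \<Longrightarrow> (r \<otimes>\<^bsub>F\<^esub> s) \<odot>\<^bsub>V\<^esub> x = r \<odot>\<^bsub>V\<^esub> (s \<odot>\<^bsub>V\<^esub> x)"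
    and "\<And>x. x \<in> carrier V \<Longrightarrow> \<one>\<^bsub>F\<^esub> \<odot>\<^bsub>V\<^esub> x = x"
  shows "lin_space F V"
  by (rule lin_space.intro[OF assms(1)], rule moduleI)
    (use assms in \<open>simp_all add: fieldE(1)\<close>)

lemma unital_algebraD:
  assumes "unital_algebra F A"
  shows "assoc_algebra F A" "lin_space F A" "monoid A" "ring A" "field F"
proof -
  show 1: "assoc_algebra F A" "monoid A"
    using assms by (simp_all add: unital_algebra_def)
  then show 2: "lin_space F A"
    by (simp add: assoc_algebra_def)
  then show "field F"
    by (simp add: lin_space_def)
  show "ring A"
    by (rule ringI)
      (use 1 lin_space_abelian_group[OF 2] in
        \<open>auto simp: assoc_algebra.alg_l_distr assoc_algebra.alg_r_distr\<close>)
qed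

lemma unital_alg_homD:
  assumes "h \<in> unital_alg_hom F A B"
  shows "h \<in> linear_map F A B" "h \<in> alg_hom F A B" "h \<one>\<^bsub>A\<^esub> = \<one>\<^bsub>B\<^esub>"
    and "x \<in> carrier A \<Longrightarrow> h x \<in> carrier B"
    and "x \<in> carrier A \<Longrightarrow> y \<in> carrier A \<Longrightarrow> h (x \<oplus>\<^bsub>A\<^esub> y) = h x \<oplus>\<^bsub>B\<^esub> h y"
    and "r \<in> carrier F \<Longrightarrow> x \<in> carrier A \<Longrightarrow> h (r \<odot>\<^bsub>A\<^esub> x) = r \<odot>\<^bsub>B\<^esub> h x"
    and "x \<in> carrier A \<Longrightarrow> y \<in> carrier A \<Longrightarrow> h (x \<otimes>\<^bsub>A\<^esub> y) = h x \<otimes>\<^bsub>B\<^esub> h y"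
  using assms by (auto simp: unital_alg_hom_def alg_hom_def linear_mapD)

lemma unital_alg_homI:
  assumes "h \<in> linear_map F A B"
    and "\<And>x y. x \<in> carrier A \<Longrightarrow> y \<in> carrier A \<Longrightarrow> h (x \<otimes>\<^bsub>A\<^esub> y) = h x \<otimes>\<^bsub>B\<^esub> h y"
    and "h \<one>\<^bsub>A\<^esub> = \<one>\<^bsub>B\<^esub>"
  shows "h \<in> unital_alg_hom F A B"
  using assms by (simp add: unital_alg_hom_def alg_hom_def)

text \<open>No axiom is assumed for W: each identity in W is the image under h of the same identity
  in V. This serves images, quotient algebras and twists alike.\<close>

lemma lin_space_image:
  assumes V: "lin_space F V" and surj: "h ` carrier V = carrier W"
    and add: "\<And>x y. x \<in> carrier V \<Longrightarrow> y \<in> carrier V \<Longrightarrow> h x \<oplus>\<^bsub>W\<^esub> h y = h (x \<oplus>\<^bsub>V\<^esub> y)"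
    and smult: "\<And>r x. r \<in> carrier F \<Longrightarrow> x \<in> carrier V \<Longrightarrow> r \<odot>\<^bsub>W\<^esub> h x = h (r \<odot>\<^bsub>V\<^esub> x)"
    and zero: "\<zero>\<^bsub>W\<^esub> = h \<zero>\<^bsub>V\<^esub>"
  shows "lin_space F W"
proof -
  interpret V: lin_space F V by (rule V)
  have ex: "\<exists>a\<in>carrier V. x = h a" if "x \<in> carrier W" for x
    using that surj by blast
  have mem: "h a \<in> carrier W" if "a \<in> carrier V" for a
    using that surj by blast
  show ?thesis
  proof (rule lin_spaceI)
    show "abelian_group W"
    proof (rule abelian_groupI)
      fix x assume "x \<in> carrier W"
      then obtain a where a: "a \<in> carrier V" and x: "x = h a"
        using ex by blast
      show "\<exists>y\<in>carrier W. y \<oplus>\<^bsub>W\<^esub> x = \<zero>\<^bsub>W\<^esub>"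
        unfolding x using a
        by (intro bexI[of _ "h (\<ominus>\<^bsub>V\<^esub> a)"]) (simp_all add: add zero mem V.V.M.l_neg)
    qed (auto dest!: ex simp: add zero mem V.V.M.a_ac)
  qed (use V.F.field_axioms in
      \<open>auto dest!: ex simp: add smult mem V.V.smult_l_distr V.V.smult_r_distr V.V.smult_assoc1\<close>)
qed

lemma lin_space_subspace:
  assumes V: "lin_space F V" and sub: "S \<subseteq> carrier V" and zero: "\<zero>\<^bsub>V\<^esub> \<in> S"
    and add: "\<And>x y. x \<in> S \<Longrightarrow> y \<in> S \<Longrightarrow> x \<oplus>\<^bsub>V\<^esub> y \<in> S"
    and smult: "\<And>r x. r \<in> carrier F \<Longrightarrow> x \<in> S \<Longrightarrow> r \<odot>\<^bsub>V\<^esub> x \<in> S"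
  shows "lin_space F (V\<lparr>carrier := S\<rparr>)"
proof -
  interpret V: lin_space F V by (rule V)
  have c: "x \<in> carrier V" if "x \<in> S" for x
    using sub that by blast
  have neg: "\<ominus>\<^bsub>V\<^esub> x \<in> S" if "x \<in> S" for x
    using smult[of "\<ominus>\<^bsub>F\<^esub> \<one>\<^bsub>F\<^esub>", OF _ that] V.V.smult_l_minus[OF V.F.one_closed c[OF that]]
      V.V.smult_one[OF c[OF that]] by simp
  show ?thesis
  proof (rule lin_spaceI)
    show "abelian_group (V\<lparr>carrier := S\<rparr>)"
    proof (rule abelian_groupI)
      fix x assume "x \<in> carrier (V\<lparr>carrier := S\<rparr>)"
      then show "\<exists>y\<in>carrier (V\<lparr>carrier := S\<rparr>). y \<oplus>\<^bsub>V\<lparr>carrier := S\<rparr>\<^esub> x = \<zero>\<^bsub>V\<lparr>carrier := S\<rparr>\<^esub>"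
        by (intro bexI[of _ "\<ominus>\<^bsub>V\<^esub> x"]) (simp_all add: V.V.M.l_neg c neg)
    qed (simp_all add: c add zero V.V.M.a_ac)
  qed (use V.F.field_axioms in
      \<open>simp_all add: c smult V.V.smult_l_distr V.V.smult_r_distr V.V.smult_assoc1\<close>)
qed

lemma unital_algebra_image:
  assumes E: "unital_algebra F E" and surj: "h ` carrier E = carrier W"
    and add: "\<And>x y. x \<in> carrier E \<Longrightarrow> y \<in> carrier E \<Longrightarrow> h x \<oplus>\<^bsub>W\<^esub> h y = h (x \<oplus>\<^bsub>E\<^esub> y)"
    and smult: "\<And>r x. r \<in> carrier F \<Longrightarrow> x \<in> carrier E \<Longrightarrow> r \<odot>\<^bsub>W\<^esub> h x = h (r \<odot>\<^bsub>E\<^esub> x)"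
    and zero: "\<zero>\<^bsub>W\<^esub> = h \<zero>\<^bsub>E\<^esub>"
    and mult: "\<And>x y. x \<in> carrier E \<Longrightarrow> y \<in> carrier E \<Longrightarrow> h x \<otimes>\<^bsub>W\<^esub> h y = h (x \<otimes>\<^bsub>E\<^esub> y)"
    and one: "\<one>\<^bsub>W\<^esub> = h \<one>\<^bsub>E\<^esub>"
  shows "unital_algebra F W" "h \<in> unital_alg_hom F E W"
proof -
  interpret E: ring E by (rule unital_algebraD[OF E])
  note alg = unital_algebraD(1)[OF E]
  note lin = unital_algebraD(2)[OF E]
  have ex: "\<exists>a\<in>carrier E. x = h a" if "x \<in> carrier W" for x
    using that surj by blast
  have mem: "h a \<in> carrier W" if "a \<in> carrier E" for a
    using that surj by blast
  have W: "lin_space F W"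
    by (rule lin_space_image[OF lin surj add smult zero])
  show "unital_algebra F W"
  proof (intro unital_algebra.intro assoc_algebra.intro W assoc_algebra_axioms.intro monoidI)
  qed (auto dest!: ex simp: add smult mult one mem E.m_assoc E.l_distr E.r_distr
      lin_space_smult[OF lin] assoc_algebra.alg_smult_l[OF alg] assoc_algebra.alg_smult_r[OF alg])
  show "h \<in> unital_alg_hom F E W"
    by (intro unital_alg_homI linear_mapI) (simp_all add: add smult mult one mem)
qed

text \<open>The crossed product lives on a type of pairs, whereas \<open>Ext\<close> ranges over
  algebras in the type \<open>'e\<close>; this copies an algebra along an injection.\<close>

definition transport_alg :: "('e \<Rightarrow> 'x) \<Rightarrow> ('f, 'e) module \<Rightarrow> ('f, 'x) module" where
  "transport_alg g E = (let i = inv_into (carrier E) g in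
     \<lparr>carrier = g ` carrier E, monoid.mult = \<lambda>x y. g (i x \<otimes>\<^bsub>E\<^esub> i y), monoid.one = g \<one>\<^bsub>E\<^esub>, ring.zero = g \<zero>\<^bsub>E\<^esub>,
      ring.add = \<lambda>x y. g (i x \<oplus>\<^bsub>E\<^esub> i y), module.smult = \<lambda>r x. g (r \<odot>\<^bsub>E\<^esub> i x)\<rparr>)"

lemma transport_alg:
  assumes "unital_algebra F E" "inj_on g (carrier E)"
  shows "unital_algebra F (transport_alg g E)" "g \<in> unital_alg_iso F E (transport_alg g E)"
proof -
  have "g ` carrier E = carrier (transport_alg g E)"
    by (simp add: transport_alg_def Let_def)
  moreover note * = unital_algebra_image[OF assms(1) this]
  ultimately show "unital_algebra F (transport_alg g E)"
    "g \<in> unital_alg_iso F E (transport_alg g E)"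
    by (auto intro!: * simp: transport_alg_def Let_def assms(2) unital_alg_iso_def bij_betw_def)
qed

text \<open>Multiplication by the scalar r is multiplication by the element r 1 of E, so a ring
  ideal is a subspace. The scalars of \<open>quot_alg\<close> rely on this.\<close>

lemma ideal_smult_closed:
  assumes E: "unital_algebra F E" and I: "ideal I E" and r: "r \<in> carrier F" "x \<in> I"
  shows "r \<odot>\<^bsub>E\<^esub> x \<in> I"
proof -
  interpret ideal I E by (rule I)
  have "r \<odot>\<^bsub>E\<^esub> x = (r \<odot>\<^bsub>E\<^esub> \<one>\<^bsub>E\<^esub>) \<otimes>\<^bsub>E\<^esub> x"
    using r assoc_algebra.alg_smult_l[OF unital_algebraD(1)[OF E], of r "\<one>\<^bsub>E\<^esub>" x] by simp
  then show ?thesis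
    using r lin_space_smult(1)[OF unital_algebraD(2)[OF E]] I_l_closed by simp
qed

lemma ideal_coset_eq_iff:
  assumes "ideal I E" "x \<in> carrier E" "y \<in> carrier E"
  shows "I +>\<^bsub>E\<^esub> x = I +>\<^bsub>E\<^esub> y \<longleftrightarrow> x \<ominus>\<^bsub>E\<^esub> y \<in> I"
proof -
  interpret ideal I E by fact
  have "x \<in> I +>\<^bsub>E\<^esub> y \<longleftrightarrow> x \<ominus>\<^bsub>E\<^esub> y \<in> I"
    by (rule a_rcos_module_minus) (use assms ring_axioms in auto)
  then show ?thesis
    using assms a_repr_independence'[of x y] a_rcos_self[of x] by auto
qed

lemma quot_alg_ops:
  assumes E: "unital_algebra F E" and I: "ideal I E"
  shows quot_alg_carrier: "(\<lambda>x. I +>\<^bsub>E\<^esub> x) ` carrier E = carrier (quot_alg E I)"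
    and quot_alg_zero: "\<zero>\<^bsub>quot_alg E I\<^esub> = I +>\<^bsub>E\<^esub> \<zero>\<^bsub>E\<^esub>"
    and quot_alg_one: "\<one>\<^bsub>quot_alg E I\<^esub> = I +>\<^bsub>E\<^esub> \<one>\<^bsub>E\<^esub>"
    and quot_alg_add: "x \<in> carrier E \<Longrightarrow> y \<in> carrier E
      \<Longrightarrow> (I +>\<^bsub>E\<^esub> x) \<oplus>\<^bsub>quot_alg E I\<^esub> (I +>\<^bsub>E\<^esub> y) = I +>\<^bsub>E\<^esub> (x \<oplus>\<^bsub>E\<^esub> y)"
    and quot_alg_mult: "x \<in> carrier E \<Longrightarrow> y \<in> carrier E
      \<Longrightarrow> (I +>\<^bsub>E\<^esub> x) \<otimes>\<^bsub>quot_alg E I\<^esub> (I +>\<^bsub>E\<^esub> y) = I +>\<^bsub>E\<^esub> (x \<otimes>\<^bsub>E\<^esub> y)"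
    and quot_alg_smult: "r \<in> carrier F \<Longrightarrow> x \<in> carrier E
      \<Longrightarrow> r \<odot>\<^bsub>quot_alg E I\<^esub> (I +>\<^bsub>E\<^esub> x) = I +>\<^bsub>E\<^esub> (r \<odot>\<^bsub>E\<^esub> x)"
proof -
  interpret ideal I E by (rule I)
  note lin = unital_algebraD(2)[OF E]
  show "(\<lambda>x. I +>\<^bsub>E\<^esub> x) ` carrier E = carrier (quot_alg E I)"
    by (auto simp: quot_alg_def FactRing_simps)
  show "\<zero>\<^bsub>quot_alg E I\<^esub> = I +>\<^bsub>E\<^esub> \<zero>\<^bsub>E\<^esub>" "\<one>\<^bsub>quot_alg E I\<^esub> = I +>\<^bsub>E\<^esub> \<one>\<^bsub>E\<^esub>"
    by (simp_all add: quot_alg_def FactRing_def a_rcos_const)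
  show "(I +>\<^bsub>E\<^esub> x) \<oplus>\<^bsub>quot_alg E I\<^esub> (I +>\<^bsub>E\<^esub> y) = I +>\<^bsub>E\<^esub> (x \<oplus>\<^bsub>E\<^esub> y)"
    "(I +>\<^bsub>E\<^esub> x) \<otimes>\<^bsub>quot_alg E I\<^esub> (I +>\<^bsub>E\<^esub> y) = I +>\<^bsub>E\<^esub> (x \<otimes>\<^bsub>E\<^esub> y)"
    if "x \<in> carrier E" "y \<in> carrier E"
    using that by (simp_all add: quot_alg_def FactRing_def a_rcos_sum rcoset_mult_add)
  show "r \<odot>\<^bsub>quot_alg E I\<^esub> (I +>\<^bsub>E\<^esub> x) = I +>\<^bsub>E\<^esub> (r \<odot>\<^bsub>E\<^esub> x)"
    if r: "r \<in> carrier F" and x: "x \<in> carrier E" for r x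
  proof -
    \<comment> \<open>The scalar multiple of a coset is defined as a union over its elements. All of
      them yield the same coset, so this is a union of a constant family over a nonempty
      set.\<close>
    have eq: "I +>\<^bsub>E\<^esub> (r \<odot>\<^bsub>E\<^esub> y) = I +>\<^bsub>E\<^esub> (r \<odot>\<^bsub>E\<^esub> x)" if y: "y \<in> I +>\<^bsub>E\<^esub> x" for y
    proof -
      have yE: "y \<in> carrier E"
        using y x a_elemrcos_carrier by blast
      have "y \<ominus>\<^bsub>E\<^esub> x \<in> I"
        using y x yE a_rcos_module_minus ring_axioms by blast
      then have "r \<odot>\<^bsub>E\<^esub> (y \<ominus>\<^bsub>E\<^esub> x) \<in> I"
        by (rule ideal_smult_closed[OF E I r])
      moreover have "r \<odot>\<^bsub>E\<^esub> (y \<ominus>\<^bsub>E\<^esub> x) = r \<odot>\<^bsub>E\<^esub> y \<ominus>\<^bsub>E\<^esub> r \<odot>\<^bsub>E\<^esub> x"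
        unfolding a_minus_def using lin_space_smult(2)[OF lin r yE a_inv_closed[OF x]]
          lin_space_smult(4)[OF lin r x] by (simp only:)
      ultimately show ?thesis
        using ideal_coset_eq_iff[OF I lin_space_smult(1)[OF lin r yE]
            lin_space_smult(1)[OF lin r x]] by (simp only:)
    qed
    have "I +>\<^bsub>E\<^esub> x \<noteq> {}"
      using a_rcos_self[OF x] by blast
    then have "(\<Union>y\<in>I +>\<^bsub>E\<^esub> x. I +>\<^bsub>E\<^esub> (r \<odot>\<^bsub>E\<^esub> y)) = I +>\<^bsub>E\<^esub> (r \<odot>\<^bsub>E\<^esub> x)"
      by (rule SUP_eq_const) (rule eq)
    then show ?thesis
      by (simp only: quot_alg_def module.simps)
  qed
qed

lemma quot_alg_unital_algebra:
  assumes E: "unital_algebra F E" and I: "ideal I E"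
  shows "unital_algebra F (quot_alg E I)" "(\<lambda>x. I +>\<^bsub>E\<^esub> x) \<in> unital_alg_hom F E (quot_alg E I)"
  by (rule unital_algebra_image[OF E quot_alg_carrier[OF E I]];
      simp add: quot_alg_ops[OF E I])+

lemma kernel_ideal:
  assumes E: "unital_algebra F E" and A: "unital_algebra F A" and h: "h \<in> unital_alg_hom F E A"
  shows "ideal {e \<in> carrier E. h e = \<zero>\<^bsub>A\<^esub>} E"
proof -
  interpret E: ring E by (rule unital_algebraD[OF E])
  interpret A: ring A by (rule unital_algebraD[OF A])
  note simps = unital_alg_homD[OF h]
    linear_map_zero[OF unital_algebraD(2)[OF E] unital_algebraD(2)[OF A] unital_alg_homD(1)[OF h]]
    linear_map_neg[OF unital_algebraD(2)[OF E] unital_algebraD(2)[OF A] unital_alg_homD(1)[OF h]]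
  show ?thesis
    by (rule idealI[OF E.ring_axioms], unfold_locales)
      (auto simp: simps simp flip: a_inv_def)
qed

text \<open>The first isomorphism theorem. The ideal is a variable of its own because it is taken to
  be Z(K, E) and the image of \<partial>, which are recognized as kernels by separate
  arguments.\<close>

lemma quot_alg_kernel_iso:
  assumes E: "unital_algebra F E" and A: "unital_algebra F A" and h: "h \<in> unital_alg_hom F E A"
    and surj: "h ` carrier E = carrier A"
    and I: "I = {e \<in> carrier E. h e = \<zero>\<^bsub>A\<^esub>}"
  obtains \<alpha> where "\<alpha> \<in> unital_alg_iso F (quot_alg E I) A"
    "\<And>e. e \<in> carrier E \<Longrightarrow> \<alpha> (I +>\<^bsub>E\<^esub> e) = h e"
proof -
  interpret E: ring E by (rule unital_algebraD[OF E])
  interpret A: ring A by (rule unital_algebraD[OF A])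
  have idl: "ideal I E"
    unfolding I by (rule kernel_ideal[OF E A h])
  have eq_iff: "I +>\<^bsub>E\<^esub> x = I +>\<^bsub>E\<^esub> y \<longleftrightarrow> h x = h y" if "x \<in> carrier E" "y \<in> carrier E" for x y
  proof -
    have "h (x \<ominus>\<^bsub>E\<^esub> y) = h x \<ominus>\<^bsub>A\<^esub> h y"
      by (rule linear_map_minus[OF unital_algebraD(2)[OF E] unital_algebraD(2)[OF A]
            unital_alg_homD(1)[OF h]]) fact+
    then show ?thesis
      using that by (simp add: ideal_coset_eq_iff[OF idl]) (simp add: I unital_alg_homD[OF h])
  qed
  define \<alpha> where "\<alpha> S = h (SOME e. e \<in> carrier E \<and> I +>\<^bsub>E\<^esub> e = S)" for S
  have \<alpha>: "\<alpha> (I +>\<^bsub>E\<^esub> e) = h e" if "e \<in> carrier E" for e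
    unfolding \<alpha>_def using that by (rule_tac someI2[of _ e]) (auto simp: eq_iff)
  note carr = quot_alg_carrier[OF E idl, symmetric]
  have "\<alpha> \<in> unital_alg_iso F (quot_alg E I) A"
    unfolding unital_alg_iso_def
  proof (intro CollectI conjI unital_alg_homI linear_mapI)
    show "bij_betw \<alpha> (carrier (quot_alg E I)) (carrier A)"
      unfolding bij_betw_def carr by (auto simp: inj_on_def \<alpha> eq_iff image_image surj)
  qed (auto simp: carr \<alpha> quot_alg_ops(2-)[OF E idl] lin_space_smult[OF unital_algebraD(2)[OF E]]
      unital_alg_homD[OF h])
  then show thesis
    using that \<alpha> by blast
qed

section \<open>Hochschild cochains in low degrees\<close>

text \<open>The curried form in which factor sets are handled; the lemmas of this section exchange
  it with the list encoding of 2-cochains.\<close>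

definition bilinear_map where
  "bilinear_map F V W g \<longleftrightarrow> (\<forall>x\<in>carrier V. g x \<in> linear_map F V W)
     \<and> (\<forall>y\<in>carrier V. (\<lambda>x. g x y) \<in> linear_map F V W)"

lemma bilinear_mapI:
  assumes "\<And>x y. x \<in> carrier V \<Longrightarrow> y \<in> carrier V \<Longrightarrow> g x y \<in> carrier W"
    and "\<And>x x' y. x \<in> carrier V \<Longrightarrow> x' \<in> carrier V \<Longrightarrow> y \<in> carrier V
      \<Longrightarrow> g (x \<oplus>\<^bsub>V\<^esub> x') y = g x y \<oplus>\<^bsub>W\<^esub> g x' y"
    and "\<And>x y y'. x \<in> carrier V \<Longrightarrow> y \<in> carrier V \<Longrightarrow> y' \<in> carrier V
      \<Longrightarrow> g x (y \<oplus>\<^bsub>V\<^esub> y') = g x y \<oplus>\<^bsub>W\<^esub> g x y'"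
    and "\<And>r x y. r \<in> carrier F \<Longrightarrow> x \<in> carrier V \<Longrightarrow> y \<in> carrier V
      \<Longrightarrow> g (r \<odot>\<^bsub>V\<^esub> x) y = r \<odot>\<^bsub>W\<^esub> g x y"
    and "\<And>r x y. r \<in> carrier F \<Longrightarrow> x \<in> carrier V \<Longrightarrow> y \<in> carrier V
      \<Longrightarrow> g x (r \<odot>\<^bsub>V\<^esub> y) = r \<odot>\<^bsub>W\<^esub> g x y"
  shows "bilinear_map F V W g"
  unfolding bilinear_map_def using assms by (auto intro!: linear_mapI)

lemma bilinear_mapD:
  assumes "bilinear_map F V W g" "x \<in> carrier V" "y \<in> carrier V"
  shows "g x y \<in> carrier W"
    and "x' \<in> carrier V \<Longrightarrow> g (x \<oplus>\<^bsub>V\<^esub> x') y = g x y \<oplus>\<^bsub>W\<^esub> g x' y"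
    and "y' \<in> carrier V \<Longrightarrow> g x (y \<oplus>\<^bsub>V\<^esub> y') = g x y \<oplus>\<^bsub>W\<^esub> g x y'"
    and "r \<in> carrier F \<Longrightarrow> g (r \<odot>\<^bsub>V\<^esub> x) y = r \<odot>\<^bsub>W\<^esub> g x y"
    and "r \<in> carrier F \<Longrightarrow> g x (r \<odot>\<^bsub>V\<^esub> y) = r \<odot>\<^bsub>W\<^esub> g x y"
  using assms linear_mapD[of "g x" F V W] linear_mapD[of "\<lambda>x. g x y" F V W]
  by (auto simp: bilinear_map_def)

lemma tuples_Suc_iff:
  "xs \<in> tuples C (Suc n) \<longleftrightarrow> (\<exists>x ys. xs = x # ys \<and> x \<in> carrier C \<and> ys \<in> tuples C n)"
  by (cases xs) (auto simp: tuples_def)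

lemma tuples_0_iff: "xs \<in> tuples C 0 \<longleftrightarrow> xs = []"
  by (auto simp: tuples_def)

lemma tuples_1_iff: "xs \<in> tuples C (Suc 0) \<longleftrightarrow> (\<exists>x. xs = [x] \<and> x \<in> carrier C)"
  and tuples_2_iff: "xs \<in> tuples C 2 \<longleftrightarrow> (\<exists>x y. xs = [x, y] \<and> x \<in> carrier C \<and> y \<in> carrier C)"
  and tuples_3_iff: "xs \<in> tuples C 3 \<longleftrightarrow>
      (\<exists>x y z. xs = [x, y, z] \<and> x \<in> carrier C \<and> y \<in> carrier C \<and> z \<in> carrier C)"
  by (auto simp: tuples_Suc_iff tuples_0_iff numeral_2_eq_2 numeral_3_eq_3)

lemma tuples_mem [simp]:
  "[x] \<in> tuples C (Suc 0) \<longleftrightarrow> x \<in> carrier C"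
  "[x, y] \<in> tuples C 2 \<longleftrightarrow> x \<in> carrier C \<and> y \<in> carrier C"
  "[x, y, z] \<in> tuples C 3 \<longleftrightarrow> x \<in> carrier C \<and> y \<in> carrier C \<and> z \<in> carrier C"
  by (auto simp: tuples_1_iff tuples_2_iff tuples_3_iff)

lemma hh_cochains_PiE: "f \<in> hh_cochains F C B n \<Longrightarrow> f \<in> tuples C n \<rightarrow>\<^sub>E carrier B"
  by (simp add: hh_cochains_def)

lemma hh_cochains_slot:
  assumes "f \<in> hh_cochains F C B n" "x \<in> carrier C" "set xs \<subseteq> carrier C" "set ys \<subseteq> carrier C"
    "length xs + 1 + length ys = n"
  shows "y \<in> carrier C \<Longrightarrow> f (xs @ (x \<oplus>\<^bsub>C\<^esub> y) # ys) = f (xs @ x # ys) \<oplus>\<^bsub>B\<^esub> f (xs @ y # ys)"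
    and "r \<in> carrier F \<Longrightarrow> f (xs @ (r \<odot>\<^bsub>C\<^esub> x) # ys) = r \<odot>\<^bsub>B\<^esub> f (xs @ x # ys)"
  using assms unfolding hh_cochains_def by blast+

lemma hh_cochains_1_linear:
  assumes f: "f \<in> hh_cochains F C B (Suc 0)"
  shows "(\<lambda>x. f [x]) \<in> linear_map F C B"
proof (rule linear_mapI)
  fix x assume x: "x \<in> carrier C"
  show "f [x] \<in> carrier B"
    using hh_cochains_PiE[OF f] x by (auto simp: PiE_iff)
  show "f [x \<oplus>\<^bsub>C\<^esub> y] = f [x] \<oplus>\<^bsub>B\<^esub> f [y]" if "y \<in> carrier C" for y
    using hh_cochains_slot(1)[OF f x, of "[]" "[]"] that by simp
  show "f [r \<odot>\<^bsub>C\<^esub> x] = r \<odot>\<^bsub>B\<^esub> f [x]" if "r \<in> carrier F" for r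
    using hh_cochains_slot(2)[OF f x, of "[]" "[]"] that by simp
qed

lemma hh_cochains_2_bilinear:
  assumes f: "f \<in> hh_cochains F C B 2"
  shows "bilinear_map F C B (\<lambda>x y. f [x, y])"
proof (rule bilinear_mapI)
  fix x y assume xy: "x \<in> carrier C" "y \<in> carrier C"
  show "f [x, y] \<in> carrier B"
    using hh_cochains_PiE[OF f] xy by (auto simp: PiE_iff)
  show "f [x \<oplus>\<^bsub>C\<^esub> x', y] = f [x, y] \<oplus>\<^bsub>B\<^esub> f [x', y]" if "x' \<in> carrier C" for x'
    using hh_cochains_slot(1)[OF f xy(1), of "[]" "[y]"] xy that by simp
  show "f [x, y \<oplus>\<^bsub>C\<^esub> y'] = f [x, y] \<oplus>\<^bsub>B\<^esub> f [x, y']" if "y' \<in> carrier C" for y'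
    using hh_cochains_slot(1)[OF f xy(2), of "[x]" "[]"] xy that by simp
  show "f [r \<odot>\<^bsub>C\<^esub> x, y] = r \<odot>\<^bsub>B\<^esub> f [x, y]" if "r \<in> carrier F" for r
    using hh_cochains_slot(2)[OF f xy(1), of "[]" "[y]"] xy that by simp
  show "f [x, r \<odot>\<^bsub>C\<^esub> y] = r \<odot>\<^bsub>B\<^esub> f [x, y]" if "r \<in> carrier F" for r
    using hh_cochains_slot(2)[OF f xy(2), of "[x]" "[]"] xy that by simp
qed

lemma linear_hh_cochain:
  assumes C: "unital_algebra F C" and h: "h \<in> linear_map F C B"
  shows "(\<lambda>xs\<in>tuples C (Suc 0). h (hd xs)) \<in> hh_cochains F C B (Suc 0)"
proof -
  interpret ring C by (rule unital_algebraD[OF C])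
  show ?thesis
    unfolding hh_cochains_def
    by (auto simp: linear_mapD[OF h] tuples_1_iff lin_space_smult[OF unital_algebraD(2)[OF C]])
qed

lemma bilinear_hh_cochain:
  assumes C: "unital_algebra F C" and g: "bilinear_map F C B g"
  shows "(\<lambda>xs\<in>tuples C 2. g (xs ! 0) (xs ! 1)) \<in> hh_cochains F C B 2"
proof -
  interpret ring C by (rule unital_algebraD[OF C])
  note sm = lin_space_smult(1)[OF unital_algebraD(2)[OF C]]
  show ?thesis
    unfolding hh_cochains_def
  proof (intro CollectI conjI allI ballI impI)
    show "(\<lambda>xs\<in>tuples C 2. g (xs ! 0) (xs ! 1)) \<in> tuples C 2 \<rightarrow>\<^sub>E carrier B"
      by (auto simp: tuples_2_iff bilinear_mapD[OF g])
    fix xs ys x assume A: "x \<in> carrier C" "set xs \<subseteq> carrier C" "set ys \<subseteq> carrier C"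
      and len: "length xs + 1 + length ys = 2"
    let ?f = "\<lambda>xs\<in>tuples C 2. g (xs ! 0) (xs ! 1)"
    consider w where "xs = []" "ys = [w]" | w where "xs = [w]" "ys = []"
      using len by (cases xs; cases ys) auto
    note cs = this
    show "?f (xs @ (x \<oplus>\<^bsub>C\<^esub> y) # ys) = ?f (xs @ x # ys) \<oplus>\<^bsub>B\<^esub> ?f (xs @ y # ys)"
      if "y \<in> carrier C" for y
      by (rule cs) (use A that in \<open>simp_all add: bilinear_mapD(2,3)[OF g]\<close>)
    show "?f (xs @ (r \<odot>\<^bsub>C\<^esub> x) # ys) = r \<odot>\<^bsub>B\<^esub> ?f (xs @ x # ys)" if "r \<in> carrier F" for r
      by (rule cs) (use A that in \<open>simp_all add: bilinear_mapD(4,5)[OF g] sm\<close>)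
  qed
qed

abbreviation cochain_add where
  "cochain_add C B n f g \<equiv> (\<lambda>xs\<in>tuples C n. f xs \<oplus>\<^bsub>B\<^esub> g xs)"

abbreviation cochain_neg where
  "cochain_neg C B n f \<equiv> (\<lambda>xs\<in>tuples C n. \<ominus>\<^bsub>B\<^esub> f xs)"

lemma PiE_const_mem: "f \<in> S \<rightarrow>\<^sub>E T \<Longrightarrow> x \<in> S \<Longrightarrow> f x \<in> T"
  by (rule PiE_mem)

lemma PiE_eqI:
  assumes "f \<in> S \<rightarrow>\<^sub>E T" "g \<in> S \<rightarrow>\<^sub>E T" "\<And>x. x \<in> S \<Longrightarrow> f x = g x"
  shows "f = g"
  using assms by (intro extensionalityI[of f S g]) (auto simp: PiE_def)

text \<open>K and Z(K) enter as additive groups, so \<open>algebra\<close> is given the laws of an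
  abelian group to normalize with.\<close>

lemmas (in abelian_group) abelian_group_simprules
  [algebra abelian_group "ring.zero G" "ring.add G" "a_inv G" "a_minus G"] =
  a_closed zero_closed a_inv_closed minus_closed a_assoc l_zero l_neg a_comm minus_eq r_zero r_neg
  r_neg2 r_neg1 minus_add minus_minus minus_zero a_lcomm

text \<open>The cancellation behind \<delta>\<delta>h = 0 for a 1-cochain h, at (x, y, z): here a =
  x*y*h(z), b = x*h(y*z), c = x*h(y)*z, u = h(x*y)*z, v = h(x*y*z) and w = h(x)*y*z.\<close>

lemma (in abelian_group) alternating_sum_cancel:
  assumes "a \<in> carrier G" "b \<in> carrier G" "c \<in> carrier G" "u \<in> carrier G" "v \<in> carrier G"
    "w \<in> carrier G"
  shows "(a \<ominus> b \<oplus> c) \<ominus> (a \<ominus> v \<oplus> u) \<oplus> (b \<ominus> v \<oplus> w) \<ominus> (c \<ominus> u \<oplus> w) = \<zero>"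
  using assms by algebra

section \<open>Additivity of the coboundary, equality of classes, and the group structure in degree
  2\<close>

context bimodule
begin

lemma abelian_group_B: "abelian_group B"
  by (rule lin_space_abelian_group[OF B.lin_space_axioms])

lemma ring_C: "ring C"
  by (rule unital_algebraD[OF C.unital_algebra_axioms])

lemma contract_closed:
  assumes "xs \<in> tuples C (Suc n)" "i < n"
  shows "contract C i xs \<in> tuples C n"
proof -
  interpret CC: ring C by (rule ring_C)
  have xs: "length xs = Suc n" "set xs \<subseteq> carrier C"
    using assms(1) by (auto simp: tuples_def)
  have "xs ! i \<in> carrier C" "xs ! (i + 1) \<in> carrier C"
    using xs assms(2) by (auto simp: subset_iff)
  moreover have "set (take i xs) \<subseteq> carrier C" "set (drop (i + 2) xs) \<subseteq> carrier C"
    using xs(2) by (auto dest: in_set_takeD in_set_dropD)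
  ultimately show ?thesis
    using xs(1) assms(2) by (auto simp: contract_def tuples_def)
qed

lemma hd_tl_butlast_last:
  assumes "xs \<in> tuples C (Suc n)"
  shows "hd xs \<in> carrier C" "tl xs \<in> tuples C n" "butlast xs \<in> tuples C n" "last xs \<in> carrier C"
proof -
  have "xs \<noteq> []"
    using assms by (auto simp: tuples_def)
  then show "hd xs \<in> carrier C" "tl xs \<in> tuples C n" "butlast xs \<in> tuples C n" "last xs \<in> carrier C"
    using assms by (auto simp: tuples_def subset_iff dest: in_set_butlastD list.set_sel(2))
qed

lemma hh_delta_closed:
  assumes f: "f \<in> tuples C n \<rightarrow> carrier B"
  shows "hh_delta C B \<xi> n f \<in> tuples C (Suc n) \<rightarrow>\<^sub>E carrier B"
proof -
  have c: "f xs \<in> carrier B" if "xs \<in> tuples C n" for xs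
    using f that by blast
  show ?thesis
  proof (rule PiE_I)
    fix xs assume xs: "xs \<in> tuples C (Suc n)"
    note m = hd_tl_butlast_last[OF xs] contract_closed[OF xs]
    show "hh_delta C B \<xi> n f xs \<in> carrier B"
      unfolding hh_delta_def alt_sign_def using xs
      by (auto intro!: B.V.M.a_closed B.V.M.finsum_closed B.V.M.a_inv_closed simp: c m lact_closed ract_closed)
  qed (simp add: hh_delta_def)
qed

lemma hh_delta_add:
  assumes f: "f \<in> tuples C n \<rightarrow> carrier B" and g: "g \<in> tuples C n \<rightarrow> carrier B"
  shows "hh_delta C B \<xi> n (cochain_add C B n f g)
    = cochain_add C B (Suc n) (hh_delta C B \<xi> n f) (hh_delta C B \<xi> n g)"
proof
  have c: "f xs \<in> carrier B" "g xs \<in> carrier B" if "xs \<in> tuples C n" for xs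
    using f g that by blast+
  have sign: "alt_sign B m (a \<oplus>\<^bsub>B\<^esub> b) = alt_sign B m a \<oplus>\<^bsub>B\<^esub> alt_sign B m b"
    if "a \<in> carrier B" "b \<in> carrier B" for m a b
    using that by (simp_all add: alt_sign_def B.V.M.minus_add)
  have sign_closed: "alt_sign B m a \<in> carrier B" if "a \<in> carrier B" for m a
    using that by (simp add: alt_sign_def)
  fix xs
  show "hh_delta C B \<xi> n (cochain_add C B n f g) xs
    = cochain_add C B (Suc n) (hh_delta C B \<xi> n f) (hh_delta C B \<xi> n g) xs"
  proof (cases "xs \<in> tuples C (Suc n)")
    case xs: True
    note m = hd_tl_butlast_last[OF xs] contract_closed[OF xs]
    let ?S = "\<lambda>f. \<Oplus>\<^bsub>B\<^esub>i\<in>{..<n}. alt_sign B (Suc i) (f (contract C i xs))"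
    have S: "(\<Oplus>\<^bsub>B\<^esub>i\<in>{..<n}. alt_sign B (Suc i) (cochain_add C B n f g (contract C i xs)))
        = ?S f \<oplus>\<^bsub>B\<^esub> ?S g"
    proof -
      have "(\<Oplus>\<^bsub>B\<^esub>i\<in>{..<n}. alt_sign B (Suc i) (cochain_add C B n f g (contract C i xs)))
        = (\<Oplus>\<^bsub>B\<^esub>i\<in>{..<n}. alt_sign B (Suc i) (f (contract C i xs))
            \<oplus>\<^bsub>B\<^esub> alt_sign B (Suc i) (g (contract C i xs)))"
        by (rule B.V.M.finsum_cong') (auto simp: m c sign sign_closed)
      also have "\<dots> = ?S f \<oplus>\<^bsub>B\<^esub> ?S g"
        by (rule B.V.M.finsum_addf) (auto simp: m c sign_closed)
      finally show ?thesis .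
    qed
    have cl: "?S f \<in> carrier B" "?S g \<in> carrier B"
      by (auto intro!: B.V.M.finsum_closed simp: m c sign sign_closed)
    show ?thesis
      using cl by (simp only: hh_delta_def restrict_apply'[OF xs] restrict_apply'[OF m(2)]
          restrict_apply'[OF m(3)] S)
        (simp add: m c sign sign_closed lact_closed ract_closed lact_add_r ract_add_l B.V.M.a_ac)
  qed (simp add: hh_delta_def)
qed

lemma hh_delta_1:
  assumes f: "\<And>x. x \<in> carrier C \<Longrightarrow> f [x] \<in> carrier B" and xy: "x \<in> carrier C" "y \<in> carrier C"
  shows "hh_delta C B \<xi> (Suc 0) f [x, y] =
    fst \<xi> x (f [y]) \<ominus>\<^bsub>B\<^esub> f [x \<otimes>\<^bsub>C\<^esub> y] \<oplus>\<^bsub>B\<^esub> snd \<xi> (f [x]) y"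
proof -
  interpret CC: ring C by (rule ring_C)
  have "[x, y] \<in> tuples C (Suc (Suc 0))"
    using xy by (simp add: tuples_Suc_iff tuples_0_iff)
  moreover have "{..<Suc 0} = {0}" by auto
  ultimately show ?thesis
    using xy by (simp add: hh_delta_def contract_def alt_sign_def f lact_closed ract_closed
        a_minus_def Pi_def B.V.M.finsum_insert)
qed

text \<open>Written in the shape of \<open>obstruction\<close>, with the bimodule actions in place
  of a linear lift to A.\<close>

lemma hh_delta_2:
  assumes f: "\<And>x y. x \<in> carrier C \<Longrightarrow> y \<in> carrier C \<Longrightarrow> f [x, y] \<in> carrier B"
    and xyz: "x \<in> carrier C" "y \<in> carrier C" "z \<in> carrier C"
  shows "hh_delta C B \<xi> 2 f [x, y, z] =
    fst \<xi> x (f [y, z]) \<ominus>\<^bsub>B\<^esub> f [x \<otimes>\<^bsub>C\<^esub> y, z] \<oplus>\<^bsub>B\<^esub> f [x, y \<otimes>\<^bsub>C\<^esub> z] \<ominus>\<^bsub>B\<^esub> snd \<xi> (f [x, y]) z"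
proof -
  interpret CC: ring C by (rule ring_C)
  have "[x, y, z] \<in> tuples C (Suc 2)"
    using xyz by (simp add: tuples_Suc_iff tuples_0_iff numeral_2_eq_2)
  moreover have "{..<2} = {0, 1::nat}" by auto
  ultimately show ?thesis
    using xyz by (simp add: hh_delta_def contract_def alt_sign_def f lact_closed ract_closed
        a_minus_def Pi_def B.V.M.finsum_insert B.V.M.a_assoc)
qed

lemma hh_zero_PiE: "hh_zero C B n \<in> tuples C n \<rightarrow>\<^sub>E carrier B"
proof -
  show ?thesis
    by (simp add: hh_zero_def)
qed

lemma hh_cochains_group:
  shows hh_cochains_zero: "hh_zero C B n \<in> hh_cochains F C B n"
    and hh_cochains_add: "f \<in> hh_cochains F C B n \<Longrightarrow> g \<in> hh_cochains F C B n
      \<Longrightarrow> cochain_add C B n f g \<in> hh_cochains F C B n"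
    and hh_cochains_neg: "f \<in> hh_cochains F C B n \<Longrightarrow> cochain_neg C B n f \<in> hh_cochains F C B n"
proof -
  interpret CC: ring C by (rule ring_C)
  note smB = lin_space_smult[OF B.lin_space_axioms]
  note smC = lin_space_smult[OF C.lin_space_axioms]
  have t: "xs @ x # ys \<in> tuples C n \<longleftrightarrow> True"
    if "length xs + 1 + length ys = n" "set xs \<subseteq> carrier C" "set ys \<subseteq> carrier C" "x \<in> carrier C"
    for x xs ys
    using that by (auto simp: tuples_def)
  show "hh_zero C B n \<in> hh_cochains F C B n"
    unfolding hh_cochains_def hh_zero_def by (auto simp: t smC(1) smB(3)[OF _ B.V.M.zero_closed])
  show "cochain_add C B n f g \<in> hh_cochains F C B n"
    if fg: "f \<in> hh_cochains F C B n" "g \<in> hh_cochains F C B n"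
    unfolding hh_cochains_def
  proof (intro CollectI conjI allI ballI impI)
    have c: "f xs \<in> carrier B" "g xs \<in> carrier B" if "xs \<in> tuples C n" for xs
      using fg[THEN hh_cochains_PiE] that by auto
    then show "cochain_add C B n f g \<in> tuples C n \<rightarrow>\<^sub>E carrier B"
      by auto
    fix xs ys x assume A: "x \<in> carrier C" "set xs \<subseteq> carrier C" "set ys \<subseteq> carrier C"
      and len: "length xs + 1 + length ys = n"
    note tt = t[OF len A(2,3)]
    show "cochain_add C B n f g (xs @ (x \<oplus>\<^bsub>C\<^esub> y) # ys) =
        cochain_add C B n f g (xs @ x # ys) \<oplus>\<^bsub>B\<^esub> cochain_add C B n f g (xs @ y # ys)"
      if "y \<in> carrier C" for y
    proof -
      have "f (xs @ (x \<oplus>\<^bsub>C\<^esub> y) # ys) = f (xs @ x # ys) \<oplus>\<^bsub>B\<^esub> f (xs @ y # ys)"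
        "g (xs @ (x \<oplus>\<^bsub>C\<^esub> y) # ys) = g (xs @ x # ys) \<oplus>\<^bsub>B\<^esub> g (xs @ y # ys)"
        using fg[THEN hh_cochains_slot(1), OF A len] that by simp_all
      then show ?thesis
        using A that by (simp add: tt c B.V.M.a_ac)
    qed
    show "cochain_add C B n f g (xs @ (r \<odot>\<^bsub>C\<^esub> x) # ys) = r \<odot>\<^bsub>B\<^esub> cochain_add C B n f g (xs @ x # ys)"
      if "r \<in> carrier F" for r
    proof -
      have "f (xs @ (r \<odot>\<^bsub>C\<^esub> x) # ys) = r \<odot>\<^bsub>B\<^esub> f (xs @ x # ys)"
        "g (xs @ (r \<odot>\<^bsub>C\<^esub> x) # ys) = r \<odot>\<^bsub>B\<^esub> g (xs @ x # ys)"
        using fg[THEN hh_cochains_slot(2), OF A len] that by simp_all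
      then show ?thesis
        using A that by (simp add: tt c smB(2) smC(1))
    qed
  qed
  show "cochain_neg C B n f \<in> hh_cochains F C B n" if f: "f \<in> hh_cochains F C B n"
    unfolding hh_cochains_def
  proof (intro CollectI conjI allI ballI impI)
    have c: "f xs \<in> carrier B" if "xs \<in> tuples C n" for xs
      using hh_cochains_PiE[OF f] that by auto
    then show "cochain_neg C B n f \<in> tuples C n \<rightarrow>\<^sub>E carrier B"
      by auto
    fix xs ys x assume A: "x \<in> carrier C" "set xs \<subseteq> carrier C" "set ys \<subseteq> carrier C"
      and len: "length xs + 1 + length ys = n"
    note tt = t[OF len A(2,3)]
    show "cochain_neg C B n f (xs @ (x \<oplus>\<^bsub>C\<^esub> y) # ys) =
        cochain_neg C B n f (xs @ x # ys) \<oplus>\<^bsub>B\<^esub> cochain_neg C B n f (xs @ y # ys)"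
      if "y \<in> carrier C" for y
    proof -
      have "f (xs @ (x \<oplus>\<^bsub>C\<^esub> y) # ys) = f (xs @ x # ys) \<oplus>\<^bsub>B\<^esub> f (xs @ y # ys)"
        using hh_cochains_slot(1)[OF f A len] that by simp
      then show ?thesis
        using A that by (simp add: tt c B.V.M.minus_add)
    qed
    show "cochain_neg C B n f (xs @ (r \<odot>\<^bsub>C\<^esub> x) # ys) = r \<odot>\<^bsub>B\<^esub> cochain_neg C B n f (xs @ x # ys)"
      if "r \<in> carrier F" for r
    proof -
      have "f (xs @ (r \<odot>\<^bsub>C\<^esub> x) # ys) = r \<odot>\<^bsub>B\<^esub> f (xs @ x # ys)"
        using hh_cochains_slot(2)[OF f A len] that by simp
      then show ?thesis
        using A that by (simp add: tt c smB(4) smC(1))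
    qed
  qed
qed

text \<open>Additivity gives \<delta>0 = \<delta>0 + \<delta>0, which spares evaluating the
  alternating sum.\<close>

lemma hh_delta_zero: "hh_delta C B \<xi> n (hh_zero C B n) = hh_zero C B (Suc n)"
proof (rule PiE_eqI[OF hh_delta_closed hh_zero_PiE])
  show z: "hh_zero C B n \<in> tuples C n \<rightarrow> carrier B"
    using hh_zero_PiE by auto
  have "cochain_add C B n (hh_zero C B n) (hh_zero C B n) = hh_zero C B n"
    by (auto simp: hh_zero_def fun_eq_iff)
  then have eq: "hh_delta C B \<xi> n (hh_zero C B n)
      = cochain_add C B (Suc n) (hh_delta C B \<xi> n (hh_zero C B n)) (hh_delta C B \<xi> n (hh_zero C B n))"
    using hh_delta_add[OF z z] by simp
  fix xs assume xs: "xs \<in> tuples C (Suc n)"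
  then have "hh_delta C B \<xi> n (hh_zero C B n) xs \<in> carrier B"
    using hh_delta_closed[OF z] by auto
  moreover have "hh_delta C B \<xi> n (hh_zero C B n) xs
      = hh_delta C B \<xi> n (hh_zero C B n) xs \<oplus>\<^bsub>B\<^esub> hh_delta C B \<xi> n (hh_zero C B n) xs"
    using fun_cong[OF eq, of xs] xs by simp
  ultimately show "hh_delta C B \<xi> n (hh_zero C B n) xs = hh_zero C B (Suc n) xs"
    using xs by (simp add: hh_zero_def)
qed

lemma hh_delta_neg:
  assumes f: "f \<in> tuples C n \<rightarrow> carrier B"
  shows "hh_delta C B \<xi> n (cochain_neg C B n f) = cochain_neg C B (Suc n) (hh_delta C B \<xi> n f)"
proof -
  have g: "cochain_neg C B n f \<in> tuples C n \<rightarrow> carrier B"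
    using f by auto
  have "cochain_add C B n (cochain_neg C B n f) f = hh_zero C B n"
    using f by (auto simp: hh_zero_def fun_eq_iff B.V.M.l_neg Pi_iff)
  then have eq: "cochain_add C B (Suc n) (hh_delta C B \<xi> n (cochain_neg C B n f)) (hh_delta C B \<xi> n f)
      = hh_zero C B (Suc n)"
    using hh_delta_add[OF g f] hh_delta_zero by simp
  show ?thesis
  proof (rule PiE_eqI[OF hh_delta_closed[OF g]])
    show "cochain_neg C B (Suc n) (hh_delta C B \<xi> n f) \<in> tuples C (Suc n) \<rightarrow>\<^sub>E carrier B"
      using hh_delta_closed[OF f] by auto
    fix xs assume xs: "xs \<in> tuples C (Suc n)"
    then have "hh_delta C B \<xi> n (cochain_neg C B n f) xs \<oplus>\<^bsub>B\<^esub> hh_delta C B \<xi> n f xs = \<zero>\<^bsub>B\<^esub>"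
      using fun_cong[OF eq, of xs] by (simp add: hh_zero_def)
    then show "hh_delta C B \<xi> n (cochain_neg C B n f) xs = cochain_neg C B (Suc n) (hh_delta C B \<xi> n f) xs"
      using xs hh_delta_closed[OF f, THEN PiE_const_mem, OF xs]
        hh_delta_closed[OF g, THEN PiE_const_mem, OF xs]
      by (simp add: B.V.M.minus_equality)
  qed
qed

lemma hh_coboundaries_group:
  shows hh_coboundaries_PiE: "f \<in> hh_coboundaries F C B \<xi> (Suc n) \<Longrightarrow> f \<in> tuples C (Suc n) \<rightarrow>\<^sub>E carrier B"
    and hh_coboundaries_zero: "hh_zero C B (Suc n) \<in> hh_coboundaries F C B \<xi> (Suc n)"
    and hh_coboundaries_add: "f \<in> hh_coboundaries F C B \<xi> (Suc n) \<Longrightarrow> g \<in> hh_coboundaries F C B \<xi> (Suc n)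
      \<Longrightarrow> cochain_add C B (Suc n) f g \<in> hh_coboundaries F C B \<xi> (Suc n)"
    and hh_coboundaries_neg: "f \<in> hh_coboundaries F C B \<xi> (Suc n)
      \<Longrightarrow> cochain_neg C B (Suc n) f \<in> hh_coboundaries F C B \<xi> (Suc n)"
proof -
  have c: "f \<in> tuples C n \<rightarrow> carrier B" if "f \<in> hh_cochains F C B n" for f
    using hh_cochains_PiE[OF that] by auto
  show "f \<in> tuples C (Suc n) \<rightarrow>\<^sub>E carrier B" if "f \<in> hh_coboundaries F C B \<xi> (Suc n)" for f
    using that hh_delta_closed[OF c] unfolding hh_coboundaries_def by auto
  show "hh_zero C B (Suc n) \<in> hh_coboundaries F C B \<xi> (Suc n)"
    using hh_delta_zero[of n, symmetric] hh_cochains_zero[of n] unfolding hh_coboundaries_def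
    by (simp add: image_iff) metis
  show "cochain_add C B (Suc n) f g \<in> hh_coboundaries F C B \<xi> (Suc n)"
    if "f \<in> hh_coboundaries F C B \<xi> (Suc n)" "g \<in> hh_coboundaries F C B \<xi> (Suc n)"
  proof -
    obtain a b where ab: "f = hh_delta C B \<xi> n a" "a \<in> hh_cochains F C B n"
      "g = hh_delta C B \<xi> n b" "b \<in> hh_cochains F C B n"
      using \<open>f \<in> _\<close> \<open>g \<in> _\<close> unfolding hh_coboundaries_def by auto
    show ?thesis
      unfolding ab(1,3) hh_delta_add[OF c[OF ab(2)] c[OF ab(4)], symmetric]
      using hh_cochains_add[OF ab(2,4)] by (simp add: hh_coboundaries_def)
  qed
  show "cochain_neg C B (Suc n) f \<in> hh_coboundaries F C B \<xi> (Suc n)"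
    if "f \<in> hh_coboundaries F C B \<xi> (Suc n)"
  proof -
    obtain a where a: "f = hh_delta C B \<xi> n a" "a \<in> hh_cochains F C B n"
      using \<open>f \<in> _\<close> unfolding hh_coboundaries_def by auto
    show ?thesis
      unfolding a(1) hh_delta_neg[OF c[OF a(2)], symmetric]
      using hh_cochains_neg[OF a(2)] by (simp add: hh_coboundaries_def)
  qed
qed

lemma hh_class_eq:
  "hh_class F C B \<xi> n f = (\<lambda>b. cochain_add C B n b f) ` hh_coboundaries F C B \<xi> n"
  by (auto simp: hh_class_def r_coset_def hh_cocycle_group_def)

text \<open>Cosets are formed by pointwise addition, so equality comes down to coboundaries being
  closed under addition and negation. It is stated for functions known to have values in B, which is
  what is recorded about \<open>biext_cocycle\<close>.\<close>

lemma hh_class_eq_iff: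
  assumes f: "f \<in> tuples C (Suc n) \<rightarrow>\<^sub>E carrier B" and g: "g \<in> tuples C (Suc n) \<rightarrow>\<^sub>E carrier B"
  shows "hh_class F C B \<xi> (Suc n) f = hh_class F C B \<xi> (Suc n) g \<longleftrightarrow>
    (\<exists>b\<in>hh_coboundaries F C B \<xi> (Suc n). f = cochain_add C B (Suc n) b g)"
proof
  have "cochain_add C B (Suc n) (hh_zero C B (Suc n)) f = f"
    by (rule PiE_eqI[OF _ f]) (auto simp: hh_zero_def PiE_const_mem[OF f])
  then have "f \<in> hh_class F C B \<xi> (Suc n) f"
    unfolding hh_class_eq by (intro image_eqI[OF _ hh_coboundaries_zero]) (rule sym)
  moreover assume "hh_class F C B \<xi> (Suc n) f = hh_class F C B \<xi> (Suc n) g"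
  ultimately have "f \<in> hh_class F C B \<xi> (Suc n) g"
    by simp
  then show "\<exists>b\<in>hh_coboundaries F C B \<xi> (Suc n). f = cochain_add C B (Suc n) b g"
    unfolding hh_class_eq by (elim imageE) (rule bexI)
next
  have sub: "hh_class F C B \<xi> (Suc n) f \<subseteq> hh_class F C B \<xi> (Suc n) g"
    if fg: "f = cochain_add C B (Suc n) b g" and b: "b \<in> hh_coboundaries F C B \<xi> (Suc n)"
      and g: "g \<in> tuples C (Suc n) \<rightarrow>\<^sub>E carrier B" for f g b
  proof
    fix x assume "x \<in> hh_class F C B \<xi> (Suc n) f"
    then obtain a where a: "a \<in> hh_coboundaries F C B \<xi> (Suc n)" "x = cochain_add C B (Suc n) a f"
      unfolding hh_class_eq by auto
    have "x = cochain_add C B (Suc n) (cochain_add C B (Suc n) a b) g"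
      unfolding a(2) fg using hh_coboundaries_PiE[OF a(1), THEN PiE_const_mem]
        hh_coboundaries_PiE[OF b, THEN PiE_const_mem] g[THEN PiE_const_mem]
      by (auto simp: fun_eq_iff B.V.M.a_assoc)
    then show "x \<in> hh_class F C B \<xi> (Suc n) g"
      unfolding hh_class_eq using hh_coboundaries_add[OF a(1) b] by blast
  qed
  assume "\<exists>b\<in>hh_coboundaries F C B \<xi> (Suc n). f = cochain_add C B (Suc n) b g"
  then obtain b where b: "b \<in> hh_coboundaries F C B \<xi> (Suc n)" and fg: "f = cochain_add C B (Suc n) b g"
    by blast
  \<comment> \<open>The relation is symmetric, as -b is a coboundary too; so the inclusion
    \<open>sub\<close> applies in both directions.\<close>
  have gf: "g = cochain_add C B (Suc n) (cochain_neg C B (Suc n) b) f"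
  proof (rule PiE_eqI[OF g])
    note bc = hh_coboundaries_PiE[OF b]
    show "cochain_add C B (Suc n) (cochain_neg C B (Suc n) b) f \<in> tuples C (Suc n) \<rightarrow>\<^sub>E carrier B"
      by (auto simp: PiE_const_mem[OF bc] PiE_const_mem[OF f])
    show "g x = cochain_add C B (Suc n) (cochain_neg C B (Suc n) b) f x" if "x \<in> tuples C (Suc n)" for x
      unfolding fg using that
      by (simp add: PiE_const_mem[OF bc] PiE_const_mem[OF g] B.V.M.r_neg1)
  qed
  show "hh_class F C B \<xi> (Suc n) f = hh_class F C B \<xi> (Suc n) g"
    by (rule subset_antisym[OF sub[OF fg b g] sub[OF gf hh_coboundaries_neg[OF b] f]])
qed

text \<open>The unit of the factor group is the set of coboundaries itself, which is the class of
  the zero cochain.\<close>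

lemma hh_class_trivial_iff:
  assumes f: "f \<in> tuples C (Suc n) \<rightarrow>\<^sub>E carrier B"
  shows "hh_class F C B \<xi> (Suc n) f = \<one>\<^bsub>HH F C B \<xi> (Suc n)\<^esub> \<longleftrightarrow> f \<in> hh_coboundaries F C B \<xi> (Suc n)"
proof -
  have add_zero: "cochain_add C B (Suc n) b (hh_zero C B (Suc n)) = b"
    if "b \<in> tuples C (Suc n) \<rightarrow>\<^sub>E carrier B" for b
    by (rule PiE_eqI[OF _ that]) (auto simp: hh_zero_def PiE_const_mem[OF that])
  have "\<one>\<^bsub>HH F C B \<xi> (Suc n)\<^esub> = hh_class F C B \<xi> (Suc n) (hh_zero C B (Suc n))"
    unfolding hh_class_eq using hh_coboundaries_PiE
    by (force simp: HH_def FactGroup_def add_zero image_iff)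
  then show ?thesis
    using hh_coboundaries_PiE
    by (auto simp: hh_class_eq_iff[OF f hh_zero_PiE] add_zero)
qed

lemma hh_cocycle_group_comm_group: "comm_group (hh_cocycle_group F C B \<xi> n)"
proof -
  have c: "f \<in> hh_cochains F C B n" "f \<in> tuples C n \<rightarrow>\<^sub>E carrier B" "f \<in> tuples C n \<rightarrow> carrier B"
    "hh_delta C B \<xi> n f = hh_zero C B (Suc n)" if "f \<in> hh_cocycles F C B \<xi> n" for f
    using that hh_cochains_PiE[of f F C B n] by (auto simp: hh_cocycles_def)
  have v: "f xs \<in> carrier B" if "f \<in> hh_cocycles F C B \<xi> n" "xs \<in> tuples C n" for f xs
    using c(3)[OF that(1)] that(2) by blast
  have add: "cochain_add C B n f g \<in> hh_cocycles F C B \<xi> n"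
    if "f \<in> hh_cocycles F C B \<xi> n" "g \<in> hh_cocycles F C B \<xi> n" for f g
    unfolding hh_cocycles_def using hh_cochains_add[OF c(1)[OF that(1)] c(1)[OF that(2)]]
      hh_delta_add[OF c(3)[OF that(1)] c(3)[OF that(2)]]
    by (simp add: c(4)[OF that(1)] c(4)[OF that(2)]) (auto simp: hh_zero_def fun_eq_iff)
  have neg: "cochain_neg C B n f \<in> hh_cocycles F C B \<xi> n"
    if "f \<in> hh_cocycles F C B \<xi> n" for f
    unfolding hh_cocycles_def using hh_cochains_neg[OF c(1)[OF that]] hh_delta_neg[OF c(3)[OF that]]
    by (simp add: c(4)[OF that]) (auto simp: hh_zero_def fun_eq_iff)
  have zero: "hh_zero C B n \<in> hh_cocycles F C B \<xi> n"
    by (simp add: hh_cocycles_def hh_cochains_zero hh_delta_zero)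
  show ?thesis
  proof (rule comm_groupI)
    fix f assume "f \<in> carrier (hh_cocycle_group F C B \<xi> n)"
    then have f: "f \<in> hh_cocycles F C B \<xi> n"
      by (simp add: hh_cocycle_group_def)
    show "\<one>\<^bsub>hh_cocycle_group F C B \<xi> n\<^esub> \<otimes>\<^bsub>hh_cocycle_group F C B \<xi> n\<^esub> f = f"
      by (rule PiE_eqI[OF _ c(2)[OF f]]) (auto simp: hh_cocycle_group_def hh_zero_def v[OF f])
    show "\<exists>g\<in>carrier (hh_cocycle_group F C B \<xi> n).
        g \<otimes>\<^bsub>hh_cocycle_group F C B \<xi> n\<^esub> f = \<one>\<^bsub>hh_cocycle_group F C B \<xi> n\<^esub>"
      using neg[OF f] v[OF f] by (intro bexI[of _ "cochain_neg C B n f"])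
        (auto simp: hh_cocycle_group_def hh_zero_def fun_eq_iff B.V.M.l_neg)
  qed (auto simp: hh_cocycle_group_def add zero v B.V.M.a_ac fun_eq_iff)
qed

text \<open>The vanishing of \<delta>\<delta> is proved in the degree where cohomology has to be a
  group in order to act; in degree 3 the vanishing of one class is at stake.\<close>

lemma hh_coboundaries_2_cocycles: "hh_coboundaries F C B \<xi> 2 \<subseteq> hh_cocycles F C B \<xi> 2"
proof
  interpret CC: ring C by (rule ring_C)
  fix f assume f: "f \<in> hh_coboundaries F C B \<xi> 2"
  then obtain h where h: "h \<in> hh_cochains F C B (Suc 0)" and fh: "f = hh_delta C B \<xi> (Suc 0) h"
    by (auto simp: hh_coboundaries_def numeral_2_eq_2)
  note lin = linear_mapD[OF hh_cochains_1_linear[OF h]]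
  note B_simps = lact_closed ract_closed lact_add_l lact_add_r lact_smult_l lact_smult_r ract_add_l
    ract_add_r ract_smult_l ract_smult_r lact_mult ract_mult lact_ract a_minus_def B.V.M.minus_add
    lin_space_smult(1,2,4)[OF B.lin_space_axioms]
  have neg_act: "fst \<xi> x (\<ominus>\<^bsub>B\<^esub> b) = \<ominus>\<^bsub>B\<^esub> fst \<xi> x b" "snd \<xi> (\<ominus>\<^bsub>B\<^esub> b) x = \<ominus>\<^bsub>B\<^esub> snd \<xi> b x"
    if "x \<in> carrier C" "b \<in> carrier B" for x b
    using that by (auto intro!: additive_neg abelian_group_B simp: B_simps)
  have minus_act: "fst \<xi> x (b \<ominus>\<^bsub>B\<^esub> b') = fst \<xi> x b \<ominus>\<^bsub>B\<^esub> fst \<xi> x b'"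
    "snd \<xi> (b \<ominus>\<^bsub>B\<^esub> b') x = snd \<xi> b x \<ominus>\<^bsub>B\<^esub> snd \<xi> b' x"
    if "x \<in> carrier C" "b \<in> carrier B" "b' \<in> carrier B" for x b b'
    using that by (simp_all add: a_minus_def neg_act B_simps(1-13))
  have val: "f [x, y] = fst \<xi> x (h [y]) \<ominus>\<^bsub>B\<^esub> h [x \<otimes>\<^bsub>C\<^esub> y] \<oplus>\<^bsub>B\<^esub> snd \<xi> (h [x]) y"
    if "x \<in> carrier C" "y \<in> carrier C" for x y
    unfolding fh by (rule hh_delta_1[where f = h, OF lin(1)]) (use that in auto)
  have bil: "bilinear_map F C B (\<lambda>x y. f [x, y])"
    by (rule bilinear_mapI)
      (simp_all add: val lin B_simps CC.l_distr CC.r_distr B.V.M.a_ac lin_space_smult[OF C.lin_space_axioms]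
        C.alg_smult_l C.alg_smult_r)
  have fP: "f \<in> tuples C 2 \<rightarrow>\<^sub>E carrier B"
    using hh_coboundaries_PiE[of f 1] f by (simp add: numeral_2_eq_2)
  have "f = (\<lambda>xs\<in>tuples C 2. f [xs ! 0, xs ! 1])"
    by (rule PiE_eqI[OF fP]) (use fP in \<open>auto simp: tuples_2_iff PiE_iff\<close>)
  then have "f \<in> hh_cochains F C B 2"
    using bilinear_hh_cochain[OF C.unital_algebra_axioms bil] by simp
  moreover have "hh_delta C B \<xi> 2 f = hh_zero C B (Suc 2)"
  proof (rule PiE_eqI[OF hh_delta_closed hh_zero_PiE])
    show "f \<in> tuples C 2 \<rightarrow> carrier B"
      using fP by auto
    fix xs assume xs: "xs \<in> tuples C (Suc 2)"
    then obtain x y z where e: "xs = [x, y, z]" "x \<in> carrier C" "y \<in> carrier C" "z \<in> carrier C"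
      using tuples_3_iff[of xs C] by (auto simp: numeral_3_eq_3 numeral_2_eq_2)
    have "hh_delta C B \<xi> 2 f [x, y, z] = \<zero>\<^bsub>B\<^esub>"
      using e(2-) by (subst hh_delta_2)
        (simp_all add: val lin B_simps(1-13) neg_act minus_act C.m_assoc B.V.M.alternating_sum_cancel)
    then show "hh_delta C B \<xi> 2 f xs = hh_zero C B (Suc 2) xs"
      using e xs by (simp add: hh_zero_def)
  qed
  ultimately show "f \<in> hh_cocycles F C B \<xi> 2"
    by (simp add: hh_cocycles_def)
qed

lemma hh_coboundaries_2_normal: "hh_coboundaries F C B \<xi> 2 \<lhd> hh_cocycle_group F C B \<xi> 2"
proof -
  interpret G: comm_group "hh_cocycle_group F C B \<xi> 2"
    by (rule hh_cocycle_group_comm_group)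
  have "subgroup (hh_coboundaries F C B \<xi> 2) (hh_cocycle_group F C B \<xi> 2)"
  proof (rule G.subgroupI)
    show "hh_coboundaries F C B \<xi> 2 \<subseteq> carrier (hh_cocycle_group F C B \<xi> 2)"
      using hh_coboundaries_2_cocycles by (simp add: hh_cocycle_group_def)
    show "hh_coboundaries F C B \<xi> 2 \<noteq> {}"
      using hh_coboundaries_zero[of 1] by (auto simp: numeral_2_eq_2)
    show "f \<otimes>\<^bsub>hh_cocycle_group F C B \<xi> 2\<^esub> g \<in> hh_coboundaries F C B \<xi> 2"
      if "f \<in> hh_coboundaries F C B \<xi> 2" "g \<in> hh_coboundaries F C B \<xi> 2" for f g
      using hh_coboundaries_add[of f 1 g] that by (simp add: hh_cocycle_group_def numeral_2_eq_2)
    show "inv\<^bsub>hh_cocycle_group F C B \<xi> 2\<^esub> f \<in> hh_coboundaries F C B \<xi> 2"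
      if f: "f \<in> hh_coboundaries F C B \<xi> 2" for f
    proof -
      have n: "cochain_neg C B 2 f \<in> hh_coboundaries F C B \<xi> 2"
        using hh_coboundaries_neg[of f 1] f by (simp add: numeral_2_eq_2)
      have "f xs \<in> carrier B" if "xs \<in> tuples C 2" for xs
        using hh_coboundaries_PiE[of f 1] f that by (auto simp: numeral_2_eq_2)
      then have "cochain_neg C B 2 f \<otimes>\<^bsub>hh_cocycle_group F C B \<xi> 2\<^esub> f = \<one>\<^bsub>hh_cocycle_group F C B \<xi> 2\<^esub>"
        by (auto simp: hh_cocycle_group_def hh_zero_def fun_eq_iff B.V.M.l_neg)
      then have "inv\<^bsub>hh_cocycle_group F C B \<xi> 2\<^esub> f = cochain_neg C B 2 f"
        using f n hh_coboundaries_2_cocycles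
        by (intro G.inv_equality) (auto simp: hh_cocycle_group_def)
      then show ?thesis
        using n by simp
    qed
  qed
  then show ?thesis
    using G.normal_iff_subgroup by blast
qed

lemma HH_2_group: "group (HH F C B \<xi> 2)"
  unfolding HH_def by (rule normal.factorgroup_is_group[OF hh_coboundaries_2_normal])

end

section \<open>Abstract kernels\<close>

lemma ann_alg_simps [simp]:
  "\<zero>\<^bsub>ann_alg K\<^esub> = \<zero>\<^bsub>K\<^esub>" "x \<oplus>\<^bsub>ann_alg K\<^esub> y = x \<oplus>\<^bsub>K\<^esub> y" "r \<odot>\<^bsub>ann_alg K\<^esub> x = r \<odot>\<^bsub>K\<^esub> x"
  by (simp_all add: ann_alg_def)

text \<open>Applied with w - v + t - u the obstruction: u and v are the terms of g left over in one
  bracketing of a triple product, w and t those in the other, and r is the part common to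
  both.\<close>

lemma (in abelian_group) cancel_two:
  assumes "s = r \<oplus> u \<oplus> v" "r \<in> carrier G" "u \<in> carrier G" "v \<in> carrier G" "w \<in> carrier G"
    "t \<in> carrier G"
  shows "s \<oplus> (w \<ominus> v \<oplus> t \<ominus> u) = r \<oplus> w \<oplus> t"
  unfolding assms(1) using assms(2-) by algebra

lemma (in abelian_group) cancel_last:
  assumes "r \<in> carrier G" "w \<in> carrier G" "v \<in> carrier G"
  shows "(r \<oplus> (w \<ominus> v)) \<oplus> v = r \<oplus> w"
  using assms by algebra

locale kernel_representative =
  fixes F :: "('f, 'm) ring_scheme"
    and C :: "('f, 'c) module"
    and K :: "('f, 'k) module"
    and D :: "('f, 'k, 'k, 'a, 'q) biext"
    and \<psi> :: "'c \<Rightarrow> 'q"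
  assumes C_alg: "unital_algebra F C"
    and K_alg: "assoc_algebra F K"
    and kernel: "abstract_kernel F C K D \<psi>"
begin

abbreviation A where "A \<equiv> bx_A1 D"
abbreviation Q where "Q \<equiv> bx_Q D"
abbreviation d where "d \<equiv> bx_d D"
abbreviation p where "p \<equiv> bx_p D"
abbreviation lact (infixl \<open>\<triangleright>\<close> 72) where "a \<triangleright> x \<equiv> fst (bx_act D) a x"
abbreviation ract (infixl \<open>\<triangleleft>\<close> 72) where "x \<triangleleft> a \<equiv> snd (bx_act D) x a"
abbreviation Z where "Z \<equiv> carrier (ann_alg K)"
abbreviation \<xi>C where "\<xi>C \<equiv> pullback_bimod \<psi> (biext_bimod D)"

lemma biext: "crossed_biextension F D"
  using kernel by (simp add: abstract_kernel_def)

lemma bx_eq [simp]: "bx_A2 D = K" "bx_B D = ann_alg K"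
  using kernel by (simp_all add: abstract_kernel_def)

lemma crossed: "crossed_bimodule F A K (bx_act D) d"
  using biext by (simp add: crossed_biextension_def)

lemma bimod: "bimodule F A K (bx_act D)"
  using crossed by (simp add: crossed_bimodule_def)

lemma A_alg: "unital_algebra F A"
  using bimod by (simp add: bimodule_def)

lemma Q_alg: "unital_algebra F Q"
  using biext by (simp add: crossed_biextension_def)

lemma K_lin: "lin_space F K"
  using K_alg by (simp add: assoc_algebra_def)

lemma A_lin: "lin_space F A" and Q_lin: "lin_space F Q" and C_lin: "lin_space F C"
  by (rule unital_algebraD(2), rule A_alg Q_alg C_alg)+

end

sublocale kernel_representative \<subseteq> K: abelian_group K
  by (rule lin_space_abelian_group[OF K_lin])

sublocale kernel_representative \<subseteq> A: ring "bx_A1 D"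
  by (rule unital_algebraD(4)[OF A_alg])

sublocale kernel_representative \<subseteq> Q: ring "bx_Q D"
  by (rule unital_algebraD(4)[OF Q_alg])

sublocale kernel_representative \<subseteq> C: ring C
  by (rule unital_algebraD(4)[OF C_alg])

context kernel_representative
begin

lemma K_mult:
  assumes "x \<in> carrier K" "y \<in> carrier K"
  shows K_m_closed [simp]: "x \<otimes>\<^bsub>K\<^esub> y \<in> carrier K"
    and K_m_assoc: "z \<in> carrier K \<Longrightarrow> (x \<otimes>\<^bsub>K\<^esub> y) \<otimes>\<^bsub>K\<^esub> z = x \<otimes>\<^bsub>K\<^esub> (y \<otimes>\<^bsub>K\<^esub> z)"
    and K_l_distr: "z \<in> carrier K \<Longrightarrow> (x \<oplus>\<^bsub>K\<^esub> y) \<otimes>\<^bsub>K\<^esub> z = x \<otimes>\<^bsub>K\<^esub> z \<oplus>\<^bsub>K\<^esub> y \<otimes>\<^bsub>K\<^esub> z"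
    and K_r_distr: "z \<in> carrier K \<Longrightarrow> z \<otimes>\<^bsub>K\<^esub> (x \<oplus>\<^bsub>K\<^esub> y) = z \<otimes>\<^bsub>K\<^esub> x \<oplus>\<^bsub>K\<^esub> z \<otimes>\<^bsub>K\<^esub> y"
    and K_smult_l: "r \<in> carrier F \<Longrightarrow> (r \<odot>\<^bsub>K\<^esub> x) \<otimes>\<^bsub>K\<^esub> y = r \<odot>\<^bsub>K\<^esub> (x \<otimes>\<^bsub>K\<^esub> y)"
    and K_smult_r: "r \<in> carrier F \<Longrightarrow> x \<otimes>\<^bsub>K\<^esub> (r \<odot>\<^bsub>K\<^esub> y) = r \<odot>\<^bsub>K\<^esub> (x \<otimes>\<^bsub>K\<^esub> y)"
  using assms K_alg by (simp_all add: assoc_algebra.alg_m_closed assoc_algebra.alg_m_assoc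
      assoc_algebra.alg_l_distr assoc_algebra.alg_r_distr assoc_algebra.alg_smult_l assoc_algebra.alg_smult_r)

lemma smult_closed [simp]:
  assumes "r \<in> carrier F"
  shows "x \<in> carrier K \<Longrightarrow> r \<odot>\<^bsub>K\<^esub> x \<in> carrier K" "a \<in> carrier A \<Longrightarrow> r \<odot>\<^bsub>A\<^esub> a \<in> carrier A"
    "y \<in> carrier Q \<Longrightarrow> r \<odot>\<^bsub>Q\<^esub> y \<in> carrier Q" "c \<in> carrier C \<Longrightarrow> r \<odot>\<^bsub>C\<^esub> c \<in> carrier C"
  using assms by (simp_all add: lin_space_smult(1)[OF K_lin] lin_space_smult(1)[OF A_lin]
      lin_space_smult(1)[OF Q_lin] lin_space_smult(1)[OF C_lin])

lemmas K_smult = lin_space_smult(2,4)[OF K_lin]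
lemmas A_smult = lin_space_smult(2,4)[OF A_lin]
lemmas C_smult_mult = assoc_algebra.alg_smult_l[OF unital_algebraD(1)[OF C_alg]]
  assoc_algebra.alg_smult_r[OF unital_algebraD(1)[OF C_alg]]
lemmas A_smult_mult = assoc_algebra.alg_smult_l[OF unital_algebraD(1)[OF A_alg]]
  assoc_algebra.alg_smult_r[OF unital_algebraD(1)[OF A_alg]]

lemmas act_closed [simp] = bimodule.lact_closed[OF bimod] bimodule.ract_closed[OF bimod]

lemmas act_add = bimodule.lact_add_l[OF bimod] bimodule.lact_add_r[OF bimod]
  bimodule.ract_add_l[OF bimod] bimodule.ract_add_r[OF bimod]

lemmas act_smult = bimodule.lact_smult_l[OF bimod] bimodule.lact_smult_r[OF bimod]
  bimodule.ract_smult_l[OF bimod] bimodule.ract_smult_r[OF bimod]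

lemmas act_mult = bimodule.lact_mult[OF bimod] bimodule.ract_mult[OF bimod]
  bimodule.lact_ract[OF bimod]

lemmas act_one [simp] = bimodule.lact_one[OF bimod] bimodule.ract_one[OF bimod]

lemma act_zero [simp]:
  "a \<in> carrier A \<Longrightarrow> a \<triangleright> \<zero>\<^bsub>K\<^esub> = \<zero>\<^bsub>K\<^esub>" "x \<in> carrier K \<Longrightarrow> \<zero>\<^bsub>A\<^esub> \<triangleright> x = \<zero>\<^bsub>K\<^esub>"
  "a \<in> carrier A \<Longrightarrow> \<zero>\<^bsub>K\<^esub> \<triangleleft> a = \<zero>\<^bsub>K\<^esub>" "x \<in> carrier K \<Longrightarrow> x \<triangleleft> \<zero>\<^bsub>A\<^esub> = \<zero>\<^bsub>K\<^esub>"
  by (auto intro!: additive_zero[where h = "\<lambda>x. a \<triangleright> x"] additive_zero[where h = "\<lambda>a. a \<triangleright> x"]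
      additive_zero[where h = "\<lambda>x. x \<triangleleft> a"] additive_zero[where h = "\<lambda>a. x \<triangleleft> a"]
      K.abelian_group_axioms A.abelian_group_axioms simp: act_add)

lemma d_linear: "d \<in> linear_map F K A"
  using crossed_bimodule.d_linear[OF crossed] .

lemmas d_closed [simp] = linear_mapD(1)[OF d_linear]
lemmas d_add = linear_mapD(2)[OF d_linear]
lemmas d_smult = linear_mapD(3)[OF d_linear]
lemmas d_zero [simp] = linear_map_zero[OF K_lin A_lin d_linear]
lemmas d_neg = linear_map_neg[OF K_lin A_lin d_linear]
lemmas d_minus = linear_map_minus[OF K_lin A_lin d_linear]
lemmas d_act = crossed_bimodule.d_lact[OF crossed] crossed_bimodule.d_ract[OF crossed]

lemma act_d:
  assumes "x \<in> carrier K" "y \<in> carrier K"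
  shows "d x \<triangleright> y = x \<otimes>\<^bsub>K\<^esub> y" "x \<triangleleft> d y = x \<otimes>\<^bsub>K\<^esub> y"
  using assms kernel crossed_bimodule.peiffer[OF crossed] by (auto simp: abstract_kernel_def)

text \<open>The product of K is the action through d from either side, so these mixed laws are
  bimodule laws combined with the equivariance of d.\<close>

lemma act_mult_K:
  assumes "x \<in> carrier K" "y \<in> carrier K" "a \<in> carrier A"
  shows "(a \<triangleright> x) \<otimes>\<^bsub>K\<^esub> y = a \<triangleright> (x \<otimes>\<^bsub>K\<^esub> y)" "x \<otimes>\<^bsub>K\<^esub> (y \<triangleleft> a) = (x \<otimes>\<^bsub>K\<^esub> y) \<triangleleft> a"
    "(x \<triangleleft> a) \<otimes>\<^bsub>K\<^esub> y = x \<otimes>\<^bsub>K\<^esub> (a \<triangleright> y)"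
proof -
  show "(a \<triangleright> x) \<otimes>\<^bsub>K\<^esub> y = a \<triangleright> (x \<otimes>\<^bsub>K\<^esub> y)"
    using assms by (simp add: d_act act_mult flip: act_d(1))
  show "(x \<triangleleft> a) \<otimes>\<^bsub>K\<^esub> y = x \<otimes>\<^bsub>K\<^esub> (a \<triangleright> y)"
    using assms by (simp add: d_act act_mult flip: act_d(1))
  show "x \<otimes>\<^bsub>K\<^esub> (y \<triangleleft> a) = (x \<otimes>\<^bsub>K\<^esub> y) \<triangleleft> a"
    using assms by (simp add: d_act act_mult flip: act_d(2))
qed

lemma d_mult: "x \<in> carrier K \<Longrightarrow> y \<in> carrier K \<Longrightarrow> d (x \<otimes>\<^bsub>K\<^esub> y) = d x \<otimes>\<^bsub>A\<^esub> d y"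
  by (simp add: d_act flip: act_d(1))

lemma p_hom: "p \<in> unital_alg_hom F A Q"
  using biext by (simp add: crossed_biextension_def)

lemmas p_simps = unital_alg_homD(3-7)[OF p_hom]
lemmas p_closed [simp] = unital_alg_homD(4)[OF p_hom]
lemmas p_minus = linear_map_minus[OF A_lin Q_lin unital_alg_homD(1)[OF p_hom]]

lemma image_d: "d ` carrier K = {a \<in> carrier A. p a = \<zero>\<^bsub>Q\<^esub>}"
  and image_p: "p ` carrier A = carrier Q"
  and image_j: "Z = {x \<in> carrier K. d x = \<zero>\<^bsub>A\<^esub>}"
  using biext kernel by (auto simp: crossed_biextension_def abstract_kernel_def)

lemma p_d [simp]: "x \<in> carrier K \<Longrightarrow> p (d x) = \<zero>\<^bsub>Q\<^esub>"
  using image_d by blast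

text \<open>Exactness at K gives a second description of Z(K), as the kernel of d. It reduces the
  membership of an alternating sum to an identity in A.\<close>

lemma Z_iff: "x \<in> Z \<longleftrightarrow> x \<in> carrier K \<and> d x = \<zero>\<^bsub>A\<^esub>"
  using image_j by blast

lemma Z_mult:
  assumes "z \<in> Z" "x \<in> carrier K"
  shows "z \<otimes>\<^bsub>K\<^esub> x = \<zero>\<^bsub>K\<^esub>" "x \<otimes>\<^bsub>K\<^esub> z = \<zero>\<^bsub>K\<^esub>"
  using assms by (auto simp: ann_alg_def)

lemma Z_closed:
  assumes "z \<in> Z"
  shows Z_K [simp]: "z \<in> carrier K"
    and "z' \<in> Z \<Longrightarrow> z \<oplus>\<^bsub>K\<^esub> z' \<in> Z" "\<ominus>\<^bsub>K\<^esub> z \<in> Z" "z' \<in> Z \<Longrightarrow> z \<ominus>\<^bsub>K\<^esub> z' \<in> Z"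
    "r \<in> carrier F \<Longrightarrow> r \<odot>\<^bsub>K\<^esub> z \<in> Z" "a \<in> carrier A \<Longrightarrow> a \<triangleright> z \<in> Z" "a \<in> carrier A \<Longrightarrow> z \<triangleleft> a \<in> Z"
  using assms lin_space_smult(3)[OF A_lin]
  by (auto simp: Z_iff d_add d_neg d_minus d_smult d_act a_minus_def)

lemma zero_Z [simp]: "\<zero>\<^bsub>K\<^esub> \<in> Z"
  by (simp add: Z_iff)

lemma Z_lin: "lin_space F (ann_alg K)"
proof -
  have eq: "K\<lparr>carrier := Z\<rparr> = ann_alg K"
    unfolding ann_alg_def by (rule arg_cong[where f = "\<lambda>S. K\<lparr>carrier := S\<rparr>"]) simp
  have "lin_space F (K\<lparr>carrier := Z\<rparr>)"
    by (rule lin_space_subspace[OF K_lin]) (auto intro: Z_closed)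
  then show ?thesis
    by (subst (asm) eq)
qed

text \<open>Negation is a definite description over the carrier, which is smaller in
  \<open>ann_alg K\<close>; so, unlike zero and sum, it does not agree with that of K by mere
  unfolding.\<close>

lemma ann_alg_neg: "z \<in> Z \<Longrightarrow> \<ominus>\<^bsub>ann_alg K\<^esub> z = \<ominus>\<^bsub>K\<^esub> z"
  and ann_alg_minus: "z \<in> Z \<Longrightarrow> z' \<in> Z \<Longrightarrow> z \<ominus>\<^bsub>ann_alg K\<^esub> z' = z \<ominus>\<^bsub>K\<^esub> z'"
proof -
  interpret Z: abelian_group "ann_alg K" by (rule lin_space_abelian_group[OF Z_lin])
  show neg: "\<ominus>\<^bsub>ann_alg K\<^esub> z = \<ominus>\<^bsub>K\<^esub> z" if "z \<in> Z" for z
    by (rule Z.minus_equality) (use that in \<open>simp_all add: K.l_neg Z_closed\<close>)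
  show "z \<ominus>\<^bsub>ann_alg K\<^esub> z' = z \<ominus>\<^bsub>K\<^esub> z'" if "z \<in> Z" "z' \<in> Z"
    using that by (simp add: a_minus_def neg)
qed

text \<open>Two elements with the same image in Q differ by some d x, which acts as multiplication
  by x and hence as zero on Z(K). This makes the action of Q well defined.\<close>

lemma act_Z_cong:
  assumes "a \<in> carrier A" "a' \<in> carrier A" "p a = p a'" "z \<in> Z"
  shows "a \<triangleright> z = a' \<triangleright> z" "z \<triangleleft> a = z \<triangleleft> a'"
proof -
  have "a \<ominus>\<^bsub>A\<^esub> a' \<in> d ` carrier K"
    using assms unfolding image_d by (simp add: p_minus)
  then obtain x where x: "x \<in> carrier K" "a \<ominus>\<^bsub>A\<^esub> a' = d x"
    by auto
  have "a = d x \<oplus>\<^bsub>A\<^esub> a'"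
    unfolding x(2)[symmetric] using assms by algebra
  then show "a \<triangleright> z = a' \<triangleright> z" "z \<triangleleft> a = z \<triangleleft> a'"
    using assms x by (simp_all add: act_add act_d Z_mult)
qed

lemma biext_bimod_act:
  assumes "a \<in> carrier A" "z \<in> Z"
  shows "fst (biext_bimod D) (p a) z = a \<triangleright> z" "snd (biext_bimod D) z (p a) = z \<triangleleft> a"
proof -
  have j: "\<And>x. x \<in> Z \<Longrightarrow> bx_j D x = x"
    using kernel by (simp add: abstract_kernel_def)
  have cl: "a \<triangleright> z \<in> Z" "z \<triangleleft> a \<in> Z"
    by (rule Z_closed(6)[OF assms(2,1)], rule Z_closed(7)[OF assms(2,1)])
  show "fst (biext_bimod D) (p a) z = a \<triangleright> z"
    unfolding biext_bimod_def fst_conv bx_eq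
  proof (rule the_equality)
    show "a \<triangleright> z \<in> Z \<and> (\<exists>a'\<in>carrier A. p a' = p a \<and> bx_j D (a \<triangleright> z) = a' \<triangleright> bx_j D z)"
      using assms cl by (intro conjI bexI[of _ a]) (simp_all add: j)
    show "b = a \<triangleright> z"
      if "b \<in> Z \<and> (\<exists>a'\<in>carrier A. p a' = p a \<and> bx_j D b = a' \<triangleright> bx_j D z)" for b
      using that assms(2) by (elim conjE bexE) (simp add: j act_Z_cong(1)[OF _ assms(1) _ assms(2)])
  qed
  show "snd (biext_bimod D) z (p a) = z \<triangleleft> a"
    unfolding biext_bimod_def snd_conv bx_eq
  proof (rule the_equality)
    show "z \<triangleleft> a \<in> Z \<and> (\<exists>a'\<in>carrier A. p a' = p a \<and> bx_j D (z \<triangleleft> a) = bx_j D z \<triangleleft> a')"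
      using assms cl by (intro conjI bexI[of _ a]) (simp_all add: j)
    show "b = z \<triangleleft> a"
      if "b \<in> Z \<and> (\<exists>a'\<in>carrier A. p a' = p a \<and> bx_j D b = bx_j D z \<triangleleft> a')" for b
      using that assms(2) by (elim conjE bexE) (simp add: j act_Z_cong(2)[OF _ assms(1) _ assms(2)])
  qed
qed

lemma psi_hom: "\<psi> \<in> unital_alg_hom F C Q"
  and image_psi: "\<psi> ` carrier C = carrier Q"
  using kernel by (auto simp: abstract_kernel_def)

lemmas psi_simps = unital_alg_homD(3-7)[OF psi_hom]
lemmas psi_closed [simp] = unital_alg_homD(4)[OF psi_hom]

text \<open>Every lift of the image of c to A may be used: \<sigma> c once a linear lift is fixed,
  \<pi> e when e is an element of an extension lying over c.\<close>

lemma \<xi>C_act: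
  assumes "a \<in> carrier A" "p a = \<psi> c" "z \<in> Z"
  shows "fst \<xi>C c z = a \<triangleright> z" "snd \<xi>C z c = z \<triangleleft> a"
  using biext_bimod_act[OF assms(1,3)] assms(2) by (simp_all add: pullback_bimod_def)

lemma ex_lift: "c \<in> carrier C \<Longrightarrow> \<exists>a\<in>carrier A. p a = \<psi> c"
  using image_p psi_closed by (metis imageE)

text \<open>Each law involves at most two elements of C. Lifting these to A turns it into the same
  law for K, since sums, multiples and products of lifts are again lifts.\<close>

lemma bimod_C: "bimodule F C (ann_alg K) \<xi>C"
proof (intro bimodule.intro bimodule_axioms.intro C_alg Z_lin)
  note [simp] = act_add act_smult act_mult Z_closed
  fix c z assume c: "c \<in> carrier C" and z: "z \<in> Z"
  obtain a where a: "a \<in> carrier A" "p a = \<psi> c"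
    using ex_lift[OF c] by blast
  note act = \<xi>C_act[OF a]
  show "fst \<xi>C c z \<in> Z" "snd \<xi>C z c \<in> Z"
    using act z a by simp_all
  show "fst \<xi>C c (z \<oplus>\<^bsub>ann_alg K\<^esub> z') = fst \<xi>C c z \<oplus>\<^bsub>ann_alg K\<^esub> fst \<xi>C c z'"
    "snd \<xi>C (z \<oplus>\<^bsub>ann_alg K\<^esub> z') c = snd \<xi>C z c \<oplus>\<^bsub>ann_alg K\<^esub> snd \<xi>C z' c" if "z' \<in> Z" for z'
    using act z a that by simp_all
  fix r assume r: "r \<in> carrier F"
  have "p (r \<odot>\<^bsub>A\<^esub> a) = \<psi> (r \<odot>\<^bsub>C\<^esub> c)"
    using a r c by (simp add: p_simps psi_simps)
  note act' = \<xi>C_act[OF _ this]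
  show "fst \<xi>C (r \<odot>\<^bsub>C\<^esub> c) z = r \<odot>\<^bsub>ann_alg K\<^esub> fst \<xi>C c z" "snd \<xi>C z (r \<odot>\<^bsub>C\<^esub> c) = r \<odot>\<^bsub>ann_alg K\<^esub> snd \<xi>C z c"
    "fst \<xi>C c (r \<odot>\<^bsub>ann_alg K\<^esub> z) = r \<odot>\<^bsub>ann_alg K\<^esub> fst \<xi>C c z"
    "snd \<xi>C (r \<odot>\<^bsub>ann_alg K\<^esub> z) c = r \<odot>\<^bsub>ann_alg K\<^esub> snd \<xi>C z c"
    using act act' z a r by simp_all
next
  note [simp] = act_add act_smult act_mult Z_closed
  fix c c' z assume c: "c \<in> carrier C" "c' \<in> carrier C" and z: "z \<in> Z"
  obtain a where a: "a \<in> carrier A" "p a = \<psi> c"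
    using ex_lift[OF c(1)] by blast
  obtain a' where a': "a' \<in> carrier A" "p a' = \<psi> c'"
    using ex_lift[OF c(2)] by blast
  have e: "p (a \<oplus>\<^bsub>A\<^esub> a') = \<psi> (c \<oplus>\<^bsub>C\<^esub> c')" "p (a \<otimes>\<^bsub>A\<^esub> a') = \<psi> (c \<otimes>\<^bsub>C\<^esub> c')"
    using a a' c by (simp_all add: p_simps psi_simps)
  note act = \<xi>C_act[OF a] \<xi>C_act[OF a'] \<xi>C_act[OF _ e(1)] \<xi>C_act[OF _ e(2)]
  show "fst \<xi>C (c \<oplus>\<^bsub>C\<^esub> c') z = fst \<xi>C c z \<oplus>\<^bsub>ann_alg K\<^esub> fst \<xi>C c' z"
    "snd \<xi>C z (c \<oplus>\<^bsub>C\<^esub> c') = snd \<xi>C z c \<oplus>\<^bsub>ann_alg K\<^esub> snd \<xi>C z c'"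
    "fst \<xi>C (c \<otimes>\<^bsub>C\<^esub> c') z = fst \<xi>C c (fst \<xi>C c' z)"
    "snd \<xi>C z (c \<otimes>\<^bsub>C\<^esub> c') = snd \<xi>C (snd \<xi>C z c) c'"
    "snd \<xi>C (fst \<xi>C c z) c' = fst \<xi>C c (snd \<xi>C z c')"
    using act z a a' by simp_all
next
  fix z assume z: "z \<in> Z"
  have "p \<one>\<^bsub>A\<^esub> = \<psi> \<one>\<^bsub>C\<^esub>"
    by (simp add: p_simps psi_simps)
  then show "fst \<xi>C \<one>\<^bsub>C\<^esub> z = z" "snd \<xi>C z \<one>\<^bsub>C\<^esub> = z"
    using z by (simp_all add: \<xi>C_act[of "\<one>\<^bsub>A\<^esub>"])
qed

text \<open>Taking C = Q with the identity map makes every result on factor sets available for Q and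
  \<open>biext_bimod D\<close>; the independence of \<open>biext_class\<close> of the sections is
  obtained in this way.\<close>

lemma kernel_representative_Q: "kernel_representative F Q K D (\<lambda>y. y)"
proof (intro kernel_representative.intro Q_alg K_alg)
  show "abstract_kernel F Q K D (\<lambda>y. y)"
    using kernel by (simp add: abstract_kernel_def unital_alg_hom_def alg_hom_def linear_map_def)
qed

lemma d_section_exists:
  obtains q where "q \<in> linear_map F (A\<lparr>carrier := d ` carrier K\<rparr>) K"
    "\<And>a. a \<in> d ` carrier K \<Longrightarrow> d (q a) = a"
proof -
  have "lin_space F (A\<lparr>carrier := d ` carrier K\<rparr>)"
    by (rule lin_space_image[OF K_lin, where h = d]) (simp_all add: d_add d_smult)
  moreover have "d \<in> linear_map F K (A\<lparr>carrier := d ` carrier K\<rparr>)"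
    by (rule linear_mapI) (simp_all add: d_add d_smult)
  ultimately show thesis
    by (rule linear_section_exists[OF K_lin]) (auto intro: that)
qed

lemma biext_sections_exist: "\<exists>s q. biext_sections F D s q"
proof -
  obtain q where "q \<in> linear_map F (A\<lparr>carrier := d ` carrier K\<rparr>) K"
    "\<And>a. a \<in> d ` carrier K \<Longrightarrow> d (q a) = a"
    by (rule d_section_exists) blast
  moreover obtain s where "s \<in> linear_map F Q A" "\<And>y. y \<in> carrier Q \<Longrightarrow> p (s y) = y"
    by (rule linear_section_exists[OF A_lin Q_lin unital_alg_homD(1)[OF p_hom] image_p]) blast
  ultimately show ?thesis
    unfolding biext_sections_def by (intro exI[of _ s] exI[of _ q]) simp
qed

section \<open>Factor sets and their obstruction\<close>

text \<open>No normalization is imposed: \<sigma> 1 need not be 1 and g need not vanish at 1, which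
  is why the unit of the crossed product takes an argument of its own.\<close>

definition factor_set where
  "factor_set \<sigma> g \<longleftrightarrow> \<sigma> \<in> linear_map F C A \<and> (\<forall>x\<in>carrier C. p (\<sigma> x) = \<psi> x)
     \<and> bilinear_map F C K g
     \<and> (\<forall>x\<in>carrier C. \<forall>y\<in>carrier C. d (g x y) = \<sigma> x \<otimes>\<^bsub>A\<^esub> \<sigma> y \<ominus>\<^bsub>A\<^esub> \<sigma> (x \<otimes>\<^bsub>C\<^esub> y))"

text \<open>The formula for the cocycle of a crossed biextension, with C in place of Q. It imitates
  a coboundary, but \<sigma> does not define an action of C on K, so it need not be one.\<close>

definition obstruction where
  "obstruction \<sigma> g x y z = \<sigma> x \<triangleright> g y z \<ominus>\<^bsub>K\<^esub> g (x \<otimes>\<^bsub>C\<^esub> y) z \<oplus>\<^bsub>K\<^esub> g x (y \<otimes>\<^bsub>C\<^esub> z) \<ominus>\<^bsub>K\<^esub> g x y \<triangleleft> \<sigma> z"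

text \<open>The K-component of the product of (x, a) and (y, b). If r is a section of an extension
  with factor set g, it is the K-part of (k x + r a) (k y + r b), the rest being r (a b).\<close>

definition crossed_mult where
  "crossed_mult \<sigma> g a b x y = x \<otimes>\<^bsub>K\<^esub> y \<oplus>\<^bsub>K\<^esub> \<sigma> a \<triangleright> y \<oplus>\<^bsub>K\<^esub> x \<triangleleft> \<sigma> b \<oplus>\<^bsub>K\<^esub> g a b"

lemma factor_setD:
  assumes "factor_set \<sigma> g"
  shows "\<sigma> \<in> linear_map F C A" "bilinear_map F C K g"
    and "x \<in> carrier C \<Longrightarrow> \<sigma> x \<in> carrier A" "x \<in> carrier C \<Longrightarrow> p (\<sigma> x) = \<psi> x"
    and "x \<in> carrier C \<Longrightarrow> y \<in> carrier C \<Longrightarrow> g x y \<in> carrier K"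
    and "x \<in> carrier C \<Longrightarrow> y \<in> carrier C \<Longrightarrow> d (g x y) = \<sigma> x \<otimes>\<^bsub>A\<^esub> \<sigma> y \<ominus>\<^bsub>A\<^esub> \<sigma> (x \<otimes>\<^bsub>C\<^esub> y)"
  using assms by (auto simp: factor_set_def linear_mapD bilinear_mapD)

text \<open>By equivariance, d turns the expression into an alternating sum of products of values of
  \<sigma> in A, which cancels because A and C are associative.\<close>

lemma obstruction_closed:
  assumes fs: "factor_set \<sigma> g" and xyz: "x \<in> carrier C" "y \<in> carrier C" "z \<in> carrier C"
  shows "obstruction \<sigma> g x y z \<in> Z"
proof -
  have cl: "obstruction \<sigma> g x y z \<in> carrier K"
    using xyz by (simp add: obstruction_def factor_setD(3,5)[OF fs])
  have "d (obstruction \<sigma> g x y z) =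
      \<sigma> x \<otimes>\<^bsub>A\<^esub> (\<sigma> y \<otimes>\<^bsub>A\<^esub> \<sigma> z \<ominus>\<^bsub>A\<^esub> \<sigma> (y \<otimes>\<^bsub>C\<^esub> z))
      \<ominus>\<^bsub>A\<^esub> (\<sigma> (x \<otimes>\<^bsub>C\<^esub> y) \<otimes>\<^bsub>A\<^esub> \<sigma> z \<ominus>\<^bsub>A\<^esub> \<sigma> (x \<otimes>\<^bsub>C\<^esub> (y \<otimes>\<^bsub>C\<^esub> z)))
      \<oplus>\<^bsub>A\<^esub> (\<sigma> x \<otimes>\<^bsub>A\<^esub> \<sigma> (y \<otimes>\<^bsub>C\<^esub> z) \<ominus>\<^bsub>A\<^esub> \<sigma> (x \<otimes>\<^bsub>C\<^esub> (y \<otimes>\<^bsub>C\<^esub> z)))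
      \<ominus>\<^bsub>A\<^esub> (\<sigma> x \<otimes>\<^bsub>A\<^esub> \<sigma> y \<ominus>\<^bsub>A\<^esub> \<sigma> (x \<otimes>\<^bsub>C\<^esub> y)) \<otimes>\<^bsub>A\<^esub> \<sigma> z"
    using xyz unfolding obstruction_def
    by (simp add: factor_setD(3,5,6)[OF fs] d_minus d_add d_act C.m_assoc)
  also have "\<dots> = \<zero>\<^bsub>A\<^esub>"
    using factor_setD(3)[OF fs xyz(1)] factor_setD(3)[OF fs xyz(2)] factor_setD(3)[OF fs xyz(3)]
      factor_setD(3)[OF fs C.m_closed[OF xyz(1,2)]] factor_setD(3)[OF fs C.m_closed[OF xyz(2,3)]]
      factor_setD(3)[OF fs C.m_closed[OF xyz(1) C.m_closed[OF xyz(2,3)]]]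
    by algebra
  finally show ?thesis
    using cl by (simp add: Z_iff)
qed

lemma crossed_mult_closed:
  assumes "factor_set \<sigma> g" "a \<in> carrier C" "b \<in> carrier C" "x \<in> carrier K" "y \<in> carrier K"
  shows "crossed_mult \<sigma> g a b x y \<in> carrier K"
  using assms by (simp add: crossed_mult_def factor_setD(3,5)[OF assms(1)])

text \<open>The obstruction is the associator of the product \<open>crossed_mult\<close>.\<close>

lemma crossed_mult_assoc:
  assumes fs: "factor_set \<sigma> g"
    and abc: "a \<in> carrier C" "b \<in> carrier C" "c \<in> carrier C"
    and xyz: "x \<in> carrier K" "y \<in> carrier K" "z \<in> carrier K"
  shows "crossed_mult \<sigma> g (a \<otimes>\<^bsub>C\<^esub> b) c (crossed_mult \<sigma> g a b x y) z \<oplus>\<^bsub>K\<^esub> obstruction \<sigma> g a b c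
    = crossed_mult \<sigma> g a (b \<otimes>\<^bsub>C\<^esub> c) x (crossed_mult \<sigma> g b c y z)"
proof -
  note cl = factor_setD(3,5)[OF fs]
  have \<sigma>\<sigma>: "\<sigma> u \<otimes>\<^bsub>A\<^esub> \<sigma> v = d (g u v) \<oplus>\<^bsub>A\<^esub> \<sigma> (u \<otimes>\<^bsub>C\<^esub> v)" if uv: "u \<in> carrier C" "v \<in> carrier C" for u v
    unfolding factor_setD(6)[OF fs uv]
    using cl(1)[OF uv(1)] cl(1)[OF uv(2)] cl(1)[OF C.m_closed[OF uv]] by algebra
  \<comment> \<open>The product \<sigma> a \<sigma> b differs from \<sigma> (a b) by d (g a b),
    which acts as multiplication by g a b; \<open>rr\<close> is the mirror image.\<close>
  have ll: "\<sigma> a \<triangleright> (\<sigma> b \<triangleright> z) = g a b \<otimes>\<^bsub>K\<^esub> z \<oplus>\<^bsub>K\<^esub> \<sigma> (a \<otimes>\<^bsub>C\<^esub> b) \<triangleright> z"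
    using abc xyz by (simp add: cl \<sigma>\<sigma> act_add act_d flip: act_mult(1))
  have rr: "x \<triangleleft> \<sigma> b \<triangleleft> \<sigma> c = x \<otimes>\<^bsub>K\<^esub> g b c \<oplus>\<^bsub>K\<^esub> x \<triangleleft> \<sigma> (b \<otimes>\<^bsub>C\<^esub> c)"
    using abc xyz by (simp add: cl \<sigma>\<sigma> act_add act_d flip: act_mult(2))
  have closed: "x \<otimes>\<^bsub>K\<^esub> y \<otimes>\<^bsub>K\<^esub> z \<in> carrier K" "\<sigma> a \<triangleright> (y \<otimes>\<^bsub>K\<^esub> z) \<in> carrier K"
    "x \<otimes>\<^bsub>K\<^esub> (\<sigma> b \<triangleright> z) \<in> carrier K" "g a b \<otimes>\<^bsub>K\<^esub> z \<in> carrier K" "\<sigma> (a \<otimes>\<^bsub>C\<^esub> b) \<triangleright> z \<in> carrier K"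
    "(x \<otimes>\<^bsub>K\<^esub> y) \<triangleleft> \<sigma> c \<in> carrier K" "\<sigma> a \<triangleright> (y \<triangleleft> \<sigma> c) \<in> carrier K" "x \<otimes>\<^bsub>K\<^esub> g b c \<in> carrier K"
    "x \<triangleleft> \<sigma> (b \<otimes>\<^bsub>C\<^esub> c) \<in> carrier K" "g a b \<triangleleft> \<sigma> c \<in> carrier K" "g (a \<otimes>\<^bsub>C\<^esub> b) c \<in> carrier K"
    "\<sigma> a \<triangleright> g b c \<in> carrier K" "g a (b \<otimes>\<^bsub>C\<^esub> c) \<in> carrier K"
    using abc xyz by (simp_all add: cl)
  have L: "crossed_mult \<sigma> g (a \<otimes>\<^bsub>C\<^esub> b) c (crossed_mult \<sigma> g a b x y) z =
      (x \<otimes>\<^bsub>K\<^esub> y \<otimes>\<^bsub>K\<^esub> z \<oplus>\<^bsub>K\<^esub> \<sigma> a \<triangleright> (y \<otimes>\<^bsub>K\<^esub> z) \<oplus>\<^bsub>K\<^esub> x \<otimes>\<^bsub>K\<^esub> (\<sigma> b \<triangleright> z) \<oplus>\<^bsub>K\<^esub> g a b \<otimes>\<^bsub>K\<^esub> z)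
      \<oplus>\<^bsub>K\<^esub> \<sigma> (a \<otimes>\<^bsub>C\<^esub> b) \<triangleright> z
      \<oplus>\<^bsub>K\<^esub> ((x \<otimes>\<^bsub>K\<^esub> y) \<triangleleft> \<sigma> c \<oplus>\<^bsub>K\<^esub> \<sigma> a \<triangleright> (y \<triangleleft> \<sigma> c)
        \<oplus>\<^bsub>K\<^esub> (x \<otimes>\<^bsub>K\<^esub> g b c \<oplus>\<^bsub>K\<^esub> x \<triangleleft> \<sigma> (b \<otimes>\<^bsub>C\<^esub> c)) \<oplus>\<^bsub>K\<^esub> g a b \<triangleleft> \<sigma> c) \<oplus>\<^bsub>K\<^esub> g (a \<otimes>\<^bsub>C\<^esub> b) c"
    using abc xyz unfolding crossed_mult_def
    by (simp add: cl K_l_distr act_add act_mult_K act_mult(3) rr)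
  have R: "crossed_mult \<sigma> g a (b \<otimes>\<^bsub>C\<^esub> c) x (crossed_mult \<sigma> g b c y z) =
      (x \<otimes>\<^bsub>K\<^esub> y \<otimes>\<^bsub>K\<^esub> z \<oplus>\<^bsub>K\<^esub> x \<otimes>\<^bsub>K\<^esub> (\<sigma> b \<triangleright> z) \<oplus>\<^bsub>K\<^esub> (x \<otimes>\<^bsub>K\<^esub> y) \<triangleleft> \<sigma> c \<oplus>\<^bsub>K\<^esub> x \<otimes>\<^bsub>K\<^esub> g b c)
      \<oplus>\<^bsub>K\<^esub> (\<sigma> a \<triangleright> (y \<otimes>\<^bsub>K\<^esub> z) \<oplus>\<^bsub>K\<^esub> (g a b \<otimes>\<^bsub>K\<^esub> z \<oplus>\<^bsub>K\<^esub> \<sigma> (a \<otimes>\<^bsub>C\<^esub> b) \<triangleright> z)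
        \<oplus>\<^bsub>K\<^esub> \<sigma> a \<triangleright> (y \<triangleleft> \<sigma> c) \<oplus>\<^bsub>K\<^esub> \<sigma> a \<triangleright> g b c) \<oplus>\<^bsub>K\<^esub> x \<triangleleft> \<sigma> (b \<otimes>\<^bsub>C\<^esub> c) \<oplus>\<^bsub>K\<^esub> g a (b \<otimes>\<^bsub>C\<^esub> c)"
    using abc xyz unfolding crossed_mult_def
    by (simp add: cl K_r_distr act_add act_mult_K(2) K_m_assoc ll)
  \<comment> \<open>The nine terms common to both bracketings. The remaining two on each side
    involve g without x, y, z and are the four terms of the obstruction.\<close>
  let ?S = "x \<otimes>\<^bsub>K\<^esub> y \<otimes>\<^bsub>K\<^esub> z \<oplus>\<^bsub>K\<^esub> \<sigma> a \<triangleright> (y \<otimes>\<^bsub>K\<^esub> z) \<oplus>\<^bsub>K\<^esub> x \<otimes>\<^bsub>K\<^esub> (\<sigma> b \<triangleright> z) \<oplus>\<^bsub>K\<^esub> g a b \<otimes>\<^bsub>K\<^esub> z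
      \<oplus>\<^bsub>K\<^esub> \<sigma> (a \<otimes>\<^bsub>C\<^esub> b) \<triangleright> z \<oplus>\<^bsub>K\<^esub> (x \<otimes>\<^bsub>K\<^esub> y) \<triangleleft> \<sigma> c \<oplus>\<^bsub>K\<^esub> \<sigma> a \<triangleright> (y \<triangleleft> \<sigma> c)
      \<oplus>\<^bsub>K\<^esub> x \<otimes>\<^bsub>K\<^esub> g b c \<oplus>\<^bsub>K\<^esub> x \<triangleleft> \<sigma> (b \<otimes>\<^bsub>C\<^esub> c)"
  have "crossed_mult \<sigma> g (a \<otimes>\<^bsub>C\<^esub> b) c (crossed_mult \<sigma> g a b x y) z
      = ?S \<oplus>\<^bsub>K\<^esub> g a b \<triangleleft> \<sigma> c \<oplus>\<^bsub>K\<^esub> g (a \<otimes>\<^bsub>C\<^esub> b) c"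
    unfolding L using closed by (simp add: K.a_ac)
  then have "crossed_mult \<sigma> g (a \<otimes>\<^bsub>C\<^esub> b) c (crossed_mult \<sigma> g a b x y) z \<oplus>\<^bsub>K\<^esub> obstruction \<sigma> g a b c
      = ?S \<oplus>\<^bsub>K\<^esub> \<sigma> a \<triangleright> g b c \<oplus>\<^bsub>K\<^esub> g a (b \<otimes>\<^bsub>C\<^esub> c)"
    unfolding obstruction_def using closed by (intro K.cancel_two) simp_all
  also have "\<dots> = crossed_mult \<sigma> g a (b \<otimes>\<^bsub>C\<^esub> c) x (crossed_mult \<sigma> g b c y z)"
    unfolding R using closed by (simp add: K.a_ac)
  finally show ?thesis .
qed

text \<open>What becomes of g when a section r with factor set g is replaced by r + k t: expand (r a
  + k (t a)) (r b + k (t b)) and subtract r (a b) + k (t (a b)).\<close>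

definition section_change where
  "section_change \<sigma> t g a b = g a b \<oplus>\<^bsub>K\<^esub> \<sigma> a \<triangleright> t b \<oplus>\<^bsub>K\<^esub> t a \<triangleleft> \<sigma> b \<oplus>\<^bsub>K\<^esub> t a \<otimes>\<^bsub>K\<^esub> t b \<ominus>\<^bsub>K\<^esub> t (a \<otimes>\<^bsub>C\<^esub> b)"

text \<open>Rather than expanding the new obstruction, the proof compares associators: the shear (x,
  a) to (x + t a, a) carries the new product to the old one, and it moves neither the obstruction
  nor anything else that depends on C-components alone.\<close>

lemma section_change:
  assumes fs: "factor_set \<sigma> g" and t: "t \<in> linear_map F C K"
    and \<sigma>': "\<And>x. x \<in> carrier C \<Longrightarrow> \<sigma>' x = \<sigma> x \<oplus>\<^bsub>A\<^esub> d (t x)"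
  shows factor_set_section_change: "factor_set \<sigma>' (section_change \<sigma> t g)"
    and obstruction_section_change: "a \<in> carrier C \<Longrightarrow> b \<in> carrier C \<Longrightarrow> c \<in> carrier C \<Longrightarrow>
      obstruction \<sigma>' (section_change \<sigma> t g) a b c = obstruction \<sigma> g a b c"
proof -
  note cl = factor_setD(3,5)[OF fs]
  note tc = linear_mapD(1)[OF t]
  note \<sigma>_lin = linear_mapD(2,3)[OF factor_setD(1)[OF fs]]
  note g_lin = bilinear_mapD(2-)[OF factor_setD(2)[OF fs]]
  note t_lin = linear_mapD(2,3)[OF t]
  show fs': "factor_set \<sigma>' (section_change \<sigma> t g)"
    unfolding factor_set_def
  proof (intro conjI ballI)
    show "\<sigma>' \<in> linear_map F C A"
      by (rule linear_mapI) (simp_all add: \<sigma>' cl tc \<sigma>_lin t_lin d_add d_smult A_smult A.a_ac)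
    show "bilinear_map F C K (section_change \<sigma> t g)"
      by (rule bilinear_mapI) (simp_all add: section_change_def a_minus_def cl tc \<sigma>_lin t_lin g_lin act_add
          act_smult K_smult K_l_distr K_r_distr K_smult_l K_smult_r C.l_distr C.r_distr C_smult_mult
          K.minus_add K.a_ac)
    fix x y assume x: "x \<in> carrier C"
    show "p (\<sigma>' x) = \<psi> x"
      using x by (simp add: \<sigma>' cl tc p_simps factor_setD(4)[OF fs])
    assume y: "y \<in> carrier C"
    have clA: "\<sigma> x \<in> carrier A" "\<sigma> y \<in> carrier A" "\<sigma> (x \<otimes>\<^bsub>C\<^esub> y) \<in> carrier A"
      "d (t x) \<in> carrier A" "d (t y) \<in> carrier A" "d (t (x \<otimes>\<^bsub>C\<^esub> y)) \<in> carrier A"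
      using x y by (simp_all add: cl tc)
    have "d (section_change \<sigma> t g x y) = (\<sigma> x \<otimes>\<^bsub>A\<^esub> \<sigma> y \<ominus>\<^bsub>A\<^esub> \<sigma> (x \<otimes>\<^bsub>C\<^esub> y)) \<oplus>\<^bsub>A\<^esub> \<sigma> x \<otimes>\<^bsub>A\<^esub> d (t y)
        \<oplus>\<^bsub>A\<^esub> d (t x) \<otimes>\<^bsub>A\<^esub> \<sigma> y \<oplus>\<^bsub>A\<^esub> d (t x) \<otimes>\<^bsub>A\<^esub> d (t y) \<ominus>\<^bsub>A\<^esub> d (t (x \<otimes>\<^bsub>C\<^esub> y))"
      using x y by (simp add: section_change_def cl tc d_minus d_add d_act d_mult factor_setD(6)[OF fs])
    also have "\<dots> = (\<sigma> x \<oplus>\<^bsub>A\<^esub> d (t x)) \<otimes>\<^bsub>A\<^esub> (\<sigma> y \<oplus>\<^bsub>A\<^esub> d (t y)) \<ominus>\<^bsub>A\<^esub> (\<sigma> (x \<otimes>\<^bsub>C\<^esub> y) \<oplus>\<^bsub>A\<^esub> d (t (x \<otimes>\<^bsub>C\<^esub> y)))"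
      using clA by algebra
    finally show "d (section_change \<sigma> t g x y) = \<sigma>' x \<otimes>\<^bsub>A\<^esub> \<sigma>' y \<ominus>\<^bsub>A\<^esub> \<sigma>' (x \<otimes>\<^bsub>C\<^esub> y)"
      using x y by (simp add: \<sigma>')
  qed
  \<comment> \<open>The K-component of the statement that the shear is multiplicative.\<close>
  have shift: "crossed_mult \<sigma>' (section_change \<sigma> t g) a b x y \<oplus>\<^bsub>K\<^esub> t (a \<otimes>\<^bsub>C\<^esub> b)
      = crossed_mult \<sigma> g a b (x \<oplus>\<^bsub>K\<^esub> t a) (y \<oplus>\<^bsub>K\<^esub> t b)"
    if ab: "a \<in> carrier C" "b \<in> carrier C" and xy: "x \<in> carrier K" "y \<in> carrier K" for a b x y
  proof -
    have closed: "x \<otimes>\<^bsub>K\<^esub> y \<in> carrier K" "\<sigma> a \<triangleright> y \<in> carrier K" "t a \<otimes>\<^bsub>K\<^esub> y \<in> carrier K"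
      "x \<triangleleft> \<sigma> b \<in> carrier K" "x \<otimes>\<^bsub>K\<^esub> t b \<in> carrier K" "g a b \<in> carrier K" "\<sigma> a \<triangleright> t b \<in> carrier K"
      "t a \<triangleleft> \<sigma> b \<in> carrier K" "t a \<otimes>\<^bsub>K\<^esub> t b \<in> carrier K" "t (a \<otimes>\<^bsub>C\<^esub> b) \<in> carrier K"
      using ab xy by (simp_all add: cl tc)
    have L: "crossed_mult \<sigma>' (section_change \<sigma> t g) a b x y = x \<otimes>\<^bsub>K\<^esub> y \<oplus>\<^bsub>K\<^esub> (\<sigma> a \<triangleright> y \<oplus>\<^bsub>K\<^esub> t a \<otimes>\<^bsub>K\<^esub> y)
        \<oplus>\<^bsub>K\<^esub> (x \<triangleleft> \<sigma> b \<oplus>\<^bsub>K\<^esub> x \<otimes>\<^bsub>K\<^esub> t b)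
        \<oplus>\<^bsub>K\<^esub> (g a b \<oplus>\<^bsub>K\<^esub> \<sigma> a \<triangleright> t b \<oplus>\<^bsub>K\<^esub> t a \<triangleleft> \<sigma> b \<oplus>\<^bsub>K\<^esub> t a \<otimes>\<^bsub>K\<^esub> t b \<ominus>\<^bsub>K\<^esub> t (a \<otimes>\<^bsub>C\<^esub> b))"
      using ab xy by (simp add: crossed_mult_def section_change_def \<sigma>' cl tc act_add act_d)
    have R: "crossed_mult \<sigma> g a b (x \<oplus>\<^bsub>K\<^esub> t a) (y \<oplus>\<^bsub>K\<^esub> t b) =
        (x \<otimes>\<^bsub>K\<^esub> y \<oplus>\<^bsub>K\<^esub> t a \<otimes>\<^bsub>K\<^esub> y \<oplus>\<^bsub>K\<^esub> (x \<otimes>\<^bsub>K\<^esub> t b \<oplus>\<^bsub>K\<^esub> t a \<otimes>\<^bsub>K\<^esub> t b))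
        \<oplus>\<^bsub>K\<^esub> (\<sigma> a \<triangleright> y \<oplus>\<^bsub>K\<^esub> \<sigma> a \<triangleright> t b) \<oplus>\<^bsub>K\<^esub> (x \<triangleleft> \<sigma> b \<oplus>\<^bsub>K\<^esub> t a \<triangleleft> \<sigma> b) \<oplus>\<^bsub>K\<^esub> g a b"
      using ab xy by (simp add: crossed_mult_def cl tc act_add K_l_distr K_r_distr)
    show ?thesis
      unfolding L R using closed by (subst K.cancel_last) (simp_all add: K.a_ac)
  qed
  assume abc: "a \<in> carrier C" "b \<in> carrier C" "c \<in> carrier C"
  let ?g' = "section_change \<sigma> t g"
  let ?m = "crossed_mult \<sigma> g" and ?m' = "crossed_mult \<sigma>' ?g'"
  note mc = crossed_mult_closed[OF fs] and mc' = crossed_mult_closed[OF fs']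
  have o: "obstruction \<sigma>' ?g' a b c \<in> carrier K" "obstruction \<sigma> g a b c \<in> carrier K"
    using obstruction_closed[OF fs' abc] obstruction_closed[OF fs abc] by simp_all
  \<comment> \<open>One bracketing, in the old product, of the sheared elements (0, a), (0, b), (0,
    c). The other bracketing exceeds it by the old obstruction, and before shearing the two differ
    by the new one; cancelling \<open>?X\<close> identifies them.\<close>
  let ?X = "?m (a \<otimes>\<^bsub>C\<^esub> b) c (?m a b (t a) (t b)) (t c)"
  have X: "?X \<in> carrier K"
    using abc by (simp add: mc tc)
  have 1: "?m' (a \<otimes>\<^bsub>C\<^esub> b) c (?m' a b \<zero>\<^bsub>K\<^esub> \<zero>\<^bsub>K\<^esub>) \<zero>\<^bsub>K\<^esub> \<oplus>\<^bsub>K\<^esub> t (a \<otimes>\<^bsub>C\<^esub> b \<otimes>\<^bsub>C\<^esub> c) = ?X"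
    using abc by (simp add: shift mc' tc)
  have 2: "?m' a (b \<otimes>\<^bsub>C\<^esub> c) \<zero>\<^bsub>K\<^esub> (?m' b c \<zero>\<^bsub>K\<^esub> \<zero>\<^bsub>K\<^esub>) \<oplus>\<^bsub>K\<^esub> t (a \<otimes>\<^bsub>C\<^esub> b \<otimes>\<^bsub>C\<^esub> c) =
      ?X \<oplus>\<^bsub>K\<^esub> obstruction \<sigma> g a b c"
    using abc by (simp add: shift mc' tc C.m_assoc crossed_mult_assoc[OF fs, simplified C.m_assoc])
  have "?X \<oplus>\<^bsub>K\<^esub> obstruction \<sigma>' ?g' a b c
      = (?m' (a \<otimes>\<^bsub>C\<^esub> b) c (?m' a b \<zero>\<^bsub>K\<^esub> \<zero>\<^bsub>K\<^esub>) \<zero>\<^bsub>K\<^esub> \<oplus>\<^bsub>K\<^esub> obstruction \<sigma>' ?g' a b c) \<oplus>\<^bsub>K\<^esub> t (a \<otimes>\<^bsub>C\<^esub> b \<otimes>\<^bsub>C\<^esub> c)"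
    unfolding 1[symmetric] using abc by (simp add: mc' tc o K.a_ac)
  also have "\<dots> = ?X \<oplus>\<^bsub>K\<^esub> obstruction \<sigma> g a b c"
    using abc by (simp add: crossed_mult_assoc[OF fs'] 2)
  finally show "obstruction \<sigma>' ?g' a b c = obstruction \<sigma> g a b c"
    using X o by simp
qed

end

text \<open>The rearrangement behind the additivity of the obstruction in g for fixed
  \<sigma>.\<close>

lemma (in abelian_group) add_alternating_sums:
  assumes "a \<in> carrier G" "b \<in> carrier G" "c \<in> carrier G" "u \<in> carrier G"
    "a' \<in> carrier G" "b' \<in> carrier G" "c' \<in> carrier G" "u' \<in> carrier G"
  shows "(a \<oplus> a') \<ominus> (b \<oplus> b') \<oplus> (c \<oplus> c') \<ominus> (u \<oplus> u') = (a \<ominus> b \<oplus> c \<ominus> u) \<oplus> (a' \<ominus> b' \<oplus> c' \<ominus> u')"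
  using assms by algebra

lemma (in abelian_group) add_minus_cancel:
  assumes "a \<in> carrier G" "b \<in> carrier G"
  shows "a \<oplus> (b \<ominus> a) = b" "(b \<ominus> a) \<oplus> a = b"
  using assms by (algebra, algebra)

lemma pullback_bimod_id [simp]: "pullback_bimod (\<lambda>y. y) \<xi> = \<xi>"
  by (simp add: pullback_bimod_def)

lemma hh_coboundaries_3: "hh_coboundaries F C B \<xi> 3 = hh_delta C B \<xi> 2 ` hh_cochains F C B 2"
proof -
  have e: "(3::nat) = Suc 2" by simp
  show ?thesis
    unfolding hh_coboundaries_def e by (simp only: nat.case)
qed

section \<open>Obstructions of different factor sets, and the class of the crossed
  biextension\<close>

context kernel_representative
begin

lemma Z_abelian_group: "abelian_group (ann_alg K)"
  by (rule lin_space_abelian_group[OF Z_lin])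

text \<open>The kernel of p is the image of d, on which d has a linear section; composing h with it
  keeps the lift linear.\<close>

lemma lift_along_d:
  assumes V: "lin_space F V" and h: "h \<in> linear_map F V A"
    and ph: "\<And>x. x \<in> carrier V \<Longrightarrow> p (h x) = \<zero>\<^bsub>Q\<^esub>"
  obtains t where "t \<in> linear_map F V K" "\<And>x. x \<in> carrier V \<Longrightarrow> d (t x) = h x"
proof -
  obtain q where q: "q \<in> linear_map F (A\<lparr>carrier := d ` carrier K\<rparr>) K"
    and dq: "\<And>a. a \<in> d ` carrier K \<Longrightarrow> d (q a) = a"
    by (rule d_section_exists) blast
  have im: "h x \<in> d ` carrier K" if "x \<in> carrier V" for x
    using linear_mapD(1)[OF h that] ph[OF that] by (simp add: image_d)
  have "h \<in> linear_map F V (A\<lparr>carrier := d ` carrier K\<rparr>)"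
    by (rule linear_mapI) (simp_all add: im linear_mapD[OF h])
  from linear_map_comp[OF this q] show thesis
    by (rule that) (rule dq[OF im])
qed

text \<open>C acts on Z(K) through any lift to A, in particular through \<sigma>; so \<delta>\<eta>
  is given by the formula of \<open>obstruction\<close> with \<eta> for g.\<close>

lemma delta_2_factor_set:
  assumes fs: "factor_set \<sigma> g" and \<eta>: "\<eta> \<in> hh_cochains F C (ann_alg K) 2"
    and abc: "a \<in> carrier C" "b \<in> carrier C" "c \<in> carrier C"
  shows "hh_delta C (ann_alg K) \<xi>C 2 \<eta> [a, b, c] =
    \<sigma> a \<triangleright> \<eta> [b, c] \<ominus>\<^bsub>K\<^esub> \<eta> [a \<otimes>\<^bsub>C\<^esub> b, c] \<oplus>\<^bsub>K\<^esub> \<eta> [a, b \<otimes>\<^bsub>C\<^esub> c] \<ominus>\<^bsub>K\<^esub> \<eta> [a, b] \<triangleleft> \<sigma> c"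
proof -
  have \<eta>Z: "\<eta> [x, y] \<in> Z" if "x \<in> carrier C" "y \<in> carrier C" for x y
    by (rule bilinear_mapD(1)[OF hh_cochains_2_bilinear[OF \<eta>] that])
  note act = \<xi>C_act[OF factor_setD(3)[OF fs] factor_setD(4)[OF fs]]
  show ?thesis
    using abc by (simp add: bimodule.hh_delta_2[where f = \<eta>, OF bimod_C \<eta>Z] act \<eta>Z Z_closed(2-)
        ann_alg_minus factor_setD(3)[OF fs])
qed

text \<open>\<eta> has values in the kernel of d, so the equation for d g is unaffected; the rest is
  additivity of the obstruction in g.\<close>

lemma factor_set_add_cochain:
  assumes fs: "factor_set \<sigma> g" and \<eta>: "\<eta> \<in> hh_cochains F C (ann_alg K) 2"
    and g': "\<And>x y. x \<in> carrier C \<Longrightarrow> y \<in> carrier C \<Longrightarrow> g' x y = g x y \<oplus>\<^bsub>K\<^esub> \<eta> [x, y]"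
  shows "factor_set \<sigma> g'"
    and "a \<in> carrier C \<Longrightarrow> b \<in> carrier C \<Longrightarrow> c \<in> carrier C \<Longrightarrow>
      obstruction \<sigma> g' a b c = obstruction \<sigma> g a b c \<oplus>\<^bsub>K\<^esub> hh_delta C (ann_alg K) \<xi>C 2 \<eta> [a, b, c]"
proof -
  note bil = bilinear_mapD[OF hh_cochains_2_bilinear[OF \<eta>]]
  note gbil = bilinear_mapD[OF factor_setD(2)[OF fs]]
  note \<eta>K = Z_K[OF bil(1)]
  have d\<eta>: "d (\<eta> [x, y]) = \<zero>\<^bsub>A\<^esub>" if "x \<in> carrier C" "y \<in> carrier C" for x y
    using bil(1)[OF that] by (simp add: Z_iff)
  show "factor_set \<sigma> g'"
    unfolding factor_set_def
  proof (intro conjI ballI)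
    show "bilinear_map F C K g'"
      by (rule bilinear_mapI) (simp_all add: g' bil(2-) gbil \<eta>K K.a_ac K_smult C.l_distr)
    show "d (g' x y) = \<sigma> x \<otimes>\<^bsub>A\<^esub> \<sigma> y \<ominus>\<^bsub>A\<^esub> \<sigma> (x \<otimes>\<^bsub>C\<^esub> y)" if "x \<in> carrier C" "y \<in> carrier C" for x y
      using that by (simp add: g' d_add d\<eta> \<eta>K gbil(1) factor_setD(3,6)[OF fs])
  qed (simp_all add: factor_setD[OF fs])
  show "obstruction \<sigma> g' a b c = obstruction \<sigma> g a b c \<oplus>\<^bsub>K\<^esub> hh_delta C (ann_alg K) \<xi>C 2 \<eta> [a, b, c]"
    if "a \<in> carrier C" "b \<in> carrier C" "c \<in> carrier C"
    using that by (simp add: obstruction_def g' delta_2_factor_set[OF fs \<eta>] \<eta>K gbil(1)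
        factor_setD(3)[OF fs] act_add K.add_alternating_sums)
qed

text \<open>The equation for d g involves \<sigma> alone, so two factor sets over the same \<sigma>
  differ by a function into the kernel of d, which is Z(K).\<close>

lemma factor_set_diff_cochain:
  assumes fs: "factor_set \<sigma> g" and fs': "factor_set \<sigma> g'"
  obtains \<eta> where "\<eta> \<in> hh_cochains F C (ann_alg K) 2"
    "\<And>x y. x \<in> carrier C \<Longrightarrow> y \<in> carrier C \<Longrightarrow> g' x y = g x y \<oplus>\<^bsub>K\<^esub> \<eta> [x, y]"
proof -
  note gbil = bilinear_mapD[OF factor_setD(2)[OF fs]] and gbil' = bilinear_mapD[OF factor_setD(2)[OF fs']]
  have "g' x y \<ominus>\<^bsub>K\<^esub> g x y \<in> Z" if "x \<in> carrier C" "y \<in> carrier C" for x y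
    using that by (simp add: Z_iff gbil(1) gbil'(1) d_minus factor_setD(3,6)[OF fs] factor_setD(6)[OF fs']
        A.r_neg a_minus_def[of A "_ \<oplus>\<^bsub>A\<^esub> _"] A.minus_eq)
  then have "bilinear_map F C (ann_alg K) (\<lambda>x y. g' x y \<ominus>\<^bsub>K\<^esub> g x y)"
    by (intro bilinear_mapI) (simp_all add: gbil gbil' a_minus_def K_smult K.minus_add K.a_ac C.l_distr)
  from bilinear_hh_cochain[OF C_alg this] show thesis
    by (rule that) (simp add: gbil(1) gbil'(1) K.add_minus_cancel)
qed

text \<open>p kills \<sigma>' - \<sigma>, so this difference is d t for a linear t. Moving along t
  leaves the obstruction unchanged and brings both factor sets over \<sigma>'; what then separates
  them is a cochain.\<close>

lemma obstruction_independent: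
  assumes fs: "factor_set \<sigma> g" and fs': "factor_set \<sigma>' g'"
  shows "\<exists>\<eta>\<in>hh_cochains F C (ann_alg K) 2. \<forall>a\<in>carrier C. \<forall>b\<in>carrier C. \<forall>c\<in>carrier C.
      obstruction \<sigma>' g' a b c = obstruction \<sigma> g a b c \<oplus>\<^bsub>K\<^esub> hh_delta C (ann_alg K) \<xi>C 2 \<eta> [a, b, c]"
proof -
  note \<sigma> = linear_mapD[OF factor_setD(1)[OF fs]] and \<sigma>' = linear_mapD[OF factor_setD(1)[OF fs']]
  have "(\<lambda>x. \<sigma>' x \<ominus>\<^bsub>A\<^esub> \<sigma> x) \<in> linear_map F C A"
    by (rule linear_mapI) (simp_all add: \<sigma> \<sigma>' a_minus_def A_smult A.minus_add A.a_ac)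
  moreover have "p (\<sigma>' x \<ominus>\<^bsub>A\<^esub> \<sigma> x) = \<zero>\<^bsub>Q\<^esub>" if "x \<in> carrier C" for x
    using that by (simp add: \<sigma>(1) \<sigma>'(1) p_minus factor_setD(4)[OF fs] factor_setD(4)[OF fs'])
  ultimately obtain t where t: "t \<in> linear_map F C K" "\<And>x. x \<in> carrier C \<Longrightarrow> d (t x) = \<sigma>' x \<ominus>\<^bsub>A\<^esub> \<sigma> x"
    by (rule lift_along_d[OF C_lin]) (assumption, rule that, simp_all)
  have \<sigma>\<sigma>': "\<sigma>' x = \<sigma> x \<oplus>\<^bsub>A\<^esub> d (t x)" if "x \<in> carrier C" for x
    using that by (simp add: t(2) \<sigma>(1) \<sigma>'(1) A.add_minus_cancel)
  note fs'' = factor_set_section_change[OF fs t(1) \<sigma>\<sigma>']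
  obtain \<eta> where \<eta>: "\<eta> \<in> hh_cochains F C (ann_alg K) 2"
    "\<And>x y. x \<in> carrier C \<Longrightarrow> y \<in> carrier C \<Longrightarrow> g' x y = section_change \<sigma> t g x y \<oplus>\<^bsub>K\<^esub> \<eta> [x, y]"
    by (rule factor_set_diff_cochain[OF fs'' fs']) (assumption, rule that, simp_all)
  show ?thesis
    by (intro bexI[OF _ \<eta>(1)] ballI)
      (simp add: factor_set_add_cochain(2)[OF fs'' \<eta>] obstruction_section_change[OF fs t(1) \<sigma>\<sigma>'])
qed

text \<open>The link between \<open>biext_class\<close> and factor sets. For the identity of Q it
  concerns the cocycle itself, for \<psi> its pullback. Exactness at A puts s(x) s(y) - s(x y) into
  the image of d, where q is defined.\<close>

lemma factor_set_of_sections: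
  assumes sq: "biext_sections F D s q"
  shows "factor_set (\<lambda>x. s (\<psi> x)) (\<lambda>x y. biext_f D s q (\<psi> x) (\<psi> y))"
    and "a \<in> carrier C \<Longrightarrow> b \<in> carrier C \<Longrightarrow> c \<in> carrier C \<Longrightarrow>
      obstruction (\<lambda>x. s (\<psi> x)) (\<lambda>x y. biext_f D s q (\<psi> x) (\<psi> y)) a b c
      = biext_cocycle D s q [\<psi> a, \<psi> b, \<psi> c]"
proof -
  have s: "s \<in> linear_map F Q A" "\<And>y. y \<in> carrier Q \<Longrightarrow> p (s y) = y"
    and q: "q \<in> linear_map F (A\<lparr>carrier := d ` carrier K\<rparr>) K"
    and dq: "\<And>a. a \<in> d ` carrier K \<Longrightarrow> d (q a) = a"
    using sq by (auto simp: biext_sections_def)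
  note sl = linear_mapD[OF s(1)]
  have ql: "x \<in> d ` carrier K \<Longrightarrow> q x \<in> carrier K"
    "x \<in> d ` carrier K \<Longrightarrow> y \<in> d ` carrier K \<Longrightarrow> q (x \<oplus>\<^bsub>A\<^esub> y) = q x \<oplus>\<^bsub>K\<^esub> q y"
    "r \<in> carrier F \<Longrightarrow> x \<in> d ` carrier K \<Longrightarrow> q (r \<odot>\<^bsub>A\<^esub> x) = r \<odot>\<^bsub>K\<^esub> q x" for x y r
    using linear_mapD[OF q] by auto
  have im: "s x \<otimes>\<^bsub>A\<^esub> s y \<ominus>\<^bsub>A\<^esub> s (x \<otimes>\<^bsub>Q\<^esub> y) \<in> d ` carrier K" if "x \<in> carrier Q" "y \<in> carrier Q" for x y
    using that by (simp add: image_d sl(1) p_minus p_simps s(2))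
  have bil: "bilinear_map F C K (\<lambda>x y. biext_f D s q (\<psi> x) (\<psi> y))"
  proof (rule bilinear_mapI)
    fix x y assume xy: "x \<in> carrier C" "y \<in> carrier C"
    show "biext_f D s q (\<psi> x) (\<psi> y) \<in> carrier K"
      using xy by (simp add: biext_f_def ql im)
    show "biext_f D s q (\<psi> (x \<oplus>\<^bsub>C\<^esub> x')) (\<psi> y)
        = biext_f D s q (\<psi> x) (\<psi> y) \<oplus>\<^bsub>K\<^esub> biext_f D s q (\<psi> x') (\<psi> y)" if "x' \<in> carrier C" for x'
    proof -
      have "s (\<psi> (x \<oplus>\<^bsub>C\<^esub> x')) \<otimes>\<^bsub>A\<^esub> s (\<psi> y) \<ominus>\<^bsub>A\<^esub> s (\<psi> (x \<oplus>\<^bsub>C\<^esub> x') \<otimes>\<^bsub>Q\<^esub> \<psi> y)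
        = (s (\<psi> x) \<otimes>\<^bsub>A\<^esub> s (\<psi> y) \<ominus>\<^bsub>A\<^esub> s (\<psi> x \<otimes>\<^bsub>Q\<^esub> \<psi> y))
          \<oplus>\<^bsub>A\<^esub> (s (\<psi> x') \<otimes>\<^bsub>A\<^esub> s (\<psi> y) \<ominus>\<^bsub>A\<^esub> s (\<psi> x' \<otimes>\<^bsub>Q\<^esub> \<psi> y))"
        using xy that by (simp add: psi_simps sl Q.l_distr A.l_distr a_minus_def A.minus_add A.a_ac)
      then show ?thesis
        using xy that by (simp add: biext_f_def ql(2) im)
    qed
    show "biext_f D s q (\<psi> x) (\<psi> (y \<oplus>\<^bsub>C\<^esub> y'))
        = biext_f D s q (\<psi> x) (\<psi> y) \<oplus>\<^bsub>K\<^esub> biext_f D s q (\<psi> x) (\<psi> y')" if "y' \<in> carrier C" for y'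
    proof -
      have "s (\<psi> x) \<otimes>\<^bsub>A\<^esub> s (\<psi> (y \<oplus>\<^bsub>C\<^esub> y')) \<ominus>\<^bsub>A\<^esub> s (\<psi> x \<otimes>\<^bsub>Q\<^esub> \<psi> (y \<oplus>\<^bsub>C\<^esub> y'))
        = (s (\<psi> x) \<otimes>\<^bsub>A\<^esub> s (\<psi> y) \<ominus>\<^bsub>A\<^esub> s (\<psi> x \<otimes>\<^bsub>Q\<^esub> \<psi> y))
          \<oplus>\<^bsub>A\<^esub> (s (\<psi> x) \<otimes>\<^bsub>A\<^esub> s (\<psi> y') \<ominus>\<^bsub>A\<^esub> s (\<psi> x \<otimes>\<^bsub>Q\<^esub> \<psi> y'))"
        using xy that by (simp add: psi_simps sl Q.r_distr A.r_distr a_minus_def A.minus_add A.a_ac)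
      then show ?thesis
        using xy that by (simp add: biext_f_def ql(2) im)
    qed
    fix r assume r: "r \<in> carrier F"
    note Qs = assoc_algebra.alg_smult_l[OF unital_algebraD(1)[OF Q_alg]]
      assoc_algebra.alg_smult_r[OF unital_algebraD(1)[OF Q_alg]]
    have "s (\<psi> (r \<odot>\<^bsub>C\<^esub> x)) \<otimes>\<^bsub>A\<^esub> s (\<psi> y) \<ominus>\<^bsub>A\<^esub> s (\<psi> (r \<odot>\<^bsub>C\<^esub> x) \<otimes>\<^bsub>Q\<^esub> \<psi> y)
        = r \<odot>\<^bsub>A\<^esub> (s (\<psi> x) \<otimes>\<^bsub>A\<^esub> s (\<psi> y) \<ominus>\<^bsub>A\<^esub> s (\<psi> x \<otimes>\<^bsub>Q\<^esub> \<psi> y))"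
      "s (\<psi> x) \<otimes>\<^bsub>A\<^esub> s (\<psi> (r \<odot>\<^bsub>C\<^esub> y)) \<ominus>\<^bsub>A\<^esub> s (\<psi> x \<otimes>\<^bsub>Q\<^esub> \<psi> (r \<odot>\<^bsub>C\<^esub> y))
        = r \<odot>\<^bsub>A\<^esub> (s (\<psi> x) \<otimes>\<^bsub>A\<^esub> s (\<psi> y) \<ominus>\<^bsub>A\<^esub> s (\<psi> x \<otimes>\<^bsub>Q\<^esub> \<psi> y))"
      using xy r by (simp_all add: psi_simps sl a_minus_def A_smult A_smult_mult Qs)
    then show "biext_f D s q (\<psi> (r \<odot>\<^bsub>C\<^esub> x)) (\<psi> y) = r \<odot>\<^bsub>K\<^esub> biext_f D s q (\<psi> x) (\<psi> y)"
      "biext_f D s q (\<psi> x) (\<psi> (r \<odot>\<^bsub>C\<^esub> y)) = r \<odot>\<^bsub>K\<^esub> biext_f D s q (\<psi> x) (\<psi> y)"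
      using xy r by (simp_all add: biext_f_def ql(3) im)
  qed
  show fs: "factor_set (\<lambda>x. s (\<psi> x)) (\<lambda>x y. biext_f D s q (\<psi> x) (\<psi> y))"
    unfolding factor_set_def
    using bil linear_map_comp[OF unital_alg_homD(1)[OF psi_hom] s(1)]
    by (auto simp: s(2) biext_f_def dq im psi_simps)
  have j: "inv_into Z (bx_j D) z = z" if "z \<in> Z" for z
  proof -
    have j_id: "\<forall>x\<in>Z. bx_j D x = x"
      using kernel by (simp add: abstract_kernel_def)
    then have "inj_on (bx_j D) Z"
      by (simp add: inj_on_def)
    from inv_into_f_f[OF this that] show ?thesis
      using j_id that by simp
  qed
  show "obstruction (\<lambda>x. s (\<psi> x)) (\<lambda>x y. biext_f D s q (\<psi> x) (\<psi> y)) a b c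
      = biext_cocycle D s q [\<psi> a, \<psi> b, \<psi> c]" if "a \<in> carrier C" "b \<in> carrier C" "c \<in> carrier C"
    using obstruction_closed[OF fs that] that
    by (simp add: biext_cocycle_def obstruction_def Let_def psi_simps j)
qed

text \<open>Read over Q itself, the cocycles of two pairs of sections are the obstructions of two
  factor sets and hence differ by a coboundary. This gives the definite description in
  \<open>biext_class\<close> its unique value.\<close>

lemma
  assumes sq: "biext_sections F D s q"
  shows biext_cocycle_PiE: "biext_cocycle D s q \<in> tuples Q 3 \<rightarrow>\<^sub>E Z"
    and biext_class_eq: "biext_class F D = hh_class F Q (ann_alg K) (biext_bimod D) 3 (biext_cocycle D s q)"
proof -
  have Suc_2: "Suc 2 = 3"
    by simp
  note fs = kernel_representative.factor_set_of_sections[OF kernel_representative_Q]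
  have PiE: "biext_cocycle D s q \<in> tuples Q 3 \<rightarrow>\<^sub>E Z" if sq: "biext_sections F D s q" for s q
  proof (rule PiE_I)
    show "biext_cocycle D s q xs \<in> Z" if "xs \<in> tuples Q 3" for xs
      using that kernel_representative.obstruction_closed[OF kernel_representative_Q fs(1)[OF sq]] by (auto simp: tuples_3_iff fs(2)[OF sq])
  qed (simp add: biext_cocycle_def)
  then show "biext_cocycle D s q \<in> tuples Q 3 \<rightarrow>\<^sub>E Z"
    using sq by blast
  have indep: "hh_class F Q (ann_alg K) (biext_bimod D) 3 (biext_cocycle D s' q')
      = hh_class F Q (ann_alg K) (biext_bimod D) 3 (biext_cocycle D s q)"
    if sq': "biext_sections F D s' q'" for s' q'
  proof -
    note bimod = kernel_representative.bimod_C[OF kernel_representative_Q, unfolded pullback_bimod_id]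
    obtain \<eta> where \<eta>1: "\<eta> \<in> hh_cochains F Q (ann_alg K) 2"
      and raw: "\<forall>a\<in>carrier Q. \<forall>b\<in>carrier Q. \<forall>c\<in>carrier Q.
        kernel_representative.obstruction Q K D (\<lambda>x. s' x) (\<lambda>x y. biext_f D s' q' x y) a b c
        = kernel_representative.obstruction Q K D (\<lambda>x. s x) (\<lambda>x y. biext_f D s q x y) a b c
          \<oplus>\<^bsub>K\<^esub> hh_delta Q (ann_alg K) (biext_bimod D) 2 \<eta> [a, b, c]"
      using kernel_representative.obstruction_independent[OF kernel_representative_Q fs(1)[OF sq]
          fs(1)[OF sq'], unfolded pullback_bimod_id]
      by (elim bexE) (rule that)
    have \<eta>2: "biext_cocycle D s' q' [a, b, c]
        = biext_cocycle D s q [a, b, c] \<oplus>\<^bsub>K\<^esub> hh_delta Q (ann_alg K) (biext_bimod D) 2 \<eta> [a, b, c]"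
      if "a \<in> carrier Q" "b \<in> carrier Q" "c \<in> carrier Q" for a b c
      unfolding fs(2)[OF sq that, symmetric] fs(2)[OF sq' that, symmetric]
      by (rule raw[rule_format, OF that])
    note \<eta> = \<eta>1 \<eta>2
    have \<delta>: "hh_delta Q (ann_alg K) (biext_bimod D) 2 \<eta> \<in> hh_coboundaries F Q (ann_alg K) (biext_bimod D) 3"
      using \<eta>(1) by (simp add: hh_coboundaries_3)
    have \<delta>P: "hh_delta Q (ann_alg K) (biext_bimod D) 2 \<eta> \<in> tuples Q 3 \<rightarrow>\<^sub>E Z"
      using bimodule.hh_delta_closed[OF bimod, of \<eta> 2] hh_cochains_PiE[OF \<eta>(1)] by auto
    have "biext_cocycle D s' q' = cochain_add Q (ann_alg K) 3
        (hh_delta Q (ann_alg K) (biext_bimod D) 2 \<eta>) (biext_cocycle D s q)"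
    proof (rule PiE_eqI[OF PiE[OF sq']])
      show "cochain_add Q (ann_alg K) 3 (hh_delta Q (ann_alg K) (biext_bimod D) 2 \<eta>) (biext_cocycle D s q)
          \<in> tuples Q 3 \<rightarrow>\<^sub>E Z"
        using \<delta>P PiE[OF sq] by (auto intro!: Z_closed(2))
      fix xs assume xs: "xs \<in> tuples Q 3"
      then obtain a b c where abc: "xs = [a, b, c]" "a \<in> carrier Q" "b \<in> carrier Q" "c \<in> carrier Q"
        by (auto simp: tuples_3_iff)
      have "biext_cocycle D s q xs \<in> Z" "hh_delta Q (ann_alg K) (biext_bimod D) 2 \<eta> xs \<in> Z"
        using xs by (rule PiE_const_mem[OF PiE[OF sq]], rule PiE_const_mem[OF \<delta>P])
      then show "biext_cocycle D s' q' xs = cochain_add Q (ann_alg K) 3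
          (hh_delta Q (ann_alg K) (biext_bimod D) 2 \<eta>) (biext_cocycle D s q) xs"
        using abc by (simp add: \<eta>(2) K.a_comm)
    qed
    then show ?thesis
      by (rule iffD2[OF bimodule.hh_class_eq_iff[OF bimod, where n = 2, unfolded Suc_2,
            OF PiE[OF sq'] PiE[OF sq]] bexI[OF _ \<delta>]])
  qed
  show "biext_class F D = hh_class F Q (ann_alg K) (biext_bimod D) 3 (biext_cocycle D s q)"
    unfolding biext_class_def bx_eq
  proof (rule the_equality)
    fix c assume "\<exists>s q. biext_sections F D s q \<and>
      c = hh_class F Q (ann_alg K) (biext_bimod D) 3 (biext_cocycle D s q)"
    then obtain s' q' where sq': "biext_sections F D s' q'"
      and c: "c = hh_class F Q (ann_alg K) (biext_bimod D) 3 (biext_cocycle D s' q')"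
      by (elim exE conjE) (rule that)
    show "c = hh_class F Q (ann_alg K) (biext_bimod D) 3 (biext_cocycle D s q)"
      unfolding c by (rule indep[OF sq'])
  qed (intro exI conjI, rule sq, rule refl)
qed

text \<open>The obstructions of all factor sets form one coset of the coboundaries, so its class
  vanishes exactly when zero is among them. It remains to see that the pullback of \<omega> lies in
  this coset.\<close>

lemma pullback_class_trivial_iff:
  assumes \<omega>: "\<omega> \<in> hh_cocycles F Q (ann_alg K) (biext_bimod D) 3"
    and cls: "hh_class F Q (ann_alg K) (biext_bimod D) 3 \<omega> = biext_class F D"
  shows "hh_class F C (ann_alg K) \<xi>C 3 (pullback_cochain C \<psi> 3 \<omega>) = \<one>\<^bsub>HH F C (ann_alg K) \<xi>C 3\<^esub> \<longleftrightarrow>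
    (\<exists>\<sigma> g. factor_set \<sigma> g \<and> (\<forall>a\<in>carrier C. \<forall>b\<in>carrier C. \<forall>c\<in>carrier C. obstruction \<sigma> g a b c = \<zero>\<^bsub>K\<^esub>))"
proof -
  interpret ZZ: abelian_group "ann_alg K"
    by (rule Z_abelian_group)
  note bimod = kernel_representative.bimod_C[OF kernel_representative_Q, unfolded pullback_bimod_id]
  obtain s q where sq: "biext_sections F D s q"
    using biext_sections_exist by blast
  have \<omega>P: "\<omega> \<in> tuples Q 3 \<rightarrow>\<^sub>E Z"
    by (rule hh_cochains_PiE[of _ F]) (use \<omega> in \<open>simp add: hh_cocycles_def\<close>)
  have Suc_2: "Suc 2 = 3"
    by simp
  have "\<exists>\<beta>\<in>hh_coboundaries F Q (ann_alg K) (biext_bimod D) 3.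
      \<omega> = cochain_add Q (ann_alg K) 3 \<beta> (biext_cocycle D s q)"
    by (rule iffD1[OF bimodule.hh_class_eq_iff[OF bimod, where n = 2, unfolded Suc_2,
          OF \<omega>P biext_cocycle_PiE[OF sq]] cls[unfolded biext_class_eq[OF sq]]])
  then obtain \<beta> where "\<beta> \<in> hh_coboundaries F Q (ann_alg K) (biext_bimod D) 3"
    and \<omega>\<beta>: "\<omega> = cochain_add Q (ann_alg K) 3 \<beta> (biext_cocycle D s q)"
    by (elim bexE) (rule that)
  then obtain \<zeta> where \<zeta>: "\<zeta> \<in> hh_cochains F Q (ann_alg K) 2"
    and \<beta>: "\<beta> = hh_delta Q (ann_alg K) (biext_bimod D) 2 \<zeta>"
    unfolding hh_coboundaries_3 by (elim imageE) (rule that)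
  note \<zeta>b = bilinear_mapD[OF hh_cochains_2_bilinear[OF \<zeta>]]
  \<comment> \<open>\<omega> differs from the cocycle of the sections by the coboundary of \<zeta>.
    Adding the pullback of \<zeta> to the pulled back factor set makes its obstruction equal to the
    pullback of \<omega>.\<close>
  define \<zeta>' where "\<zeta>' = (\<lambda>xs\<in>tuples C 2. \<zeta> [\<psi> (xs ! 0), \<psi> (xs ! 1)])"
  have "bilinear_map F C (ann_alg K) (\<lambda>x y. \<zeta> [\<psi> x, \<psi> y])"
    by (rule bilinear_mapI) (simp_all add: psi_simps \<zeta>b del: ann_alg_simps)
  then have \<zeta>'c: "\<zeta>' \<in> hh_cochains F C (ann_alg K) 2"
    unfolding \<zeta>'_def by (rule bilinear_hh_cochain[OF C_alg])
  define \<sigma> where "\<sigma> = (\<lambda>x. s (\<psi> x))"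
  define g where "g = (\<lambda>x y. biext_f D s q (\<psi> x) (\<psi> y) \<oplus>\<^bsub>K\<^esub> \<zeta>' [x, y])"
  note fs0 = factor_set_of_sections[OF sq, folded \<sigma>_def]
  have fs: "factor_set \<sigma> g"
    by (rule factor_set_add_cochain(1)[OF fs0(1) \<zeta>'c]) (simp add: g_def)
  have \<zeta>'\<zeta>: "\<zeta>' [x, y] = \<zeta> [\<psi> x, \<psi> y]" if "x \<in> carrier C" "y \<in> carrier C" for x y
    using that by (simp add: \<zeta>'_def)
  have obs: "obstruction \<sigma> g a b c = pullback_cochain C \<psi> 3 \<omega> [a, b, c]"
    if abc: "a \<in> carrier C" "b \<in> carrier C" "c \<in> carrier C" for a b c
  proof -
    have "obstruction \<sigma> g a b c = biext_cocycle D s q [\<psi> a, \<psi> b, \<psi> c]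
        \<oplus>\<^bsub>K\<^esub> hh_delta C (ann_alg K) \<xi>C 2 \<zeta>' [a, b, c]"
      by (subst factor_set_add_cochain(2)[OF fs0(1) \<zeta>'c _ abc]) (simp_all add: g_def fs0(2)[OF abc])
    \<comment> \<open>Both coboundaries act through the same elements s (\<psi> a) of A, so pulling
      back commutes with \<delta>.\<close>
    also have "hh_delta C (ann_alg K) \<xi>C 2 \<zeta>' [a, b, c] = \<beta> [\<psi> a, \<psi> b, \<psi> c]"
      using abc unfolding \<beta> delta_2_factor_set[OF fs \<zeta>'c abc]
        kernel_representative.delta_2_factor_set[OF kernel_representative_Q kernel_representative.factor_set_of_sections(1)[OF kernel_representative_Q sq] \<zeta>, unfolded pullback_bimod_id,
          OF psi_closed[OF abc(1)] psi_closed[OF abc(2)] psi_closed[OF abc(3)]]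
      by (simp add: \<zeta>'\<zeta> psi_simps \<sigma>_def)
    also have "biext_cocycle D s q [\<psi> a, \<psi> b, \<psi> c] \<oplus>\<^bsub>K\<^esub> \<beta> [\<psi> a, \<psi> b, \<psi> c] = \<omega> [\<psi> a, \<psi> b, \<psi> c]"
    proof -
      have "[\<psi> a, \<psi> b, \<psi> c] \<in> tuples Q 3"
        using abc by simp
      moreover have "\<beta> \<in> tuples Q 3 \<rightarrow>\<^sub>E Z"
        using bimodule.hh_delta_closed[OF bimod, of \<zeta> 2] hh_cochains_PiE[OF \<zeta>] unfolding \<beta> by auto
      ultimately have "biext_cocycle D s q [\<psi> a, \<psi> b, \<psi> c] \<in> Z" "\<beta> [\<psi> a, \<psi> b, \<psi> c] \<in> Z"
        using PiE_const_mem[OF biext_cocycle_PiE[OF sq]] PiE_const_mem by blast+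
      then show ?thesis
        unfolding \<omega>\<beta> using abc by (simp add: K.a_comm)
    qed
    finally show ?thesis
      using abc by (simp add: pullback_cochain_def)
  qed
  have pP: "pullback_cochain C \<psi> 3 \<omega> \<in> tuples C 3 \<rightarrow>\<^sub>E Z"
    unfolding pullback_cochain_def
    by (auto simp: tuples_3_iff intro!: PiE_const_mem[OF \<omega>P])
  have triv: "hh_class F C (ann_alg K) \<xi>C 3 (pullback_cochain C \<psi> 3 \<omega>) = \<one>\<^bsub>HH F C (ann_alg K) \<xi>C 3\<^esub> \<longleftrightarrow>
      (\<exists>\<eta>\<in>hh_cochains F C (ann_alg K) 2. pullback_cochain C \<psi> 3 \<omega> = hh_delta C (ann_alg K) \<xi>C 2 \<eta>)"
    using bimodule.hh_class_trivial_iff[OF bimod_C, of "pullback_cochain C \<psi> 3 \<omega>" 2] pP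
    by (auto simp: hh_coboundaries_3)
  have \<delta>P: "hh_delta C (ann_alg K) \<xi>C 2 \<eta> \<in> tuples C 3 \<rightarrow>\<^sub>E Z"
    if "\<eta> \<in> hh_cochains F C (ann_alg K) 2" for \<eta>
    using bimodule.hh_delta_closed[OF bimod_C, of \<eta> 2] hh_cochains_PiE[OF that] by auto
  show ?thesis
    unfolding triv
  proof
    assume "\<exists>\<eta>\<in>hh_cochains F C (ann_alg K) 2. pullback_cochain C \<psi> 3 \<omega> = hh_delta C (ann_alg K) \<xi>C 2 \<eta>"
    then obtain \<eta> where \<eta>: "\<eta> \<in> hh_cochains F C (ann_alg K) 2"
      and eq: "pullback_cochain C \<psi> 3 \<omega> = hh_delta C (ann_alg K) \<xi>C 2 \<eta>" by blast
    \<comment> \<open>The obstruction of g is \<delta>\<eta>, so subtracting \<eta> from g removes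
      it.\<close>
    let ?n = "cochain_neg C (ann_alg K) 2 \<eta>"
    have n: "?n \<in> hh_cochains F C (ann_alg K) 2"
      by (rule bimodule.hh_cochains_neg[OF bimod_C \<eta>])
    have \<delta>n: "hh_delta C (ann_alg K) \<xi>C 2 ?n = cochain_neg C (ann_alg K) (Suc 2) (hh_delta C (ann_alg K) \<xi>C 2 \<eta>)"
      by (rule bimodule.hh_delta_neg[OF bimod_C]) (use hh_cochains_PiE[OF \<eta>] in auto)
    let ?g = "\<lambda>x y. g x y \<oplus>\<^bsub>K\<^esub> ?n [x, y]"
    have "factor_set \<sigma> ?g"
      by (rule factor_set_add_cochain(1)[OF fs n]) simp
    moreover have "obstruction \<sigma> ?g a b c = \<zero>\<^bsub>K\<^esub>"
      if abc: "a \<in> carrier C" "b \<in> carrier C" "c \<in> carrier C" for a b c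
    proof -
      have t: "[a, b, c] \<in> tuples C 3"
        using abc by simp
      have z: "hh_delta C (ann_alg K) \<xi>C 2 \<eta> [a, b, c] \<in> Z"
        by (rule PiE_const_mem[OF \<delta>P[OF \<eta>] t])
      have "obstruction \<sigma> ?g a b c = obstruction \<sigma> g a b c \<oplus>\<^bsub>K\<^esub> hh_delta C (ann_alg K) \<xi>C 2 ?n [a, b, c]"
        by (rule factor_set_add_cochain(2)[OF fs n _ abc]) simp
      also have "\<dots> = \<zero>\<^bsub>K\<^esub>"
        unfolding \<delta>n obs[OF abc] eq using t z by (simp add: ann_alg_neg K.r_neg)
      finally show ?thesis .
    qed
    ultimately show "\<exists>\<sigma> g. factor_set \<sigma> g \<and>
        (\<forall>a\<in>carrier C. \<forall>b\<in>carrier C. \<forall>c\<in>carrier C. obstruction \<sigma> g a b c = \<zero>\<^bsub>K\<^esub>)"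
      by blast
  next
    assume "\<exists>\<sigma> g. factor_set \<sigma> g \<and>
        (\<forall>a\<in>carrier C. \<forall>b\<in>carrier C. \<forall>c\<in>carrier C. obstruction \<sigma> g a b c = \<zero>\<^bsub>K\<^esub>)"
    then obtain \<sigma>' g' where fs': "factor_set \<sigma>' g'"
      and zero: "\<And>a b c. a \<in> carrier C \<Longrightarrow> b \<in> carrier C \<Longrightarrow> c \<in> carrier C \<Longrightarrow> obstruction \<sigma>' g' a b c = \<zero>\<^bsub>K\<^esub>"
      by blast
    \<comment> \<open>Compare the unobstructed factor set with g, whose obstruction is the pullback
      of \<omega>: their difference is the coboundary that is sought.\<close>
    obtain \<eta> where \<eta>: "\<eta> \<in> hh_cochains F C (ann_alg K) 2"
      "\<And>a b c. a \<in> carrier C \<Longrightarrow> b \<in> carrier C \<Longrightarrow> c \<in> carrier C \<Longrightarrow>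
        obstruction \<sigma> g a b c = obstruction \<sigma>' g' a b c \<oplus>\<^bsub>K\<^esub> hh_delta C (ann_alg K) \<xi>C 2 \<eta> [a, b, c]"
      using obstruction_independent[OF fs' fs] by blast
    have "pullback_cochain C \<psi> 3 \<omega> = hh_delta C (ann_alg K) \<xi>C 2 \<eta>"
    proof (rule PiE_eqI[OF pP \<delta>P[OF \<eta>(1)]])
      fix xs assume xs: "xs \<in> tuples C 3"
      then obtain a b c where abc: "xs = [a, b, c]" "a \<in> carrier C" "b \<in> carrier C" "c \<in> carrier C"
        by (auto simp: tuples_3_iff)
      have "hh_delta C (ann_alg K) \<xi>C 2 \<eta> xs \<in> carrier K"
        by (rule Z_K[OF PiE_const_mem[OF \<delta>P[OF \<eta>(1)] xs]])
      then show "pullback_cochain C \<psi> 3 \<omega> xs = hh_delta C (ann_alg K) \<xi>C 2 \<eta> xs"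
        using \<eta>(2)[OF abc(2-)] by (simp add: abc(1) obs[OF abc(2-)] zero[OF abc(2-)])
    qed
    then show "\<exists>\<eta>\<in>hh_cochains F C (ann_alg K) 2. pullback_cochain C \<psi> 3 \<omega> = hh_delta C (ann_alg K) \<xi>C 2 \<eta>"
      using \<eta>(1) by blast
  qed
qed

end

section \<open>Extensions inducing an abstract kernel\<close>

lemma unital_alg_hom_comp:
  assumes "h \<in> unital_alg_hom F A B" "h' \<in> unital_alg_hom F B C"
  shows "(\<lambda>x. h' (h x)) \<in> unital_alg_hom F A C"
  by (rule unital_alg_homI)
    (simp_all add: linear_map_comp[OF unital_alg_homD(1)[OF assms(1)] unital_alg_homD(1)[OF assms(2)]]
      unital_alg_homD[OF assms(1)] unital_alg_homD[OF assms(2)])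

locale algebra_extension =
  fixes F :: "('f, 'm) ring_scheme"
    and C :: "('f, 'c) module"
    and K :: "('f, 'k) module"
    and E :: "('f, 'e) module"
    and k :: "'k \<Rightarrow> 'e"
    and f :: "'e \<Rightarrow> 'c"
  assumes base_alg: "unital_algebra F C"
    and kernel_alg: "assoc_algebra F K"
    and ext: "(E, k, f) \<in> extensions F C K"
begin

lemma E_alg: "unital_algebra F E"
  and k_hom: "k \<in> alg_hom F K E"
  and f_hom: "f \<in> unital_alg_hom F E C"
  and k_inj: "inj_on k (carrier K)"
  and image_k: "k ` carrier K = {e \<in> carrier E. f e = \<zero>\<^bsub>C\<^esub>}"
  and image_f: "f ` carrier E = carrier C"
  using ext by (simp_all add: extensions_def)

lemma kernel_lin: "lin_space F K"
  using kernel_alg by (simp add: assoc_algebra_def)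

end

sublocale algebra_extension \<subseteq> K: abelian_group K
  by (rule lin_space_abelian_group[OF kernel_lin])

sublocale algebra_extension \<subseteq> C: ring C
  by (rule unital_algebraD(4)[OF base_alg])

sublocale algebra_extension \<subseteq> E: ring E
  by (rule unital_algebraD(4)[OF E_alg])

section \<open>The crossed biextension induced by an extension\<close>

context algebra_extension
begin

lemma E_lin: "lin_space F E"
  by (rule unital_algebraD(2)[OF E_alg])

lemma k_linear: "k \<in> linear_map F K E"
  using k_hom by (simp add: alg_hom_def)

lemmas k_closed [simp] = linear_mapD(1)[OF k_linear]
lemmas k_add = linear_mapD(2)[OF k_linear]
lemmas k_smult = linear_mapD(3)[OF k_linear]
lemmas k_zero [simp] = linear_map_zero[OF kernel_lin E_lin k_linear]
lemmas k_neg = linear_map_neg[OF kernel_lin E_lin k_linear]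
lemmas k_minus = linear_map_minus[OF kernel_lin E_lin k_linear]

lemma k_mult: "x \<in> carrier K \<Longrightarrow> y \<in> carrier K \<Longrightarrow> k (x \<otimes>\<^bsub>K\<^esub> y) = k x \<otimes>\<^bsub>E\<^esub> k y"
  using k_hom by (simp add: alg_hom_def)

lemma k_eq_iff: "x \<in> carrier K \<Longrightarrow> y \<in> carrier K \<Longrightarrow> k x = k y \<longleftrightarrow> x = y"
  using k_inj by (auto simp: inj_on_def)

lemma k_eq_zero_iff: "x \<in> carrier K \<Longrightarrow> k x = \<zero>\<^bsub>E\<^esub> \<longleftrightarrow> x = \<zero>\<^bsub>K\<^esub>"
  using k_eq_iff[of x "\<zero>\<^bsub>K\<^esub>"] by simp

lemmas f_simps = unital_alg_homD(3-7)[OF f_hom]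
lemmas f_closed [simp] = unital_alg_homD(4)[OF f_hom]
lemmas f_zero [simp] = linear_map_zero[OF E_lin unital_algebraD(2)[OF base_alg] unital_alg_homD(1)[OF f_hom]]
lemmas f_minus = linear_map_minus[OF E_lin unital_algebraD(2)[OF base_alg] unital_alg_homD(1)[OF f_hom]]
lemmas f_neg = linear_map_neg[OF E_lin unital_algebraD(2)[OF base_alg] unital_alg_homD(1)[OF f_hom]]

lemma f_k [simp]: "x \<in> carrier K \<Longrightarrow> f (k x) = \<zero>\<^bsub>C\<^esub>"
  using image_k by blast

abbreviation k_inv where "k_inv \<equiv> inv_into (carrier K) k"

lemma k_inv_k [simp]: "x \<in> carrier K \<Longrightarrow> k_inv (k x) = x"
  by (rule inv_into_f_f[OF k_inj])

lemma k_inv: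
  assumes "e \<in> carrier E" "f e = \<zero>\<^bsub>C\<^esub>"
  shows "k_inv e \<in> carrier K" "k (k_inv e) = e"
proof -
  have "e \<in> k ` carrier K"
    using assms by (simp add: image_k)
  then show "k_inv e \<in> carrier K" "k (k_inv e) = e"
    by (rule inv_into_into, rule f_inv_into_f)
qed

lemma f_mult_k:
  assumes "e \<in> carrier E" "x \<in> carrier K"
  shows "f (e \<otimes>\<^bsub>E\<^esub> k x) = \<zero>\<^bsub>C\<^esub>" "f (k x \<otimes>\<^bsub>E\<^esub> e) = \<zero>\<^bsub>C\<^esub>"
  using assms by (simp_all add: f_simps)

abbreviation ann where "ann \<equiv> ext_ann K E k"
abbreviation AE where "AE \<equiv> quot_alg E ann"
abbreviation coset where "coset e \<equiv> ann +>\<^bsub>E\<^esub> e"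
abbreviation J where "J \<equiv> (\<lambda>x. coset (k x)) ` carrier K"
abbreviation IB where "IB \<equiv> induced_biext K (E, k, f)"

text \<open>k(K) is an ideal of E: the product of k x with e is again in k(K), so it is killed by
  every element that annihilates k(K).\<close>

lemma ann_ideal: "ideal ann E"
proof (rule idealI[OF E.ring_axioms])
  show "subgroup ann (add_monoid E)"
    by (rule E.add.subgroupI)
      (auto simp: ext_ann_def E.l_distr E.r_distr E.l_minus E.r_minus)
  fix a e assume a: "a \<in> ann" and e: "e \<in> carrier E"
  have aE: "a \<in> carrier E" and ak: "\<And>x. x \<in> carrier K \<Longrightarrow> a \<otimes>\<^bsub>E\<^esub> k x = \<zero>\<^bsub>E\<^esub>"
    "\<And>x. x \<in> carrier K \<Longrightarrow> k x \<otimes>\<^bsub>E\<^esub> a = \<zero>\<^bsub>E\<^esub>"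
    using a by (auto simp: ext_ann_def)
  have "k x \<otimes>\<^bsub>E\<^esub> (e \<otimes>\<^bsub>E\<^esub> a) = \<zero>\<^bsub>E\<^esub>" "a \<otimes>\<^bsub>E\<^esub> e \<otimes>\<^bsub>E\<^esub> k x = \<zero>\<^bsub>E\<^esub>" if x: "x \<in> carrier K" for x
  proof -
    have "k x \<otimes>\<^bsub>E\<^esub> (e \<otimes>\<^bsub>E\<^esub> a) = k (k_inv (k x \<otimes>\<^bsub>E\<^esub> e)) \<otimes>\<^bsub>E\<^esub> a"
      using x e aE by (simp add: k_inv f_mult_k E.m_assoc)
    then show "k x \<otimes>\<^bsub>E\<^esub> (e \<otimes>\<^bsub>E\<^esub> a) = \<zero>\<^bsub>E\<^esub>"
      using x e by (simp add: ak k_inv(1) f_mult_k)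
    have "a \<otimes>\<^bsub>E\<^esub> e \<otimes>\<^bsub>E\<^esub> k x = a \<otimes>\<^bsub>E\<^esub> k (k_inv (e \<otimes>\<^bsub>E\<^esub> k x))"
      using x e aE by (simp add: k_inv f_mult_k E.m_assoc)
    then show "a \<otimes>\<^bsub>E\<^esub> e \<otimes>\<^bsub>E\<^esub> k x = \<zero>\<^bsub>E\<^esub>"
      using x e by (simp add: ak k_inv(1) f_mult_k)
  qed
  then show "e \<otimes>\<^bsub>E\<^esub> a \<in> ann" "a \<otimes>\<^bsub>E\<^esub> e \<in> ann"
    using aE e by (simp_all add: ext_ann_def ak E.m_assoc) (simp_all add: ak flip: E.m_assoc)
qed

lemma AE_alg: "unital_algebra F AE" and coset_hom: "coset \<in> unital_alg_hom F E AE"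
  by (rule quot_alg_unital_algebra[OF E_alg ann_ideal])+

lemmas coset_simps = unital_alg_homD(3-7)[OF coset_hom]
lemmas carrier_AE = quot_alg_carrier[OF E_alg ann_ideal, symmetric]

lemma coset_mem: "e \<in> coset e" if "e \<in> carrier E"
proof -
  interpret ideal ann E by (rule ann_ideal)
  show ?thesis
    by (rule a_rcos_self[OF that])
qed

text \<open>The reason why E / Z(K, E) acts on K by multiplication with representatives.\<close>

lemma coset_mult_k:
  assumes e: "e \<in> carrier E" and e': "e' \<in> coset e" and x: "x \<in> carrier K"
  shows "e' \<otimes>\<^bsub>E\<^esub> k x = e \<otimes>\<^bsub>E\<^esub> k x" "k x \<otimes>\<^bsub>E\<^esub> e' = k x \<otimes>\<^bsub>E\<^esub> e"
proof -
  obtain a where a: "a \<in> ann" "e' = a \<oplus>\<^bsub>E\<^esub> e"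
    using e' by (auto simp: a_r_coset_def r_coset_def)
  have "a \<in> carrier E" "a \<otimes>\<^bsub>E\<^esub> k x = \<zero>\<^bsub>E\<^esub>" "k x \<otimes>\<^bsub>E\<^esub> a = \<zero>\<^bsub>E\<^esub>"
    using a(1) x by (auto simp: ext_ann_def)
  then show "e' \<otimes>\<^bsub>E\<^esub> k x = e \<otimes>\<^bsub>E\<^esub> k x" "k x \<otimes>\<^bsub>E\<^esub> e' = k x \<otimes>\<^bsub>E\<^esub> e"
    unfolding a(2) using e x by (simp_all add: E.l_distr E.r_distr)
qed

lemma IB_simps [simp]:
  "bx_B IB = ann_alg K" "bx_A2 IB = K" "bx_A1 IB = AE" "bx_Q IB = quot_alg AE J"
  "bx_j IB = (\<lambda>x. x)" "bx_d IB = (\<lambda>x. coset (k x))" "bx_p IB = (\<lambda>S. J +>\<^bsub>AE\<^esub> S)"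
  by (simp_all add: induced_biext_def Let_def)

text \<open>The definite descriptions in \<open>induced_biext\<close> have a value because k(K) is
  an ideal; it is unique by \<open>coset_mult_k\<close> and the injectivity of k.\<close>

lemma IB_act:
  assumes e: "e \<in> carrier E" and x: "x \<in> carrier K"
  shows "fst (bx_act IB) (coset e) x = k_inv (e \<otimes>\<^bsub>E\<^esub> k x)"
    "snd (bx_act IB) x (coset e) = k_inv (k x \<otimes>\<^bsub>E\<^esub> e)"
proof -
  have kk: "k_inv (e \<otimes>\<^bsub>E\<^esub> k x) \<in> carrier K" "k (k_inv (e \<otimes>\<^bsub>E\<^esub> k x)) = e \<otimes>\<^bsub>E\<^esub> k x"
    "k_inv (k x \<otimes>\<^bsub>E\<^esub> e) \<in> carrier K" "k (k_inv (k x \<otimes>\<^bsub>E\<^esub> e)) = k x \<otimes>\<^bsub>E\<^esub> e"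
    using e x by (simp_all add: k_inv f_mult_k)
  show "fst (bx_act IB) (coset e) x = k_inv (e \<otimes>\<^bsub>E\<^esub> k x)"
    unfolding induced_biext_def Let_def prod.case biext.simps fst_conv
  proof (rule the_equality)
    show "k_inv (e \<otimes>\<^bsub>E\<^esub> k x) \<in> carrier K
        \<and> (\<exists>e'\<in>coset e. k (k_inv (e \<otimes>\<^bsub>E\<^esub> k x)) = e' \<otimes>\<^bsub>E\<^esub> k x)"
      using kk coset_mem[OF e] by blast
    show "y = k_inv (e \<otimes>\<^bsub>E\<^esub> k x)"
      if y: "y \<in> carrier K \<and> (\<exists>e'\<in>coset e. k y = e' \<otimes>\<^bsub>E\<^esub> k x)" for y
    proof -
      have "k y = e \<otimes>\<^bsub>E\<^esub> k x"
        using y coset_mult_k(1)[OF e _ x] by (elim conjE bexE) simp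
      then have "k y = k (k_inv (e \<otimes>\<^bsub>E\<^esub> k x))"
        by (simp only: kk)
      then show ?thesis
        by (rule iffD1[OF k_eq_iff[OF conjunct1[OF y] kk(1)]])
    qed
  qed
  show "snd (bx_act IB) x (coset e) = k_inv (k x \<otimes>\<^bsub>E\<^esub> e)"
    unfolding induced_biext_def Let_def prod.case biext.simps snd_conv
  proof (rule the_equality)
    show "k_inv (k x \<otimes>\<^bsub>E\<^esub> e) \<in> carrier K
        \<and> (\<exists>e'\<in>coset e. k (k_inv (k x \<otimes>\<^bsub>E\<^esub> e)) = k x \<otimes>\<^bsub>E\<^esub> e')"
      using kk coset_mem[OF e] by blast
    show "y = k_inv (k x \<otimes>\<^bsub>E\<^esub> e)"
      if y: "y \<in> carrier K \<and> (\<exists>e'\<in>coset e. k y = k x \<otimes>\<^bsub>E\<^esub> e')" for y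
    proof -
      have "k y = k x \<otimes>\<^bsub>E\<^esub> e"
        using y coset_mult_k(2)[OF e _ x] by (elim conjE bexE) simp
      then have "k y = k (k_inv (k x \<otimes>\<^bsub>E\<^esub> e))"
        by (simp only: kk)
      then show ?thesis
        by (rule iffD1[OF k_eq_iff[OF conjunct1[OF y] kk(3)]])
    qed
  qed
qed

text \<open>The image in E / Z(K, E) of k(K), which is an ideal of E as the kernel of f.\<close>

lemma J_ideal: "ideal J AE"
proof -
  interpret AE: ring AE by (rule unital_algebraD(4)[OF AE_alg])
  note c = coset_simps(2)
  have neg: "\<ominus>\<^bsub>AE\<^esub> coset e = coset (\<ominus>\<^bsub>E\<^esub> e)" if "e \<in> carrier E" for e
    by (rule linear_map_neg[OF E_lin unital_algebraD(2)[OF AE_alg] unital_alg_homD(1)[OF coset_hom] that,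
          symmetric])
  show ?thesis
  proof (rule idealI[OF AE.ring_axioms])
    show "subgroup J (add_monoid AE)"
    proof (rule AE.add.subgroupI)
      show "J \<subseteq> carrier AE"
        by (auto simp: c)
      show "J \<noteq> {}"
        using K.zero_closed by blast
      show "\<ominus>\<^bsub>AE\<^esub> S \<in> J" if S: "S \<in> J" for S
      proof -
        obtain x where x: "x \<in> carrier K" "S = coset (k x)"
          using S by blast
        then have "\<ominus>\<^bsub>AE\<^esub> S = coset (k (\<ominus>\<^bsub>K\<^esub> x))"
          by (simp add: neg k_neg)
        then show ?thesis
          by (rule image_eqI) (simp add: x)
      qed
      show "S \<oplus>\<^bsub>AE\<^esub> T \<in> J" if S: "S \<in> J" and T: "T \<in> J" for S T
      proof -
        obtain x y where xy: "x \<in> carrier K" "S = coset (k x)" "y \<in> carrier K" "T = coset (k y)"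
          using S T by blast
        then have "S \<oplus>\<^bsub>AE\<^esub> T = coset (k (x \<oplus>\<^bsub>K\<^esub> y))"
          by (simp add: k_add coset_simps(3))
        then show ?thesis
          by (rule image_eqI) (simp add: xy)
      qed
    qed
    fix S T assume S: "S \<in> J" and T: "T \<in> carrier AE"
    obtain x where x: "x \<in> carrier K" "S = coset (k x)"
      using S by blast
    obtain e where e: "e \<in> carrier E" "T = coset e"
      using T unfolding carrier_AE by blast
    have "T \<otimes>\<^bsub>AE\<^esub> S = coset (k (k_inv (e \<otimes>\<^bsub>E\<^esub> k x)))" "S \<otimes>\<^bsub>AE\<^esub> T = coset (k (k_inv (k x \<otimes>\<^bsub>E\<^esub> e)))"
      using x e by (simp_all add: k_inv f_mult_k coset_simps(5))
    moreover have "k_inv (e \<otimes>\<^bsub>E\<^esub> k x) \<in> carrier K" "k_inv (k x \<otimes>\<^bsub>E\<^esub> e) \<in> carrier K"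
      using x e by (simp_all add: k_inv f_mult_k)
    ultimately show "T \<otimes>\<^bsub>AE\<^esub> S \<in> J" "S \<otimes>\<^bsub>AE\<^esub> T \<in> J"
      by (auto intro!: image_eqI)
  qed
qed

text \<open>Two elements of E with the same image in C differ by an element of k(K), whose coset
  lies in the image of \<partial>; so the definite description has a unique value.\<close>

lemma induced_psi_f:
  assumes e: "e \<in> carrier E"
  shows "induced_psi K (E, k, f) (f e) = J +>\<^bsub>AE\<^esub> coset e"
  unfolding induced_psi_def prod.case IB_simps
proof (rule the_equality)
  fix y assume "\<exists>e'\<in>carrier E. f e' = f e \<and> y = J +>\<^bsub>AE\<^esub> coset e'"
  then obtain e' where e': "e' \<in> carrier E" "f e' = f e" "y = J +>\<^bsub>AE\<^esub> coset e'"
    by (elim bexE conjE) (rule that)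
  have z: "f (e' \<ominus>\<^bsub>E\<^esub> e) = \<zero>\<^bsub>C\<^esub>"
    using e e' by (simp add: f_simps f_neg C.r_neg a_minus_def)
  have "coset e' \<ominus>\<^bsub>AE\<^esub> coset e = coset (k (k_inv (e' \<ominus>\<^bsub>E\<^esub> e)))"
    unfolding k_inv(2)[OF E.minus_closed[OF e'(1) e] z]
    by (rule linear_map_minus[OF E_lin unital_algebraD(2)[OF AE_alg] unital_alg_homD(1)[OF coset_hom]
          e'(1) e, symmetric])
  then have "coset e' \<ominus>\<^bsub>AE\<^esub> coset e \<in> J"
    by (rule image_eqI) (rule k_inv(1)[OF E.minus_closed[OF e'(1) e] z])
  then show "y = J +>\<^bsub>AE\<^esub> coset e"
    unfolding e'(3) by (subst ideal_coset_eq_iff[OF J_ideal]) (simp_all add: coset_simps(2) e' e)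
qed (use e in blast)

end

text \<open>
  An extension induces the abstract kernel of \<open>(D, \<psi>)\<close> iff there is a map \<open>\<pi>\<close> from \<open>E\<close> to the algebra
  \<open>A\<close> of \<open>D\<close> through which \<open>E\<close> acts on \<open>K\<close> by multiplication; \<open>\<pi>\<close> has kernel \<open>Z(K, E)\<close> and
  identifies \<open>E / Z(K, E)\<close> with \<open>A\<close>.
\<close>

definition (in kernel_representative) lifting where
  "lifting E k f \<pi> \<longleftrightarrow> (E, k, f) \<in> extensions F C K \<and> \<pi> \<in> unital_alg_hom F E A
     \<and> (\<forall>x\<in>carrier K. \<pi> (k x) = d x)
     \<and> (\<forall>e\<in>carrier E. \<forall>x\<in>carrier K. k (\<pi> e \<triangleright> x) = e \<otimes>\<^bsub>E\<^esub> k x \<and> k (x \<triangleleft> \<pi> e) = k x \<otimes>\<^bsub>E\<^esub> e)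
     \<and> (\<forall>e\<in>carrier E. p (\<pi> e) = \<psi> (f e))"

locale kernel_extension = kernel_representative F C K D \<psi> + algebra_extension F C K E k f
  for F :: "('f, 'm) ring_scheme"
    and C :: "('f, 'c) module"
    and K :: "('f, 'k) module"
    and D :: "('f, 'k, 'k, 'a, 'q) biext"
    and \<psi> :: "'c \<Rightarrow> 'q"
    and E :: "('f, 'e) module"
    and k :: "'k \<Rightarrow> 'e"
    and f :: "'e \<Rightarrow> 'c" +
  fixes \<pi> :: "'e \<Rightarrow> 'a"
  assumes lift: "lifting E k f \<pi>"
begin

lemma \<pi>_hom: "\<pi> \<in> unital_alg_hom F E A"
  and \<pi>_k [simp]: "x \<in> carrier K \<Longrightarrow> \<pi> (k x) = d x"
  and k_act: "e \<in> carrier E \<Longrightarrow> x \<in> carrier K \<Longrightarrow> k (\<pi> e \<triangleright> x) = e \<otimes>\<^bsub>E\<^esub> k x"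
    "e \<in> carrier E \<Longrightarrow> x \<in> carrier K \<Longrightarrow> k (x \<triangleleft> \<pi> e) = k x \<otimes>\<^bsub>E\<^esub> e"
  and p_\<pi>: "e \<in> carrier E \<Longrightarrow> p (\<pi> e) = \<psi> (f e)"
  using lift by (auto simp: lifting_def)

lemmas \<pi>_simps = unital_alg_homD(3-7)[OF \<pi>_hom]
lemmas \<pi>_closed [simp] = unital_alg_homD(4)[OF \<pi>_hom]
lemmas \<pi>_minus = linear_map_minus[OF E_lin A_lin unital_alg_homD(1)[OF \<pi>_hom]]

text \<open>p \<pi> = \<psi> f is onto Q, so \<pi> reaches every a up to the kernel of p, that is,
  up to some d x = \<pi> (k x).\<close>

lemma image_\<pi>: "\<pi> ` carrier E = carrier A"
proof
  show "carrier A \<subseteq> \<pi> ` carrier E"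
  proof
    fix a assume a: "a \<in> carrier A"
    obtain c where c: "c \<in> carrier C" "p a = \<psi> c"
      using p_closed[OF a] image_psi by (metis imageE)
    obtain e where e: "e \<in> carrier E" "f e = c"
      using c(1) image_f by (metis imageE)
    have "a \<ominus>\<^bsub>A\<^esub> \<pi> e \<in> d ` carrier K"
      using a c e by (simp add: image_d p_minus p_\<pi>)
    then obtain x where x: "x \<in> carrier K" "a \<ominus>\<^bsub>A\<^esub> \<pi> e = d x"
      by blast
    have "a = \<pi> (e \<oplus>\<^bsub>E\<^esub> k x)"
      using e x a by (simp add: \<pi>_simps A.add_minus_cancel flip: x(2))
    then show "a \<in> \<pi> ` carrier E"
      by (rule image_eqI) (simp add: e x)
  qed
qed auto

text \<open>Faithfulness enters here: as k is injective, e annihilates k(K) on both sides exactly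
  when \<pi> e acts as zero on K, and 0 is the only element of A that does.\<close>

lemma ann_eq_kernel: "ann = {e \<in> carrier E. \<pi> e = \<zero>\<^bsub>A\<^esub>}"
proof -
  have "e \<in> ann \<longleftrightarrow> \<pi> e = \<zero>\<^bsub>A\<^esub>" if e: "e \<in> carrier E" for e
  proof
    assume "e \<in> ann"
    then have "k (\<pi> e \<triangleright> x) = \<zero>\<^bsub>E\<^esub>" "k (x \<triangleleft> \<pi> e) = \<zero>\<^bsub>E\<^esub>" if "x \<in> carrier K" for x
      using that e by (simp_all add: k_act) (simp_all add: ext_ann_def)
    then have "\<forall>x\<in>carrier K. \<pi> e \<triangleright> x = \<zero>\<^bsub>K\<^esub> \<and> x \<triangleleft> \<pi> e = \<zero>\<^bsub>K\<^esub>"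
      using e by (simp add: k_eq_zero_iff)
    then show "\<pi> e = \<zero>\<^bsub>A\<^esub>"
      using kernel e by (simp add: abstract_kernel_def faithful_crossed_def)
  next
    assume z: "\<pi> e = \<zero>\<^bsub>A\<^esub>"
    show "e \<in> ann"
      unfolding ext_ann_def using e by (simp flip: k_act) (simp add: z)
  qed
  then show ?thesis
    by (auto simp: ext_ann_def)
qed

text \<open>The first isomorphism theorem is used twice: \<pi> identifies E / Z(K, E) with A, and
  since by exactness at A the image of \<partial> becomes the kernel of p, the second quotient is
  Q.\<close>

lemma kernel_iso_induced: "kernel_iso F C IB (induced_psi K (E, k, f)) D \<psi>"
proof -
  obtain \<alpha> where \<alpha>: "\<alpha> \<in> unital_alg_iso F AE A" and \<alpha>c: "\<And>e. e \<in> carrier E \<Longrightarrow> \<alpha> (coset e) = \<pi> e"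
    by (rule quot_alg_kernel_iso[OF E_alg A_alg \<pi>_hom image_\<pi> ann_eq_kernel]) (rule that, simp_all)
  have \<alpha>_hom: "\<alpha> \<in> unital_alg_hom F AE A"
    using \<alpha> by (simp add: unital_alg_iso_def)
  have J_eq: "J = {S \<in> carrier AE. p (\<alpha> S) = \<zero>\<^bsub>Q\<^esub>}"
  proof
    show "J \<subseteq> {S \<in> carrier AE. p (\<alpha> S) = \<zero>\<^bsub>Q\<^esub>}"
      by (auto simp: \<alpha>c coset_simps(2))
    show "{S \<in> carrier AE. p (\<alpha> S) = \<zero>\<^bsub>Q\<^esub>} \<subseteq> J"
    proof
      fix S assume S: "S \<in> {S \<in> carrier AE. p (\<alpha> S) = \<zero>\<^bsub>Q\<^esub>}"
      then obtain e where e: "e \<in> carrier E" "S = coset e"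
        unfolding carrier_AE by blast
      have "\<pi> e \<in> d ` carrier K"
        using S e by (simp add: \<alpha>c image_d)
      then obtain x where x: "x \<in> carrier K" "\<pi> e = d x"
        by blast
      \<comment> \<open>e and k x have the same image under \<pi>, whose kernel is Z(K, E), so they
        define the same coset.\<close>
      have "e \<ominus>\<^bsub>E\<^esub> k x \<in> ann"
        unfolding ann_eq_kernel using e x by (simp add: \<pi>_minus)
      then have "S = coset (k x)"
        unfolding e(2) using e x by (subst ideal_coset_eq_iff[OF ann_ideal]) simp_all
      then show "S \<in> J"
        by (rule image_eqI) (rule x)
    qed
  qed
  have im: "(\<lambda>S. p (\<alpha> S)) ` carrier AE = carrier Q"
  proof -
    have "\<alpha> ` carrier AE = carrier A"
      using \<alpha> by (simp add: unital_alg_iso_def bij_betw_def)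
    then have "p ` \<alpha> ` carrier AE = carrier Q"
      by (simp only: image_p)
    then show ?thesis
      by (simp only: image_image)
  qed
  obtain \<tau> where \<tau>: "\<tau> \<in> unital_alg_iso F (quot_alg AE J) Q"
    and \<tau>c: "\<And>S. S \<in> carrier AE \<Longrightarrow> \<tau> (J +>\<^bsub>AE\<^esub> S) = p (\<alpha> S)"
    by (rule quot_alg_kernel_iso[OF AE_alg Q_alg unital_alg_hom_comp[OF \<alpha>_hom p_hom] im J_eq])
      (rule that, simp_all)
  have id_lin: "id \<in> linear_iso F V V" for V
    by (simp add: linear_iso_def linear_map_def)
  have "biext_iso F IB D id id \<alpha> \<tau>"
    unfolding biext_iso_def IB_simps bx_eq
  proof (intro conjI ballI id_lin \<alpha> \<tau>)
    show "id (x) = bx_j D (id x)" if "x \<in> Z" for x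
      using kernel that by (simp add: abstract_kernel_def)
    show "\<alpha> (coset (k x)) = d (id x)" if "x \<in> carrier K" for x
      using that by (simp add: \<alpha>c)
    show "\<tau> (J +>\<^bsub>AE\<^esub> S) = p (\<alpha> S)" if "S \<in> carrier AE" for S
      by (rule \<tau>c[OF that])
    fix S x assume S: "S \<in> carrier AE" and x: "x \<in> carrier K"
    obtain e where e: "e \<in> carrier E" "S = coset e"
      using S unfolding carrier_AE by blast
    show "id (fst (bx_act IB) S x) = \<alpha> S \<triangleright> id x" "id (snd (bx_act IB) x S) = id x \<triangleleft> \<alpha> S"
      using e x by (simp_all add: IB_act \<alpha>c flip: k_act)
  qed
  moreover have "\<psi> c = \<tau> (induced_psi K (E, k, f) c)" if c: "c \<in> carrier C" for c
  proof -
    obtain e where e: "e \<in> carrier E" "c = f e"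
      using c image_f by (metis imageE)
    show ?thesis
      using e by (simp add: induced_psi_f \<tau>c \<alpha>c p_\<pi> coset_simps(2))
  qed
  ultimately show ?thesis
    unfolding kernel_iso_def by blast
qed

text \<open>For an arbitrary section the error \<sigma> - \<pi> \<open>r\<^sub>0\<close> is killed
  by p, hence equal to some d t; adding k t corrects it and stays in the fibres of f. Factor sets of
  different extensions can thereby be placed over the same \<sigma>.\<close>

lemma section_lift:
  assumes \<sigma>: "\<sigma> \<in> linear_map F C A" and p\<sigma>: "\<And>x. x \<in> carrier C \<Longrightarrow> p (\<sigma> x) = \<psi> x"
  obtains r where "r \<in> linear_map F C E" "\<And>x. x \<in> carrier C \<Longrightarrow> f (r x) = x"
    "\<And>x. x \<in> carrier C \<Longrightarrow> \<pi> (r x) = \<sigma> x"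
proof -
  obtain r\<^sub>0 where r0: "r\<^sub>0 \<in> linear_map F C E" and fr0: "\<And>x. x \<in> carrier C \<Longrightarrow> f (r\<^sub>0 x) = x"
    by (rule linear_section_exists[OF E_lin C_lin unital_alg_homD(1)[OF f_hom] image_f])
      (rule that, simp_all)
  note r0s = linear_mapD[OF r0] and \<sigma>s = linear_mapD[OF \<sigma>]
  have "(\<lambda>x. \<sigma> x \<ominus>\<^bsub>A\<^esub> \<pi> (r\<^sub>0 x)) \<in> linear_map F C A"
    by (rule linear_mapI) (simp_all add: r0s \<sigma>s \<pi>_simps a_minus_def A_smult A.minus_add A.a_ac)
  moreover have "p (\<sigma> x \<ominus>\<^bsub>A\<^esub> \<pi> (r\<^sub>0 x)) = \<zero>\<^bsub>Q\<^esub>" if "x \<in> carrier C" for x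
    using that by (simp add: r0s(1) \<sigma>s(1) p_minus p\<sigma> p_\<pi> fr0)
  ultimately obtain t where t: "t \<in> linear_map F C K"
    and dt: "\<And>x. x \<in> carrier C \<Longrightarrow> d (t x) = \<sigma> x \<ominus>\<^bsub>A\<^esub> \<pi> (r\<^sub>0 x)"
    by (rule lift_along_d[OF C_lin]) (assumption, rule that, simp_all)
  note ts = linear_mapD[OF t]
  show thesis
  proof (rule that)
    show "(\<lambda>x. r\<^sub>0 x \<oplus>\<^bsub>E\<^esub> k (t x)) \<in> linear_map F C E"
      by (rule linear_mapI) (simp_all add: r0s ts k_add k_smult E.a_ac lin_space_smult(2)[OF E_lin])
    show "f (r\<^sub>0 x \<oplus>\<^bsub>E\<^esub> k (t x)) = x" "\<pi> (r\<^sub>0 x \<oplus>\<^bsub>E\<^esub> k (t x)) = \<sigma> x" if "x \<in> carrier C" for x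
      using that by (simp_all add: f_simps \<pi>_simps r0s(1) ts(1) fr0 dt \<sigma>s(1) A.add_minus_cancel)
  qed
qed

text \<open>r x r y - r (x y) lies in the kernel of f and so comes from K; applying \<pi> to it
  gives the equation that a factor set over \<pi> r has to satisfy.\<close>

lemma factor_set_of_lift:
  assumes r: "r \<in> linear_map F C E" and sec: "\<forall>x\<in>carrier C. f (r x) = x"
  defines "g \<equiv> \<lambda>x y. k_inv (r x \<otimes>\<^bsub>E\<^esub> r y \<ominus>\<^bsub>E\<^esub> r (x \<otimes>\<^bsub>C\<^esub> y))"
  shows "factor_set (\<lambda>x. \<pi> (r x)) g"
    and "x \<in> carrier C \<Longrightarrow> y \<in> carrier C \<Longrightarrow> k (g x y) = r x \<otimes>\<^bsub>E\<^esub> r y \<ominus>\<^bsub>E\<^esub> r (x \<otimes>\<^bsub>C\<^esub> y)"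
    and "x \<in> carrier C \<Longrightarrow> y \<in> carrier C \<Longrightarrow> z \<in> carrier C \<Longrightarrow>
      obstruction (\<lambda>x. \<pi> (r x)) g x y z = \<zero>\<^bsub>K\<^esub>"
proof -
  note fr = sec[rule_format]
  note rs = linear_mapD[OF r]
  have g: "g x y \<in> carrier K" "k (g x y) = r x \<otimes>\<^bsub>E\<^esub> r y \<ominus>\<^bsub>E\<^esub> r (x \<otimes>\<^bsub>C\<^esub> y)"
    if "x \<in> carrier C" "y \<in> carrier C" for x y
    using that unfolding g_def by (simp_all add: k_inv rs(1) f_minus f_simps fr C.r_neg a_minus_def f_neg)
  show "k (g x y) = r x \<otimes>\<^bsub>E\<^esub> r y \<ominus>\<^bsub>E\<^esub> r (x \<otimes>\<^bsub>C\<^esub> y)" if "x \<in> carrier C" "y \<in> carrier C"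
    by (rule g(2)[OF that])
  note E_s = assoc_algebra.alg_smult_l[OF unital_algebraD(1)[OF E_alg]]
    assoc_algebra.alg_smult_r[OF unital_algebraD(1)[OF E_alg]] lin_space_smult[OF E_lin]
  have bil: "bilinear_map F C K g"
  proof (rule bilinear_mapI)
    fix x y assume x: "x \<in> carrier C" and y: "y \<in> carrier C"
    show "g x y \<in> carrier K"
      by (rule g(1)[OF x y])
    show "g (x \<oplus>\<^bsub>C\<^esub> x') y = g x y \<oplus>\<^bsub>K\<^esub> g x' y" if x': "x' \<in> carrier C" for x'
    proof -
      have "k (g (x \<oplus>\<^bsub>C\<^esub> x') y) = k (g x y \<oplus>\<^bsub>K\<^esub> g x' y)"
        using x y x' by (simp add: g k_add rs C.l_distr E.l_distr a_minus_def E.minus_add E.a_ac)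
      then show ?thesis
        using x y x' by (simp add: k_eq_iff g(1))
    qed
    show "g x (y \<oplus>\<^bsub>C\<^esub> y') = g x y \<oplus>\<^bsub>K\<^esub> g x y'" if y': "y' \<in> carrier C" for y'
    proof -
      have "k (g x (y \<oplus>\<^bsub>C\<^esub> y')) = k (g x y \<oplus>\<^bsub>K\<^esub> g x y')"
        using x y y' by (simp add: g k_add rs C.r_distr E.r_distr a_minus_def E.minus_add E.a_ac)
      then show ?thesis
        using x y y' by (simp add: k_eq_iff g(1))
    qed
    fix s assume s: "s \<in> carrier F"
    have "k (g (s \<odot>\<^bsub>C\<^esub> x) y) = k (s \<odot>\<^bsub>K\<^esub> g x y)" "k (g x (s \<odot>\<^bsub>C\<^esub> y)) = k (s \<odot>\<^bsub>K\<^esub> g x y)"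
      using x y s by (simp_all add: g k_smult rs C_smult_mult E_s(1,2,3,4,6) a_minus_def)
    then show "g (s \<odot>\<^bsub>C\<^esub> x) y = s \<odot>\<^bsub>K\<^esub> g x y" "g x (s \<odot>\<^bsub>C\<^esub> y) = s \<odot>\<^bsub>K\<^esub> g x y"
      using x y s by (simp_all add: k_eq_iff g(1))
  qed
  have dg: "d (g x y) = \<pi> (r x) \<otimes>\<^bsub>A\<^esub> \<pi> (r y) \<ominus>\<^bsub>A\<^esub> \<pi> (r (x \<otimes>\<^bsub>C\<^esub> y))"
    if "x \<in> carrier C" "y \<in> carrier C" for x y
    using that \<pi>_k[OF g(1)[OF that]] by (simp add: g(2) rs(1) \<pi>_minus \<pi>_simps)
  show "factor_set (\<lambda>x. \<pi> (r x)) g"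
    unfolding factor_set_def using bil dg linear_map_comp[OF r unital_alg_homD(1)[OF \<pi>_hom]]
    by (simp add: p_\<pi> rs(1) fr)
  show "obstruction (\<lambda>x. \<pi> (r x)) g x y z = \<zero>\<^bsub>K\<^esub>"
    if xyz: "x \<in> carrier C" "y \<in> carrier C" "z \<in> carrier C"
  proof -
    have rc: "r x \<in> carrier E" "r y \<in> carrier E" "r z \<in> carrier E" "r (x \<otimes>\<^bsub>C\<^esub> y) \<in> carrier E"
      "r (y \<otimes>\<^bsub>C\<^esub> z) \<in> carrier E" "r (x \<otimes>\<^bsub>C\<^esub> (y \<otimes>\<^bsub>C\<^esub> z)) \<in> carrier E"
      using xyz by (simp_all add: rs(1))
    \<comment> \<open>Under k both actions become products in E, so the obstruction becomes an
      alternating sum that cancels by associativity; k is injective.\<close>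
    have "k (obstruction (\<lambda>x. \<pi> (r x)) g x y z) =
        r x \<otimes>\<^bsub>E\<^esub> (r y \<otimes>\<^bsub>E\<^esub> r z \<ominus>\<^bsub>E\<^esub> r (y \<otimes>\<^bsub>C\<^esub> z))
        \<ominus>\<^bsub>E\<^esub> (r (x \<otimes>\<^bsub>C\<^esub> y) \<otimes>\<^bsub>E\<^esub> r z \<ominus>\<^bsub>E\<^esub> r (x \<otimes>\<^bsub>C\<^esub> (y \<otimes>\<^bsub>C\<^esub> z)))
        \<oplus>\<^bsub>E\<^esub> (r x \<otimes>\<^bsub>E\<^esub> r (y \<otimes>\<^bsub>C\<^esub> z) \<ominus>\<^bsub>E\<^esub> r (x \<otimes>\<^bsub>C\<^esub> (y \<otimes>\<^bsub>C\<^esub> z)))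
        \<ominus>\<^bsub>E\<^esub> (r x \<otimes>\<^bsub>E\<^esub> r y \<ominus>\<^bsub>E\<^esub> r (x \<otimes>\<^bsub>C\<^esub> y)) \<otimes>\<^bsub>E\<^esub> r z"
      unfolding obstruction_def using xyz rc by (simp add: k_minus k_add k_act g C.m_assoc)
    also have "\<dots> = \<zero>\<^bsub>E\<^esub>"
      using rc by algebra
    finally show ?thesis
      using xyz rc by (simp add: k_eq_zero_iff obstruction_def g(1))
  qed
qed

lemma unobstructed_factor_set:
  "\<exists>\<sigma> g. factor_set \<sigma> g \<and> (\<forall>a\<in>carrier C. \<forall>b\<in>carrier C. \<forall>c\<in>carrier C. obstruction \<sigma> g a b c = \<zero>\<^bsub>K\<^esub>)"
proof -
  obtain r where r: "r \<in> linear_map F C E" "\<And>x. x \<in> carrier C \<Longrightarrow> f (r x) = x"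
    by (rule linear_section_exists[OF E_lin C_lin unital_alg_homD(1)[OF f_hom] image_f])
      (rule that, simp_all)
  have sec: "\<forall>x\<in>carrier C. f (r x) = x"
    by (simp add: r(2))
  let ?g = "\<lambda>x y. k_inv (r x \<otimes>\<^bsub>E\<^esub> r y \<ominus>\<^bsub>E\<^esub> r (x \<otimes>\<^bsub>C\<^esub> y))"
  have "factor_set (\<lambda>x. \<pi> (r x)) ?g"
    by (rule factor_set_of_lift(1)[OF r(1) sec])
  moreover have "\<forall>a\<in>carrier C. \<forall>b\<in>carrier C. \<forall>c\<in>carrier C.
      obstruction (\<lambda>x. \<pi> (r x)) ?g a b c = \<zero>\<^bsub>K\<^esub>"
    by (intro ballI) (rule factor_set_of_lift(3)[OF r(1) sec])
  ultimately show ?thesis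
    by (intro exI conjI)
qed

end

text \<open>Here the map \<pi> is still to be constructed from an isomorphism of kernels, whereas
  \<open>kernel_extension\<close> has it as a parameter.\<close>

locale extension_candidate = kernel_representative F C K D \<psi> + algebra_extension F C K E k f
  for F :: "('f, 'm) ring_scheme"
    and C :: "('f, 'c) module"
    and K :: "('f, 'k) module"
    and D :: "('f, 'k, 'k, 'a, 'q) biext"
    and \<psi> :: "'c \<Rightarrow> 'q"
    and E :: "('f, 'e) module"
    and k :: "'k \<Rightarrow> 'e"
    and f :: "'e \<Rightarrow> 'c"
begin

text \<open>\<pi> is the quotient map of E followed by the A-component of the isomorphism. As that
  isomorphism is the identity on K, it matches the action of cosets, which is multiplication in E,
  with the action of A.\<close>

lemma ex_lifting:
  assumes "kernel_iso F C IB (induced_psi K (E, k, f)) D \<psi>"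
  shows "\<exists>\<pi>. lifting E k f \<pi>"
proof -
  obtain \<alpha> \<tau> where iso: "biext_iso F IB D id id \<alpha> \<tau>"
    and \<psi>\<tau>: "\<And>c. c \<in> carrier C \<Longrightarrow> \<psi> c = \<tau> (induced_psi K (E, k, f) c)"
    using assms unfolding kernel_iso_def by (elim exE conjE) (rule that, simp_all)
  have \<alpha>: "\<alpha> \<in> unital_alg_hom F AE A"
    and d\<alpha>: "\<And>x. x \<in> carrier K \<Longrightarrow> \<alpha> (coset (k x)) = d x"
    and p\<alpha>: "\<And>S. S \<in> carrier AE \<Longrightarrow> \<tau> (J +>\<^bsub>AE\<^esub> S) = p (\<alpha> S)"
    and act: "\<And>S x. S \<in> carrier AE \<Longrightarrow> x \<in> carrier K \<Longrightarrow> fst (bx_act IB) S x = \<alpha> S \<triangleright> x"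
      "\<And>S x. S \<in> carrier AE \<Longrightarrow> x \<in> carrier K \<Longrightarrow> snd (bx_act IB) x S = x \<triangleleft> \<alpha> S"
    using iso unfolding biext_iso_def IB_simps bx_eq unital_alg_iso_def by simp_all
  have "lifting E k f (\<lambda>e. \<alpha> (coset e))"
    unfolding lifting_def
  proof (intro conjI ballI)
    show "(E, k, f) \<in> extensions F C K"
      by (rule ext)
    show "(\<lambda>e. \<alpha> (coset e)) \<in> unital_alg_hom F E A"
      by (rule unital_alg_hom_comp[OF coset_hom \<alpha>])
    show "\<alpha> (coset (k x)) = d x" if "x \<in> carrier K" for x
      by (rule d\<alpha>[OF that])
    fix e assume e: "e \<in> carrier E"
    note c = coset_simps(2)[OF e]
    show "p (\<alpha> (coset e)) = \<psi> (f e)"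
      using e by (simp add: \<psi>\<tau> induced_psi_f p\<alpha>[OF c])
    fix x assume x: "x \<in> carrier K"
    show "k (\<alpha> (coset e) \<triangleright> x) = e \<otimes>\<^bsub>E\<^esub> k x" "k (x \<triangleleft> \<alpha> (coset e)) = k x \<otimes>\<^bsub>E\<^esub> e"
      unfolding act[OF c x, symmetric] IB_act[OF e x]
      using e x by (simp_all add: k_inv(2) f_mult_k)
  qed
  then show ?thesis by blast
qed

end

context kernel_representative
begin

lemma algebra_extensionI: "(E, k, f) \<in> extensions F C K \<Longrightarrow> algebra_extension F C K E k f"
  by (rule algebra_extension.intro[OF C_alg K_alg])

lemma kernel_extensionI:
  assumes "lifting E k f \<pi>"
  shows "kernel_extension F C K D \<psi> E k f \<pi>"
  using assms by (intro kernel_extension.intro kernel_extension_axioms.intro algebra_extensionI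
      kernel_representative_axioms) (simp_all add: lifting_def)

lemma kernel_iso_iff_lifting:
  assumes "(E, k, f) \<in> extensions F C K"
  shows "kernel_iso F C (induced_biext K (E, k, f)) (induced_psi K (E, k, f)) D \<psi> \<longleftrightarrow> (\<exists>\<pi>. lifting E k f \<pi>)"
proof
  show "\<exists>\<pi>. lifting E k f \<pi>"
    if "kernel_iso F C (induced_biext K (E, k, f)) (induced_psi K (E, k, f)) D \<psi>"
    by (rule extension_candidate.ex_lifting[OF extension_candidate.intro[OF
            kernel_representative_axioms algebra_extensionI[OF assms]] that])
  show "kernel_iso F C (induced_biext K (E, k, f)) (induced_psi K (E, k, f)) D \<psi>"
    if "\<exists>\<pi>. lifting E k f \<pi>"
    using that by (elim exE) (rule kernel_extension.kernel_iso_induced[OF kernel_extensionI])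
qed

end

section \<open>Isomorphisms of extensions\<close>

lemma unital_alg_isoD:
  assumes "h \<in> unital_alg_iso F A B"
  shows "h \<in> unital_alg_hom F A B" "inj_on h (carrier A)" "h ` carrier A = carrier B"
  using assms by (auto simp: unital_alg_iso_def bij_betw_def)

lemma unital_alg_iso_id: "id \<in> unital_alg_iso F A A"
  by (simp add: unital_alg_iso_def unital_alg_hom_def alg_hom_def linear_map_def)

lemma unital_alg_iso_comp:
  assumes "h \<in> unital_alg_iso F A B" "h' \<in> unital_alg_iso F B C"
  shows "(\<lambda>x. h' (h x)) \<in> unital_alg_iso F A C"
proof -
  have "bij_betw (h' \<circ> h) (carrier A) (carrier C)"
    using assms by (auto simp: unital_alg_iso_def intro: bij_betw_trans)
  then show ?thesis
    using unital_alg_hom_comp[OF unital_alg_isoD(1)[OF assms(1)] unital_alg_isoD(1)[OF assms(2)]]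
    by (simp add: unital_alg_iso_def comp_def)
qed

lemma unital_alg_iso_inv:
  assumes A: "unital_algebra F A" and h: "h \<in> unital_alg_iso F A B"
  shows "inv_into (carrier A) h \<in> unital_alg_iso F B A"
proof -
  interpret A: ring A by (rule unital_algebraD[OF A])
  let ?i = "inv_into (carrier A) h"
  note hom = unital_alg_homD[OF unital_alg_isoD(1)[OF h]]
  have i: "?i (h x) = x" if "x \<in> carrier A" for x
    using inv_into_f_f[OF unital_alg_isoD(2)[OF h] that] .
  have carr: "carrier B = h ` carrier A"
    by (rule unital_alg_isoD(3)[OF h, symmetric])
  have i_add: "?i (h x \<oplus>\<^bsub>B\<^esub> h y) = x \<oplus>\<^bsub>A\<^esub> y" "?i (h x \<otimes>\<^bsub>B\<^esub> h y) = x \<otimes>\<^bsub>A\<^esub> y"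
    if "x \<in> carrier A" "y \<in> carrier A" for x y
    using that by (simp_all add: hom(5,7)[symmetric] i)
  have i_smult: "?i (r \<odot>\<^bsub>B\<^esub> h x) = r \<odot>\<^bsub>A\<^esub> x" if "r \<in> carrier F" "x \<in> carrier A" for r x
    using that lin_space_smult(1)[OF unital_algebraD(2)[OF A]] by (simp add: hom(6)[symmetric] i)
  have i_one: "?i \<one>\<^bsub>B\<^esub> = \<one>\<^bsub>A\<^esub>"
    by (simp add: hom(3)[symmetric] i)
  have "?i \<in> unital_alg_hom F B A"
    by (intro unital_alg_homI linear_mapI i_one; unfold carr; elim imageE)
      (simp_all add: i i_add i_smult)
  then show ?thesis
    using h by (simp add: unital_alg_iso_def bij_betw_inv_into)
qed

lemma ext_relI:
  assumes "(E, k, f) \<in> extensions F C K" "(E', k', f') \<in> extensions F C K"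
    "h \<in> unital_alg_iso F E E'" "\<And>x. x \<in> carrier K \<Longrightarrow> h (k x) = k' x"
    "\<And>e. e \<in> carrier E \<Longrightarrow> f' (h e) = f e"
  shows "((E, k, f), (E', k', f')) \<in> ext_rel F C K"
  unfolding ext_rel_def mem_Collect_eq case_prod_conv
  by (intro conjI assms(1,2) bexI[OF _ assms(3)] ballI) (simp_all add: assms(4,5))

lemma ext_relE:
  assumes "((E, k, f), (E', k', f')) \<in> ext_rel F C K"
  obtains h where "(E, k, f) \<in> extensions F C K" "(E', k', f') \<in> extensions F C K"
    "h \<in> unital_alg_iso F E E'" "\<And>x. x \<in> carrier K \<Longrightarrow> h (k x) = k' x"
    "\<And>e. e \<in> carrier E \<Longrightarrow> f' (h e) = f e"
  using assms unfolding ext_rel_def by auto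

lemma extensionsD:
  assumes "(E, k, f) \<in> extensions F C K"
  shows "unital_algebra F E" "k \<in> alg_hom F K E" "f \<in> unital_alg_hom F E C" "inj_on k (carrier K)"
    "k ` carrier K = {e \<in> carrier E. f e = \<zero>\<^bsub>C\<^esub>}" "f ` carrier E = carrier C"
    "x \<in> carrier K \<Longrightarrow> k x \<in> carrier E"
  using assms by (auto simp: extensions_def alg_hom_def linear_map_def)

lemma ext_rel_refl: "S \<in> extensions F C K \<Longrightarrow> (S, S) \<in> ext_rel F C K"
  by (cases S) (auto intro!: ext_relI[where h = id] unital_alg_iso_id)

lemma ext_rel_sym:
  assumes "(S, T) \<in> ext_rel F C K"
  shows "(T, S) \<in> ext_rel F C K"
proof -
  obtain E k f E' k' f' where ST: "S = (E, k, f)" "T = (E', k', f')"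
    by (metis prod_cases3)
  obtain h where S: "(E, k, f) \<in> extensions F C K" and T: "(E', k', f') \<in> extensions F C K"
    and h: "h \<in> unital_alg_iso F E E'" and hk: "\<And>x. x \<in> carrier K \<Longrightarrow> h (k x) = k' x"
    and fh: "\<And>e. e \<in> carrier E \<Longrightarrow> f' (h e) = f e"
    using assms unfolding ST by (rule ext_relE) (rule that, simp_all)
  let ?i = "inv_into (carrier E) h"
  have i: "?i (h e) = e" if "e \<in> carrier E" for e
    using inv_into_f_f[OF unital_alg_isoD(2)[OF h] that] .
  show ?thesis
    unfolding ST
  proof (rule ext_relI[OF T S unital_alg_iso_inv[OF extensionsD(1)[OF S] h]])
    show "?i (k' x) = k x" if "x \<in> carrier K" for x
      unfolding hk[OF that, symmetric] by (rule i[OF extensionsD(7)[OF S that]])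
    fix e assume "e \<in> carrier E'"
    then obtain e' where e': "e' \<in> carrier E" "e = h e'"
      using unital_alg_isoD(3)[OF h] by blast
    show "f (?i e) = f' e"
      unfolding e'(2) by (simp add: i e' fh)
  qed
qed

lemma ext_rel_trans:
  assumes "(S, T) \<in> ext_rel F C K" "(T, U) \<in> ext_rel F C K"
  shows "(S, U) \<in> ext_rel F C K"
proof -
  obtain E k f E' k' f' E'' k'' f'' where STU: "S = (E, k, f)" "T = (E', k', f')" "U = (E'', k'', f'')"
    by (metis prod_cases3)
  obtain h where S: "(E, k, f) \<in> extensions F C K"
    and h: "h \<in> unital_alg_iso F E E'" and hk: "\<And>x. x \<in> carrier K \<Longrightarrow> h (k x) = k' x"
    and fh: "\<And>e. e \<in> carrier E \<Longrightarrow> f' (h e) = f e"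
    using assms(1) unfolding STU by (rule ext_relE) (rule that, simp_all)
  obtain h' where U: "(E'', k'', f'') \<in> extensions F C K"
    and h': "h' \<in> unital_alg_iso F E' E''" and hk': "\<And>x. x \<in> carrier K \<Longrightarrow> h' (k' x) = k'' x"
    and fh': "\<And>e. e \<in> carrier E' \<Longrightarrow> f'' (h' e) = f' e"
    using assms(2) unfolding STU by (rule ext_relE) (rule that, simp_all)
  have hc: "h e \<in> carrier E'" if "e \<in> carrier E" for e
    using unital_alg_isoD(3)[OF h] that by blast
  show ?thesis
    unfolding STU
    by (rule ext_relI[OF S U unital_alg_iso_comp[OF h h']]) (simp_all add: hk hk' fh fh' hc)
qed

lemma ext_rel_equiv: "equiv (extensions F C K) (ext_rel F C K)"
proof (rule equivI)
  show "ext_rel F C K \<subseteq> extensions F C K \<times> extensions F C K"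
    by (auto simp: ext_rel_def)
  show "refl_on (extensions F C K) (ext_rel F C K)"
    by (rule refl_onI) (rule ext_rel_refl)
  show "sym (ext_rel F C K)" "trans (ext_rel F C K)"
    by (rule symI, erule ext_rel_sym, rule transI, erule (1) ext_rel_trans)
qed

lemma transport_extension:
  assumes S: "(E, k, f) \<in> extensions F C K" and g: "inj_on g (carrier E)"
  shows "(transport_alg g E, \<lambda>x. g (k x), \<lambda>e. f (inv_into (carrier E) g e)) \<in> extensions F C K"
proof -
  let ?i = "inv_into (carrier E) g"
  note E = extensionsD(1)[OF S]
  note tr = transport_alg[OF E g]
  note gi = unital_alg_isoD(3)[OF tr(2)]
  have i: "?i (g e) = e" if "e \<in> carrier E" for e
    by (rule inv_into_f_f[OF g that])
  note kl = extensionsD(7)[OF S]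
  have fi: "(\<lambda>e. f (?i e)) \<in> unital_alg_hom F (transport_alg g E) C"
    by (rule unital_alg_hom_comp[OF unital_alg_isoD(1)[OF unital_alg_iso_inv[OF E tr(2)]] extensionsD(3)[OF S]])
  have gk: "(\<lambda>x. g (k x)) \<in> alg_hom F K (transport_alg g E)"
    using extensionsD(2)[OF S] unital_alg_homD(2)[OF unital_alg_isoD(1)[OF tr(2)]]
    by (auto simp: alg_hom_def linear_map_def Pi_iff)
  have inj: "inj_on (\<lambda>x. g (k x)) (carrier K)"
    using comp_inj_on[OF extensionsD(4)[OF S] inj_on_subset[OF g]] kl by (auto simp: comp_def)
  have ker: "(\<lambda>x. g (k x)) ` carrier K = {e \<in> carrier (transport_alg g E). f (?i e) = \<zero>\<^bsub>C\<^esub>}"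
  proof -
    have "(\<lambda>x. g (k x)) ` carrier K = g ` {e \<in> carrier E. f e = \<zero>\<^bsub>C\<^esub>}"
      by (simp only: image_image[symmetric, of g k] extensionsD(5)[OF S])
    also have "\<dots> = {e \<in> g ` carrier E. f (?i e) = \<zero>\<^bsub>C\<^esub>}"
      by (auto simp: i)
    finally show ?thesis
      by (simp only: gi)
  qed
  have "(\<lambda>e. f (?i e)) ` g ` carrier E = f ` carrier E"
    unfolding image_image by (rule image_cong) (simp_all add: i)
  then have surj: "(\<lambda>e. f (?i e)) ` carrier (transport_alg g E) = carrier C"
    by (simp only: gi extensionsD(6)[OF S])
  show ?thesis
    unfolding extensions_def using tr(1) gk fi inj ker surj by (intro CollectI case_prodI conjI)
qed

text \<open>\<pi> composed with the inverse of h; the existence of such a map thus depends only on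
  the isomorphism class.\<close>

lemma (in kernel_extension) lifting_iso:
  assumes S: "(E', k', f') \<in> extensions F C K" and h: "h \<in> unital_alg_iso F E E'"
    and hk: "\<And>x. x \<in> carrier K \<Longrightarrow> h (k x) = k' x" and fh: "\<And>e. e \<in> carrier E \<Longrightarrow> f' (h e) = f e"
  shows "\<exists>\<pi>'. lifting E' k' f' \<pi>'"
proof -
  let ?i = "inv_into (carrier E) h"
  have i: "?i (h e) = e" if "e \<in> carrier E" for e
    using inv_into_f_f[OF unital_alg_isoD(2)[OF h] that] .
  note hom = unital_alg_homD[OF unital_alg_isoD(1)[OF h]]
  have "lifting E' k' f' (\<lambda>e. \<pi> (?i e))"
    unfolding lifting_def
  proof (intro conjI ballI S)
    show "(\<lambda>e. \<pi> (?i e)) \<in> unital_alg_hom F E' A"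
      by (rule unital_alg_hom_comp[OF unital_alg_isoD(1)[OF unital_alg_iso_inv[OF E_alg h]] \<pi>_hom])
    show "\<pi> (?i (k' x)) = d x" if "x \<in> carrier K" for x
      using that by (simp add: i flip: hk)
    fix e assume "e \<in> carrier E'"
    then obtain e' where e': "e' \<in> carrier E" "e = h e'"
      using unital_alg_isoD(3)[OF h] by blast
    show "p (\<pi> (?i e)) = \<psi> (f' e)"
      unfolding e'(2) using e'(1) by (simp add: i fh p_\<pi>)
    fix x assume x: "x \<in> carrier K"
    show "k' (\<pi> (?i e) \<triangleright> x) = e \<otimes>\<^bsub>E'\<^esub> k' x" "k' (x \<triangleleft> \<pi> (?i e)) = k' x \<otimes>\<^bsub>E'\<^esub> e"
      unfolding e'(2) using e'(1) x by (simp_all add: i k_act hom(7) flip: hk)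
  qed
  then show ?thesis by blast
qed

section \<open>The extension defined by an unobstructed factor set\<close>

text \<open>\<open>u = 1 - (1 - e)^2\<close> in the unitalization, and the premises say that \<open>(1 - e)^2\<close> kills \<open>x\<close>.\<close>

lemma two_sided_unit:
  assumes A: "assoc_algebra F A" and e: "e \<in> carrier A" and x: "x \<in> carrier A"
  defines "u \<equiv> e \<oplus>\<^bsub>A\<^esub> e \<ominus>\<^bsub>A\<^esub> e \<otimes>\<^bsub>A\<^esub> e"
  shows "e \<otimes>\<^bsub>A\<^esub> (e \<otimes>\<^bsub>A\<^esub> x) \<oplus>\<^bsub>A\<^esub> x = e \<otimes>\<^bsub>A\<^esub> x \<oplus>\<^bsub>A\<^esub> e \<otimes>\<^bsub>A\<^esub> x \<Longrightarrow> u \<otimes>\<^bsub>A\<^esub> x = x"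
    and "x \<otimes>\<^bsub>A\<^esub> e \<otimes>\<^bsub>A\<^esub> e \<oplus>\<^bsub>A\<^esub> x = x \<otimes>\<^bsub>A\<^esub> e \<oplus>\<^bsub>A\<^esub> x \<otimes>\<^bsub>A\<^esub> e \<Longrightarrow> x \<otimes>\<^bsub>A\<^esub> u = x"
proof -
  interpret A: abelian_group A
    by (rule lin_space_abelian_group[of F]) (use A in \<open>simp add: assoc_algebra_def\<close>)
  note simps = assoc_algebra.alg_m_closed[OF A] assoc_algebra.alg_l_distr[OF A]
    assoc_algebra.alg_r_distr[OF A] assoc_algebra.alg_m_assoc[OF A]
  have neg: "(\<ominus>\<^bsub>A\<^esub> y) \<otimes>\<^bsub>A\<^esub> x = \<ominus>\<^bsub>A\<^esub> (y \<otimes>\<^bsub>A\<^esub> x)" "x \<otimes>\<^bsub>A\<^esub> (\<ominus>\<^bsub>A\<^esub> y) = \<ominus>\<^bsub>A\<^esub> (x \<otimes>\<^bsub>A\<^esub> y)"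
    if "y \<in> carrier A" for y
    using that x by (auto intro!: additive_neg[where h = "\<lambda>y. y \<otimes>\<^bsub>A\<^esub> x"]
        additive_neg[where h = "\<lambda>y. x \<otimes>\<^bsub>A\<^esub> y"] A.abelian_group_axioms simp: simps)
  have cancel: "y \<oplus>\<^bsub>A\<^esub> y \<ominus>\<^bsub>A\<^esub> z = x" if "z \<oplus>\<^bsub>A\<^esub> x = y \<oplus>\<^bsub>A\<^esub> y" "z \<in> carrier A" for y z
    using that x A.add_minus_cancel[of z x] by (simp add: that(1)[symmetric] a_minus_def A.a_ac A.r_neg1)
  show "u \<otimes>\<^bsub>A\<^esub> x = x" if "e \<otimes>\<^bsub>A\<^esub> (e \<otimes>\<^bsub>A\<^esub> x) \<oplus>\<^bsub>A\<^esub> x = e \<otimes>\<^bsub>A\<^esub> x \<oplus>\<^bsub>A\<^esub> e \<otimes>\<^bsub>A\<^esub> x"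
    using cancel[OF that] e x by (simp add: u_def simps neg a_minus_def)
  show "x \<otimes>\<^bsub>A\<^esub> u = x" if "x \<otimes>\<^bsub>A\<^esub> e \<otimes>\<^bsub>A\<^esub> e \<oplus>\<^bsub>A\<^esub> x = x \<otimes>\<^bsub>A\<^esub> e \<oplus>\<^bsub>A\<^esub> x \<otimes>\<^bsub>A\<^esub> e"
    using cancel[OF that] e x by (simp add: u_def simps neg a_minus_def)
qed

context kernel_representative
begin

text \<open>The unit is a parameter because it is found only once the product is known to be
  associative; the other fields do not depend on it.\<close>

definition crossed_product :: "('c \<Rightarrow> 'a) \<Rightarrow> ('c \<Rightarrow> 'c \<Rightarrow> 'k) \<Rightarrow> 'k \<times> 'c \<Rightarrow> ('f, 'k \<times> 'c) module" where
  "crossed_product \<sigma> g u = \<lparr>carrier = carrier K \<times> carrier C,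
     monoid.mult = \<lambda>v w. (crossed_mult \<sigma> g (snd v) (snd w) (fst v) (fst w), snd v \<otimes>\<^bsub>C\<^esub> snd w),
     monoid.one = u, ring.zero = (\<zero>\<^bsub>K\<^esub>, \<zero>\<^bsub>C\<^esub>),
     ring.add = \<lambda>v w. (fst v \<oplus>\<^bsub>K\<^esub> fst w, snd v \<oplus>\<^bsub>C\<^esub> snd w),
     module.smult = \<lambda>r v. (r \<odot>\<^bsub>K\<^esub> fst v, r \<odot>\<^bsub>C\<^esub> snd v)\<rparr>"

lemma crossed_product_simps [simp]:
  "v \<in> carrier (crossed_product \<sigma> g u) \<longleftrightarrow> fst v \<in> carrier K \<and> snd v \<in> carrier C"
  "v \<otimes>\<^bsub>crossed_product \<sigma> g u\<^esub> w = (crossed_mult \<sigma> g (snd v) (snd w) (fst v) (fst w), snd v \<otimes>\<^bsub>C\<^esub> snd w)"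
  "\<one>\<^bsub>crossed_product \<sigma> g u\<^esub> = u"
  "\<zero>\<^bsub>crossed_product \<sigma> g u\<^esub> = (\<zero>\<^bsub>K\<^esub>, \<zero>\<^bsub>C\<^esub>)"
  "v \<oplus>\<^bsub>crossed_product \<sigma> g u\<^esub> w = (fst v \<oplus>\<^bsub>K\<^esub> fst w, snd v \<oplus>\<^bsub>C\<^esub> snd w)"
  "r \<odot>\<^bsub>crossed_product \<sigma> g u\<^esub> v = (r \<odot>\<^bsub>K\<^esub> fst v, r \<odot>\<^bsub>C\<^esub> snd v)"
  by (auto simp: crossed_product_def mem_Times_iff)

lemma crossed_product_lin_space: "lin_space F (crossed_product \<sigma> g u)"
proof -
  interpret VK: lin_space F K by (rule K_lin)
  interpret VC: lin_space F C by (rule C_lin)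
  show ?thesis
  proof (rule lin_spaceI)
    show "field F" by (rule unital_algebraD(5)[OF C_alg])
    show "abelian_group (crossed_product \<sigma> g u)"
    proof (rule abelian_groupI)
      fix v assume "v \<in> carrier (crossed_product \<sigma> g u)"
      then show "\<exists>w\<in>carrier (crossed_product \<sigma> g u). w \<oplus>\<^bsub>crossed_product \<sigma> g u\<^esub> v = \<zero>\<^bsub>crossed_product \<sigma> g u\<^esub>"
        by (intro bexI[of _ "(\<ominus>\<^bsub>K\<^esub> fst v, \<ominus>\<^bsub>C\<^esub> snd v)"]) (simp_all add: K.l_neg C.l_neg)
    qed (simp_all add: K.a_ac C.a_ac)
  qed (simp_all add: VK.V.smult_l_distr VK.V.smult_r_distr VK.V.smult_assoc1
      VC.V.smult_l_distr VC.V.smult_r_distr VC.V.smult_assoc1)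
qed

lemma factor_set_zero:
  assumes fs: "factor_set \<sigma> g"
  shows "\<sigma> \<zero>\<^bsub>C\<^esub> = \<zero>\<^bsub>A\<^esub>" "x \<in> carrier C \<Longrightarrow> g x \<zero>\<^bsub>C\<^esub> = \<zero>\<^bsub>K\<^esub>" "x \<in> carrier C \<Longrightarrow> g \<zero>\<^bsub>C\<^esub> x = \<zero>\<^bsub>K\<^esub>"
  using factor_setD(1,2)[OF fs] linear_map_zero[OF C_lin A_lin, of \<sigma>]
    linear_map_zero[OF C_lin K_lin, of "g x"] linear_map_zero[OF C_lin K_lin, of "\<lambda>y. g y x"]
  by (simp_all add: bilinear_map_def)

lemma crossed_product_algebra:
  assumes fs: "factor_set \<sigma> g"
    and obs: "\<And>a b c. a \<in> carrier C \<Longrightarrow> b \<in> carrier C \<Longrightarrow> c \<in> carrier C \<Longrightarrow> obstruction \<sigma> g a b c = \<zero>\<^bsub>K\<^esub>"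
  shows "assoc_algebra F (crossed_product \<sigma> g u)"
proof (intro assoc_algebra.intro assoc_algebra_axioms.intro crossed_product_lin_space)
  note cl = factor_setD(3,5)[OF fs]
  note lin = linear_mapD(2,3)[OF factor_setD(1)[OF fs]] bilinear_mapD(2-)[OF factor_setD(2)[OF fs]]
  note mc = crossed_mult_closed[OF fs]
  fix v w assume v: "v \<in> carrier (crossed_product \<sigma> g u)" and w: "w \<in> carrier (crossed_product \<sigma> g u)"
  show "v \<otimes>\<^bsub>crossed_product \<sigma> g u\<^esub> w \<in> carrier (crossed_product \<sigma> g u)"
    using v w by (simp add: mc)
  fix r assume "r \<in> carrier F"
  then show "(r \<odot>\<^bsub>crossed_product \<sigma> g u\<^esub> v) \<otimes>\<^bsub>crossed_product \<sigma> g u\<^esub> w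
      = r \<odot>\<^bsub>crossed_product \<sigma> g u\<^esub> (v \<otimes>\<^bsub>crossed_product \<sigma> g u\<^esub> w)"
    "v \<otimes>\<^bsub>crossed_product \<sigma> g u\<^esub> (r \<odot>\<^bsub>crossed_product \<sigma> g u\<^esub> w)
      = r \<odot>\<^bsub>crossed_product \<sigma> g u\<^esub> (v \<otimes>\<^bsub>crossed_product \<sigma> g u\<^esub> w)"
    using v w by (simp_all add: crossed_mult_def cl lin K_smult K_smult_l K_smult_r act_smult C_smult_mult)
next
  note cl = factor_setD(3,5)[OF fs]
  note lin = linear_mapD(2,3)[OF factor_setD(1)[OF fs]] bilinear_mapD(2-)[OF factor_setD(2)[OF fs]]
  note mc = crossed_mult_closed[OF fs]
  fix v w x assume v: "v \<in> carrier (crossed_product \<sigma> g u)" and w: "w \<in> carrier (crossed_product \<sigma> g u)"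
    and x: "x \<in> carrier (crossed_product \<sigma> g u)"
  show "v \<otimes>\<^bsub>crossed_product \<sigma> g u\<^esub> w \<otimes>\<^bsub>crossed_product \<sigma> g u\<^esub> x
      = v \<otimes>\<^bsub>crossed_product \<sigma> g u\<^esub> (w \<otimes>\<^bsub>crossed_product \<sigma> g u\<^esub> x)"
    using v w x crossed_mult_assoc[OF fs, of "snd v" "snd w" "snd x" "fst v" "fst w" "fst x"]
    by (simp add: obs mc C.m_assoc)
  show "(v \<oplus>\<^bsub>crossed_product \<sigma> g u\<^esub> w) \<otimes>\<^bsub>crossed_product \<sigma> g u\<^esub> x
      = v \<otimes>\<^bsub>crossed_product \<sigma> g u\<^esub> x \<oplus>\<^bsub>crossed_product \<sigma> g u\<^esub> w \<otimes>\<^bsub>crossed_product \<sigma> g u\<^esub> x"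
    "x \<otimes>\<^bsub>crossed_product \<sigma> g u\<^esub> (v \<oplus>\<^bsub>crossed_product \<sigma> g u\<^esub> w)
      = x \<otimes>\<^bsub>crossed_product \<sigma> g u\<^esub> v \<oplus>\<^bsub>crossed_product \<sigma> g u\<^esub> x \<otimes>\<^bsub>crossed_product \<sigma> g u\<^esub> w"
    using v w x by (simp_all add: crossed_mult_def cl lin K_l_distr K_r_distr act_add C.l_distr C.r_distr K.a_ac)
qed

text \<open>p (\<sigma> 1) = \<psi> 1 = 1, so 1 - \<sigma> 1 = d t for some t. Then e = (t, 1) acts
  as the identity on K and lies over 1 in C, so 1 - e maps the crossed product into K and kills K,
  from either side. The element t is returned with the unit since it is used to show that \<pi>
  preserves the unit.\<close>

lemma crossed_product_unit:
  assumes fs: "factor_set \<sigma> g"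
    and obs: "\<And>a b c. a \<in> carrier C \<Longrightarrow> b \<in> carrier C \<Longrightarrow> c \<in> carrier C \<Longrightarrow> obstruction \<sigma> g a b c = \<zero>\<^bsub>K\<^esub>"
  obtains t u where "t \<in> carrier K" "d t \<oplus>\<^bsub>A\<^esub> \<sigma> \<one>\<^bsub>C\<^esub> = \<one>\<^bsub>A\<^esub>" "u \<in> carrier K \<times> carrier C"
    "\<And>v u'. v \<in> carrier K \<times> carrier C \<Longrightarrow> u \<otimes>\<^bsub>crossed_product \<sigma> g u'\<^esub> v = v"
    "\<And>v u'. v \<in> carrier K \<times> carrier C \<Longrightarrow> v \<otimes>\<^bsub>crossed_product \<sigma> g u'\<^esub> u = v"
proof -
  note cl = factor_setD(3,5)[OF fs]
  have "\<one>\<^bsub>A\<^esub> \<ominus>\<^bsub>A\<^esub> \<sigma> \<one>\<^bsub>C\<^esub> \<in> d ` carrier K"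
    by (simp add: image_d cl p_minus factor_setD(4)[OF fs] p_simps psi_simps)
  then obtain t where t: "t \<in> carrier K" and "\<one>\<^bsub>A\<^esub> \<ominus>\<^bsub>A\<^esub> \<sigma> \<one>\<^bsub>C\<^esub> = d t"
    by blast
  then have dt: "d t \<oplus>\<^bsub>A\<^esub> \<sigma> \<one>\<^bsub>C\<^esub> = \<one>\<^bsub>A\<^esub>"
    using A.add_minus_cancel(2)[of "\<sigma> \<one>\<^bsub>C\<^esub>" "\<one>\<^bsub>A\<^esub>"] cl(1)[OF C.one_closed] by simp
  let ?N = "crossed_product \<sigma> g (\<zero>\<^bsub>K\<^esub>, \<zero>\<^bsub>C\<^esub>)"
  let ?e = "(t, \<one>\<^bsub>C\<^esub>)"
  have alg: "assoc_algebra F ?N"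
    by (rule crossed_product_algebra[OF fs obs])
  interpret N: abelian_group ?N
    by (rule lin_space_abelian_group[OF crossed_product_lin_space])
  have e: "?e \<in> carrier ?N"
    by (simp add: t)
  have unit_l: "t \<otimes>\<^bsub>K\<^esub> x \<oplus>\<^bsub>K\<^esub> \<sigma> \<one>\<^bsub>C\<^esub> \<triangleright> x = x" and unit_r: "x \<otimes>\<^bsub>K\<^esub> t \<oplus>\<^bsub>K\<^esub> x \<triangleleft> \<sigma> \<one>\<^bsub>C\<^esub> = x"
    if x: "x \<in> carrier K" for x
  proof -
    have "t \<otimes>\<^bsub>K\<^esub> x \<oplus>\<^bsub>K\<^esub> \<sigma> \<one>\<^bsub>C\<^esub> \<triangleright> x = (d t \<oplus>\<^bsub>A\<^esub> \<sigma> \<one>\<^bsub>C\<^esub>) \<triangleright> x"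
      "x \<otimes>\<^bsub>K\<^esub> t \<oplus>\<^bsub>K\<^esub> x \<triangleleft> \<sigma> \<one>\<^bsub>C\<^esub> = x \<triangleleft> (d t \<oplus>\<^bsub>A\<^esub> \<sigma> \<one>\<^bsub>C\<^esub>)"
      using x t by (simp_all add: act_add act_d cl)
    then show "t \<otimes>\<^bsub>K\<^esub> x \<oplus>\<^bsub>K\<^esub> \<sigma> \<one>\<^bsub>C\<^esub> \<triangleright> x = x" "x \<otimes>\<^bsub>K\<^esub> t \<oplus>\<^bsub>K\<^esub> x \<triangleleft> \<sigma> \<one>\<^bsub>C\<^esub> = x"
      using x by (simp_all add: dt)
  qed
  \<comment> \<open>Multiplying by e adds to v a correction in K that depends only on the
    C-component of v.\<close>
  have mult_e: "?e \<otimes>\<^bsub>?N\<^esub> v = (fst v \<oplus>\<^bsub>K\<^esub> (t \<triangleleft> \<sigma> (snd v) \<oplus>\<^bsub>K\<^esub> g \<one>\<^bsub>C\<^esub> (snd v)), snd v)"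
    "v \<otimes>\<^bsub>?N\<^esub> ?e = (fst v \<oplus>\<^bsub>K\<^esub> (\<sigma> (snd v) \<triangleright> t \<oplus>\<^bsub>K\<^esub> g (snd v) \<one>\<^bsub>C\<^esub>), snd v)"
    if v: "v \<in> carrier ?N" for v
  proof -
    have "crossed_mult \<sigma> g \<one>\<^bsub>C\<^esub> (snd v) t (fst v)
        = (t \<otimes>\<^bsub>K\<^esub> fst v \<oplus>\<^bsub>K\<^esub> \<sigma> \<one>\<^bsub>C\<^esub> \<triangleright> fst v) \<oplus>\<^bsub>K\<^esub> (t \<triangleleft> \<sigma> (snd v) \<oplus>\<^bsub>K\<^esub> g \<one>\<^bsub>C\<^esub> (snd v))"
      "crossed_mult \<sigma> g (snd v) \<one>\<^bsub>C\<^esub> (fst v) t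
        = (fst v \<otimes>\<^bsub>K\<^esub> t \<oplus>\<^bsub>K\<^esub> fst v \<triangleleft> \<sigma> \<one>\<^bsub>C\<^esub>) \<oplus>\<^bsub>K\<^esub> (\<sigma> (snd v) \<triangleright> t \<oplus>\<^bsub>K\<^esub> g (snd v) \<one>\<^bsub>C\<^esub>)"
      using v t by (simp_all add: crossed_mult_def cl K.a_ac)
    then show "?e \<otimes>\<^bsub>?N\<^esub> v = (fst v \<oplus>\<^bsub>K\<^esub> (t \<triangleleft> \<sigma> (snd v) \<oplus>\<^bsub>K\<^esub> g \<one>\<^bsub>C\<^esub> (snd v)), snd v)"
      "v \<otimes>\<^bsub>?N\<^esub> ?e = (fst v \<oplus>\<^bsub>K\<^esub> (\<sigma> (snd v) \<triangleright> t \<oplus>\<^bsub>K\<^esub> g (snd v) \<one>\<^bsub>C\<^esub>), snd v)"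
      using v by (simp_all add: unit_l unit_r)
  qed
  define u where "u = ?e \<oplus>\<^bsub>?N\<^esub> ?e \<ominus>\<^bsub>?N\<^esub> ?e \<otimes>\<^bsub>?N\<^esub> ?e"
  have uN: "u \<in> carrier ?N"
    unfolding u_def using e assoc_algebra.alg_m_closed[OF alg e e]
    by (intro N.minus_closed N.a_closed)
  have unit: "u \<otimes>\<^bsub>?N\<^esub> v = v \<and> v \<otimes>\<^bsub>?N\<^esub> u = v" if v: "v \<in> carrier ?N" for v
  proof
    have ev: "?e \<otimes>\<^bsub>?N\<^esub> v \<in> carrier ?N" "v \<otimes>\<^bsub>?N\<^esub> ?e \<in> carrier ?N"
      by (rule assoc_algebra.alg_m_closed[OF alg e v], rule assoc_algebra.alg_m_closed[OF alg v e])
    have cK: "t \<triangleleft> \<sigma> (snd v) \<in> carrier K" "g \<one>\<^bsub>C\<^esub> (snd v) \<in> carrier K" "\<sigma> (snd v) \<triangleright> t \<in> carrier K"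
      "g (snd v) \<one>\<^bsub>C\<^esub> \<in> carrier K" "fst v \<in> carrier K" "snd v \<in> carrier C"
      using v t by (simp_all add: cl)
    \<comment> \<open>e leaves the C-component alone, so applying e twice adds the same correction
      twice. This is the premise of \<open>two_sided_unit\<close>, that (1 - e)^2 acts as
      zero.\<close>
    have eqs: "?e \<otimes>\<^bsub>?N\<^esub> (?e \<otimes>\<^bsub>?N\<^esub> v) \<oplus>\<^bsub>?N\<^esub> v = ?e \<otimes>\<^bsub>?N\<^esub> v \<oplus>\<^bsub>?N\<^esub> ?e \<otimes>\<^bsub>?N\<^esub> v"
      "v \<otimes>\<^bsub>?N\<^esub> ?e \<otimes>\<^bsub>?N\<^esub> ?e \<oplus>\<^bsub>?N\<^esub> v = v \<otimes>\<^bsub>?N\<^esub> ?e \<oplus>\<^bsub>?N\<^esub> v \<otimes>\<^bsub>?N\<^esub> ?e"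
      unfolding mult_e(1)[OF ev(1)] mult_e(2)[OF ev(2)] unfolding mult_e(1)[OF v] mult_e(2)[OF v]
      using cK by (simp_all add: K.a_ac del: crossed_product_simps(2))
    show "u \<otimes>\<^bsub>?N\<^esub> v = v" "v \<otimes>\<^bsub>?N\<^esub> u = v"
      unfolding u_def
      by (rule two_sided_unit(1)[OF alg e v eqs(1)], rule two_sided_unit(2)[OF alg e v eqs(2)])
  qed
  show thesis
  proof (rule that[OF t dt])
    show "u \<in> carrier K \<times> carrier C"
      using uN by (simp add: mem_Times_iff)
    show "u \<otimes>\<^bsub>crossed_product \<sigma> g u'\<^esub> v = v" "v \<otimes>\<^bsub>crossed_product \<sigma> g u'\<^esub> u = v"
      if "v \<in> carrier K \<times> carrier C" for v u'
      using unit[of v] that by (simp_all add: mem_Times_iff)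
  qed
qed

lemma crossed_product_extension:
  assumes fs: "factor_set \<sigma> g"
    and obs: "\<And>a b c. a \<in> carrier C \<Longrightarrow> b \<in> carrier C \<Longrightarrow> c \<in> carrier C \<Longrightarrow> obstruction \<sigma> g a b c = \<zero>\<^bsub>K\<^esub>"
  obtains u where "lifting (crossed_product \<sigma> g u) (\<lambda>x. (x, \<zero>\<^bsub>C\<^esub>)) snd (\<lambda>v. d (fst v) \<oplus>\<^bsub>A\<^esub> \<sigma> (snd v))"
proof -
  note cl = factor_setD(3,5)[OF fs]
  note zero = factor_set_zero[OF fs]
  note lin = linear_mapD(2,3)[OF factor_setD(1)[OF fs]]
  obtain t u where t: "t \<in> carrier K" "d t \<oplus>\<^bsub>A\<^esub> \<sigma> \<one>\<^bsub>C\<^esub> = \<one>\<^bsub>A\<^esub>" and u: "u \<in> carrier K \<times> carrier C"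
    and unit: "\<And>v u'. v \<in> carrier K \<times> carrier C \<Longrightarrow> u \<otimes>\<^bsub>crossed_product \<sigma> g u'\<^esub> v = v"
    "\<And>v u'. v \<in> carrier K \<times> carrier C \<Longrightarrow> v \<otimes>\<^bsub>crossed_product \<sigma> g u'\<^esub> u = v"
    by (rule crossed_product_unit[OF fs obs]) (assumption, assumption, assumption, rule that, simp_all)
  let ?N = "crossed_product \<sigma> g u"
  let ?\<pi> = "\<lambda>v. d (fst v) \<oplus>\<^bsub>A\<^esub> \<sigma> (snd v)"
  have alg: "unital_algebra F ?N"
  proof (intro unital_algebra.intro monoidI)
    show alg: "assoc_algebra F ?N"
      by (rule crossed_product_algebra[OF fs obs])
    show "v \<otimes>\<^bsub>?N\<^esub> w \<in> carrier ?N" if "v \<in> carrier ?N" "w \<in> carrier ?N" for v w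
      by (rule assoc_algebra.alg_m_closed[OF alg that])
    show "v \<otimes>\<^bsub>?N\<^esub> w \<otimes>\<^bsub>?N\<^esub> x = v \<otimes>\<^bsub>?N\<^esub> (w \<otimes>\<^bsub>?N\<^esub> x)"
      if "v \<in> carrier ?N" "w \<in> carrier ?N" "x \<in> carrier ?N" for v w x
      by (rule assoc_algebra.alg_m_assoc[OF alg that])
    show "\<one>\<^bsub>?N\<^esub> \<in> carrier ?N"
      using u by (simp add: mem_Times_iff)
    show "\<one>\<^bsub>?N\<^esub> \<otimes>\<^bsub>?N\<^esub> v = v" "v \<otimes>\<^bsub>?N\<^esub> \<one>\<^bsub>?N\<^esub> = v" if "v \<in> carrier ?N" for v
      unfolding crossed_product_simps(3) using that
      by (intro unit; simp add: mem_Times_iff)+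
  qed
  \<comment> \<open>Compare the C-components in u (0, 1) = (0, 1).\<close>
  have f1: "snd u = \<one>\<^bsub>C\<^esub>"
    using unit(1)[of "(\<zero>\<^bsub>K\<^esub>, \<one>\<^bsub>C\<^esub>)" u] u by (simp add: mem_Times_iff)
  have \<pi>_mult: "?\<pi> (v \<otimes>\<^bsub>?N\<^esub> w) = ?\<pi> v \<otimes>\<^bsub>A\<^esub> ?\<pi> w" if "v \<in> carrier ?N" "w \<in> carrier ?N" for v w
  proof -
    let ?x = "fst v" and ?y = "fst w" and ?a = "snd v" and ?b = "snd w"
    have c: "?x \<in> carrier K" "?y \<in> carrier K" "?a \<in> carrier C" "?b \<in> carrier C"
      using that by simp_all
    have cA: "d ?x \<in> carrier A" "d ?y \<in> carrier A" "\<sigma> ?a \<in> carrier A" "\<sigma> ?b \<in> carrier A" "\<sigma> (?a \<otimes>\<^bsub>C\<^esub> ?b) \<in> carrier A"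
      using c by (simp_all add: cl)
    have "?\<pi> (v \<otimes>\<^bsub>?N\<^esub> w) = d ?x \<otimes>\<^bsub>A\<^esub> d ?y \<oplus>\<^bsub>A\<^esub> \<sigma> ?a \<otimes>\<^bsub>A\<^esub> d ?y \<oplus>\<^bsub>A\<^esub> d ?x \<otimes>\<^bsub>A\<^esub> \<sigma> ?b
        \<oplus>\<^bsub>A\<^esub> (\<sigma> ?a \<otimes>\<^bsub>A\<^esub> \<sigma> ?b \<ominus>\<^bsub>A\<^esub> \<sigma> (?a \<otimes>\<^bsub>C\<^esub> ?b)) \<oplus>\<^bsub>A\<^esub> \<sigma> (?a \<otimes>\<^bsub>C\<^esub> ?b)"
      using c by (simp add: crossed_mult_def cl d_add d_mult d_act factor_setD(6)[OF fs])
    also have "\<dots> = ?\<pi> v \<otimes>\<^bsub>A\<^esub> ?\<pi> w"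
      using cA by algebra
    finally show ?thesis .
  qed
  \<comment> \<open>The choice of t gives \<pi> (t, 1) = 1; applying the multiplicative map \<pi> to
    u (t, 1) = (t, 1) then yields \<pi> u = 1.\<close>
  have \<pi>1: "?\<pi> u = \<one>\<^bsub>A\<^esub>"
  proof -
    have c: "u \<in> carrier ?N" "(t, \<one>\<^bsub>C\<^esub>) \<in> carrier ?N"
      using u t by (simp_all add: mem_Times_iff)
    have "?\<pi> u \<in> carrier A"
      using u by (simp add: cl mem_Times_iff)
    then have "?\<pi> u = ?\<pi> u \<otimes>\<^bsub>A\<^esub> ?\<pi> (t, \<one>\<^bsub>C\<^esub>)"
      by (simp add: t)
    also have "\<dots> = ?\<pi> (u \<otimes>\<^bsub>?N\<^esub> (t, \<one>\<^bsub>C\<^esub>))"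
      by (rule \<pi>_mult[OF c, symmetric])
    also have "u \<otimes>\<^bsub>?N\<^esub> (t, \<one>\<^bsub>C\<^esub>) = (t, \<one>\<^bsub>C\<^esub>)"
      by (rule unit(1)) (simp add: t)
    finally show ?thesis
      by (simp add: t)
  qed
  have smult0: "r \<odot>\<^bsub>C\<^esub> \<zero>\<^bsub>C\<^esub> = \<zero>\<^bsub>C\<^esub>" if "r \<in> carrier F" for r
    by (rule lin_space_smult(3)[OF C_lin that C.zero_closed])
  have ext: "(?N, \<lambda>x. (x, \<zero>\<^bsub>C\<^esub>), snd) \<in> extensions F C K"
    unfolding extensions_def
  proof (intro CollectI case_prodI conjI alg)
    show "(\<lambda>x. (x, \<zero>\<^bsub>C\<^esub>)) \<in> alg_hom F K ?N"
      by (auto simp: alg_hom_def linear_map_def crossed_mult_def zero smult0)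
    show "snd \<in> unital_alg_hom F ?N C"
      by (intro unital_alg_homI linear_mapI) (simp_all add: f1)
    show "inj_on (\<lambda>x. (x, \<zero>\<^bsub>C\<^esub>)) (carrier K)"
      by (simp add: inj_on_def)
    show "(\<lambda>x. (x, \<zero>\<^bsub>C\<^esub>)) ` carrier K = {e \<in> carrier ?N. snd e = \<zero>\<^bsub>C\<^esub>}"
      by (auto simp: image_iff)
    show "snd ` carrier ?N = carrier C"
    proof
      show "carrier C \<subseteq> snd ` carrier ?N"
      proof
        fix c assume "c \<in> carrier C"
        then show "c \<in> snd ` carrier ?N"
          by (intro image_eqI[of _ _ "(\<zero>\<^bsub>K\<^esub>, c)"]) simp_all
      qed
    qed auto
  qed
  have "lifting ?N (\<lambda>x. (x, \<zero>\<^bsub>C\<^esub>)) snd ?\<pi>"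
    unfolding lifting_def
  proof (intro conjI ballI ext)
    show "?\<pi> \<in> unital_alg_hom F ?N A"
    proof (intro unital_alg_homI linear_mapI)
      show "?\<pi> (v \<otimes>\<^bsub>?N\<^esub> w) = ?\<pi> v \<otimes>\<^bsub>A\<^esub> ?\<pi> w" if "v \<in> carrier ?N" "w \<in> carrier ?N" for v w
        by (rule \<pi>_mult[OF that])
    qed (simp_all add: cl lin d_add d_smult A_smult A.a_ac \<pi>1)
  qed (simp_all add: zero cl crossed_mult_def act_add act_d p_simps factor_setD(4)[OF fs])
  then show thesis
    by (rule that)
qed

section \<open>The extensions that induce the given kernel, and their existence\<close>

definition inducing :: "('f, 'k, 'c, 'e) extension set" where
  "inducing = {S \<in> extensions F C K. kernel_iso F C (induced_biext K S) (induced_psi K S) D \<psi>}"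

lemma Ext_eq: "Ext F C K D \<psi> = inducing // ext_rel F C K"
  by (simp add: Ext_def inducing_def)

lemma inducing_iff: "(E, k, f) \<in> inducing \<longleftrightarrow> (\<exists>\<pi>. lifting E k f \<pi>)"
proof
  show "\<exists>\<pi>. lifting E k f \<pi>" if "(E, k, f) \<in> inducing"
    using that kernel_iso_iff_lifting[of E k f] by (simp add: inducing_def)
  assume ex: "\<exists>\<pi>. lifting E k f \<pi>"
  then have "(E, k, f) \<in> extensions F C K"
    by (auto simp: lifting_def)
  then show "(E, k, f) \<in> inducing"
    using ex kernel_iso_iff_lifting[of E k f] by (simp add: inducing_def)
qed

text \<open>The set is saturated for \<open>ext_rel\<close>, so every member of a class in
  \<open>Ext\<close> comes with a map \<pi>.\<close>

lemma inducing_rel: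
  assumes S: "S \<in> inducing" and rel: "(S, T) \<in> ext_rel F C K"
  shows "T \<in> inducing"
proof -
  obtain E k f E' k' f' where ST: "S = (E, k, f)" "T = (E', k', f')"
    by (metis prod_cases3)
  obtain \<pi> where \<pi>: "lifting E k f \<pi>"
    using S unfolding ST inducing_iff by blast
  show ?thesis
    using rel unfolding ST inducing_iff
    by (rule ext_relE) (rule kernel_extension.lifting_iso[OF kernel_extensionI[OF \<pi>]])
qed

text \<open>The injection h moves the crossed product from the type of pairs into \<open>'e\<close>,
  and \<open>lifting_iso\<close> carries \<pi> along.\<close>

lemma Ext_nonempty_iff:
  assumes "inj_on (h :: 'k \<times> 'c \<Rightarrow> 'e) (carrier K \<times> carrier C)"
  shows "(Ext F C K D \<psi> :: ('f, 'k, 'c, 'e) extension set set) \<noteq> {} \<longleftrightarrow>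
    (\<exists>\<sigma> g. factor_set \<sigma> g \<and> (\<forall>a\<in>carrier C. \<forall>b\<in>carrier C. \<forall>c\<in>carrier C. obstruction \<sigma> g a b c = \<zero>\<^bsub>K\<^esub>))"
proof
  assume "(Ext F C K D \<psi> :: ('f, 'k, 'c, 'e) extension set set) \<noteq> {}"
  then obtain S :: "('f, 'k, 'c, 'e) extension" where "S \<in> inducing"
    by (auto simp: Ext_eq quotient_def)
  then obtain E k f \<pi> where "lifting (E :: ('f, 'e) module) k f \<pi>"
    by (cases S) (auto simp: inducing_iff)
  then show "\<exists>\<sigma> g. factor_set \<sigma> g \<and>
      (\<forall>a\<in>carrier C. \<forall>b\<in>carrier C. \<forall>c\<in>carrier C. obstruction \<sigma> g a b c = \<zero>\<^bsub>K\<^esub>)"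
    by (rule kernel_extension.unobstructed_factor_set[OF kernel_extensionI])
next
  assume "\<exists>\<sigma> g. factor_set \<sigma> g \<and>
      (\<forall>a\<in>carrier C. \<forall>b\<in>carrier C. \<forall>c\<in>carrier C. obstruction \<sigma> g a b c = \<zero>\<^bsub>K\<^esub>)"
  then obtain \<sigma> g where fs: "factor_set \<sigma> g"
    and "\<forall>a\<in>carrier C. \<forall>b\<in>carrier C. \<forall>c\<in>carrier C. obstruction \<sigma> g a b c = \<zero>\<^bsub>K\<^esub>"
    by (elim exE conjE) (rule that)
  note obs = this(2)[rule_format]
  obtain u where l: "lifting (crossed_product \<sigma> g u) (\<lambda>x. (x, \<zero>\<^bsub>C\<^esub>)) snd (\<lambda>v. d (fst v) \<oplus>\<^bsub>A\<^esub> \<sigma> (snd v))"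
    by (rule crossed_product_extension[OF fs obs]) (assumption, assumption, assumption, rule that)
  let ?N = "crossed_product \<sigma> g u"
  have ext: "(?N, \<lambda>x. (x, \<zero>\<^bsub>C\<^esub>), snd) \<in> extensions F C K"
    using l by (simp add: lifting_def)
  have h: "inj_on h (carrier ?N)"
    using assms by (simp add: crossed_product_def)
  have hi: "inv_into (carrier ?N) h (h e) = e" if "e \<in> carrier ?N" for e
    by (rule inv_into_f_f[OF h that])
  have "\<exists>\<pi>'. lifting (transport_alg h ?N) (\<lambda>x. h (x, \<zero>\<^bsub>C\<^esub>)) (\<lambda>e. snd (inv_into (carrier ?N) h e)) \<pi>'"
    by (rule kernel_extension.lifting_iso[OF kernel_extensionI[OF l] transport_extension[OF ext h]
          transport_alg(2)[OF extensionsD(1)[OF ext] h]]) (simp_all only: hi)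
  then have "(transport_alg h ?N, \<lambda>x. h (x, \<zero>\<^bsub>C\<^esub>), \<lambda>e. snd (inv_into (carrier ?N) h e)) \<in> inducing"
    by (simp only: inducing_iff)
  then show "(Ext F C K D \<psi> :: ('f, 'k, 'c, 'e) extension set set) \<noteq> {}"
    unfolding Ext_eq quotient_def by blast
qed

end

section \<open>Twisting an extension by a cocycle\<close>

text \<open>A multiplicative surjection preserves the unit: if h e = 1, then h 1 = h 1 h e = h (1 e)
  = 1. The units of twists differ in general, and this spares comparing them.\<close>

lemma unital_alg_isoI:
  assumes A: "unital_algebra F A" and B: "unital_algebra F B" and lin: "h \<in> linear_map F A B"
    and mult: "\<And>x y. x \<in> carrier A \<Longrightarrow> y \<in> carrier A \<Longrightarrow> h (x \<otimes>\<^bsub>A\<^esub> y) = h x \<otimes>\<^bsub>B\<^esub> h y"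
    and bij: "bij_betw h (carrier A) (carrier B)"
  shows "h \<in> unital_alg_iso F A B"
proof -
  interpret A: ring A by (rule unital_algebraD[OF A])
  interpret B: ring B by (rule unital_algebraD[OF B])
  obtain e where e: "e \<in> carrier A" "h e = \<one>\<^bsub>B\<^esub>"
    using bij B.one_closed unfolding bij_betw_def by (metis imageE)
  have "h \<one>\<^bsub>A\<^esub> = h \<one>\<^bsub>A\<^esub> \<otimes>\<^bsub>B\<^esub> h e"
    using e linear_mapD(1)[OF lin A.one_closed] by simp
  also have "\<dots> = h (\<one>\<^bsub>A\<^esub> \<otimes>\<^bsub>A\<^esub> e)"
    using e by (simp only: mult A.one_closed)
  also have "\<dots> = \<one>\<^bsub>B\<^esub>"
    using e by simp
  finally show ?thesis
    by (simp add: unital_alg_iso_def unital_alg_homI lin mult bij)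
qed

context kernel_representative
begin

lemma Z_memI:
  assumes "x \<in> carrier K" "\<And>a. a \<in> carrier K \<Longrightarrow> x \<otimes>\<^bsub>K\<^esub> a = \<zero>\<^bsub>K\<^esub> \<and> a \<otimes>\<^bsub>K\<^esub> x = \<zero>\<^bsub>K\<^esub>"
  shows "x \<in> Z"
  unfolding ann_alg_def using assms by simp

lemma Suc_1_eq_2: "Suc (Suc 0) = 2"
  by simp

lemmas hh_class_2_eq_iff = bimodule.hh_class_eq_iff[OF bimod_C, where n = "Suc 0", unfolded Suc_1_eq_2]

abbreviation cocycles where "cocycles \<equiv> hh_cocycles F C (ann_alg K) \<xi>C 2"

lemma cocycleD:
  assumes "\<chi> \<in> cocycles"
  shows "\<chi> \<in> hh_cochains F C (ann_alg K) 2" "bilinear_map F C (ann_alg K) (\<lambda>x y. \<chi> [x, y])"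
    "\<chi> \<in> tuples C 2 \<rightarrow>\<^sub>E Z"
    "a \<in> carrier C \<Longrightarrow> b \<in> carrier C \<Longrightarrow> \<chi> [a, b] \<in> Z"
    "a \<in> carrier C \<Longrightarrow> b \<in> carrier C \<Longrightarrow> \<chi> [a, b] \<in> carrier K"
    "a \<in> carrier C \<Longrightarrow> b \<in> carrier C \<Longrightarrow> d (\<chi> [a, b]) = \<zero>\<^bsub>A\<^esub>"
    "a \<in> carrier C \<Longrightarrow> b \<in> carrier C \<Longrightarrow> c \<in> carrier C
      \<Longrightarrow> hh_delta C (ann_alg K) \<xi>C 2 \<chi> [a, b, c] = \<zero>\<^bsub>K\<^esub>"
    "a \<in> carrier C \<Longrightarrow> \<chi> [a, \<zero>\<^bsub>C\<^esub>] = \<zero>\<^bsub>K\<^esub>" "a \<in> carrier C \<Longrightarrow> \<chi> [\<zero>\<^bsub>C\<^esub>, a] = \<zero>\<^bsub>K\<^esub>"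
proof -
  show 1: "\<chi> \<in> hh_cochains F C (ann_alg K) 2"
    using assms by (simp add: hh_cocycles_def)
  show 2: "bilinear_map F C (ann_alg K) (\<lambda>x y. \<chi> [x, y])"
    by (rule hh_cochains_2_bilinear[OF 1])
  show "\<chi> \<in> tuples C 2 \<rightarrow>\<^sub>E Z"
    by (rule hh_cochains_PiE[OF 1])
  show Z: "\<chi> [a, b] \<in> Z" if "a \<in> carrier C" "b \<in> carrier C" for a b
    by (rule bilinear_mapD(1)[OF 2 that])
  show "\<chi> [a, b] \<in> carrier K" "d (\<chi> [a, b]) = \<zero>\<^bsub>A\<^esub>" if "a \<in> carrier C" "b \<in> carrier C"
    using Z[OF that] by (simp_all add: Z_iff)
  show "hh_delta C (ann_alg K) \<xi>C 2 \<chi> [a, b, c] = \<zero>\<^bsub>K\<^esub>"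
    if "a \<in> carrier C" "b \<in> carrier C" "c \<in> carrier C"
  proof -
    have "hh_delta C (ann_alg K) \<xi>C 2 \<chi> = hh_zero C (ann_alg K) 3"
      using assms by (simp add: hh_cocycles_def)
    then show ?thesis
      using that by (simp add: hh_zero_def)
  qed
  show "\<chi> [a, \<zero>\<^bsub>C\<^esub>] = \<zero>\<^bsub>K\<^esub>" "\<chi> [\<zero>\<^bsub>C\<^esub>, a] = \<zero>\<^bsub>K\<^esub>" if "a \<in> carrier C"
    using 2 that linear_map_zero[OF C_lin Z_lin, of "\<lambda>y. \<chi> [a, y]"]
      linear_map_zero[OF C_lin Z_lin, of "\<lambda>y. \<chi> [y, a]"] by (simp_all add: bilinear_map_def)
qed

lemma coboundaries_2: "hh_coboundaries F C (ann_alg K) \<xi>C 2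
    = hh_delta C (ann_alg K) \<xi>C (Suc 0) ` hh_cochains F C (ann_alg K) (Suc 0)"
  unfolding hh_coboundaries_def Suc_1_eq_2[symmetric] by (simp only: nat.case)

end

section \<open>Twisted algebras and the isomorphisms between them\<close>

context kernel_extension
begin

lemmas E_smult = assoc_algebra.alg_smult_l[OF unital_algebraD(1)[OF E_alg]]
    assoc_algebra.alg_smult_r[OF unital_algebraD(1)[OF E_alg]] lin_space_smult(1,2,4)[OF E_lin]

definition twisted :: "('c list \<Rightarrow> 'k) \<Rightarrow> ('f, 'e) module" where
  "twisted \<chi> = fst (twist C \<chi> (E, k, f))"

lemma twist_eq: "twist C \<chi> (E, k, f) = (twisted \<chi>, k, f)"
  by (simp add: twisted_def twist_def)

lemma twisted_simps [simp]:
  "carrier (twisted \<chi>) = carrier E" "\<zero>\<^bsub>twisted \<chi>\<^esub> = \<zero>\<^bsub>E\<^esub>" "e \<oplus>\<^bsub>twisted \<chi>\<^esub> e' = e \<oplus>\<^bsub>E\<^esub> e'"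
  "r \<odot>\<^bsub>twisted \<chi>\<^esub> e = r \<odot>\<^bsub>E\<^esub> e" "e \<otimes>\<^bsub>twisted \<chi>\<^esub> e' = e \<otimes>\<^bsub>E\<^esub> e' \<oplus>\<^bsub>E\<^esub> k (\<chi> [f e, f e'])"
  "\<one>\<^bsub>twisted \<chi>\<^esub> = \<one>\<^bsub>E\<^esub> \<ominus>\<^bsub>E\<^esub> k (\<chi> [\<one>\<^bsub>C\<^esub>, \<one>\<^bsub>C\<^esub>])"
  by (simp_all add: twisted_def twist_def)

text \<open>The cocycle condition moved into E by k, with multiplication by e in place of the action
  of f e. Associativity of the twisted product amounts to it, and setting two of the three arguments
  to 1 yields the unit.\<close>

lemma k_cocycle:
  assumes \<chi>: "\<chi> \<in> cocycles" and e: "e \<in> carrier E" "e' \<in> carrier E" "e'' \<in> carrier E"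
  shows "e \<otimes>\<^bsub>E\<^esub> k (\<chi> [f e', f e'']) \<oplus>\<^bsub>E\<^esub> k (\<chi> [f e, f e' \<otimes>\<^bsub>C\<^esub> f e''])
    = k (\<chi> [f e \<otimes>\<^bsub>C\<^esub> f e', f e'']) \<oplus>\<^bsub>E\<^esub> k (\<chi> [f e, f e']) \<otimes>\<^bsub>E\<^esub> e''"
proof -
  note \<chi>K = cocycleD(5)[OF \<chi>] and \<chi>Z = cocycleD(4)[OF \<chi>]
  note act = \<xi>C_act[OF \<pi>_closed p_\<pi>]
  have c: "e \<otimes>\<^bsub>E\<^esub> k (\<chi> [f e', f e'']) \<in> carrier E" "k (\<chi> [f e \<otimes>\<^bsub>C\<^esub> f e', f e'']) \<in> carrier E"
    "k (\<chi> [f e, f e' \<otimes>\<^bsub>C\<^esub> f e'']) \<in> carrier E" "k (\<chi> [f e, f e']) \<otimes>\<^bsub>E\<^esub> e'' \<in> carrier E"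
    using e by (simp_all add: \<chi>K)
  have "\<pi> e \<triangleright> \<chi> [f e', f e''] \<ominus>\<^bsub>K\<^esub> \<chi> [f e \<otimes>\<^bsub>C\<^esub> f e', f e''] \<oplus>\<^bsub>K\<^esub> \<chi> [f e, f e' \<otimes>\<^bsub>C\<^esub> f e'']
      \<ominus>\<^bsub>K\<^esub> \<chi> [f e, f e'] \<triangleleft> \<pi> e'' = \<zero>\<^bsub>K\<^esub>"
    using e cocycleD(7)[OF \<chi>, of "f e" "f e'" "f e''"]
    by (simp add: bimodule.hh_delta_2[where f = \<chi>, OF bimod_C \<chi>Z] act \<chi>Z Z_closed(2-) ann_alg_minus)
  then have "k (\<pi> e \<triangleright> \<chi> [f e', f e''] \<ominus>\<^bsub>K\<^esub> \<chi> [f e \<otimes>\<^bsub>C\<^esub> f e', f e''] \<oplus>\<^bsub>K\<^esub> \<chi> [f e, f e' \<otimes>\<^bsub>C\<^esub> f e'']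
      \<ominus>\<^bsub>K\<^esub> \<chi> [f e, f e'] \<triangleleft> \<pi> e'') = \<zero>\<^bsub>E\<^esub>"
    by (simp only: k_zero)
  then have z: "e \<otimes>\<^bsub>E\<^esub> k (\<chi> [f e', f e'']) \<ominus>\<^bsub>E\<^esub> k (\<chi> [f e \<otimes>\<^bsub>C\<^esub> f e', f e''])
      \<oplus>\<^bsub>E\<^esub> k (\<chi> [f e, f e' \<otimes>\<^bsub>C\<^esub> f e'']) \<ominus>\<^bsub>E\<^esub> k (\<chi> [f e, f e']) \<otimes>\<^bsub>E\<^esub> e'' = \<zero>\<^bsub>E\<^esub>"
    using e by (simp add: k_add k_minus k_act \<chi>K)
  have "a \<oplus>\<^bsub>E\<^esub> c = b \<oplus>\<^bsub>E\<^esub> u" if abcu: "a \<in> carrier E" "b \<in> carrier E" "c \<in> carrier E" "u \<in> carrier E"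
    and "a \<ominus>\<^bsub>E\<^esub> b \<oplus>\<^bsub>E\<^esub> c \<ominus>\<^bsub>E\<^esub> u = \<zero>\<^bsub>E\<^esub>" for a b c u
  proof -
    have "a \<oplus>\<^bsub>E\<^esub> c = (a \<ominus>\<^bsub>E\<^esub> b \<oplus>\<^bsub>E\<^esub> c \<ominus>\<^bsub>E\<^esub> u) \<oplus>\<^bsub>E\<^esub> (b \<oplus>\<^bsub>E\<^esub> u)"
      using abcu by algebra
    then show ?thesis
      using abcu by (simp add: that(5))
  qed
  from this[OF c z] show ?thesis .
qed

text \<open>The same \<pi> serves the twist. The values of \<chi> lie in the kernel of d, so \<pi>
  stays multiplicative; and \<chi> vanishes when one argument is f (k x) = 0, so products with k x
  do not change.\<close>

lemma twist_lifting:
  assumes \<chi>: "\<chi> \<in> cocycles"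
  shows "lifting (twisted \<chi>) k f \<pi>"
proof -
  note \<chi>K = cocycleD(5)[OF \<chi>] and \<chi>0 = cocycleD(8,9)[OF \<chi>]
  note bil = bilinear_mapD(2-)[OF cocycleD(2)[OF \<chi>], simplified ann_alg_simps]
  have ks: "k (\<chi> [f e, f e']) \<in> carrier E" if "e \<in> carrier E" "e' \<in> carrier E" for e e'
    using that by (simp add: \<chi>K)
  have lin: "lin_space F (twisted \<chi>)"
    by (rule lin_space_image[OF E_lin, where h = "\<lambda>e. e"]) simp_all
  have assoc: "e \<otimes>\<^bsub>twisted \<chi>\<^esub> e' \<otimes>\<^bsub>twisted \<chi>\<^esub> e'' = e \<otimes>\<^bsub>twisted \<chi>\<^esub> (e' \<otimes>\<^bsub>twisted \<chi>\<^esub> e'')"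
    if eE: "e \<in> carrier E" "e' \<in> carrier E" "e'' \<in> carrier E" for e e' e''
  proof -
    have "e \<otimes>\<^bsub>twisted \<chi>\<^esub> e' \<otimes>\<^bsub>twisted \<chi>\<^esub> e'' = e \<otimes>\<^bsub>E\<^esub> e' \<otimes>\<^bsub>E\<^esub> e''
        \<oplus>\<^bsub>E\<^esub> (k (\<chi> [f e \<otimes>\<^bsub>C\<^esub> f e', f e'']) \<oplus>\<^bsub>E\<^esub> k (\<chi> [f e, f e']) \<otimes>\<^bsub>E\<^esub> e'')"
      using eE by (simp add: \<chi>K f_simps E.l_distr E.a_ac)
    also have "\<dots> = e \<otimes>\<^bsub>twisted \<chi>\<^esub> (e' \<otimes>\<^bsub>twisted \<chi>\<^esub> e'')"
      unfolding k_cocycle[OF \<chi> eE, symmetric]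
      using eE by (simp add: \<chi>K f_simps E.r_distr E.m_assoc E.a_ac)
    finally show ?thesis .
  qed
  have alg: "unital_algebra F (twisted \<chi>)"
  proof (intro unital_algebra.intro assoc_algebra.intro assoc_algebra_axioms.intro lin monoidI)
    fix e e' e'' assume e: "e \<in> carrier (twisted \<chi>)" "e' \<in> carrier (twisted \<chi>)" "e'' \<in> carrier (twisted \<chi>)"
    show "(e \<oplus>\<^bsub>twisted \<chi>\<^esub> e') \<otimes>\<^bsub>twisted \<chi>\<^esub> e'' = e \<otimes>\<^bsub>twisted \<chi>\<^esub> e'' \<oplus>\<^bsub>twisted \<chi>\<^esub> e' \<otimes>\<^bsub>twisted \<chi>\<^esub> e''"
      "e'' \<otimes>\<^bsub>twisted \<chi>\<^esub> (e \<oplus>\<^bsub>twisted \<chi>\<^esub> e') = e'' \<otimes>\<^bsub>twisted \<chi>\<^esub> e \<oplus>\<^bsub>twisted \<chi>\<^esub> e'' \<otimes>\<^bsub>twisted \<chi>\<^esub> e'"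
      using e by (simp_all add: \<chi>K f_simps bil k_add E.l_distr E.r_distr E.a_ac)
    show "e \<otimes>\<^bsub>twisted \<chi>\<^esub> e' \<otimes>\<^bsub>twisted \<chi>\<^esub> e'' = e \<otimes>\<^bsub>twisted \<chi>\<^esub> (e' \<otimes>\<^bsub>twisted \<chi>\<^esub> e'')"
      by (rule assoc) (use e in simp_all)
    then show "e \<otimes>\<^bsub>twisted \<chi>\<^esub> e' \<otimes>\<^bsub>twisted \<chi>\<^esub> e'' = e \<otimes>\<^bsub>twisted \<chi>\<^esub> (e' \<otimes>\<^bsub>twisted \<chi>\<^esub> e'')" .
  next
    fix r e e' assume "r \<in> carrier F" "e \<in> carrier (twisted \<chi>)" "e' \<in> carrier (twisted \<chi>)"
    then show "(r \<odot>\<^bsub>twisted \<chi>\<^esub> e) \<otimes>\<^bsub>twisted \<chi>\<^esub> e' = r \<odot>\<^bsub>twisted \<chi>\<^esub> (e \<otimes>\<^bsub>twisted \<chi>\<^esub> e')"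
      "e \<otimes>\<^bsub>twisted \<chi>\<^esub> (r \<odot>\<^bsub>twisted \<chi>\<^esub> e') = r \<odot>\<^bsub>twisted \<chi>\<^esub> (e \<otimes>\<^bsub>twisted \<chi>\<^esub> e')"
      by (simp_all add: \<chi>K f_simps bil k_smult E_smult)
  next
    fix e assume "e \<in> carrier (twisted \<chi>)"
    then have e: "e \<in> carrier E" by simp
    have f1: "f (\<one>\<^bsub>E\<^esub> \<ominus>\<^bsub>E\<^esub> k (\<chi> [\<one>\<^bsub>C\<^esub>, \<one>\<^bsub>C\<^esub>])) = \<one>\<^bsub>C\<^esub>"
      by (simp add: f_neg f_simps \<chi>K a_minus_def)
    \<comment> \<open>Under k, the cocycle identity at (1, 1, f e) gives \<chi>(1, 1) e = \<chi>(1,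
      f e), and at (f e, 1, 1) the mirror image. Hence 1 - k (\<chi>(1, 1)) is a unit on both
      sides.\<close>
    have "k (\<chi> [\<one>\<^bsub>C\<^esub>, f e]) \<oplus>\<^bsub>E\<^esub> k (\<chi> [\<one>\<^bsub>C\<^esub>, f e]) = k (\<chi> [\<one>\<^bsub>C\<^esub>, f e]) \<oplus>\<^bsub>E\<^esub> k (\<chi> [\<one>\<^bsub>C\<^esub>, \<one>\<^bsub>C\<^esub>]) \<otimes>\<^bsub>E\<^esub> e"
      using k_cocycle[OF \<chi> E.one_closed E.one_closed e] e by (simp add: f_simps \<chi>K)
    then have l: "k (\<chi> [\<one>\<^bsub>C\<^esub>, \<one>\<^bsub>C\<^esub>]) \<otimes>\<^bsub>E\<^esub> e = k (\<chi> [\<one>\<^bsub>C\<^esub>, f e])"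
      using e by (simp add: \<chi>K)
    have "e \<otimes>\<^bsub>E\<^esub> k (\<chi> [\<one>\<^bsub>C\<^esub>, \<one>\<^bsub>C\<^esub>]) \<oplus>\<^bsub>E\<^esub> k (\<chi> [f e, \<one>\<^bsub>C\<^esub>]) = k (\<chi> [f e, \<one>\<^bsub>C\<^esub>]) \<oplus>\<^bsub>E\<^esub> k (\<chi> [f e, \<one>\<^bsub>C\<^esub>])"
      using k_cocycle[OF \<chi> e E.one_closed E.one_closed] e by (simp add: f_simps \<chi>K)
    then have r: "e \<otimes>\<^bsub>E\<^esub> k (\<chi> [\<one>\<^bsub>C\<^esub>, \<one>\<^bsub>C\<^esub>]) = k (\<chi> [f e, \<one>\<^bsub>C\<^esub>])"
      using e by (simp add: \<chi>K)
    show "\<one>\<^bsub>twisted \<chi>\<^esub> \<otimes>\<^bsub>twisted \<chi>\<^esub> e = e"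
      using e by (simp add: f1) (simp add: a_minus_def E.l_distr E.l_minus l \<chi>K E.a_assoc E.l_neg)
    show "e \<otimes>\<^bsub>twisted \<chi>\<^esub> \<one>\<^bsub>twisted \<chi>\<^esub> = e"
      using e by (simp add: f1) (simp add: a_minus_def E.r_distr E.r_minus r \<chi>K E.a_assoc E.l_neg)
  qed (simp_all add: \<chi>K)
  have ext': "(twisted \<chi>, k, f) \<in> extensions F C K"
    unfolding extensions_def mem_Collect_eq case_prod_conv
  proof (intro conjI alg k_inj)
    show "k \<in> alg_hom F K (twisted \<chi>)"
      using k_linear by (simp add: alg_hom_def linear_map_def k_mult \<chi>0)
    show "f \<in> unital_alg_hom F (twisted \<chi>) C"
      by (intro unital_alg_homI linear_mapI) (simp_all add: f_simps \<chi>K f_neg a_minus_def)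
  qed (simp_all add: image_k image_f)
  show ?thesis
    unfolding lifting_def
  proof (intro conjI ballI ext')
    show "\<pi> \<in> unital_alg_hom F (twisted \<chi>) A"
      by (intro unital_alg_homI linear_mapI)
        (simp_all add: \<pi>_simps \<chi>K cocycleD(6)[OF \<chi>] a_minus_def
          linear_map_neg[OF E_lin A_lin unital_alg_homD(1)[OF \<pi>_hom]])
  qed (simp_all add: k_act p_\<pi> \<chi>0)
qed

lemma twist_extension: "\<chi> \<in> cocycles \<Longrightarrow> (twisted \<chi>, k, f) \<in> extensions F C K"
  using twist_lifting by (simp add: lifting_def)

lemma twisted_alg: "\<chi> \<in> cocycles \<Longrightarrow> unital_algebra F (twisted \<chi>)"
  by (rule extensionsD(1)[OF twist_extension])

text \<open>Any elements e, e' over the two arguments may be taken: their images under \<pi> are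
  lifts to A, so acting on values of t becomes multiplication in E.\<close>

lemma delta_1:
  assumes t: "t \<in> hh_cochains F C (ann_alg K) (Suc 0)" and e: "e \<in> carrier E" "e' \<in> carrier E"
  shows "k (hh_delta C (ann_alg K) \<xi>C (Suc 0) t [f e, f e'])
    = e \<otimes>\<^bsub>E\<^esub> k (t [f e']) \<ominus>\<^bsub>E\<^esub> k (t [f e \<otimes>\<^bsub>C\<^esub> f e']) \<oplus>\<^bsub>E\<^esub> k (t [f e]) \<otimes>\<^bsub>E\<^esub> e'"
proof -
  note tZ = linear_mapD(1)[OF hh_cochains_1_linear[OF t]]
  note act = \<xi>C_act[OF \<pi>_closed p_\<pi>]
  show ?thesis
    using e by (simp add: bimodule.hh_delta_1[where f = t, OF bimod_C tZ] act tZ Z_closed(2-)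
        ann_alg_minus k_add k_minus k_act)
qed

lemma twist_rel_if_class_eq:
  assumes \<chi>: "\<chi> \<in> cocycles" and \<chi>': "\<chi>' \<in> cocycles"
    and cls: "hh_class F C (ann_alg K) \<xi>C 2 \<chi> = hh_class F C (ann_alg K) \<xi>C 2 \<chi>'"
  shows "(twist C \<chi> (E, k, f), twist C \<chi>' (E, k, f)) \<in> ext_rel F C K"
proof -
  note \<chi>K = cocycleD(5)[OF \<chi>] and \<chi>K' = cocycleD(5)[OF \<chi>']
  have "\<exists>b\<in>hh_coboundaries F C (ann_alg K) \<xi>C 2. \<chi> = cochain_add C (ann_alg K) 2 b \<chi>'"
    by (rule iffD1[OF hh_class_2_eq_iff[OF cocycleD(3)[OF \<chi>] cocycleD(3)[OF \<chi>']] cls])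
  then obtain t where t: "t \<in> hh_cochains F C (ann_alg K) (Suc 0)"
    and \<chi>t: "\<chi> = cochain_add C (ann_alg K) 2 (hh_delta C (ann_alg K) \<xi>C (Suc 0) t) \<chi>'"
    unfolding coboundaries_2 by (elim bexE imageE) (rule that, assumption, simp only:)
  note ts = linear_mapD[OF hh_cochains_1_linear[OF t], simplified ann_alg_simps]
  have tK: "t [c] \<in> carrier K" if "c \<in> carrier C" for c
    by (rule Z_K[OF ts(1)[OF that]])
  have t0: "t [\<zero>\<^bsub>C\<^esub>] = \<zero>\<^bsub>K\<^esub>"
    using linear_map_zero[OF C_lin Z_lin hh_cochains_1_linear[OF t]] by simp
  have \<delta>P: "hh_delta C (ann_alg K) \<xi>C (Suc 0) t \<in> tuples C 2 \<rightarrow>\<^sub>E Z"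
    by (rule bimodule.hh_delta_closed[OF bimod_C, of t "Suc 0", unfolded Suc_1_eq_2])
      (use hh_cochains_PiE[OF t] in auto)
  have \<delta>Z: "hh_delta C (ann_alg K) \<xi>C (Suc 0) t [c, c'] \<in> Z" if "c \<in> carrier C" "c' \<in> carrier C" for c c'
    by (rule PiE_const_mem[OF \<delta>P]) (simp add: that)
  have k\<chi>: "k (\<chi> [f e, f e']) = (e \<otimes>\<^bsub>E\<^esub> k (t [f e']) \<ominus>\<^bsub>E\<^esub> k (t [f e \<otimes>\<^bsub>C\<^esub> f e']) \<oplus>\<^bsub>E\<^esub> k (t [f e]) \<otimes>\<^bsub>E\<^esub> e')
      \<oplus>\<^bsub>E\<^esub> k (\<chi>' [f e, f e'])" if "e \<in> carrier E" "e' \<in> carrier E" for e e'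
  proof -
    have "\<chi> [f e, f e'] = hh_delta C (ann_alg K) \<xi>C (Suc 0) t [f e, f e'] \<oplus>\<^bsub>K\<^esub> \<chi>' [f e, f e']"
      using that by (subst \<chi>t) simp
    then show ?thesis
      using that by (simp add: k_add \<delta>Z \<chi>K' delta_1[OF t])
  qed
  let ?h = "\<lambda>e. e \<oplus>\<^bsub>E\<^esub> k (t [f e])"
  have fh: "f (?h e) = f e" if "e \<in> carrier E" for e
    using that by (simp add: f_simps tK)
  show ?thesis
    unfolding twist_eq
  proof (rule ext_relI[OF twist_extension[OF \<chi>] twist_extension[OF \<chi>']])
    show "?h \<in> unital_alg_iso F (twisted \<chi>) (twisted \<chi>')"
    proof (rule unital_alg_isoI[OF twisted_alg[OF \<chi>] twisted_alg[OF \<chi>']])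
      show "?h \<in> linear_map F (twisted \<chi>) (twisted \<chi>')"
        by (rule linear_mapI) (simp_all add: tK f_simps ts(2,3) k_add k_smult E_smult E.a_ac)
      show "bij_betw ?h (carrier (twisted \<chi>)) (carrier (twisted \<chi>'))"
      proof (rule bij_betwI)
        let ?i = "\<lambda>e. e \<ominus>\<^bsub>E\<^esub> k (t [f e])"
        show "?h \<in> carrier (twisted \<chi>) \<rightarrow> carrier (twisted \<chi>')"
          "?i \<in> carrier (twisted \<chi>') \<rightarrow> carrier (twisted \<chi>)"
          by (simp_all add: tK)
        fix e assume "e \<in> carrier (twisted \<chi>)"
        then have e: "e \<in> carrier E" by simp
        show "?i (?h e) = e"
          unfolding fh[OF e] using e by (simp add: tK E.a_assoc a_minus_def E.r_neg)
      next
        let ?i = "\<lambda>e. e \<ominus>\<^bsub>E\<^esub> k (t [f e])"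
        fix e assume "e \<in> carrier (twisted \<chi>')"
        then have e: "e \<in> carrier E" by simp
        have fi: "f (?i e) = f e"
          using e by (simp add: f_simps f_neg tK a_minus_def)
        show "?h (?i e) = e"
          unfolding fi using e by (simp add: tK E.a_assoc a_minus_def E.l_neg)
      qed
      fix e e' assume "e \<in> carrier (twisted \<chi>)" "e' \<in> carrier (twisted \<chi>)"
      then have e: "e \<in> carrier E" "e' \<in> carrier E" by simp_all
      \<comment> \<open>Both factors come from Z(K), so the quadratic term in the product of
        \<open>?h e\<close> and \<open>?h e'\<close> vanishes. The mixed terms, less the shift of
        the product, make up \<delta>t.\<close>
      have tt: "k (t [f e]) \<otimes>\<^bsub>E\<^esub> k (t [f e']) = \<zero>\<^bsub>E\<^esub>"
        using e Z_mult(1)[OF ts(1)[of "f e"] tK[of "f e'"]] by (simp add: tK flip: k_mult)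
      have c: "e \<otimes>\<^bsub>E\<^esub> e' \<in> carrier E" "e \<otimes>\<^bsub>E\<^esub> k (t [f e']) \<in> carrier E" "k (t [f e \<otimes>\<^bsub>C\<^esub> f e']) \<in> carrier E"
        "k (t [f e]) \<otimes>\<^bsub>E\<^esub> e' \<in> carrier E" "k (\<chi>' [f e, f e']) \<in> carrier E"
        using e by (simp_all add: tK \<chi>K')
      have "?h (e \<otimes>\<^bsub>twisted \<chi>\<^esub> e') = e \<otimes>\<^bsub>E\<^esub> e' \<oplus>\<^bsub>E\<^esub> ((e \<otimes>\<^bsub>E\<^esub> k (t [f e']) \<ominus>\<^bsub>E\<^esub> k (t [f e \<otimes>\<^bsub>C\<^esub> f e'])
          \<oplus>\<^bsub>E\<^esub> k (t [f e]) \<otimes>\<^bsub>E\<^esub> e') \<oplus>\<^bsub>E\<^esub> k (\<chi>' [f e, f e'])) \<oplus>\<^bsub>E\<^esub> k (t [f e \<otimes>\<^bsub>C\<^esub> f e'])"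
        using e by (simp add: f_simps \<chi>K flip: k\<chi>)
      \<comment> \<open>The summand zero holds the place of the vanishing quadratic term, which the
        next step puts back.\<close>
      also have "\<dots> = e \<otimes>\<^bsub>E\<^esub> e' \<oplus>\<^bsub>E\<^esub> e \<otimes>\<^bsub>E\<^esub> k (t [f e']) \<oplus>\<^bsub>E\<^esub> (k (t [f e]) \<otimes>\<^bsub>E\<^esub> e' \<oplus>\<^bsub>E\<^esub> \<zero>\<^bsub>E\<^esub>)
          \<oplus>\<^bsub>E\<^esub> k (\<chi>' [f e, f e'])"
        using c by algebra
      also have "\<dots> = ?h e \<otimes>\<^bsub>twisted \<chi>'\<^esub> ?h e'"
        unfolding twisted_simps fh[OF e(1)] fh[OF e(2)] tt[symmetric]
        using e by (simp add: tK \<chi>K' E.l_distr E.r_distr E.a_ac)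
      finally show "?h (e \<otimes>\<^bsub>twisted \<chi>\<^esub> e') = ?h e \<otimes>\<^bsub>twisted \<chi>'\<^esub> ?h e'" .
    qed
    show "?h (k x) = k x" if "x \<in> carrier K" for x
      using that by (simp add: t0)
    show "f (?h e) = f e" if "e \<in> carrier (twisted \<chi>)" for e
      using fh that by simp
  qed
qed

lemma class_eq_if_twist_rel:
  assumes \<chi>: "\<chi> \<in> cocycles" and \<chi>': "\<chi>' \<in> cocycles"
    and rel: "(twist C \<chi> (E, k, f), twist C \<chi>' (E, k, f)) \<in> ext_rel F C K"
  shows "hh_class F C (ann_alg K) \<xi>C 2 \<chi> = hh_class F C (ann_alg K) \<xi>C 2 \<chi>'"
proof -
  note \<chi>K = cocycleD(5)[OF \<chi>] and \<chi>K' = cocycleD(5)[OF \<chi>']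
  obtain h where "h \<in> unital_alg_iso F (twisted \<chi>) (twisted \<chi>')"
    and hk: "\<And>x. x \<in> carrier K \<Longrightarrow> h (k x) = k x" and "\<And>e. e \<in> carrier (twisted \<chi>) \<Longrightarrow> f (h e) = f e"
    using rel unfolding twist_eq by (rule ext_relE) (rule that, assumption, simp_all)
  then have h: "h \<in> unital_alg_hom F (twisted \<chi>) (twisted \<chi>')" and fh: "\<And>e. e \<in> carrier E \<Longrightarrow> f (h e) = f e"
    by (simp_all add: unital_alg_iso_def)
  note hs = unital_alg_homD(4-7)[OF h, simplified twisted_simps]
  obtain r where r: "r \<in> linear_map F C E" and fr: "\<And>x. x \<in> carrier C \<Longrightarrow> f (r x) = x"
    by (rule linear_section_exists[OF E_lin C_lin unital_alg_homD(1)[OF f_hom] image_f])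
      (rule that, simp_all)
  note rs = linear_mapD[OF r]
  \<comment> \<open>f h = f, so h shifts each element by something in k(K); t records the shift
    along a section.\<close>
  define t where "t c = k_inv (h (r c) \<ominus>\<^bsub>E\<^esub> r c)" for c
  have t: "t c \<in> carrier K" "k (t c) = h (r c) \<ominus>\<^bsub>E\<^esub> r c" if "c \<in> carrier C" for c
    unfolding t_def using that by (simp_all add: k_inv rs(1) hs(1) f_minus fh)
  \<comment> \<open>h fixes k(K), so the shift of e depends only on f e.\<close>
  have ht: "h e = e \<oplus>\<^bsub>E\<^esub> k (t (f e))" if e: "e \<in> carrier E" for e
  proof -
    let ?x = "k_inv (e \<ominus>\<^bsub>E\<^esub> r (f e))"
    have x: "?x \<in> carrier K" "k ?x = e \<ominus>\<^bsub>E\<^esub> r (f e)"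
      using e by (simp_all add: k_inv rs(1) f_minus fr)
    have ce: "e = k ?x \<oplus>\<^bsub>E\<^esub> r (f e)"
      unfolding x(2) using e by (simp add: rs(1) E.add_minus_cancel)
    have "h e = k ?x \<oplus>\<^bsub>E\<^esub> h (r (f e))"
      using hs(2)[of "k ?x" "r (f e)"] x(1) e by (simp add: hk rs(1) flip: ce)
    also have "\<dots> = e \<oplus>\<^bsub>E\<^esub> k (t (f e))"
    proof -
      have c: "r (f e) \<in> carrier E" "h (r (f e)) \<in> carrier E"
        using e by (simp_all add: rs(1) hs(1))
      show ?thesis
        unfolding x(2) t(2)[OF f_closed[OF e]] using e c by algebra
    qed
    finally show ?thesis .
  qed
  \<comment> \<open>h fixes k x and also its products with elements of E, as these lie in k(K) and
    twisting adds nothing to them. Multiplicativity then forces the shift t c to annihilate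
    K.\<close>
  have tZ: "t c \<in> Z" if c: "c \<in> carrier C" for c
  proof -
    have "t c \<otimes>\<^bsub>K\<^esub> x = \<zero>\<^bsub>K\<^esub> \<and> x \<otimes>\<^bsub>K\<^esub> t c = \<zero>\<^bsub>K\<^esub>" if x: "x \<in> carrier K" for x
    proof -
      let ?e = "r c"
      have e: "?e \<in> carrier E" by (rule rs(1)[OF c])
      have kk: "?e \<otimes>\<^bsub>E\<^esub> k x = k (\<pi> ?e \<triangleright> x)" "k x \<otimes>\<^bsub>E\<^esub> ?e = k (x \<triangleleft> \<pi> ?e)"
        using e x by (simp_all add: k_act)
      have "h (?e \<otimes>\<^bsub>E\<^esub> k x) = h ?e \<otimes>\<^bsub>E\<^esub> k x" "h (k x \<otimes>\<^bsub>E\<^esub> ?e) = k x \<otimes>\<^bsub>E\<^esub> h ?e"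
        using hs(4)[OF e k_closed[OF x]] hs(4)[OF k_closed[OF x] e] e x c
        by (simp_all add: cocycleD(8,9)[OF \<chi>] cocycleD(8,9)[OF \<chi>'] hk fh hs(1))
      moreover have "h (?e \<otimes>\<^bsub>E\<^esub> k x) = ?e \<otimes>\<^bsub>E\<^esub> k x" "h (k x \<otimes>\<^bsub>E\<^esub> ?e) = k x \<otimes>\<^bsub>E\<^esub> ?e"
        unfolding kk using e x by (simp_all add: hk)
      ultimately have "?e \<otimes>\<^bsub>E\<^esub> k x \<oplus>\<^bsub>E\<^esub> k (t c) \<otimes>\<^bsub>E\<^esub> k x = ?e \<otimes>\<^bsub>E\<^esub> k x"
        "k x \<otimes>\<^bsub>E\<^esub> ?e \<oplus>\<^bsub>E\<^esub> k x \<otimes>\<^bsub>E\<^esub> k (t c) = k x \<otimes>\<^bsub>E\<^esub> ?e"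
        using e x c by (simp_all add: ht fr t(1) E.l_distr E.r_distr)
      then have "k (t c) \<otimes>\<^bsub>E\<^esub> k x = \<zero>\<^bsub>E\<^esub>" "k x \<otimes>\<^bsub>E\<^esub> k (t c) = \<zero>\<^bsub>E\<^esub>"
        using e x c by (simp_all add: t(1))
      then show ?thesis
        using x c by (simp add: t(1) k_eq_zero_iff flip: k_mult)
    qed
    then show ?thesis
      by (intro Z_memI t(1)[OF c])
  qed
  have t_lin: "t \<in> linear_map F C (ann_alg K)"
  proof (rule linear_mapI)
    fix c assume c: "c \<in> carrier C"
    show "t c \<in> Z" by (rule tZ[OF c])
    show "t (c \<oplus>\<^bsub>C\<^esub> c') = t c \<oplus>\<^bsub>ann_alg K\<^esub> t c'" if c': "c' \<in> carrier C" for c'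
    proof -
      have "k (t (c \<oplus>\<^bsub>C\<^esub> c')) = k (t c \<oplus>\<^bsub>K\<^esub> t c')"
        using c c' by (simp add: t k_add rs hs(1,2) a_minus_def E.minus_add E.a_ac)
      then show ?thesis
        using c c' by (simp add: k_eq_iff t(1))
    qed
    show "t (s \<odot>\<^bsub>C\<^esub> c) = s \<odot>\<^bsub>ann_alg K\<^esub> t c" if s: "s \<in> carrier F" for s
    proof -
      have "k (t (s \<odot>\<^bsub>C\<^esub> c)) = k (s \<odot>\<^bsub>K\<^esub> t c)"
        using c s by (simp add: t k_smult rs hs(1,3) a_minus_def E_smult)
      then show ?thesis
        using c s by (simp add: k_eq_iff t(1))
    qed
  qed
  define T where "T = (\<lambda>xs\<in>tuples C (Suc 0). t (hd xs))"
  have T: "T \<in> hh_cochains F C (ann_alg K) (Suc 0)"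
    unfolding T_def by (rule linear_hh_cochain[OF C_alg t_lin])
  have Tt: "T [c] = t c" if "c \<in> carrier C" for c
    using that by (simp add: T_def)
  let ?b = "hh_delta C (ann_alg K) \<xi>C (Suc 0) T"
  have bP: "?b \<in> tuples C 2 \<rightarrow>\<^sub>E Z"
    by (rule bimodule.hh_delta_closed[OF bimod_C, of T "Suc 0", unfolded Suc_1_eq_2])
      (use hh_cochains_PiE[OF T] in auto)
  have "\<chi> = cochain_add C (ann_alg K) 2 ?b \<chi>'"
  proof (rule PiE_eqI[OF cocycleD(3)[OF \<chi>]])
    show "cochain_add C (ann_alg K) 2 ?b \<chi>' \<in> tuples C 2 \<rightarrow>\<^sub>E Z"
      using PiE_const_mem[OF bP] PiE_const_mem[OF cocycleD(3)[OF \<chi>']] by (auto intro!: Z_closed(2))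
    fix xs assume xs: "xs \<in> tuples C 2"
    then obtain a b where ab: "xs = [a, b]" "a \<in> carrier C" "b \<in> carrier C"
      by (auto simp: tuples_2_iff)
    have bZ: "?b [a, b] \<in> carrier K"
      by (rule Z_K[OF PiE_const_mem[OF bP]]) (simp add: ab)
    let ?e = "r a" and ?e' = "r b"
    have e: "?e \<in> carrier E" "?e' \<in> carrier E"
      using ab by (simp_all add: rs(1))
    have c: "?e \<otimes>\<^bsub>E\<^esub> ?e' \<in> carrier E" "k (\<chi> [a, b]) \<in> carrier E" "k (t (a \<otimes>\<^bsub>C\<^esub> b)) \<in> carrier E"
      "?e \<otimes>\<^bsub>E\<^esub> k (t b) \<in> carrier E" "k (t a) \<otimes>\<^bsub>E\<^esub> ?e' \<in> carrier E" "k (\<chi>' [a, b]) \<in> carrier E"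
      using ab e by (simp_all add: \<chi>K \<chi>K' t(1))
    have tt: "k (t a) \<otimes>\<^bsub>E\<^esub> k (t b) = \<zero>\<^bsub>E\<^esub>"
      using ab Z_mult(1)[OF tZ[of a] t(1)[of b]] by (simp add: t(1) flip: k_mult)
    \<comment> \<open>Multiplicativity of h at r a and r b, read with h e = e + k (t (f e)), is the
      equation \<chi> = \<delta>t + \<chi>' at (a, b).\<close>
    have "h (?e \<otimes>\<^bsub>E\<^esub> ?e' \<oplus>\<^bsub>E\<^esub> k (\<chi> [a, b])) = h ?e \<otimes>\<^bsub>E\<^esub> h ?e' \<oplus>\<^bsub>E\<^esub> k (\<chi>' [a, b])"
      using hs(4)[OF e] ab e by (simp add: fr fh)
    then have "?e \<otimes>\<^bsub>E\<^esub> ?e' \<oplus>\<^bsub>E\<^esub> k (\<chi> [a, b]) \<oplus>\<^bsub>E\<^esub> k (t (a \<otimes>\<^bsub>C\<^esub> b))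
        = (?e \<otimes>\<^bsub>E\<^esub> ?e' \<oplus>\<^bsub>E\<^esub> k (t a) \<otimes>\<^bsub>E\<^esub> ?e') \<oplus>\<^bsub>E\<^esub> (?e \<otimes>\<^bsub>E\<^esub> k (t b) \<oplus>\<^bsub>E\<^esub> \<zero>\<^bsub>E\<^esub>) \<oplus>\<^bsub>E\<^esub> k (\<chi>' [a, b])"
      unfolding tt[symmetric] using ab e
      by (simp add: ht fr f_simps \<chi>K \<chi>K' t(1) E.l_distr E.r_distr)
    then have eq: "?e \<otimes>\<^bsub>E\<^esub> ?e' \<oplus>\<^bsub>E\<^esub> (k (\<chi> [a, b]) \<oplus>\<^bsub>E\<^esub> k (t (a \<otimes>\<^bsub>C\<^esub> b)))
        = ?e \<otimes>\<^bsub>E\<^esub> ?e' \<oplus>\<^bsub>E\<^esub> (k (t a) \<otimes>\<^bsub>E\<^esub> ?e' \<oplus>\<^bsub>E\<^esub> ?e \<otimes>\<^bsub>E\<^esub> k (t b) \<oplus>\<^bsub>E\<^esub> k (\<chi>' [a, b]))"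
      using c by (simp add: E.a_ac)
    have eq': "k (\<chi> [a, b]) \<oplus>\<^bsub>E\<^esub> k (t (a \<otimes>\<^bsub>C\<^esub> b))
        = k (t a) \<otimes>\<^bsub>E\<^esub> ?e' \<oplus>\<^bsub>E\<^esub> ?e \<otimes>\<^bsub>E\<^esub> k (t b) \<oplus>\<^bsub>E\<^esub> k (\<chi>' [a, b])"
      by (rule E.add.l_cancel[OF eq]) (use c in simp_all)
    have "k (\<chi> [a, b]) = (k (\<chi> [a, b]) \<oplus>\<^bsub>E\<^esub> k (t (a \<otimes>\<^bsub>C\<^esub> b))) \<ominus>\<^bsub>E\<^esub> k (t (a \<otimes>\<^bsub>C\<^esub> b))"
      using c by (simp add: E.a_assoc a_minus_def E.r_neg)
    also have "\<dots> = (?e \<otimes>\<^bsub>E\<^esub> k (t b) \<ominus>\<^bsub>E\<^esub> k (t (a \<otimes>\<^bsub>C\<^esub> b)) \<oplus>\<^bsub>E\<^esub> k (t a) \<otimes>\<^bsub>E\<^esub> ?e') \<oplus>\<^bsub>E\<^esub> k (\<chi>' [a, b])"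
      unfolding eq' using c by (simp add: a_minus_def E.a_ac)
    also have "\<dots> = k (?b [a, b]) \<oplus>\<^bsub>E\<^esub> k (\<chi>' [a, b])"
      using delta_1[OF T e] ab by (simp add: fr Tt)
    also have "\<dots> = k (?b [a, b] \<oplus>\<^bsub>K\<^esub> \<chi>' [a, b])"
      using bZ ab by (simp add: k_add \<chi>K')
    finally show "\<chi> xs = cochain_add C (ann_alg K) 2 ?b \<chi>' xs"
      using bZ ab by (simp add: k_eq_iff \<chi>K \<chi>K')
  qed
  then show ?thesis
    by (rule iffD2[OF hh_class_2_eq_iff[OF cocycleD(3)[OF \<chi>] cocycleD(3)[OF \<chi>']] bexI])
      (unfold coboundaries_2, rule imageI, rule T)
qed

text \<open>The added term is built from k and f, which an isomorphism of extensions respects; so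
  the same h is an isomorphism of the twists.\<close>

lemma twist_cong:
  assumes \<chi>: "\<chi> \<in> cocycles" and T: "kernel_extension F C K D \<psi> E' k' f' \<pi>'"
    and rel: "((E, k, f), (E', k', f')) \<in> ext_rel F C K"
  shows "(twist C \<chi> (E, k, f), twist C \<chi> (E', k', f')) \<in> ext_rel F C K"
proof -
  note \<chi>K = cocycleD(5)[OF \<chi>]
  obtain h where h: "h \<in> unital_alg_iso F E E'"
    and hk: "\<And>x. x \<in> carrier K \<Longrightarrow> h (k x) = k' x" and fh: "\<And>e. e \<in> carrier E \<Longrightarrow> f' (h e) = f e"
    using rel by (rule ext_relE) (rule that, assumption, simp_all)
  note hs = unital_alg_homD(4-7)[OF unital_alg_isoD(1)[OF h]]
  note T_simps = kernel_extension.twisted_simps[OF T]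
  show ?thesis
    unfolding twist_eq kernel_extension.twist_eq[OF T]
  proof (rule ext_relI[OF twist_extension[OF \<chi>] kernel_extension.twist_extension[OF T \<chi>]])
    show "h \<in> unital_alg_iso F (twisted \<chi>) (kernel_extension.twisted C E' k' f' \<chi>)"
    proof (rule unital_alg_isoI[OF twisted_alg[OF \<chi>] kernel_extension.twisted_alg[OF T \<chi>]])
      show "h \<in> linear_map F (twisted \<chi>) (kernel_extension.twisted C E' k' f' \<chi>)"
        by (rule linear_mapI) (simp_all add: T_simps hs)
      show "bij_betw h (carrier (twisted \<chi>)) (carrier (kernel_extension.twisted C E' k' f' \<chi>))"
        using h by (simp add: T_simps unital_alg_iso_def)
    qed (simp add: T_simps hs fh \<chi>K hk)
  qed (simp_all add: hk fh)
qed

text \<open>Carrier and addition agree and the two added terms sum up, so the identity is an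
  isomorphism.\<close>

lemma twist_twist:
  assumes \<chi>: "\<chi> \<in> cocycles" and \<chi>': "\<chi>' \<in> cocycles" and \<chi>'': "\<chi>'' \<in> cocycles"
    and sum: "\<And>a b. a \<in> carrier C \<Longrightarrow> b \<in> carrier C \<Longrightarrow> \<chi>'' [a, b] = \<chi> [a, b] \<oplus>\<^bsub>K\<^esub> \<chi>' [a, b]"
  shows "(twist C \<chi> (twist C \<chi>' (E, k, f)), twist C \<chi>'' (E, k, f)) \<in> ext_rel F C K"
proof -
  note \<chi>K = cocycleD(5)[OF \<chi>] cocycleD(5)[OF \<chi>']
  have T: "kernel_extension F C K D \<psi> (twisted \<chi>') k f \<pi>"
    by (rule kernel_extensionI[OF twist_lifting[OF \<chi>']])
  note T_simps = kernel_extension.twisted_simps[OF T]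
  show ?thesis
    unfolding twist_eq kernel_extension.twist_eq[OF T]
  proof (rule ext_relI[where h = id, OF kernel_extension.twist_extension[OF T \<chi>] twist_extension[OF \<chi>'']])
    show "id \<in> unital_alg_iso F (kernel_extension.twisted C (twisted \<chi>') k f \<chi>) (twisted \<chi>'')"
    proof (rule unital_alg_isoI[OF kernel_extension.twisted_alg[OF T \<chi>] twisted_alg[OF \<chi>'']])
      show "id \<in> linear_map F (kernel_extension.twisted C (twisted \<chi>') k f \<chi>) (twisted \<chi>'')"
        by (rule linear_mapI) (simp_all add: T_simps)
    qed (simp_all add: T_simps sum k_add \<chi>K E.a_ac)
  qed simp_all
qed

lemma twist_zero:
  assumes \<chi>: "\<chi> \<in> cocycles" and zero: "\<And>a b. a \<in> carrier C \<Longrightarrow> b \<in> carrier C \<Longrightarrow> \<chi> [a, b] = \<zero>\<^bsub>K\<^esub>"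
  shows "(twist C \<chi> (E, k, f), (E, k, f)) \<in> ext_rel F C K"
  unfolding twist_eq
proof (rule ext_relI[where h = id, OF twist_extension[OF \<chi>] ext])
  show "id \<in> unital_alg_iso F (twisted \<chi>) E"
  proof (rule unital_alg_isoI[OF twisted_alg[OF \<chi>] E_alg])
    show "id \<in> linear_map F (twisted \<chi>) E"
      by (rule linear_mapI) simp_all
  qed (simp_all add: zero)
qed simp_all

text \<open>The section splits E as a vector space into k(K) and r(C); the inverse image of e - r (f
  e) under k is the K-coordinate of e.\<close>

lemma section_decomposition:
  assumes r: "r \<in> linear_map F C E" and sec: "\<forall>x\<in>carrier C. f (r x) = x"
  shows "e \<in> carrier E \<Longrightarrow> k_inv (e \<ominus>\<^bsub>E\<^esub> r (f e)) \<in> carrier K"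
    and "e \<in> carrier E \<Longrightarrow> k (k_inv (e \<ominus>\<^bsub>E\<^esub> r (f e))) \<oplus>\<^bsub>E\<^esub> r (f e) = e"
    and "x \<in> carrier K \<Longrightarrow> c \<in> carrier C \<Longrightarrow>
      k_inv ((k x \<oplus>\<^bsub>E\<^esub> r c) \<ominus>\<^bsub>E\<^esub> r (f (k x \<oplus>\<^bsub>E\<^esub> r c))) = x"
proof -
  note fr = sec[rule_format]
  note rs = linear_mapD[OF r]
  show "k_inv (e \<ominus>\<^bsub>E\<^esub> r (f e)) \<in> carrier K" "k (k_inv (e \<ominus>\<^bsub>E\<^esub> r (f e))) \<oplus>\<^bsub>E\<^esub> r (f e) = e"
    if "e \<in> carrier E"
    using that by (simp_all add: k_inv rs(1) f_minus fr E.add_minus_cancel)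
  show "k_inv ((k x \<oplus>\<^bsub>E\<^esub> r c) \<ominus>\<^bsub>E\<^esub> r (f (k x \<oplus>\<^bsub>E\<^esub> r c))) = x" if "x \<in> carrier K" "c \<in> carrier C"
  proof -
    have "f (k x \<oplus>\<^bsub>E\<^esub> r c) = c"
      using that by (simp add: f_simps rs(1) fr)
    moreover have "(k x \<oplus>\<^bsub>E\<^esub> r c) \<ominus>\<^bsub>E\<^esub> r c = k x"
      using that by (simp add: rs(1) E.a_assoc a_minus_def E.r_neg)
    ultimately show ?thesis
      using that by simp
  qed
qed

text \<open>In the coordinates given by r, the product of E is that of the crossed product; so every
  extension inducing the kernel is a crossed product in disguise.\<close>

lemma mult_decomposition:
  assumes r: "r \<in> linear_map F C E" and sec: "\<forall>x\<in>carrier C. f (r x) = x"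
    and ab: "a \<in> carrier C" "b \<in> carrier C" and xy: "x \<in> carrier K" "y \<in> carrier K"
  defines "g \<equiv> \<lambda>x y. k_inv (r x \<otimes>\<^bsub>E\<^esub> r y \<ominus>\<^bsub>E\<^esub> r (x \<otimes>\<^bsub>C\<^esub> y))"
  shows "(k x \<oplus>\<^bsub>E\<^esub> r a) \<otimes>\<^bsub>E\<^esub> (k y \<oplus>\<^bsub>E\<^esub> r b)
    = k (crossed_mult (\<lambda>c. \<pi> (r c)) g a b x y) \<oplus>\<^bsub>E\<^esub> r (a \<otimes>\<^bsub>C\<^esub> b)"
proof -
  note fr = sec[rule_format]
  note rs = linear_mapD[OF r]
  note fs = factor_set_of_lift[OF r sec, folded g_def]
  have gK: "g a b \<in> carrier K"
    by (rule factor_setD(5)[OF fs(1) ab])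
  have kg: "k (g a b) = r a \<otimes>\<^bsub>E\<^esub> r b \<ominus>\<^bsub>E\<^esub> r (a \<otimes>\<^bsub>C\<^esub> b)"
    unfolding g_def by (rule factor_set_of_lift(2)[OF r sec ab])
  have rr: "r a \<otimes>\<^bsub>E\<^esub> r b = k (g a b) \<oplus>\<^bsub>E\<^esub> r (a \<otimes>\<^bsub>C\<^esub> b)"
    unfolding kg using ab by (simp add: rs(1) E.add_minus_cancel)
  show ?thesis
    using ab xy by (simp add: crossed_mult_def k_add k_mult k_act rs(1) gK rr E.l_distr E.r_distr E.a_ac)
qed

lemma ex_twist_rel:
  assumes T: "kernel_extension F C K D \<psi> E' k' f' \<pi>'"
  shows "\<exists>\<chi>\<in>cocycles. (twist C \<chi> (E, k, f), (E', k', f')) \<in> ext_rel F C K"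
proof -
  have T_ext: "algebra_extension F C K E' k' f'"
    using T by (simp add: kernel_extension_def)
  interpret E': ring E'
    by (rule unital_algebraD(4)[OF algebra_extension.E_alg[OF T_ext]])
  \<comment> \<open>The sections of D provide a linear lift \<sigma> of \<psi>. It has to be the
    same for both extensions, so that their factor sets can be subtracted.\<close>
  obtain s q where sq: "biext_sections F D s q"
    using biext_sections_exist by blast
  define \<sigma> where "\<sigma> = (\<lambda>x. s (\<psi> x))"
  have \<sigma>: "\<sigma> \<in> linear_map F C A" "\<And>x. x \<in> carrier C \<Longrightarrow> p (\<sigma> x) = \<psi> x"
    using factor_set_of_sections(1)[OF sq] unfolding \<sigma>_def factor_set_def by simp_all
  obtain r where r: "r \<in> linear_map F C E" and fr: "\<And>x. x \<in> carrier C \<Longrightarrow> f (r x) = x"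
    and \<pi>r: "\<And>x. x \<in> carrier C \<Longrightarrow> \<pi> (r x) = \<sigma> x"
    by (rule section_lift[OF \<sigma>]) (assumption, rule that, simp_all)
  obtain r' where r': "r' \<in> linear_map F C E'" and fr': "\<And>x. x \<in> carrier C \<Longrightarrow> f' (r' x) = x"
    and \<pi>r': "\<And>x. x \<in> carrier C \<Longrightarrow> \<pi>' (r' x) = \<sigma> x"
    by (rule kernel_extension.section_lift[OF T \<sigma>]) (assumption, rule that, simp_all)
  have sec: "\<forall>x\<in>carrier C. f (r x) = x" and sec': "\<forall>x\<in>carrier C. f' (r' x) = x"
    by (simp_all add: fr fr')
  note rs = linear_mapD[OF r] and rs' = linear_mapD[OF r']
  let ?k' = "inv_into (carrier K) k'"
  define g where "g = (\<lambda>x y. k_inv (r x \<otimes>\<^bsub>E\<^esub> r y \<ominus>\<^bsub>E\<^esub> r (x \<otimes>\<^bsub>C\<^esub> y)))"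
  define g' where "g' = (\<lambda>x y. ?k' (r' x \<otimes>\<^bsub>E'\<^esub> r' y \<ominus>\<^bsub>E'\<^esub> r' (x \<otimes>\<^bsub>C\<^esub> y)))"
  note fs0 = factor_set_of_lift[OF r sec, folded g_def]
  note fs0' = kernel_extension.factor_set_of_lift[OF T r' sec', folded g'_def]
  have fs: "factor_set \<sigma> g"
    using fs0(1) \<sigma> unfolding factor_set_def by (simp add: \<pi>r)
  have fs': "factor_set \<sigma> g'"
    using fs0'(1) \<sigma> unfolding factor_set_def by (simp add: \<pi>r')
  have obs: "obstruction \<sigma> g a b c = \<zero>\<^bsub>K\<^esub>" "obstruction \<sigma> g' a b c = \<zero>\<^bsub>K\<^esub>"
    if "a \<in> carrier C" "b \<in> carrier C" "c \<in> carrier C" for a b c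
    using fs0(3)[OF that] fs0'(3)[OF that] that by (simp_all add: obstruction_def \<pi>r \<pi>r')
  obtain \<chi> where \<chi>c: "\<chi> \<in> hh_cochains F C (ann_alg K) 2"
    and g'g: "\<And>x y. x \<in> carrier C \<Longrightarrow> y \<in> carrier C \<Longrightarrow> g' x y = g x y \<oplus>\<^bsub>K\<^esub> \<chi> [x, y]"
    by (rule factor_set_diff_cochain[OF fs fs']) (rule that, simp_all)
  \<comment> \<open>Neither factor set is obstructed, and adding \<chi> changes the obstruction by
    \<delta>\<chi>; so \<chi> is a cocycle.\<close>
  have "hh_delta C (ann_alg K) \<xi>C 2 \<chi> = hh_zero C (ann_alg K) (Suc 2)"
  proof (rule PiE_eqI[OF bimodule.hh_delta_closed[OF bimod_C] bimodule.hh_zero_PiE[OF bimod_C]])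
    show \<chi>P: "\<chi> \<in> tuples C 2 \<rightarrow> Z"
      using hh_cochains_PiE[OF \<chi>c] by auto
    fix xs assume xs: "xs \<in> tuples C (Suc 2)"
    then have "xs \<in> tuples C 3" by simp
    then obtain a b c where abc: "xs = [a, b, c]" "a \<in> carrier C" "b \<in> carrier C" "c \<in> carrier C"
      by (auto simp: tuples_3_iff)
    have "hh_delta C (ann_alg K) \<xi>C 2 \<chi> xs \<in> Z"
      by (rule PiE_const_mem[OF bimodule.hh_delta_closed[OF bimod_C \<chi>P] xs])
    moreover have "\<zero>\<^bsub>K\<^esub> = \<zero>\<^bsub>K\<^esub> \<oplus>\<^bsub>K\<^esub> hh_delta C (ann_alg K) \<xi>C 2 \<chi> [a, b, c]"
      using factor_set_add_cochain(2)[OF fs \<chi>c g'g abc(2-)] unfolding obs[OF abc(2-)] by simp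
    ultimately show "hh_delta C (ann_alg K) \<xi>C 2 \<chi> xs = hh_zero C (ann_alg K) (Suc 2) xs"
      using xs by (simp add: abc(1) hh_zero_def)
  qed
  then have \<chi>: "\<chi> \<in> cocycles"
    using \<chi>c by (simp add: hh_cocycles_def)
  note \<chi>K = cocycleD(5)[OF \<chi>]
  let ?x = "\<lambda>e. k_inv (e \<ominus>\<^bsub>E\<^esub> r (f e))"
  let ?x' = "\<lambda>e. ?k' (e \<ominus>\<^bsub>E'\<^esub> r' (f' e))"
  note dec = section_decomposition[OF r sec]
  note dec' = kernel_extension.section_decomposition[OF T r' sec']
  note f's = algebra_extension.f_simps[OF T_ext] and f'_k' = algebra_extension.f_k[OF T_ext]
    and f'c = algebra_extension.f_closed[OF T_ext]
    and k'c = algebra_extension.k_closed[OF T_ext] and k'_add = algebra_extension.k_add[OF T_ext]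
    and k'_smult = algebra_extension.k_smult[OF T_ext]
    and E'_smult = lin_space_smult(2)[OF algebra_extension.E_lin[OF T_ext]]
  \<comment> \<open>Matches coordinates: k x + r c goes to k' x + r' c.\<close>
  define h where "h e = k' (?x e) \<oplus>\<^bsub>E'\<^esub> r' (f e)" for e
  have h_val: "h (k x \<oplus>\<^bsub>E\<^esub> r c) = k' x \<oplus>\<^bsub>E'\<^esub> r' c" if "x \<in> carrier K" "c \<in> carrier C" for x c
    unfolding h_def dec(3)[OF that] using that by (simp add: f_simps rs(1) fr)
  have e_ex: "\<exists>x\<in>carrier K. \<exists>c\<in>carrier C. e = k x \<oplus>\<^bsub>E\<^esub> r c" if "e \<in> carrier E" for e
    using dec(1,2)[OF that] f_closed[OF that] by metis
  have "h \<in> unital_alg_iso F (twisted \<chi>) E'"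
  proof (rule unital_alg_isoI[OF twisted_alg[OF \<chi>] algebra_extension.E_alg[OF T_ext]])
    show "h \<in> linear_map F (twisted \<chi>) E'"
    proof (rule linear_mapI; unfold twisted_simps)
      fix e assume "e \<in> carrier E"
      then obtain x c where xc: "x \<in> carrier K" "c \<in> carrier C" "e = k x \<oplus>\<^bsub>E\<^esub> r c"
        using e_ex by blast
      show "h e \<in> carrier E'"
        unfolding xc(3) h_val[OF xc(1,2)] using xc(1,2) by (simp add: k'c rs'(1))
      show "h (e \<oplus>\<^bsub>E\<^esub> e') = h e \<oplus>\<^bsub>E'\<^esub> h e'" if e': "e' \<in> carrier E" for e'
      proof -
        obtain x' c' where xc': "x' \<in> carrier K" "c' \<in> carrier C" "e' = k x' \<oplus>\<^bsub>E\<^esub> r c'"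
          using e_ex[OF e'] by blast
        have "e \<oplus>\<^bsub>E\<^esub> e' = k (x \<oplus>\<^bsub>K\<^esub> x') \<oplus>\<^bsub>E\<^esub> r (c \<oplus>\<^bsub>C\<^esub> c')"
          unfolding xc(3) xc'(3) using xc(1,2) xc'(1,2) by (simp add: k_add rs E.a_ac)
        then have "h (e \<oplus>\<^bsub>E\<^esub> e') = k' (x \<oplus>\<^bsub>K\<^esub> x') \<oplus>\<^bsub>E'\<^esub> r' (c \<oplus>\<^bsub>C\<^esub> c')"
          using xc(1,2) xc'(1,2) by (simp add: h_val)
        also have "\<dots> = h e \<oplus>\<^bsub>E'\<^esub> h e'"
          unfolding xc(3) xc'(3) h_val[OF xc(1,2)] h_val[OF xc'(1,2)]
          using xc(1,2) xc'(1,2) by (simp add: k'_add rs' k'c E'.a_ac)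
        finally show ?thesis .
      qed
      show "h (s \<odot>\<^bsub>E\<^esub> e) = s \<odot>\<^bsub>E'\<^esub> h e" if s: "s \<in> carrier F" for s
      proof -
        have "s \<odot>\<^bsub>E\<^esub> e = k (s \<odot>\<^bsub>K\<^esub> x) \<oplus>\<^bsub>E\<^esub> r (s \<odot>\<^bsub>C\<^esub> c)"
          unfolding xc(3) using xc(1,2) s by (simp add: k_smult rs E_smult)
        then have "h (s \<odot>\<^bsub>E\<^esub> e) = k' (s \<odot>\<^bsub>K\<^esub> x) \<oplus>\<^bsub>E'\<^esub> r' (s \<odot>\<^bsub>C\<^esub> c)"
          using xc(1,2) s by (simp add: h_val)
        also have "\<dots> = s \<odot>\<^bsub>E'\<^esub> h e"
          unfolding xc(3) h_val[OF xc(1,2)] using xc(1,2) s by (simp add: k'_smult rs' k'c E'_smult)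
        finally show ?thesis .
      qed
    qed
    have "bij_betw h (carrier E) (carrier E')"
    proof (rule bij_betwI)
      let ?i = "\<lambda>e. k (?x' e) \<oplus>\<^bsub>E\<^esub> r (f' e)"
      show "h \<in> carrier E \<rightarrow> carrier E'"
        by (simp add: h_def dec(1) k'c rs'(1))
      show "?i \<in> carrier E' \<rightarrow> carrier E"
        by (simp add: dec'(1) rs(1) f'c)
      show "?i (h e) = e" if "e \<in> carrier E" for e
      proof -
        have fh: "f' (h e) = f e"
          using that by (simp add: h_def dec(1) k'c rs'(1) f's f'_k' fr')
        have "?x' (h e) = ?x e"
          unfolding h_def by (rule dec'(3)[OF dec(1)[OF that] f_closed[OF that]])
        then show ?thesis
          using dec(2)[OF that] by (simp add: fh)
      qed
      show "h (?i e) = e" if "e \<in> carrier E'" for e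
        unfolding h_val[OF dec'(1)[OF that] f'c[OF that]] by (rule dec'(2)[OF that])
    qed
    then show "bij_betw h (carrier (twisted \<chi>)) (carrier E')"
      by simp
    fix e e' assume "e \<in> carrier (twisted \<chi>)" "e' \<in> carrier (twisted \<chi>)"
    then have e: "e \<in> carrier E" "e' \<in> carrier E" by simp_all
    obtain x c where xc: "x \<in> carrier K" "c \<in> carrier C" "e = k x \<oplus>\<^bsub>E\<^esub> r c"
      using e_ex[OF e(1)] by blast
    obtain x' c' where xc': "x' \<in> carrier K" "c' \<in> carrier C" "e' = k x' \<oplus>\<^bsub>E\<^esub> r c'"
      using e_ex[OF e(2)] by blast
    have ff: "f e = c" "f e' = c'"
      using xc xc' by (simp_all add: f_simps rs(1) fr)
    have cm: "crossed_mult \<sigma> g c c' x x' \<in> carrier K" "crossed_mult \<sigma> g' c c' x x' \<in> carrier K"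
      by (rule crossed_mult_closed[OF fs xc(2) xc'(2) xc(1) xc'(1)],
          rule crossed_mult_closed[OF fs' xc(2) xc'(2) xc(1) xc'(1)])
    have cg: "crossed_mult \<sigma> g' c c' x x' = crossed_mult \<sigma> g c c' x x' \<oplus>\<^bsub>K\<^esub> \<chi> [c, c']"
      using xc(1,2) xc'(1,2) by (simp add: crossed_mult_def g'g factor_setD(3,5)[OF fs] \<chi>K K.a_assoc)
    have cm_eq: "crossed_mult (\<lambda>c. \<pi> (r c)) g c c' x x' = crossed_mult \<sigma> g c c' x x'"
      "crossed_mult (\<lambda>c. \<pi>' (r' c)) g' c c' x x' = crossed_mult \<sigma> g' c c' x x'"
      using xc(2) xc'(2) by (simp_all add: crossed_mult_def \<pi>r \<pi>r')
    have md: "e \<otimes>\<^bsub>E\<^esub> e' = k (crossed_mult \<sigma> g c c' x x') \<oplus>\<^bsub>E\<^esub> r (c \<otimes>\<^bsub>C\<^esub> c')"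
      unfolding xc(3) xc'(3) mult_decomposition[OF r sec xc(2) xc'(2) xc(1) xc'(1), folded g_def] cm_eq ..
    have md': "(k' x \<oplus>\<^bsub>E'\<^esub> r' c) \<otimes>\<^bsub>E'\<^esub> (k' x' \<oplus>\<^bsub>E'\<^esub> r' c')
        = k' (crossed_mult \<sigma> g' c c' x x') \<oplus>\<^bsub>E'\<^esub> r' (c \<otimes>\<^bsub>C\<^esub> c')"
      unfolding kernel_extension.mult_decomposition[OF T r' sec' xc(2) xc'(2) xc(1) xc'(1), folded g'_def] cm_eq ..
    \<comment> \<open>Adding \<chi> to g turns the product of E, in coordinates, into the crossed
      product for g', which is the product of E' in its own coordinates.\<close>
    have "e \<otimes>\<^bsub>twisted \<chi>\<^esub> e' = k (crossed_mult \<sigma> g' c c' x x') \<oplus>\<^bsub>E\<^esub> r (c \<otimes>\<^bsub>C\<^esub> c')"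
      unfolding twisted_simps md ff cg using cm(1) xc(1,2) xc'(1,2)
      by (simp add: k_add \<chi>K rs(1) E.a_ac)
    then have "h (e \<otimes>\<^bsub>twisted \<chi>\<^esub> e') = k' (crossed_mult \<sigma> g' c c' x x') \<oplus>\<^bsub>E'\<^esub> r' (c \<otimes>\<^bsub>C\<^esub> c')"
      using cm(2) xc(1,2) xc'(1,2) by (simp only: h_val C.m_closed)
    also have "\<dots> = h e \<otimes>\<^bsub>E'\<^esub> h e'"
      unfolding xc(3) xc'(3) h_val[OF xc(1,2)] h_val[OF xc'(1,2)] md' ..
    finally show "h (e \<otimes>\<^bsub>twisted \<chi>\<^esub> e') = h e \<otimes>\<^bsub>E'\<^esub> h e'" .
  qed
  then have "(twist C \<chi> (E, k, f), (E', k', f')) \<in> ext_rel F C K"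
    unfolding twist_eq
  proof (rule ext_relI[OF twist_extension[OF \<chi>] algebra_extension.ext[OF T_ext]])
    show "h (k x) = k' x" if x: "x \<in> carrier K" for x
    proof -
      have "h (k x \<oplus>\<^bsub>E\<^esub> r \<zero>\<^bsub>C\<^esub>) = k' x \<oplus>\<^bsub>E'\<^esub> r' \<zero>\<^bsub>C\<^esub>"
        by (rule h_val[OF x C.zero_closed])
      then show ?thesis
        using x linear_map_zero[OF C_lin E_lin r]
          linear_map_zero[OF C_lin algebra_extension.E_lin[OF T_ext] r'] by (simp add: k'c)
    qed
    show "f' (h e) = f e" if "e \<in> carrier (twisted \<chi>)" for e
      using that by (simp add: h_def dec(1) k'c rs'(1) f's f'_k' fr')
  qed
  with \<chi> show ?thesis by blast
qed

end

section \<open>The action of second cohomology\<close>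

context kernel_representative
begin

abbreviation cls where "cls \<equiv> hh_class F C (ann_alg K) \<xi>C 2"
abbreviation H2 where "H2 \<equiv> HH F C (ann_alg K) \<xi>C 2"
abbreviation rel :: "(('f, 'k, 'c, 'e) extension \<times> ('f, 'k, 'c, 'e) extension) set"
  where "rel \<equiv> ext_rel F C K"

lemma cocycle_add:
  assumes "\<chi> \<in> cocycles" "\<chi>' \<in> cocycles"
  shows "cochain_add C (ann_alg K) 2 \<chi> \<chi>' \<in> cocycles"
proof -
  interpret G: comm_group "hh_cocycle_group F C (ann_alg K) \<xi>C 2"
    by (rule bimodule.hh_cocycle_group_comm_group[OF bimod_C])
  show ?thesis
    using G.m_closed[of \<chi> \<chi>'] assms by (simp add: hh_cocycle_group_def)
qed

lemma cocycle_zero: "hh_zero C (ann_alg K) 2 \<in> cocycles"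
proof -
  interpret G: comm_group "hh_cocycle_group F C (ann_alg K) \<xi>C 2"
    by (rule bimodule.hh_cocycle_group_comm_group[OF bimod_C])
  show ?thesis
    using G.one_closed by (simp add: hh_cocycle_group_def)
qed

lemma H2_carrier: "g \<in> carrier H2 \<longleftrightarrow> (\<exists>\<chi>\<in>cocycles. g = cls \<chi>)"
  by (auto simp: HH_def FactGroup_def RCOSETS_def hh_class_def hh_cocycle_group_def)

lemma H2_one: "\<one>\<^bsub>H2\<^esub> = cls (hh_zero C (ann_alg K) 2)"
  using iffD2[OF bimodule.hh_class_trivial_iff[OF bimod_C bimodule.hh_zero_PiE[OF bimod_C],
        where n = "Suc 0"] bimodule.hh_coboundaries_zero[OF bimod_C]]
  unfolding Suc_1_eq_2 by (rule sym)

lemma H2_mult: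
  assumes "\<chi> \<in> cocycles" "\<chi>' \<in> cocycles"
  shows "cls \<chi> \<otimes>\<^bsub>H2\<^esub> cls \<chi>' = cls (cochain_add C (ann_alg K) 2 \<chi> \<chi>')"
  using normal.rcos_sum[OF bimodule.hh_coboundaries_2_normal[OF bimod_C], of \<chi> \<chi>'] assms
  by (simp add: HH_def FactGroup_def hh_class_def hh_cocycle_group_def)

lemma class_self: "\<chi> \<in> cocycles \<Longrightarrow> \<chi> \<in> cls \<chi>"
proof -
  assume \<chi>: "\<chi> \<in> cocycles"
  have "cochain_add C (ann_alg K) 2 (hh_zero C (ann_alg K) 2) \<chi> = \<chi>"
    by (rule PiE_eqI[OF _ cocycleD(3)[OF \<chi>]])
      (auto simp: hh_zero_def PiE_const_mem[OF cocycleD(3)[OF \<chi>]])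
  moreover have "hh_zero C (ann_alg K) 2 \<in> hh_coboundaries F C (ann_alg K) \<xi>C 2"
    using bimodule.hh_coboundaries_zero[OF bimod_C, of "Suc 0"] by (simp only: Suc_1_eq_2)
  ultimately show "\<chi> \<in> cls \<chi>"
    unfolding bimodule.hh_class_eq[OF bimod_C] by (intro image_eqI[OF sym])
qed

lemma class_mem:
  assumes \<chi>: "\<chi> \<in> cocycles" and mem: "\<chi>' \<in> cls \<chi>"
  shows "\<chi>' \<in> cocycles" "cls \<chi>' = cls \<chi>"
proof -
  obtain b where b: "b \<in> hh_coboundaries F C (ann_alg K) \<xi>C 2"
    and \<chi>'b: "\<chi>' = cochain_add C (ann_alg K) 2 b \<chi>"
    using mem unfolding bimodule.hh_class_eq[OF bimod_C] by (elim imageE) (rule that)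
  show \<chi>': "\<chi>' \<in> cocycles"
    unfolding \<chi>'b using cocycle_add[OF _ \<chi>] bimodule.hh_coboundaries_2_cocycles[OF bimod_C] b by blast
  show "cls \<chi>' = cls \<chi>"
    by (rule iffD2[OF hh_class_2_eq_iff[OF cocycleD(3)[OF \<chi>'] cocycleD(3)[OF \<chi>]]],
        rule bexI[OF _ b], rule \<chi>'b)
qed

lemma inducing_extension: "S \<in> inducing \<Longrightarrow> S \<in> extensions F C K"
  by (simp add: inducing_def)

lemma inducingE:
  assumes "S \<in> inducing"
  obtains E k f \<pi> where "S = (E, k, f)" "kernel_extension F C K D \<psi> E k f \<pi>"
proof -
  obtain E k f where S: "S = (E, k, f)"
    by (rule prod_cases3)
  obtain \<pi> where "lifting E k f \<pi>"
    using assms unfolding S inducing_iff by (elim exE)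
  then show thesis
    by (intro that[OF S] kernel_extensionI)
qed

lemma twist_inducing:
  assumes "S \<in> inducing" "\<chi> \<in> cocycles"
  shows "twist C \<chi> S \<in> inducing"
proof -
  obtain E k f \<pi> where S: "S = (E, k, f)" and T: "kernel_extension F C K D \<psi> E k f \<pi>"
    using assms(1) by (rule inducingE)
  show ?thesis
    unfolding S kernel_extension.twist_eq[OF T] inducing_iff
    by (rule exI, rule kernel_extension.twist_lifting[OF T assms(2)])
qed

lemma inducing_twist_rel_iff:
  assumes "S \<in> inducing" "\<chi> \<in> cocycles" "\<chi>' \<in> cocycles"
  shows "(twist C \<chi> S, twist C \<chi>' S) \<in> rel \<longleftrightarrow> cls \<chi> = cls \<chi>'"
proof -
  obtain E k f \<pi> where S: "S = (E, k, f)" and T: "kernel_extension F C K D \<psi> E k f \<pi>"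
    using assms(1) by (rule inducingE)
  show ?thesis
    unfolding S using kernel_extension.twist_rel_if_class_eq[OF T assms(2,3)]
      kernel_extension.class_eq_if_twist_rel[OF T assms(2,3)] by (rule iffI[rotated])
qed

lemma inducing_twist_cong:
  assumes "S \<in> inducing" "T \<in> inducing" "\<chi> \<in> cocycles" "(S, T) \<in> rel"
  shows "(twist C \<chi> S, twist C \<chi> T) \<in> rel"
proof -
  obtain E k f \<pi> where S: "S = (E, k, f)" and S': "kernel_extension F C K D \<psi> E k f \<pi>"
    using assms(1) by (rule inducingE)
  obtain E' k' f' \<pi>' where T: "T = (E', k', f')" and T': "kernel_extension F C K D \<psi> E' k' f' \<pi>'"
    using assms(2) by (rule inducingE)
  show ?thesis
    using assms(4) unfolding S T by (rule kernel_extension.twist_cong[OF S' assms(3) T'])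
qed

lemma inducing_ex_twist:
  assumes "S \<in> inducing" "T \<in> inducing"
  shows "\<exists>\<chi>\<in>cocycles. (twist C \<chi> S, T) \<in> rel"
proof -
  obtain E k f \<pi> where S: "S = (E, k, f)" and S': "kernel_extension F C K D \<psi> E k f \<pi>"
    using assms(1) by (rule inducingE)
  obtain E' k' f' \<pi>' where T: "T = (E', k', f')" and T': "kernel_extension F C K D \<psi> E' k' f' \<pi>'"
    using assms(2) by (rule inducingE)
  show ?thesis
    unfolding S T by (rule kernel_extension.ex_twist_rel[OF S' T'])
qed

lemma inducing_twist_twist:
  assumes "S \<in> inducing" and \<chi>: "\<chi> \<in> cocycles" "\<chi>' \<in> cocycles"
  shows "(twist C (cochain_add C (ann_alg K) 2 \<chi> \<chi>') S, twist C \<chi> (twist C \<chi>' S)) \<in> rel"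
proof -
  obtain E k f \<pi> where S: "S = (E, k, f)" and T: "kernel_extension F C K D \<psi> E k f \<pi>"
    using assms(1) by (rule inducingE)
  show ?thesis
    unfolding S by (rule ext_rel_sym, rule kernel_extension.twist_twist[OF T \<chi> cocycle_add[OF \<chi>]]) simp
qed

lemma inducing_twist_zero:
  assumes "S \<in> inducing"
  shows "(twist C (hh_zero C (ann_alg K) 2) S, S) \<in> rel"
proof -
  obtain E k f \<pi> where S: "S = (E, k, f)" and T: "kernel_extension F C K D \<psi> E k f \<pi>"
    using assms(1) by (rule inducingE)
  show ?thesis
    unfolding S by (rule kernel_extension.twist_zero[OF T cocycle_zero]) (simp add: hh_zero_def)
qed

lemma rel_class_eq: "(S, T) \<in> rel \<Longrightarrow> rel `` {S} = rel `` {T}"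
  by (rule equiv_class_eq[OF ext_rel_equiv])

lemma rel_class_eqD: "T \<in> inducing \<Longrightarrow> rel `` {S} = rel `` {T} \<Longrightarrow> (S, T) \<in> rel"
  by (rule eq_equiv_class[OF _ ext_rel_equiv]) (simp_all add: inducing_extension)

lemma Ext_mem: "S \<in> inducing \<Longrightarrow> rel `` {S} \<in> Ext F C K D \<psi>"
  unfolding Ext_eq by (rule quotientI)

lemma ExtE:
  assumes "x \<in> Ext F C K D \<psi>"
  obtains S where "S \<in> inducing" "x = rel `` {S}"
  using assms unfolding Ext_eq by (rule quotientE)

text \<open>Well-definedness of the action: isomorphic extensions have isomorphic twists, and
  cohomologous cocycles twist one extension to isomorphic ones, so all choices in
  \<open>ext_action\<close> lead into a single class.\<close>

lemma ext_action_class: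
  assumes S: "S \<in> inducing" and \<chi>: "\<chi> \<in> cocycles"
  shows "ext_action F C K D \<psi> (cls \<chi>) (rel `` {S}) = rel `` {twist C \<chi> S}"
proof -
  have "{Y. \<exists>\<chi>'\<in>cls \<chi>. \<exists>U\<in>rel `` {S}. (twist C \<chi>' U, Y) \<in> rel} = rel `` {twist C \<chi> S}"
  proof (intro subset_antisym subsetI)
    fix Y assume "Y \<in> {Y. \<exists>\<chi>'\<in>cls \<chi>. \<exists>U\<in>rel `` {S}. (twist C \<chi>' U, Y) \<in> rel}"
    then obtain \<chi>' U where \<chi>': "\<chi>' \<in> cls \<chi>" and U: "(S, U) \<in> rel" and Y: "(twist C \<chi>' U, Y) \<in> rel"
      by blast
    note \<chi>'c = class_mem[OF \<chi> \<chi>']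
    have "(twist C \<chi> S, twist C \<chi>' S) \<in> rel"
      by (rule iffD2[OF inducing_twist_rel_iff[OF S \<chi> \<chi>'c(1)] \<chi>'c(2)[symmetric]])
    moreover have "(twist C \<chi>' S, twist C \<chi>' U) \<in> rel"
      by (rule inducing_twist_cong[OF S inducing_rel[OF S U] \<chi>'c(1) U])
    ultimately have "(twist C \<chi> S, Y) \<in> rel"
      using Y by (blast intro: ext_rel_trans)
    then show "Y \<in> rel `` {twist C \<chi> S}" by simp
  next
    fix Y assume "Y \<in> rel `` {twist C \<chi> S}"
    then show "Y \<in> {Y. \<exists>\<chi>'\<in>cls \<chi>. \<exists>U\<in>rel `` {S}. (twist C \<chi>' U, Y) \<in> rel}"
      using class_self[OF \<chi>] ext_rel_refl[OF inducing_extension[OF S]] by blast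
  qed
  then show ?thesis
    using Ext_mem[OF S] by (simp add: ext_action_def)
qed

lemma ext_action_laws:
  assumes x: "x \<in> Ext F C K D \<psi>"
  shows "g \<in> carrier H2 \<Longrightarrow> ext_action F C K D \<psi> g x \<in> Ext F C K D \<psi>"
    and "g \<in> carrier H2 \<Longrightarrow> h \<in> carrier H2 \<Longrightarrow>
      ext_action F C K D \<psi> (g \<otimes>\<^bsub>H2\<^esub> h) x = ext_action F C K D \<psi> g (ext_action F C K D \<psi> h x)"
    and "ext_action F C K D \<psi> \<one>\<^bsub>H2\<^esub> x = x"
proof -
  obtain S where S: "S \<in> inducing" and xS: "x = rel `` {S}"
    using x by (rule ExtE)
  show "ext_action F C K D \<psi> g x \<in> Ext F C K D \<psi>" if "g \<in> carrier H2"
  proof -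
    obtain \<chi> where \<chi>: "\<chi> \<in> cocycles" "g = cls \<chi>"
      using \<open>g \<in> carrier H2\<close> unfolding H2_carrier by (elim bexE) (rule that)
    show ?thesis
      unfolding xS \<chi>(2) ext_action_class[OF S \<chi>(1)] by (rule Ext_mem[OF twist_inducing[OF S \<chi>(1)]])
  qed
  show "ext_action F C K D \<psi> (g \<otimes>\<^bsub>H2\<^esub> h) x = ext_action F C K D \<psi> g (ext_action F C K D \<psi> h x)"
    if "g \<in> carrier H2" "h \<in> carrier H2"
  proof -
    obtain \<chi> where \<chi>: "\<chi> \<in> cocycles" "g = cls \<chi>"
      using \<open>g \<in> carrier H2\<close> unfolding H2_carrier by (elim bexE) (rule that)
    obtain \<chi>' where \<chi>': "\<chi>' \<in> cocycles" "h = cls \<chi>'"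
      using \<open>h \<in> carrier H2\<close> unfolding H2_carrier by (elim bexE) (rule that)
    show ?thesis
      unfolding xS \<chi>(2) \<chi>'(2) H2_mult[OF \<chi>(1) \<chi>'(1)] ext_action_class[OF S cocycle_add[OF \<chi>(1) \<chi>'(1)]]
        ext_action_class[OF S \<chi>'(1)] ext_action_class[OF twist_inducing[OF S \<chi>'(1)] \<chi>(1)]
      by (rule rel_class_eq[OF inducing_twist_twist[OF S \<chi>(1) \<chi>'(1)]])
  qed
  show "ext_action F C K D \<psi> \<one>\<^bsub>H2\<^esub> x = x"
    unfolding xS H2_one ext_action_class[OF S cocycle_zero]
    by (rule rel_class_eq[OF inducing_twist_zero[OF S]])
qed

text \<open>On classes, existence of the group element is \<open>inducing_ex_twist\<close> and its
  uniqueness is \<open>inducing_twist_rel_iff\<close>.\<close>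

theorem ext_action_simply_transitive:
  "simply_transitive_action H2 (Ext F C K D \<psi> :: ('f, 'k, 'c, 'e) extension set set) (ext_action F C K D \<psi>)"
proof -
  let ?X = "Ext F C K D \<psi> :: ('f, 'k, 'c, 'e) extension set set"
  let ?\<phi> = "ext_action F C K D \<psi> :: _ \<Rightarrow> ('f, 'k, 'c, 'e) extension set \<Rightarrow> _"
  interpret H2: group H2
    by (rule bimodule.HH_2_group[OF bimod_C])
  \<comment> \<open>\<open>group_action\<close> asks for a homomorphism into the group of
    extensional bijections; the inverse group element supplies the inverse bijection.\<close>
  have Bij: "?\<phi> g \<in> Bij ?X" if g: "g \<in> carrier H2" for g
  proof -
    have "bij_betw (?\<phi> g) ?X ?X"
    proof (rule bij_betwI)
      show "?\<phi> g \<in> ?X \<rightarrow> ?X" "?\<phi> (inv\<^bsub>H2\<^esub> g) \<in> ?X \<rightarrow> ?X"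
        using g by (auto intro: ext_action_laws(1))
      show "?\<phi> (inv\<^bsub>H2\<^esub> g) (?\<phi> g x) = x" "?\<phi> g (?\<phi> (inv\<^bsub>H2\<^esub> g) x) = x" if "x \<in> ?X" for x
        using g by (simp_all add: ext_action_laws(3)[OF that] flip: ext_action_laws(2)[OF that])
    qed
    moreover have "?\<phi> g \<in> extensional ?X"
      by (simp add: ext_action_def)
    ultimately show ?thesis
      by (simp add: Bij_def)
  qed
  show ?thesis
  proof (intro simply_transitive_action.intro group_action.intro group_hom.intro H2.group_axioms
      group_BijGroup group_hom_axioms.intro homI simply_transitive_action_axioms.intro)
    show "?\<phi> g \<in> carrier (BijGroup ?X)" if "g \<in> carrier H2" for g
      using Bij[OF that] by (simp add: BijGroup_def)
    show "?\<phi> (g \<otimes>\<^bsub>H2\<^esub> h) = ?\<phi> g \<otimes>\<^bsub>BijGroup ?X\<^esub> ?\<phi> h" if gh: "g \<in> carrier H2" "h \<in> carrier H2" for g h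
    proof -
      have "?\<phi> (g \<otimes>\<^bsub>H2\<^esub> h) = compose ?X (?\<phi> g) (?\<phi> h)"
      proof (rule extensionalityI[of _ ?X])
        show "?\<phi> (g \<otimes>\<^bsub>H2\<^esub> h) \<in> extensional ?X"
          by (simp add: ext_action_def)
        show "?\<phi> (g \<otimes>\<^bsub>H2\<^esub> h) x = compose ?X (?\<phi> g) (?\<phi> h) x" if "x \<in> ?X" for x
          using that by (simp add: compose_eq ext_action_laws(2)[OF that gh])
      qed (rule compose_extensional)
      then show ?thesis
        using Bij[OF gh(1)] Bij[OF gh(2)] by (simp add: BijGroup_def)
    qed
    fix x y assume x: "x \<in> ?X" and y: "y \<in> ?X"
    obtain S where S: "S \<in> inducing" and xS: "x = rel `` {S}"
      using x by (rule ExtE)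
    obtain T where T: "T \<in> inducing" and yT: "y = rel `` {T}"
      using y by (rule ExtE)
    obtain \<chi> where \<chi>: "\<chi> \<in> cocycles" and rel: "(twist C \<chi> S, T) \<in> rel"
      using inducing_ex_twist[OF S T] by (elim bexE) (rule that)
    have xy: "?\<phi> (cls \<chi>) x = y"
      unfolding xS yT ext_action_class[OF S \<chi>] by (rule rel_class_eq[OF rel])
    show "\<exists>!g. g \<in> carrier H2 \<and> ?\<phi> g x = y"
    proof (rule ex1I[of _ "cls \<chi>"])
      show "cls \<chi> \<in> carrier H2 \<and> ?\<phi> (cls \<chi>) x = y"
        using xy \<chi> by (auto simp: H2_carrier)
      fix g assume g: "g \<in> carrier H2 \<and> ?\<phi> g x = y"
      obtain \<chi>' where \<chi>': "\<chi>' \<in> cocycles" and g\<chi>': "g = cls \<chi>'"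
        using conjunct1[OF g] unfolding H2_carrier by (elim bexE) (rule that)
      have "rel `` {twist C \<chi>' S} = rel `` {twist C \<chi> S}"
        using conjunct2[OF g] xy unfolding g\<chi>' xS ext_action_class[OF S \<chi>] ext_action_class[OF S \<chi>']
        by simp
      then have "(twist C \<chi>' S, twist C \<chi> S) \<in> rel"
        by (rule rel_class_eqD[OF twist_inducing[OF S \<chi>]])
      then show "g = cls \<chi>"
        unfolding g\<chi>' by (rule iffD1[OF inducing_twist_rel_iff[OF S \<chi>' \<chi>]])
    qed
  qed
qed

end

theorem theorem7p4:
  fixes F :: "('f, 'm) ring_scheme"
    and C :: "('f, 'c) module"
    and K :: "('f, 'k) module"
    and D :: "('f, 'k, 'k, 'a, 'q) biext"
    and \<psi>\<^sub>0 :: "'c \<Rightarrow> 'q"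
  assumes "field F"
    and "unital_algebra F C"
    and "assoc_algebra F K"
    and "abstract_kernel F C K D \<psi>\<^sub>0"
    and "\<exists>g :: 'k \<times> 'c \<Rightarrow> 'e. inj_on g (carrier K \<times> carrier C)"
  shows
    "let Z = ann_alg K;
         \<xi> = biext_bimod D;
         \<xi>\<^sub>C = pullback_bimod \<psi>\<^sub>0 \<xi>;
         Exts = (Ext F C K D \<psi>\<^sub>0 :: ('f, 'k, 'c, 'e) extension set set)
     in (\<forall>\<omega> \<in> hh_cocycles F (bx_Q D) Z \<xi> 3.
            hh_class F (bx_Q D) Z \<xi> 3 \<omega> = biext_class F D \<longrightarrow>
              (Exts \<noteq> {} \<longleftrightarrow>
               hh_class F C Z \<xi>\<^sub>C 3 (pullback_cochain C \<psi>\<^sub>0 3 \<omega>) = \<one>\<^bsub>HH F C Z \<xi>\<^sub>C 3\<^esub>))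
      \<and> (Exts \<noteq> {} \<longrightarrow>
            simply_transitive_action (HH F C Z \<xi>\<^sub>C 2) Exts (ext_action F C K D \<psi>\<^sub>0))"
proof -
  have kr: "kernel_representative F C K D \<psi>\<^sub>0"
    using assms(2-4) by (rule kernel_representative.intro)
  obtain h :: "'k \<times> 'c \<Rightarrow> 'e" where h: "inj_on h (carrier K \<times> carrier C)"
    using assms(5) by (elim exE)
  show ?thesis
    unfolding Let_def
    by (intro conjI ballI impI kernel_representative.ext_action_simply_transitive[OF kr])
      (simp only: kernel_representative.Ext_nonempty_iff[OF kr h]
        kernel_representative.pullback_class_trivial_iff[OF kr])
qed

end
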